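(* Let $f\in W_2^{1/2}(\mathbb{T})\cap W_1^1(\mathbb{T})$. Then for every $\varphi\in\mathcal{W}_1[0,\|f\|_\infty^2]$, $$\operatorname{Tr}\big(\varphi(T_f^*T_f)-\varphi(T_fT_f^* )\big)=\frac{1}{2\pi i}\int_{\mathbb{T}}\big(\varphi(|f(t)|^2)-\varphi(0)\big)\frac{f'(t)}{f(t)}\,dt .$$
   Context: $\mathbb{T}=\mathbb{R}/2\pi\mathbb{Z}$, identified with the unit circle via $t\mapsto e^{it}$; functions are complex-valued and $\int_{\mathbb{T}}\cdots dt$ is integration over a period of length $2\pi$. For $f\in L^1(\mathbb{T})$, $\hat f(n)=\frac1{2\pi}\int_{\mathbb{T}}f(t)e^{-int}dt$. $L^2(\mathbb{T})$ is taken with respect to $dt/2\pi$, and $\|f\|_\infty$ is the $L^\infty$ norm. $W_2^{1/2}(\mathbb{T})=\{f\in L^2(\mathbb{T}):\sum_{n\in\mathbb{Z}}(1+|n|)|\hat f(n)|^2<\infty\}$, and $W_1^1(\mathbb{T})$ is the set of absolutely continuous functions on $\mathbb{T}$. The Hardy space is $H^2=\{f\in L^2(\mathbb{T}):\hat f(n)=0\ \forall n<0\}$, $P_+$ is the orthogonal projection of $L^2(\mathbb{T})$ onto $H^2$, and for $f\in L^\infty(\mathbb{T})$ the Toeplitz operator $T_f\in B(H^2)$ is $T_fh=P_+(fh)$. $\mathcal{W}_1(\mathbb{R})$ is the set of $\varphi\in C^1(\mathbb{R})$ such that $\varphi'$ is the Fourier transform of a finite complex Borel measure on $\mathbb{R}$,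 i.e. $\varphi'(x)=\int_{\mathbb{R}}e^{ixy}d\mu(y)$. For a finite closed interval $[a,b]$, $\mathcal{W}_1[a,b]$ is the set of $\varphi\in C^1[a,b]$ that extend to a function in $\mathcal{W}_1(\mathbb{R})$. If $A,B$ are bounded self-adjoint operators with $A-B$ trace class, then $\varphi(A)-\varphi(B)$ is trace class for every $\varphi\in\mathcal{W}_1(\mathbb{R})$ (Krein), and $T_f^*T_f-T_fT_f^*$ is trace class here, so the trace makes sense; operators are defined by continuous functional calculus. Convention: $(\varphi(|f(t)|^2)-\varphi(0))\frac{f'(t)}{f(t)}$ is understood to be $0$ whenever $f(t)=0$; equivalently it denotes $\Phi(|f(t)|^2)\overline{f(t)}f'(t)$ where $\Phi(x)=(\varphi(x)-\varphi(0))/x$ for $x\ne0$ and $\Phi(0)=\varphi'(0)$. *)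

theory Defs
  imports
    "HOL-Analysis.Analysis"
    "HOL-Probability.Essential_Supremum"
    "HOL-Computational_Algebra.Polynomial"
begin

section \<open>Complex inner product spaces\<close>

text \<open>
  The sesquilinear form is linear in the first argument. Norm, metric and topology are those of
  the real inner product space with inner product the real part of \<open>cinner\<close>. Completeness is not
  part of the class; the operator-theoretic notions below have their usual meaning when the space
  is complete, as is the case for the Hardy space to which they are applied.
\<close>

class complex_inner = real_inner +
  fixes scaleC :: "complex \<Rightarrow> 'a \<Rightarrow> 'a" (infixr "*\<^sub>C" 75)
    and cinner :: "'a \<Rightarrow> 'a \<Rightarrow> complex"
  assumes scaleR_scaleC: "r *\<^sub>R x = complex_of_real r *\<^sub>C x"
    and scaleC_add_right: "c *\<^sub>C (x + y) = c *\<^sub>C x + c *\<^sub>C y"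
    and scaleC_add_left: "(c + d) *\<^sub>C x = c *\<^sub>C x + d *\<^sub>C x"
    and scaleC_scaleC: "c *\<^sub>C d *\<^sub>C x = (c * d) *\<^sub>C x"
    and cinner_commute: "cinner x y = cnj (cinner y x)"
    and cinner_add_left: "cinner (x + y) z = cinner x z + cinner y z"
    and cinner_scaleC_left: "cinner (c *\<^sub>C x) y = c * cinner x y"
    and inner_eq_Re_cinner: "inner x y = Re (cinner x y)"

definition orthonormal_basis :: "'a::complex_inner set \<Rightarrow> bool" where
  "orthonormal_basis E \<longleftrightarrow>
     (\<forall>x\<in>E. \<forall>y\<in>E. cinner x y = (if x = y then 1 else 0)) \<and>
     (\<forall>x. (\<forall>e\<in>E. cinner x e = 0) \<longrightarrow> x = 0)"

section \<open>Bounded operators\<close>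

text \<open>
  Bounded operators are elements of the library type of bounded \<open>\<real>\<close>-linear maps, with its
  operator norm. All operators occurring in the theorem are \<open>\<complex>\<close>-linear.
\<close>

definition cadjoint :: "('a::complex_inner \<Rightarrow>\<^sub>L 'a) \<Rightarrow> ('a \<Rightarrow>\<^sub>L 'a)" where
  "cadjoint A = (THE B. \<forall>x y. cinner (blinfun_apply A x) y = cinner x (blinfun_apply B y))"

text \<open>
  If \<open>A\<close> is \<open>\<complex>\<close>-linear then a two-sided inverse of \<open>A - z\<close> is automatically \<open>\<complex>\<close>-linear,
  so this is the usual spectrum.
\<close>

definition spectrum :: "('a::complex_inner \<Rightarrow>\<^sub>L 'a) \<Rightarrow> complex set" where
  "spectrum A =
     {z. \<not> (\<exists>B::'a \<Rightarrow>\<^sub>L 'a. \<forall>x.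
            blinfun_apply B (blinfun_apply A x - z *\<^sub>C x) = x \<and>
            blinfun_apply A (blinfun_apply B x) - z *\<^sub>C blinfun_apply B x = x)}"

definition poly_op :: "complex poly \<Rightarrow> ('a::complex_inner \<Rightarrow>\<^sub>L 'a) \<Rightarrow> ('a \<Rightarrow>\<^sub>L 'a)" where
  "poly_op p A = Blinfun (\<lambda>x. \<Sum>i\<le>degree p. coeff p i *\<^sub>C (blinfun_apply A ^^ i) x)"

text \<open>
  Continuous functional calculus of a self-adjoint operator \<open>A\<close>: \<open>\<phi>(A)\<close> is the limit in operator
  norm of \<open>p\<^sub>n(A)\<close> for polynomials \<open>p\<^sub>n\<close> converging to \<open>\<phi>\<close> uniformly on the (real) spectrum
  of \<open>A\<close>.
\<close>

definition cfc :: "(real \<Rightarrow> complex) \<Rightarrow> ('a::complex_inner \<Rightarrow>\<^sub>L 'a) \<Rightarrow> ('a \<Rightarrow>\<^sub>L 'a)" where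
  "cfc \<phi> A = (THE B. \<exists>p :: nat \<Rightarrow> complex poly.
     uniform_limit {x. complex_of_real x \<in> spectrum A}
       (\<lambda>n x. poly (p n) (complex_of_real x)) \<phi> sequentially \<and>
     (\<lambda>n. poly_op (p n) A) \<longlonglongrightarrow> B)"

definition abs_op :: "('a::complex_inner \<Rightarrow>\<^sub>L 'a) \<Rightarrow> ('a \<Rightarrow>\<^sub>L 'a)" where
  "abs_op A = cfc (\<lambda>x. complex_of_real (sqrt x)) (cadjoint A o\<^sub>L A)"

definition trace_class :: "('a::complex_inner \<Rightarrow>\<^sub>L 'a) \<Rightarrow> bool" where
  "trace_class A \<longleftrightarrow>
     (\<exists>E. orthonormal_basis E \<and> (\<lambda>e. cinner (blinfun_apply (abs_op A) e) e) summable_on E)"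

definition trace_op :: "('a::complex_inner \<Rightarrow>\<^sub>L 'a) \<Rightarrow> complex" where
  "trace_op A = (THE t. \<forall>E. orthonormal_basis E \<longrightarrow>
     ((\<lambda>e. cinner (blinfun_apply A e) e) has_sum t) E)"

section \<open>Functions on the circle\<close>

text \<open>
  A point of the circle is given by a real \<open>t\<close>, with fundamental domain \<open>[0, 2\<pi>]\<close>;
  \<open>circle_measure\<close> is \<open>dt/2\<pi>\<close> on this interval (and null outside).
\<close>

definition circle_measure :: "real measure" where
  "circle_measure = uniform_measure lebesgue {0..2*pi}"

definition square_integrable :: "(real \<Rightarrow> complex) \<Rightarrow> bool" where
  "square_integrable f \<longleftrightarrow>
     f \<in> borel_measurable circle_measure \<and> integrable circle_measure (\<lambda>t. (cmod (f t))\<^sup>2)"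

definition fourier_coeff :: "(real \<Rightarrow> complex) \<Rightarrow> int \<Rightarrow> complex" where
  "fourier_coeff f n = (LINT t|circle_measure. f t * exp (- \<i> * of_int n * of_real t))"

definition Linf_norm :: "(real \<Rightarrow> complex) \<Rightarrow> real" where
  "Linf_norm f = real_of_ereal (esssup circle_measure (\<lambda>t. ereal (cmod (f t))))"

definition W_half_2 :: "(real \<Rightarrow> complex) set" where
  "W_half_2 = {f. square_integrable f \<and>
     (\<lambda>n::int. (1 + \<bar>of_int n\<bar>) * (cmod (fourier_coeff f n))\<^sup>2) summable_on UNIV}"

text \<open>A finite family of non-overlapping intervals is given by the pairs of their end points.
  Members of \<open>W_1_1\<close> are genuine \<open>2\<pi>\<close>-periodic functions, not classes modulo null sets.\<close>

definition abs_continuous_on :: "real \<Rightarrow> real \<Rightarrow> (real \<Rightarrow> complex) \<Rightarrow> bool" where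
  "abs_continuous_on a b f \<longleftrightarrow>
     (\<forall>\<epsilon>>0. \<exists>\<delta>>0. \<forall>I :: (real \<times> real) set.
        finite I \<longrightarrow> (\<forall>(x, y)\<in>I. a \<le> x \<and> x \<le> y \<and> y \<le> b) \<longrightarrow>
        pairwise (\<lambda>(x, y) (x', y'). {x<..<y} \<inter> {x'<..<y'} = {}) I \<longrightarrow>
        (\<Sum>(x, y)\<in>I. y - x) < \<delta> \<longrightarrow>
        (\<Sum>(x, y)\<in>I. cmod (f y - f x)) < \<epsilon>)"

definition W_1_1 :: "(real \<Rightarrow> complex) set" where
  "W_1_1 = {f. (\<forall>t. f (t + 2*pi) = f t) \<and> abs_continuous_on 0 (2*pi) f}"

section \<open>The space \<open>L\<^sup>2\<close> of the circle\<close>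

lemma space_circle_measure [simp]: "space circle_measure = UNIV"
  by (simp add: circle_measure_def)

lemma sets_circle_measure [simp]: "sets circle_measure = sets lebesgue"
  by (simp add: circle_measure_def)

lemma square_integrable_measurable [measurable_dest]:
  "square_integrable f \<Longrightarrow> f \<in> borel_measurable circle_measure"
  by (simp add: square_integrable_def)

lemma square_integrable_zero: "square_integrable (\<lambda>t. 0)"
  by (simp add: square_integrable_def)

lemma square_integrable_scale:
  assumes "square_integrable f"
  shows "square_integrable (\<lambda>t. c * f t)"
  using assms by (auto simp: square_integrable_def norm_mult power_mult_distrib)

lemma square_integrable_add:
  assumes f: "square_integrable f" and g: "square_integrable g"
  shows "square_integrable (\<lambda>t. f t + g t)"
proof -
  note [measurable] = square_integrable_measurable[OF f] square_integrable_measurable[OF g]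
  have *: "(cmod (a + b))\<^sup>2 \<le> 2 * (cmod a)\<^sup>2 + 2 * (cmod b)\<^sup>2" for a b :: complex
  proof -
    have "(cmod (a + b))\<^sup>2 \<le> (cmod a + cmod b)\<^sup>2"
      by (intro power_mono norm_triangle_ineq) auto
    also have "\<dots> \<le> 2 * (cmod a)\<^sup>2 + 2 * (cmod b)\<^sup>2"
      using sum_squares_bound[of "cmod a" "cmod b"] by (simp add: power2_sum)
    finally show ?thesis .
  qed
  have "integrable circle_measure (\<lambda>t. 2 * (cmod (f t))\<^sup>2 + 2 * (cmod (g t))\<^sup>2)"
    using f g by (auto simp: square_integrable_def)
  then have "integrable circle_measure (\<lambda>t. (cmod (f t + g t))\<^sup>2)"
    by (rule Bochner_Integration.integrable_bound) (use * in auto)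
  then show ?thesis
    by (simp add: square_integrable_def)
qed

lemma borel_measurable_cnj [measurable]:
  "f \<in> borel_measurable M \<Longrightarrow> (\<lambda>t. cnj (f t)) \<in> borel_measurable M"
  by (rule borel_measurable_continuous_on[where f = cnj]) (auto intro: continuous_intros)

lemma integrable_mult_cnj:
  assumes f: "square_integrable f" and g: "square_integrable g"
  shows "integrable circle_measure (\<lambda>t. f t * cnj (g t))"
proof -
  note [measurable] = square_integrable_measurable[OF f] square_integrable_measurable[OF g]
  have *: "cmod (a * cnj b) \<le> (cmod a)\<^sup>2 + (cmod b)\<^sup>2" for a b :: complex
    using sum_squares_bound[of "cmod a" "cmod b"]
      mult_nonneg_nonneg[OF norm_ge_zero[of a] norm_ge_zero[of b]]
    unfolding norm_mult complex_mod_cnj by linarith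
  have "integrable circle_measure (\<lambda>t. (cmod (f t))\<^sup>2 + (cmod (g t))\<^sup>2)"
    using f g by (auto simp: square_integrable_def)
  then show ?thesis
    by (rule Bochner_Integration.integrable_bound) (use * in auto)
qed

lemma measurable_character:
  "(\<lambda>t. exp (- \<i> * of_int n * of_real t)) \<in> borel_measurable circle_measure"
proof -
  have "(\<lambda>t::real. exp (- \<i> * of_int n * of_real t)) \<in> borel_measurable borel"
    by (intro borel_measurable_continuous_onI continuous_intros)
  then have "(\<lambda>t::real. exp (- \<i> * of_int n * of_real t)) \<in> borel_measurable lebesgue"
    by (simp add: measurable_completion)
  then show ?thesis
    by (simp add: measurable_def)
qed

lemma square_integrable_character:
  "square_integrable (\<lambda>t. exp (\<i> * of_int n * of_real t))"
proof -
  have "emeasure circle_measure (space circle_measure) < \<infinity>"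
    by (simp add: circle_measure_def emeasure_uniform_measure ennreal_divide_self divide_ennreal)
  then have "integrable circle_measure (\<lambda>t. 1 :: real)"
    by (intro finite_measure.integrable_const finite_measureI) auto
  then show ?thesis
    using measurable_character[of "- n"] by (simp add: square_integrable_def)
qed

text \<open>Square-integrable functions modulo equality almost everywhere.\<close>

quotient_type L2T = "real \<Rightarrow> complex" / partial:
  "\<lambda>f g. square_integrable f \<and> square_integrable g \<and> (AE t in circle_measure. f t = g t)"
proof (rule part_equivpI)
  show "\<exists>f. square_integrable f \<and> square_integrable f \<and> (AE t in circle_measure. f t = f t)"
    using square_integrable_zero by blast
qed (auto intro!: sympI transpI elim: AE_mp)

instantiation L2T :: complex_inner
begin

lift_definition zero_L2T :: L2T is "\<lambda>t. 0"
  by (simp add: square_integrable_zero)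

lift_definition plus_L2T :: "L2T \<Rightarrow> L2T \<Rightarrow> L2T" is "\<lambda>f g t. f t + g t"
  by (auto intro: square_integrable_add)

lift_definition scaleC_L2T :: "complex \<Rightarrow> L2T \<Rightarrow> L2T" is "\<lambda>c f t. c * f t"
  by (auto intro: square_integrable_scale)

lift_definition cinner_L2T :: "L2T \<Rightarrow> L2T \<Rightarrow> complex" is
  "\<lambda>f g. LINT t|circle_measure. f t * cnj (g t)"
  by (intro integral_cong_AE)
     (auto intro!: borel_measurable_times borel_measurable_cnj intro: square_integrable_measurable)

definition uminus_L2T :: "L2T \<Rightarrow> L2T" where "uminus_L2T x = (-1) *\<^sub>C x"
definition minus_L2T :: "L2T \<Rightarrow> L2T \<Rightarrow> L2T" where "minus_L2T x y = x + - y"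
definition scaleR_L2T :: "real \<Rightarrow> L2T \<Rightarrow> L2T" where
  "scaleR_L2T r x = complex_of_real r *\<^sub>C x"
definition inner_L2T :: "L2T \<Rightarrow> L2T \<Rightarrow> real" where "inner_L2T x y = Re (cinner x y)"
definition norm_L2T :: "L2T \<Rightarrow> real" where "norm_L2T x = sqrt (inner x x)"
definition sgn_L2T :: "L2T \<Rightarrow> L2T" where "sgn_L2T x = inverse (norm x) *\<^sub>R x"
definition dist_L2T :: "L2T \<Rightarrow> L2T \<Rightarrow> real" where "dist_L2T x y = norm (x - y)"
definition uniformity_L2T :: "(L2T \<times> L2T) filter" where
  "uniformity_L2T = (INF e\<in>{0<..}. principal {(x, y). dist x y < e})"
definition open_L2T :: "L2T set \<Rightarrow> bool" where
  "open_L2T U = (\<forall>x\<in>U. eventually (\<lambda>(x', y). x' = x \<longrightarrow> y \<in> U) uniformity)"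

instance
proof
  fix x y z :: L2T and c d :: complex and r s :: real
  show 1: "x + y + z = x + (y + z)"
    by transfer (auto intro!: square_integrable_add simp: algebra_simps)
  show 2: "x + y = y + x"
    by transfer (auto intro!: square_integrable_add simp: algebra_simps)
  show 3: "0 + x = x"
    by transfer auto
  show "- x + x = 0"
    unfolding uminus_L2T_def
    by transfer (auto intro!: square_integrable_add square_integrable_scale square_integrable_zero)
  show "x - y = x + - y"
    by (simp add: minus_L2T_def)
  show add_right: "c *\<^sub>C (x + y) = c *\<^sub>C x + c *\<^sub>C y" for c :: complex and x y :: L2T
    by transfer (auto intro!: square_integrable_add square_integrable_scale simp: algebra_simps)
  show add_left: "(c + d) *\<^sub>C x = c *\<^sub>C x + d *\<^sub>C x" for c d :: complex and x :: L2T
    by transfer (auto intro!: square_integrable_add square_integrable_scale simp: algebra_simps)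
  show scale: "c *\<^sub>C d *\<^sub>C x = (c * d) *\<^sub>C x" for c d :: complex and x :: L2T
    by transfer (auto intro!: square_integrable_scale simp: algebra_simps)
  have one: "1 *\<^sub>C x = x" for x :: L2T
    by transfer auto
  show "r *\<^sub>R (x + y) = r *\<^sub>R x + r *\<^sub>R y"
    by (simp add: scaleR_L2T_def add_right)
  show "(r + s) *\<^sub>R x = r *\<^sub>R x + s *\<^sub>R x"
    by (simp add: scaleR_L2T_def add_left)
  show "r *\<^sub>R s *\<^sub>R x = (r * s) *\<^sub>R x"
    by (simp add: scaleR_L2T_def scale)
  show "1 *\<^sub>R x = x"
    by (simp add: scaleR_L2T_def one)
  show "sgn x = inverse (norm x) *\<^sub>R x"
    by (simp add: sgn_L2T_def)
  show "dist x y = norm (x - y)"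
    by (simp add: dist_L2T_def)
  show "uniformity = (INF e\<in>{0<..}. principal {(x::L2T, y). dist x y < e})"
    by (simp add: uniformity_L2T_def)
  show "open U = (\<forall>x\<in>U. \<forall>\<^sub>F (x', y) in uniformity. x' = x \<longrightarrow> y \<in> U)" for U :: "L2T set"
    by (simp add: open_L2T_def)
  show r: "r *\<^sub>R x = complex_of_real r *\<^sub>C x" for r :: real and x :: L2T
    by (simp add: scaleR_L2T_def)
  show com: "cinner x y = cnj (cinner y x)" for x y :: L2T
    by transfer (simp add: mult.commute flip: Bochner_Integration.integral_cnj)
  show add: "cinner (x + y) z = cinner x z + cinner y z"
    by transfer (simp add: distrib_right integrable_mult_cnj)
  show scl: "cinner (c *\<^sub>C x) y = c * cinner x y" for c :: complex and x y :: L2T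
    by transfer (simp add: mult.assoc)
  show re: "inner x y = Re (cinner x y)" for x y :: L2T
    by (simp add: inner_L2T_def)
  show "inner x y = inner y x"
    unfolding re by (subst com) simp
  show "inner (x + y) z = inner x z + inner y z"
    by (simp add: re add)
  show "inner (r *\<^sub>R x) y = r * inner x y"
    by (simp add: re r scl)
  have sq: "inner x x \<ge> 0 \<and> (inner x x = 0 \<longleftrightarrow> x = 0)"
    unfolding inner_L2T_def
  proof transfer
    fix f assume "square_integrable f \<and> square_integrable f \<and> (AE t in circle_measure. f t = f t)"
    then have f: "square_integrable f" by simp
    note [measurable] = square_integrable_measurable[OF f]
    have eq: "(LINT t|circle_measure. f t * cnj (f t))
        = complex_of_real (LINT t|circle_measure. (cmod (f t))\<^sup>2)"
      by (simp add: complex_norm_square[symmetric] flip: integral_complex_of_real of_real_power)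
    have "(LINT t|circle_measure. (cmod (f t))\<^sup>2) = 0 \<longleftrightarrow> (AE t in circle_measure. (cmod (f t))\<^sup>2 = 0)"
      using f by (intro integral_nonneg_eq_0_iff_AE) (auto simp: square_integrable_def)
    then show "0 \<le> Re (LINT t|circle_measure. f t * cnj (f t)) \<and>
      (Re (LINT t|circle_measure. f t * cnj (f t)) = 0) =
      (square_integrable f \<and> square_integrable (\<lambda>t. 0) \<and> (AE t in circle_measure. f t = 0))"
      using f by (auto simp: eq square_integrable_zero)
  qed
  show "inner x x \<ge> 0" "inner x x = 0 \<longleftrightarrow> x = 0"
    using sq by auto
  show "norm x = sqrt (inner x x)"
    by (simp add: norm_L2T_def)
qed

end

lift_definition fourier_L2T :: "L2T \<Rightarrow> int \<Rightarrow> complex" is fourier_coeff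
  unfolding fourier_coeff_def
  by (intro ext integral_cong_AE borel_measurable_times measurable_character)
     (auto intro: square_integrable_measurable)

text \<open>
  Multiplication by a function \<open>f\<close>; meaningful when \<open>f h\<close> is again square-integrable, in particular
  for essentially bounded measurable \<open>f\<close>.
\<close>

definition mult_L2T :: "(real \<Rightarrow> complex) \<Rightarrow> L2T \<Rightarrow> L2T" where
  "mult_L2T f h = abs_L2T (\<lambda>t. f t * rep_L2T h t)"

section \<open>The Hardy space and Toeplitz operators\<close>

lemma integrable_mult_character:
  assumes "square_integrable f"
  shows "integrable circle_measure (\<lambda>t. f t * exp (- \<i> * of_int n * of_real t))"
  using integrable_mult_cnj[OF assms square_integrable_character[of n]] by (simp add: exp_cnj)

lemma fourier_L2T_zero: "fourier_L2T 0 n = 0"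
  by transfer (simp add: fourier_coeff_def)

lemma fourier_L2T_add: "fourier_L2T (g + h) n = fourier_L2T g n + fourier_L2T h n"
proof transfer
  fix g h :: "real \<Rightarrow> complex" and n
  assume "square_integrable g \<and> square_integrable g \<and> (AE t in circle_measure. g t = g t)"
    and "square_integrable h \<and> square_integrable h \<and> (AE t in circle_measure. h t = h t)"
  then show "fourier_coeff (\<lambda>t. g t + h t) n = fourier_coeff g n + fourier_coeff h n"
    using integrable_mult_character[of g n] integrable_mult_character[of h n]
    by (simp add: fourier_coeff_def distrib_right)
qed

lemma fourier_L2T_scaleC: "fourier_L2T (c *\<^sub>C h) n = c * fourier_L2T h n"
  by transfer (simp add: fourier_coeff_def mult.assoc)

typedef H2 = "{h :: L2T. \<forall>n<0. fourier_L2T h n = 0}"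
  by (rule exI[of _ 0]) (simp add: fourier_L2T_zero)

setup_lifting type_definition_H2

instantiation H2 :: complex_inner
begin

lift_definition zero_H2 :: H2 is 0
  by (simp add: fourier_L2T_zero)

lift_definition plus_H2 :: "H2 \<Rightarrow> H2 \<Rightarrow> H2" is "(+)"
  by (simp add: fourier_L2T_add)

lift_definition scaleC_H2 :: "complex \<Rightarrow> H2 \<Rightarrow> H2" is "(*\<^sub>C)"
  by (simp add: fourier_L2T_scaleC)

lift_definition uminus_H2 :: "H2 \<Rightarrow> H2" is uminus
  by (simp add: uminus_L2T_def fourier_L2T_scaleC)

lift_definition minus_H2 :: "H2 \<Rightarrow> H2 \<Rightarrow> H2" is "(-)"
  by (simp add: minus_L2T_def uminus_L2T_def fourier_L2T_add fourier_L2T_scaleC)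

lift_definition scaleR_H2 :: "real \<Rightarrow> H2 \<Rightarrow> H2" is "(*\<^sub>R)"
  by (simp add: scaleR_scaleC fourier_L2T_scaleC)

lift_definition cinner_H2 :: "H2 \<Rightarrow> H2 \<Rightarrow> complex" is cinner .
lift_definition inner_H2 :: "H2 \<Rightarrow> H2 \<Rightarrow> real" is inner .
lift_definition norm_H2 :: "H2 \<Rightarrow> real" is norm .
lift_definition dist_H2 :: "H2 \<Rightarrow> H2 \<Rightarrow> real" is dist .

definition sgn_H2 :: "H2 \<Rightarrow> H2" where "sgn_H2 x = inverse (norm x) *\<^sub>R x"
definition uniformity_H2 :: "(H2 \<times> H2) filter" where
  "uniformity_H2 = (INF e\<in>{0<..}. principal {(x, y). dist x y < e})"
definition open_H2 :: "H2 set \<Rightarrow> bool" where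
  "open_H2 U = (\<forall>x\<in>U. eventually (\<lambda>(x', y). x' = x \<longrightarrow> y \<in> U) uniformity)"

instance
proof
  fix x y z :: H2 and c d :: complex and r s :: real
  show "x + y + z = x + (y + z)" by transfer simp
  show "x + y = y + x" by transfer simp
  show "0 + x = x" by transfer simp
  show "- x + x = 0" by transfer simp
  show "x - y = x + - y" by transfer simp
  show "c *\<^sub>C (x + y) = c *\<^sub>C x + c *\<^sub>C y" by transfer (rule scaleC_add_right)
  show "(c + d) *\<^sub>C x = c *\<^sub>C x + d *\<^sub>C x" by transfer (rule scaleC_add_left)
  show "c *\<^sub>C d *\<^sub>C x = (c * d) *\<^sub>C x" by transfer (rule scaleC_scaleC)
  show "r *\<^sub>R (x + y) = r *\<^sub>R x + r *\<^sub>R y" by transfer (rule scaleR_add_right)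
  show "(r + s) *\<^sub>R x = r *\<^sub>R x + s *\<^sub>R x" by transfer (rule scaleR_add_left)
  show "r *\<^sub>R s *\<^sub>R x = (r * s) *\<^sub>R x" by transfer simp
  show "1 *\<^sub>R x = x" by transfer simp
  show "sgn x = inverse (norm x) *\<^sub>R x" by (simp add: sgn_H2_def)
  show "dist x y = norm (x - y)" by transfer (rule dist_norm)
  show "uniformity = (INF e\<in>{0<..}. principal {(x::H2, y). dist x y < e})"
    by (simp add: uniformity_H2_def)
  show "open U = (\<forall>x\<in>U. \<forall>\<^sub>F (x', y) in uniformity. x' = x \<longrightarrow> y \<in> U)" for U :: "H2 set"
    by (simp add: open_H2_def)
  show "r *\<^sub>R x = complex_of_real r *\<^sub>C x" by transfer (rule scaleR_scaleC)
  show "cinner x y = cnj (cinner y x)" by transfer (rule cinner_commute)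
  show "cinner (x + y) z = cinner x z + cinner y z" by transfer (rule cinner_add_left)
  show "cinner (c *\<^sub>C x) y = c * cinner x y" by transfer (rule cinner_scaleC_left)
  show "inner x y = Re (cinner x y)" by transfer (rule inner_eq_Re_cinner)
  show "inner x y = inner y x" by transfer (rule inner_commute)
  show "inner (x + y) z = inner x z + inner y z" by transfer (rule inner_add_left)
  show "inner (r *\<^sub>R x) y = r * inner x y" by transfer simp
  show "inner x x \<ge> 0" by transfer simp
  show "inner x x = 0 \<longleftrightarrow> x = 0" by transfer simp
  show "norm x = sqrt (inner x x)" by transfer (rule norm_eq_sqrt_inner)
qed

end

definition P_plus :: "L2T \<Rightarrow> H2" where
  "P_plus g = (THE h. \<forall>k::H2. cinner (g - Rep_H2 h) (Rep_H2 k) = 0)"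

definition toeplitz :: "(real \<Rightarrow> complex) \<Rightarrow> (H2 \<Rightarrow>\<^sub>L H2)" where
  "toeplitz f = Blinfun (\<lambda>h. P_plus (mult_L2T f (Rep_H2 h)))"

section \<open>The classes \<open>\<W>\<^sub>1\<close>\<close>

text \<open>A complex measure is automatically finite.\<close>

definition complex_borel_measure :: "(real set \<Rightarrow> complex) \<Rightarrow> bool" where
  "complex_borel_measure \<mu> \<longleftrightarrow>
     (\<forall>A :: nat \<Rightarrow> real set. range A \<subseteq> sets borel \<longrightarrow> disjoint_family A \<longrightarrow>
        (\<lambda>i. \<mu> (A i)) sums \<mu> (\<Union>i. A i))"

text \<open>
  The integral of \<open>g\<close> with respect to \<open>\<mu>\<close> through a decomposition
  \<open>\<mu> = \<mu>\<^sub>1 - \<mu>\<^sub>2 + \<i> (\<mu>\<^sub>3 - \<mu>\<^sub>4)\<close> into finite positive measures (for instance the Jordan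
  decompositions of the real and imaginary parts); the value does not depend on the decomposition.
\<close>

definition has_complex_measure_integral ::
    "(real set \<Rightarrow> complex) \<Rightarrow> (real \<Rightarrow> complex) \<Rightarrow> complex \<Rightarrow> bool" where
  "has_complex_measure_integral \<mu> g I \<longleftrightarrow>
     (\<exists>M1 M2 M3 M4 :: real measure.
        (\<forall>M\<in>{M1, M2, M3, M4}. finite_measure M \<and> sets M = sets borel \<and> integrable M g) \<and>
        (\<forall>A\<in>sets borel. \<mu> A =
           complex_of_real (measure M1 A - measure M2 A)
           + \<i> * complex_of_real (measure M3 A - measure M4 A)) \<and>
        I = (LINT y|M1. g y) - (LINT y|M2. g y) + \<i> * ((LINT y|M3. g y) - (LINT y|M4. g y)))"

definition C1_on :: "real set \<Rightarrow> (real \<Rightarrow> complex) \<Rightarrow> bool" where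
  "C1_on S \<phi> \<longleftrightarrow> (\<exists>\<phi>'. continuous_on S \<phi>' \<and>
     (\<forall>x\<in>S. (\<phi> has_vector_derivative \<phi>' x) (at x within S)))"

definition W1_line :: "(real \<Rightarrow> complex) set" where
  "W1_line = {\<phi>. C1_on UNIV \<phi> \<and>
     (\<exists>\<mu>. complex_borel_measure \<mu> \<and>
        (\<forall>x. has_complex_measure_integral \<mu> (\<lambda>y. exp (\<i> * of_real x * of_real y))
               (vector_derivative \<phi> (at x))))}"

text \<open>Only the values of \<open>\<phi>\<close> on \<open>[a, b]\<close> matter.\<close>

definition W1_interval :: "real \<Rightarrow> real \<Rightarrow> (real \<Rightarrow> complex) set" where
  "W1_interval a b = {\<phi>. C1_on {a..b} \<phi> \<and> (\<exists>\<psi>\<in>W1_line. \<forall>x\<in>{a..b}. \<psi> x = \<phi> x)}"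

end

theory Submission
  imports Defs
    "HOL-Computational_Algebra.Fundamental_Theorem_Algebra"
    "HOL-Probability.Probability_Measure"
begin

text \<open>
  Write \<open>T\<close> for the Toeplitz operator with symbol \<open>f\<close>, and put \<open>A = T\<^sup>* T\<close>, \<open>B = T T\<^sup>*\<close>. The two sides of
  the formula are linear in \<open>\<phi>\<close> and vanish for constant \<open>\<phi>\<close>. The formula is established for
  \<open>\<phi>(x) = x\<^sup>n\<close> with \<open>n \<ge> 1\<close> by commutator calculus and is then carried over to the whole class by
  approximation, for which Krein's trace norm estimate supplies the topology.

  Powers. Subscripts denote Fourier coefficients. For symbols \<open>g\<close>, \<open>u\<close> whose commutators with the Hardy
  projection are Hilbert--Schmidt, that is, with \<open>\<Sum> \<bar>k\<bar> \<bar>g\<^sub>k\<bar>\<^sup>2\<close> and \<open>\<Sum> \<bar>k\<bar> \<bar>u\<^sub>k\<bar>\<^sup>2\<close> finite, the defect \<open>T\<^sub>g\<^sub>u - T\<^sub>g T\<^sub>u\<close> is a product of two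
  Hilbert--Schmidt operators, and its trace is \<open>\<Sum>\<close> of \<open>k g\<^sub>k u\<^sub>-\<^sub>k\<close> over \<open>k > 0\<close> (\<open>toeplitz_nuclear\<close>,
  \<open>toeplitz_defect_trace\<close>). Antisymmetrizing gives \<open>Tr [T\<^sub>h, T\<^sub>f] = \<Sum> k f\<^sub>k h\<^sub>-\<^sub>k\<close> over all integers \<open>k\<close>, and
  since the Fourier coefficients of \<open>f'\<close> are \<open>\<i> k f\<^sub>k\<close>, Parseval's formula turns this into
  \<open>1/(2\<pi>\<i>) \<integral> f' h\<close> (\<open>toeplitz_commutator_trace\<close>). Now \<open>A\<close> to the power \<open>n+1\<close> minus \<open>B\<close> to the power
  \<open>n+1\<close> is the commutator \<open>[T\<^sup>* B\<^sup>n, T]\<close>, and \<open>T\<^sup>* B\<^sup>n\<close> differs from the Toeplitz operator with symbol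
  \<open>h = f\<^sup>* \<bar>f\<bar>\<^sup>2\<^sup>n\<close>, where \<open>f\<^sup>*\<close> is the complex conjugate of \<open>f\<close>, by a trace class
  operator \<open>R\<close>, for which \<open>Tr [R, T] = 0\<close>. As \<open>f' h\<close> equals
  \<open>\<bar>f\<bar>\<^sup>2\<close> to the power \<open>n+1\<close> times \<open>f'/f\<close>, this is the formula for powers (\<open>trace_monom\<close>).

  Approximation. If \<open>\<phi>'\<close> is the Fourier transform of \<open>\<mu>\<close>, then \<open>\<phi>(x) - \<phi>(0)\<close> is the integral of
  \<open>(exp(\<i>sx) - 1)/(\<i>s)\<close> with respect to \<open>\<mu>(ds)\<close> (\<open>W1_line_representation\<close>). The trace norm of
  \<open>exp(\<i>sA) - exp(\<i>sB)\<close> is at most \<open>\<bar>s\<bar>\<close> times the trace norm of \<open>A - B\<close> (\<open>trace_norm_le_exp_diff\<close>), so the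
  quotients are bounded in trace norm uniformly in \<open>s\<close>. Replacing them by Taylor polynomials for \<open>\<bar>s\<bar> \<le> n\<close>
  and by \<open>0\<close> for \<open>\<bar>s\<bar> > n\<close> yields polynomials \<open>p\<^sub>n\<close> with \<open>p\<^sub>n(0) = 0\<close> for which \<open>p\<^sub>n(A) - p\<^sub>n(B)\<close> converges
  to \<open>\<phi>(A) - \<phi>(B)\<close> in trace norm. Moreover \<open>\<bar>p\<^sub>n(x) - \<phi>(x) + \<phi>(0)\<bar> \<le> \<epsilon>\<^sub>n x\<close>; the factor \<open>x = \<bar>f\<bar>\<^sup>2\<close>
  absorbs the zeros of the denominator in \<open>f'/f\<close>, so the integrals converge as well
  (\<open>trace_formula_limit\<close>, \<open>trace_formula_primitive\<close>).

  Foundations. The trace norm is handled through a bound on \<open>\<Sum> \<bar>\<langle>D X e, Y e\<rangle>\<bar>\<close> over finite orthonormal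
  families, uniform in bounded \<open>X\<close> and \<open>Y\<close>; it is stable under the operations above and implies the trace
  class property (\<open>trace_classI\<close>). The functional calculus rests on a bound for the norm of a polynomial in
  a self-adjoint operator by the supremum on the spectrum (\<open>norm_poly_op_le\<close>), and the integral formula
  for \<open>f\<close> on the fundamental theorem of calculus for absolutely continuous functions
  (\<open>ac_FTC_complex\<close>), whose almost everywhere differentiability comes from Vitali's covering theorem.
\<close>

section \<open>Complex inner product spaces\<close>

lemma cinner_add_right: "cinner x (y + z) = cinner x y + cinner x (z :: 'a::complex_inner)"
  by (metis cinner_add_left cinner_commute complex_cnj_add)

lemma cinner_scaleC_right: "cinner x (c *\<^sub>C y) = cnj c * cinner x (y :: 'a::complex_inner)"
  by (metis cinner_commute cinner_scaleC_left complex_cnj_mult)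

lemma scaleC_one [simp]: "1 *\<^sub>C x = (x :: 'a::complex_inner)"
  using scaleR_scaleC[of 1 x] by simp

lemma scaleC_zero [simp]: "0 *\<^sub>C x = (0 :: 'a::complex_inner)"
  using scaleR_scaleC[of 0 x] by simp

lemma scaleC_minus_one: "(-1) *\<^sub>C x = - (x :: 'a::complex_inner)"
  using scaleR_scaleC[of "-1" x] by simp

lemma cinner_self: "cinner x x = complex_of_real ((norm (x :: 'a::complex_inner))\<^sup>2)"
proof -
  have "Re (cinner x x) = (norm x)\<^sup>2"
    by (metis inner_eq_Re_cinner power2_norm_eq_inner)
  moreover have "Im (cinner x x) = 0"
    by (metis cinner_commute complex_In_mult_cnj_zero complex_cnj_cancel_iff
        cnj.simps(2) equal_neg_zero)
  ultimately show ?thesis by (simp add: complex_eq_iff)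
qed

lemma norm_scaleC: "norm (c *\<^sub>C x) = cmod c * norm (x :: 'a::complex_inner)"
proof -
  have "cinner (c *\<^sub>C x) (c *\<^sub>C x) = (c * cnj c) * cinner x x"
    by (simp add: cinner_scaleC_left cinner_scaleC_right)
  also have "\<dots> = complex_of_real ((cmod c * norm x)\<^sup>2)"
    unfolding cinner_self complex_norm_square[symmetric] by (simp add: power_mult_distrib)
  finally have "cinner (c *\<^sub>C x) (c *\<^sub>C x) = complex_of_real ((cmod c * norm x)\<^sup>2)" .
  then have "(norm (c *\<^sub>C x))\<^sup>2 = (cmod c * norm x)\<^sup>2"
    unfolding cinner_self of_real_eq_iff .
  then show ?thesis by simp
qed

lemma cmod_cinner_le: "cmod (cinner x y) \<le> norm x * norm (y :: 'a::complex_inner)"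
proof (cases "cinner x y = 0")
  case False
  define c where "c = cnj (cinner x y) / cmod (cinner x y)"
  have c1: "cmod c = 1" using False by (simp add: c_def norm_divide)
  have "c * cinner x y = (cmod (cinner x y))\<^sup>2 / cmod (cinner x y)"
    by (simp add: c_def complex_norm_square mult.commute del: of_real_power)
  also have "\<dots> = complex_of_real (cmod (cinner x y))"
    using False by (simp add: power2_eq_square)
  finally have "cmod (cinner x y) = inner (c *\<^sub>C x) y"
    by (simp add: inner_eq_Re_cinner cinner_scaleC_left)
  also have "\<dots> \<le> norm (c *\<^sub>C x) * norm y"
    by (rule norm_cauchy_schwarz)
  finally show ?thesis by (simp add: norm_scaleC c1)
qed simp

lemma bounded_bilinear_cinner: "bounded_bilinear (cinner :: 'a::complex_inner \<Rightarrow> 'a \<Rightarrow> complex)"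
proof
  show "\<exists>K. \<forall>a b. norm (cinner a b :: complex) \<le> norm (a :: 'a) * norm b * K"
    by (rule exI[of _ 1]) (simp add: cmod_cinner_le)
qed (simp_all add: cinner_add_left cinner_add_right scaleR_scaleC cinner_scaleC_left
      cinner_scaleC_right scaleR_conv_of_real)

lemma bounded_bilinear_scaleC:
  "bounded_bilinear (scaleC :: complex \<Rightarrow> 'a::complex_inner \<Rightarrow> 'a)"
proof
  show "\<exists>K. \<forall>a b. norm (a *\<^sub>C b :: 'a) \<le> norm a * norm b * K"
    by (rule exI[of _ 1]) (simp add: norm_scaleC)
qed (simp_all add: scaleC_add_left scaleC_add_right scaleR_scaleC scaleC_scaleC
      scaleR_conv_of_real mult.commute)

interpretation cinner: bounded_bilinear "cinner :: 'a::complex_inner \<Rightarrow> 'a \<Rightarrow> complex"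
  by (rule bounded_bilinear_cinner)

interpretation scaleC: bounded_bilinear "scaleC :: complex \<Rightarrow> 'a::complex_inner \<Rightarrow> 'a"
  by (rule bounded_bilinear_scaleC)

lemma cinner_eq_zeroI: "(\<And>y. cinner x y = 0) \<Longrightarrow> x = (0 :: 'a::complex_inner)"
  using cinner_self[of x] by simp

lemma cinner_ext: "(\<And>y. cinner x y = cinner x' y) \<Longrightarrow> x = (x' :: 'a::complex_inner)"
  using cinner_eq_zeroI[of "x - x'"] by (simp add: cinner.diff_left)

section \<open>Adjoint pairs of bounded operators\<close>

text \<open>
  A relation in place of an adjoint function, because every operator that occurs comes with an explicit
  adjoint.
\<close>

definition adj_pair :: "('a::complex_inner \<Rightarrow>\<^sub>L 'a) \<Rightarrow> ('a \<Rightarrow>\<^sub>L 'a) \<Rightarrow> bool" where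
  "adj_pair A B \<longleftrightarrow> (\<forall>x y. cinner (blinfun_apply A x) y = cinner x (blinfun_apply B y))"

lemma adj_pairD: "adj_pair A B \<Longrightarrow> cinner (blinfun_apply A x) y = cinner x (blinfun_apply B y)"
  by (simp add: adj_pair_def)

lemma adj_pair_sym: "adj_pair A B \<Longrightarrow> adj_pair B A"
  unfolding adj_pair_def by (metis cinner_commute)

lemma adj_pair_unique: "adj_pair A B \<Longrightarrow> adj_pair A C \<Longrightarrow> B = C"
  by (rule blinfun_eqI, rule cinner_ext) (metis adj_pairD adj_pair_sym)

lemma cadjoint_eq:
  assumes "adj_pair A B"
  shows "cadjoint A = B"
  unfolding cadjoint_def
proof (rule the_equality)
  show "\<forall>x y. cinner (blinfun_apply A x) y = cinner x (blinfun_apply B y)"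
    using assms by (simp add: adj_pair_def)
  show "C = B" if "\<forall>x y. cinner (blinfun_apply A x) y = cinner x (blinfun_apply C y)" for C
    using adj_pair_unique[OF _ assms, of C] that by (simp add: adj_pair_def)
qed

lemma adj_pair_clinear:
  assumes "adj_pair A B"
  shows "blinfun_apply A (c *\<^sub>C x) = c *\<^sub>C blinfun_apply A x"
  by (rule cinner_ext) (simp add: adj_pairD[OF assms] cinner_scaleC_left)

lemma adj_pair_diff: "adj_pair A B \<Longrightarrow> adj_pair A' B' \<Longrightarrow> adj_pair (A - A') (B - B')"
  by (simp add: adj_pair_def blinfun.diff_left cinner.diff_left cinner.diff_right)

lemma adj_pair_compose: "adj_pair A B \<Longrightarrow> adj_pair A' B' \<Longrightarrow> adj_pair (A o\<^sub>L A') (B' o\<^sub>L B)"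
  by (simp add: adj_pair_def)

lemma adj_pair_id: "adj_pair id_blinfun id_blinfun"
  by (simp add: adj_pair_def)

text \<open>
  \<open>\<parallel>B y\<parallel>\<^sup>2 = \<langle>A B y, y\<rangle> \<le> \<parallel>A\<parallel> \<parallel>B y\<parallel> \<parallel>y\<parallel>\<close>.
\<close>

lemma norm_adj_le:
  assumes "adj_pair A B"
  shows "norm B \<le> norm A"
proof (rule norm_blinfun_bound)
  fix x
  show "norm (blinfun_apply B x) \<le> norm A * norm x"
  proof (cases "blinfun_apply B x = 0")
    case False
    have "(norm (blinfun_apply B x))\<^sup>2 = cmod (cinner (blinfun_apply B x) (blinfun_apply B x))"
      unfolding cinner_self norm_of_real by simp
    also have "\<dots> = cmod (cinner (blinfun_apply A (blinfun_apply B x)) x)"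
      by (simp add: adj_pairD[OF assms])
    also have "\<dots> \<le> norm (blinfun_apply A (blinfun_apply B x)) * norm x"
      by (rule cmod_cinner_le)
    also have "\<dots> \<le> norm A * norm (blinfun_apply B x) * norm x"
      by (intro mult_right_mono norm_blinfun) auto
    finally have "norm (blinfun_apply B x) * norm (blinfun_apply B x)
        \<le> norm (blinfun_apply B x) * (norm A * norm x)"
      by (simp add: power2_eq_square mult_ac)
    then show ?thesis using False by simp
  qed auto
qed simp

lemma norm_adj_eq: "adj_pair A B \<Longrightarrow> norm B = norm A"
  by (metis norm_adj_le adj_pair_sym order_antisym)

lemma adj_pair_limit:
  assumes "\<And>n. adj_pair (A n) (B n)" "A \<longlonglongrightarrow> A'" "B \<longlonglongrightarrow> B'"
  shows "adj_pair A' B'"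
  unfolding adj_pair_def
proof (intro allI)
  fix x y
  have "(\<lambda>n. cinner (blinfun_apply (A n) x) y) \<longlonglongrightarrow> cinner (blinfun_apply A' x) y"
    by (intro cinner.tendsto blinfun.tendsto assms tendsto_const)
  moreover have "(\<lambda>n. cinner x (blinfun_apply (B n) y)) \<longlonglongrightarrow> cinner x (blinfun_apply B' y)"
    by (intro cinner.tendsto blinfun.tendsto assms tendsto_const)
  ultimately show "cinner (blinfun_apply A' x) y = cinner x (blinfun_apply B' y)"
    using LIMSEQ_unique adj_pairD[OF assms(1)] by simp
qed

section \<open>Polynomials in an operator\<close>

definition scalar_op :: "complex \<Rightarrow> 'a::complex_inner \<Rightarrow>\<^sub>L 'a" where
  "scalar_op c = Blinfun (\<lambda>x. c *\<^sub>C x)"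

lemma scalar_op_apply [simp]: "blinfun_apply (scalar_op c) x = c *\<^sub>C x"
  unfolding scalar_op_def by (simp add: bounded_linear_Blinfun_apply scaleC.bounded_linear_right)

lemma adj_pair_scalar_op: "adj_pair (scalar_op c) (scalar_op (cnj c))"
  by (simp add: adj_pair_def cinner_scaleC_left cinner_scaleC_right)

lemma bounded_linear_funpow:
  fixes A :: "'a::real_normed_vector \<Rightarrow>\<^sub>L 'a"
  shows "bounded_linear (blinfun_apply A ^^ n)"
proof (induction n)
  case 0
  have "(blinfun_apply A ^^ 0) = (\<lambda>x. x)" by auto
  then show ?case by (metis bounded_linear_ident)
next
  case (Suc n)
  then show ?case
    using bounded_linear_compose[OF blinfun.bounded_linear_right[of A] Suc] by (simp add: o_def)
qed

lemma poly_op_apply: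
  "blinfun_apply (poly_op p A) x = (\<Sum>i\<le>degree p. coeff p i *\<^sub>C (blinfun_apply A ^^ i) x)"
  unfolding poly_op_def
  by (rule arg_cong[OF bounded_linear_Blinfun_apply, THEN fun_cong[of _ _ x], of _ "\<lambda>f. f"]
      bounded_linear_Blinfun_apply[THEN fun_cong])
    (intro bounded_linear_sum bounded_linear_compose[OF scaleC.bounded_linear_right]
      bounded_linear_funpow)

lemma poly_op_0 [simp]: "poly_op 0 A = 0"
  by (rule blinfun_eqI) (simp add: poly_op_apply)

lemma poly_op_pCons_apply:
  "blinfun_apply (poly_op (pCons a p) A) x
    = a *\<^sub>C x + blinfun_apply (poly_op p A) (blinfun_apply A x)"
proof (cases "p = 0")
  case True
  then show ?thesis by (simp add: poly_op_apply)
next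
  case False
  then show ?thesis
    by (simp add: poly_op_apply sum.atMost_Suc_shift funpow_swap1 del: sum.atMost_Suc)
qed

lemma poly_op_add: "poly_op (p + q) A = poly_op p A + poly_op q A"
proof -
  have "blinfun_apply (poly_op (p + q) A) x = blinfun_apply (poly_op p A + poly_op q A) x" for x
    by (induction p q arbitrary: x rule: poly_induct2)
      (simp_all add: poly_op_pCons_apply blinfun.add_left scaleC_add_left)
  then show ?thesis by (rule blinfun_eqI)
qed

lemma poly_op_smult: "poly_op (smult c p) A = scalar_op c o\<^sub>L poly_op p A"
proof -
  have "blinfun_apply (poly_op (smult c p) A) x = c *\<^sub>C blinfun_apply (poly_op p A) x" for x
    by (induction p arbitrary: x)
      (simp_all add: poly_op_pCons_apply scaleC.zero_right scaleC_add_right scaleC_scaleC)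
  then show ?thesis by (intro blinfun_eqI) simp
qed

lemma poly_op_uminus: "poly_op (- p) A = - poly_op p A"
  using poly_op_add[of p "- p" A] by (simp add: eq_neg_iff_add_eq_0 add.commute)

lemma poly_op_diff: "poly_op (p - q) A = poly_op p A - poly_op q A"
  using poly_op_add[of p "- q" A] by (simp add: poly_op_uminus)

lemma poly_op_sum: "poly_op (\<Sum>i\<in>I. p i) A = (\<Sum>i\<in>I. poly_op (p i) A)"
  by (induction I rule: infinite_finite_induct) (simp_all add: poly_op_add)

lemma poly_op_commute:
  assumes "adj_pair A B"
  shows "blinfun_apply (poly_op p A) (blinfun_apply A x) = blinfun_apply A (blinfun_apply (poly_op p A) x)"
  by (induction p arbitrary: x)
    (simp_all add: poly_op_pCons_apply blinfun.add_right adj_pair_clinear[OF assms])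

lemma poly_op_mult:
  assumes "adj_pair A B"
  shows "poly_op (p * q) A = poly_op p A o\<^sub>L poly_op q A"
proof -
  have "blinfun_apply (poly_op (p * q) A) x = blinfun_apply (poly_op p A) (blinfun_apply (poly_op q A) x)" for x
    by (induction p arbitrary: x)
      (simp_all add: poly_op_pCons_apply poly_op_add poly_op_smult blinfun.add_left
        poly_op_commute[OF assms])
  then show ?thesis by (intro blinfun_eqI) simp
qed

lemma poly_op_const: "poly_op [:c:] A = scalar_op c"
  by (rule blinfun_eqI) (simp add: poly_op_pCons_apply)

lemma adj_pair_poly_op:
  assumes "adj_pair A A"
  shows "adj_pair (poly_op p A) (poly_op (map_poly cnj p) A)"
  unfolding adj_pair_def
proof (induction p)
  case 0
  then show ?case by (simp add: cinner.zero_left cinner.zero_right)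
next
  case (pCons a p)
  have "map_poly cnj (pCons a p) = pCons (cnj a) (map_poly cnj p)"
    by (simp add: map_poly_pCons)
  then show ?case
    using pCons.IH by (simp add: poly_op_pCons_apply cinner.add_left cinner.add_right
        cinner_scaleC_left cinner_scaleC_right adj_pairD[OF assms] poly_op_commute[OF assms])
qed

section \<open>The norm of a polynomial in a self-adjoint operator\<close>

text \<open>
  For normal operators on a complete space this is invertibility; in this form it passes to products at once.
\<close>

definition bounded_below :: "('a::complex_inner \<Rightarrow>\<^sub>L 'a) \<Rightarrow> bool" where
  "bounded_below B \<longleftrightarrow> (\<exists>c>0. \<forall>x. c * norm x \<le> norm (blinfun_apply B x))"

lemma bounded_below_compose:
  assumes "bounded_below B" "bounded_below C"
  shows "bounded_below (B o\<^sub>L C)"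
proof -
  obtain b where b: "b > 0" "\<And>x. b * norm x \<le> norm (blinfun_apply B x)"
    using assms(1) by (auto simp: bounded_below_def)
  obtain c where c: "c > 0" "\<And>x. c * norm x \<le> norm (blinfun_apply C x)"
    using assms(2) by (auto simp: bounded_below_def)
  have "(b * c) * norm x \<le> norm (blinfun_apply (B o\<^sub>L C) x)" for x
    using order_trans[OF mult_left_mono[OF c(2)[of x], of b] b(2)[of "blinfun_apply C x"]] b(1)
    by (simp add: mult.assoc)
  then show ?thesis
    unfolding bounded_below_def using b(1) c(1) by (intro exI[of _ "b * c"]) auto
qed

text \<open>
  Off the real axis, \<open>Im \<langle>(A - z) x, x\<rangle> = - Im z \<parallel>x\<parallel>\<^sup>2\<close> because \<open>\<langle>A x, x\<rangle>\<close> is real; on the real axis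
  the inverse supplied by the definition of the spectrum gives the bound.
\<close>

lemma bounded_below_shift:
  assumes sa: "adj_pair A A" and z: "\<And>r. z = complex_of_real r \<Longrightarrow> z \<notin> spectrum A"
  shows "bounded_below (A - scalar_op z)"
proof (cases "Im z = 0")
  case True
  then have "z = complex_of_real (Re z)" by (simp add: complex_eq_iff)
  then have "z \<notin> spectrum A" by (rule z)
  then obtain B where B: "\<And>x. blinfun_apply B (blinfun_apply A x - z *\<^sub>C x) = x"
    unfolding spectrum_def by blast
  have "(1 / (norm B + 1)) * norm x \<le> norm (blinfun_apply (A - scalar_op z) x)" for x
  proof -
    have "norm x = norm (blinfun_apply B (blinfun_apply (A - scalar_op z) x))"
      using B[of x] by (simp add: blinfun.diff_left)
    also have "\<dots> \<le> norm B * norm (blinfun_apply (A - scalar_op z) x)" by (rule norm_blinfun)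
    also have "\<dots> \<le> (norm B + 1) * norm (blinfun_apply (A - scalar_op z) x)"
      by (intro mult_right_mono) auto
    finally show ?thesis
      using norm_ge_zero[of B] by (simp add: pos_divide_le_eq add_nonneg_pos mult.commute)
  qed
  then show ?thesis unfolding bounded_below_def
    by (intro exI[of _ "1 / (norm B + 1)"]) (auto simp: add_nonneg_pos)
next
  case False
  have "\<bar>Im z\<bar> * norm x \<le> norm (blinfun_apply (A - scalar_op z) x)" for x
  proof (cases "x = 0")
    case False
    have "cinner (blinfun_apply A x) x = cnj (cinner (blinfun_apply A x) x)"
      using adj_pairD[OF sa, of x x] cinner_commute[of "blinfun_apply A x" x] by simp
    then have im: "Im (cinner (blinfun_apply A x) x) = 0"
      by (metis cnj.simps(2) equal_neg_zero)
    have "\<bar>Im z\<bar> * (norm x)\<^sup>2 = \<bar>Im (cinner (blinfun_apply (A - scalar_op z) x) x)\<bar>"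
      by (simp add: blinfun.diff_left cinner.diff_left cinner_scaleC_left cinner_self im abs_mult
          del: of_real_power)
    also have "\<dots> \<le> norm (blinfun_apply (A - scalar_op z) x) * norm x"
      by (rule order_trans[OF abs_Im_le_cmod cmod_cinner_le])
    finally show ?thesis using False by (simp add: power2_eq_square)
  qed simp
  then show ?thesis unfolding bounded_below_def using False by (intro exI[of _ "\<bar>Im z\<bar>"]) auto
qed

text \<open>
  The polynomial splits into linear factors, each of which is bounded below by the preceding lemma.
\<close>

lemma bounded_below_poly_op:
  assumes sa: "adj_pair A A"
    and "Q \<noteq> 0" "\<And>r. complex_of_real r \<in> spectrum A \<Longrightarrow> poly Q (complex_of_real r) \<noteq> 0"
  shows "bounded_below (poly_op Q A)"
  using assms(2,3)
proof (induction "degree Q" arbitrary: Q)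
  case 0
  then obtain c where Q: "Q = [:c:]" and c: "c \<noteq> 0"
    by (metis degree_eq_zeroE pCons_0_0)
  show ?case unfolding Q poly_op_const bounded_below_def
    using c by (intro exI[of _ "cmod c"]) (auto simp: norm_scaleC)
next
  case (Suc n)
  then have "\<not> constant (poly Q)" by (simp add: constant_degree)
  then obtain z where z: "poly Q z = 0" using fundamental_theorem_of_algebra by blast
  then obtain Q' where Q: "Q = [:-z, 1:] * Q'" by (metis poly_eq_0_iff_dvd dvdE)
  have Q'0: "Q' \<noteq> 0" using Suc.prems(1) Q by auto
  have "degree Q = Suc (degree Q')" unfolding Q using Q'0 by (subst degree_mult_eq) auto
  then have IH: "bounded_below (poly_op Q' A)"
    using Suc.hyps Suc.prems(2) Q'0 by (intro Suc.hyps(1)) (auto simp: Q)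
  have "poly_op [:-z, 1:] A = A - scalar_op z"
    by (rule blinfun_eqI) (simp add: poly_op_pCons_apply blinfun.diff_left scaleC.minus_left)
  moreover have "bounded_below (A - scalar_op z)"
    using Suc.prems(2) z by (intro bounded_below_shift[OF sa]) blast
  ultimately show ?case
    unfolding Q poly_op_mult[OF sa] using IH by (auto intro: bounded_below_compose)
qed

text \<open>
  \<open>\<parallel>P\<parallel>\<^sup>2\<close> lies in the approximate spectrum of \<open>P\<^sup>* P\<close>: with \<open>c = \<parallel>P\<parallel>\<^sup>2\<close>,
  \<open>\<parallel>(c - P\<^sup>* P) x\<parallel>\<^sup>2 \<le> c\<^sup>2 \<parallel>x\<parallel>\<^sup>2 - c \<parallel>P x\<parallel>\<^sup>2\<close>, so a lower bound for \<open>c - P\<^sup>* P\<close> would push \<open>\<parallel>P x\<parallel>\<^sup>2\<close>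
  below \<open>(c - k\<^sup>2/c) \<parallel>x\<parallel>\<^sup>2\<close>, contrary to the choice of \<open>c\<close>.
\<close>

lemma not_bounded_below_norm:
  assumes adj: "adj_pair P P'" and "norm P > 0"
  shows "\<not> bounded_below (scalar_op ((norm P)\<^sup>2) - (P' o\<^sub>L P))"
proof
  assume "bounded_below (scalar_op ((norm P)\<^sup>2) - (P' o\<^sub>L P))"
  then obtain k where k: "k > 0"
    "\<And>x. k * norm x \<le> norm (blinfun_apply (scalar_op ((norm P)\<^sup>2) - (P' o\<^sub>L P)) x)"
    by (auto simp: bounded_below_def)
  define c where "c = (norm P)\<^sup>2"
  have c0: "c > 0" using assms(2) by (simp add: c_def)
  have sq: "(norm (blinfun_apply P x))\<^sup>2 \<le> (c - k\<^sup>2 / c) * (norm x)\<^sup>2" for x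
  proof -
    let ?y = "blinfun_apply P' (blinfun_apply P x)"
    have i1: "inner x ?y = (norm (blinfun_apply P x))\<^sup>2"
      by (simp add: inner_eq_Re_cinner adj_pairD[OF adj, symmetric] cinner_self)
    have "norm ?y \<le> norm P * norm (blinfun_apply P x)"
      using norm_blinfun[of P' "blinfun_apply P x"] norm_adj_eq[OF adj] by simp
    then have "(norm ?y)\<^sup>2 \<le> (norm P * norm (blinfun_apply P x))\<^sup>2"
      by (intro power_mono) auto
    then have y2: "(norm ?y)\<^sup>2 \<le> c * (norm (blinfun_apply P x))\<^sup>2"
      by (simp add: power_mult_distrib c_def)
    have "(k * norm x)\<^sup>2 \<le> (norm (blinfun_apply (scalar_op ((norm P)\<^sup>2) - (P' o\<^sub>L P)) x))\<^sup>2"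
      using k by (intro power_mono) auto
    also have "blinfun_apply (scalar_op ((norm P)\<^sup>2) - (P' o\<^sub>L P)) x = c *\<^sub>R x - ?y"
      by (simp add: blinfun.diff_left c_def scaleR_scaleC)
    also have "(norm (c *\<^sub>R x - ?y))\<^sup>2 = c\<^sup>2 * (norm x)\<^sup>2 - 2 * c * (norm (blinfun_apply P x))\<^sup>2 + (norm ?y)\<^sup>2"
      unfolding power2_norm_eq_inner[of "c *\<^sub>R x - ?y"]
      using power2_norm_eq_inner[of x] power2_norm_eq_inner[of ?y]
      by (simp add: inner_diff_left inner_diff_right i1 inner_commute[of ?y x] power2_eq_square
          algebra_simps)
    also have "\<dots> \<le> c\<^sup>2 * (norm x)\<^sup>2 - c * (norm (blinfun_apply P x))\<^sup>2"
      using y2 by simp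
    finally have "c * (norm (blinfun_apply P x))\<^sup>2 \<le> (c\<^sup>2 - k\<^sup>2) * (norm x)\<^sup>2"
      by (simp add: algebra_simps power_mult_distrib)
    then show ?thesis using c0 by (simp add: field_simps power2_eq_square)
  qed
  define d where "d = max 0 (c - k\<^sup>2 / c)"
  have "norm (blinfun_apply P x) \<le> sqrt d * norm x" for x
  proof -
    have "(norm (blinfun_apply P x))\<^sup>2 \<le> d * (norm x)\<^sup>2"
      using sq[of x] by (rule order_trans) (intro mult_right_mono, auto simp: d_def)
    then have "norm (blinfun_apply P x) \<le> sqrt (d * (norm x)\<^sup>2)" by (rule real_le_rsqrt)
    then show ?thesis by (simp add: real_sqrt_mult)
  qed
  then have "norm P \<le> sqrt d" by (intro norm_blinfun_bound) (auto simp: d_def)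
  then have "(norm P)\<^sup>2 \<le> d" by (simp add: d_def power_mono real_le_rsqrt real_sqrt_ge_0_iff)
      (metis d_def max.cobounded1 norm_ge_zero power_mono real_sqrt_pow2)
  moreover have "d < c" using c0 k(1) by (simp add: d_def)
  ultimately show False by (simp add: c_def)
qed

lemma poly_map_cnj_of_real:
  "poly (map_poly cnj p * p) (complex_of_real r) = complex_of_real ((cmod (poly p (complex_of_real r)))\<^sup>2)"
proof -
  have "poly (map_poly cnj p) (complex_of_real r) = cnj (poly p (complex_of_real r))"
    by (induction p) (simp_all add: map_poly_pCons)
  then show ?thesis unfolding complex_norm_square poly_mult by (simp add: mult.commute)
qed

text \<open>
  Spectral radius formula and spectral mapping in one step: if \<open>c = \<parallel>p(A)\<parallel>\<close> exceeded \<open>\<bar>p\<bar>\<close> on the spectrum,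
  the polynomial \<open>c\<^sup>2 - p\<^sup>* p\<close> would have no zero there, hence \<open>c\<^sup>2 - p(A)\<^sup>* p(A)\<close> would be bounded below,
  which is impossible for \<open>c\<^sup>2 = \<parallel>p(A)\<parallel>\<^sup>2\<close>.
\<close>

lemma norm_poly_op_le:
  fixes A :: "'a::complex_inner \<Rightarrow>\<^sub>L 'a"
  assumes sa: "adj_pair A A" and b0: "b \<ge> 0"
    and b: "\<And>r. complex_of_real r \<in> spectrum A \<Longrightarrow> cmod (poly p (complex_of_real r)) \<le> b"
  shows "norm (poly_op p A) \<le> b"
proof (rule ccontr)
  assume "\<not> norm (poly_op p A) \<le> b"
  then have gt: "norm (poly_op p A) > b" by simp
  then have n0: "norm (poly_op p A) > 0" using b0 by linarith
  have key: False if "norm (poly_op q A) > 0"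
      "\<And>r. complex_of_real r \<in> spectrum A \<Longrightarrow> cmod (poly q (complex_of_real r)) < norm (poly_op q A)"
      "[:complex_of_real ((norm (poly_op q A))\<^sup>2):] \<noteq> map_poly cnj q * q" for q
  proof -
    define c where "c = norm (poly_op q A)"
    define Q where "Q = [:complex_of_real (c\<^sup>2):] - map_poly cnj q * q"
    have "poly_op Q A = scalar_op (c\<^sup>2) - (poly_op (map_poly cnj q) A o\<^sub>L poly_op q A)"
      unfolding Q_def poly_op_diff poly_op_const poly_op_mult[OF sa] ..
    moreover have "bounded_below (poly_op Q A)"
    proof (rule bounded_below_poly_op[OF sa])
      show "Q \<noteq> 0" using that(3) by (simp add: Q_def c_def)
      fix r assume r: "complex_of_real r \<in> spectrum A"
      have "(cmod (poly q (complex_of_real r)))\<^sup>2 < c\<^sup>2"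
        using that(2)[OF r] by (intro power_strict_mono) (auto simp: c_def)
      then have "complex_of_real (c\<^sup>2 - (cmod (poly q (complex_of_real r)))\<^sup>2) \<noteq> 0"
        unfolding of_real_eq_0_iff by simp
      then show "poly Q (complex_of_real r) \<noteq> 0"
        unfolding Q_def poly_diff poly_map_cnj_of_real by simp
    qed
    ultimately show False
      using not_bounded_below_norm[OF adj_pair_poly_op[OF sa] that(1)] by (simp add: c_def)
  qed
  show False
  proof (cases "\<exists>r. complex_of_real r \<in> spectrum A")
    case True
    then obtain r where r: "complex_of_real r \<in> spectrum A" by blast
    have "cmod (poly p (complex_of_real r)) < norm (poly_op p A)"
      using b[OF r] gt by linarith
    then have "(norm (poly_op p A))\<^sup>2 \<noteq> (cmod (poly p (complex_of_real r)))\<^sup>2"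
      by simp
    then have "poly [:complex_of_real ((norm (poly_op p A))\<^sup>2):] (complex_of_real r)
        \<noteq> poly (map_poly cnj p * p) (complex_of_real r)"
      unfolding poly_map_cnj_of_real poly_pCons poly_0 mult_zero_right add_0_right of_real_eq_iff .
    then have "[:complex_of_real ((norm (poly_op p A))\<^sup>2):] \<noteq> map_poly cnj p * p" by metis
    moreover have "cmod (poly p (complex_of_real r)) < norm (poly_op p A)"
      if "complex_of_real r \<in> spectrum A" for r using b[OF that] gt by linarith
    ultimately show False using n0 by (intro key[of p]) auto
  next
    case False
    \<comment> \<open>an empty spectrum forces the space to be trivial\<close>
    have "bounded_below (A - scalar_op 0)" using False by (intro bounded_below_shift[OF sa]) metis
    then obtain k where k: "k > 0" "\<And>x. k * norm x \<le> norm (blinfun_apply A x)"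
      by (auto simp: bounded_below_def blinfun.diff_left)
    have "norm A > 0"
    proof (rule ccontr)
      assume "\<not> norm A > 0"
      then have "A = 0" by simp
      then have "x = 0" for x :: 'a using k(2)[of x] k(1) by (simp add: mult_le_0_iff)
      then have "poly_op p A = 0" by (metis blinfun_eqI)
      then show False using n0 by simp
    qed
    moreover have pA: "poly_op [:0, 1:] A = A"
      by (rule blinfun_eqI) (simp add: poly_op_pCons_apply)
    moreover have "[:complex_of_real ((norm A)\<^sup>2):] \<noteq> map_poly cnj [:0, 1:] * [:0, 1:]"
      by (simp add: map_poly_pCons)
    ultimately show False using False by (intro key[of "[:0, 1:]"]) auto
  qed
qed

section \<open>The spectrum of a positive operator\<close>

text \<open>
  The inverse is the Neumann series \<open>\<Sum> B\<^sup>n\<close>.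
\<close>

lemma neumann_inverse:
  fixes B :: "'a::banach \<Rightarrow>\<^sub>L 'a"
  assumes "norm B < 1"
  shows "\<exists>C :: 'a \<Rightarrow>\<^sub>L 'a. C o\<^sub>L (id_blinfun - B) = id_blinfun \<and> (id_blinfun - B) o\<^sub>L C = id_blinfun"
proof -
  define t where "t n = ((o\<^sub>L) B ^^ n) id_blinfun" for n
  have t_Suc: "t (Suc n) = B o\<^sub>L t n" for n by (simp add: t_def)
  have t_Suc': "t (Suc n) = t n o\<^sub>L B" for n
  proof (induction n)
    case (Suc n)
    have "t (Suc (Suc n)) = B o\<^sub>L (t n o\<^sub>L B)" using Suc by (simp add: t_Suc)
    also have "\<dots> = t (Suc n) o\<^sub>L B" unfolding t_Suc by (auto intro: blinfun_eqI)
    finally show ?case .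
  qed (auto simp: t_def intro: blinfun_eqI)
  have "norm (t n) \<le> norm B ^ n" for n
  proof (induction n)
    case 0
    then show ?case by (auto simp: t_def intro: norm_blinfun_id_le)
  next
    case (Suc n)
    have "norm (t (Suc n)) \<le> norm B * norm (t n)"
      unfolding t_Suc by (rule norm_blinfun_compose)
    also have "\<dots> \<le> norm B * norm B ^ n" using Suc by (intro mult_left_mono) auto
    finally show ?case by simp
  qed
  then have sm: "summable t"
    by (intro summable_comparison_test[OF _ summable_geometric[of "norm B"]]) (use assms in auto)
  define C where "C = suminf t"
  have s: "suminf t = t 0 + (\<Sum>n. t (Suc n))" using suminf_split_head[OF sm] by simp
  have l: "(\<Sum>n. t (Suc n)) = B o\<^sub>L C"
    unfolding t_Suc C_def
    by (rule bounded_linear.suminf[OF bounded_bilinear.bounded_linear_right[OF bounded_bilinear_blinfun_compose] sm, symmetric])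
  have r: "(\<Sum>n. t (Suc n)) = C o\<^sub>L B"
    unfolding t_Suc' C_def
    by (rule bounded_linear.suminf[OF bounded_bilinear.bounded_linear_left[OF bounded_bilinear_blinfun_compose] sm, symmetric])
  have t0: "t 0 = id_blinfun" by (simp add: t_def)
  have "C = id_blinfun + (B o\<^sub>L C)" "C = id_blinfun + (C o\<^sub>L B)"
    using s l r t0 by (auto simp: C_def)
  then have eq: "C - (B o\<^sub>L C) = id_blinfun" "C - (C o\<^sub>L B) = id_blinfun"
    by (metis add_diff_cancel_right')+
  moreover have "C - (B o\<^sub>L C) = (id_blinfun - B) o\<^sub>L C" "C - (C o\<^sub>L B) = C o\<^sub>L (id_blinfun - B)"
    by (auto intro!: blinfun_eqI simp: blinfun.diff_left blinfun.diff_right)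
  ultimately show ?thesis by metis
qed

text \<open>
  The operator \<open>M/2 - P\<^sup>* P\<close> has norm at most \<open>M/2\<close>, so \<open>P\<^sup>* P - l\<close> is invertible by a Neumann series
  around \<open>M/2 - l\<close> as soon as \<open>\<bar>l - M/2\<bar> > M/2\<close>.
\<close>

lemma spectrum_positive:
  fixes P :: "'a::{complex_inner, banach} \<Rightarrow>\<^sub>L 'a"
  assumes adj: "adj_pair P P'" and M: "(norm P)\<^sup>2 \<le> M"
  shows "{x. complex_of_real x \<in> spectrum (P' o\<^sub>L P)} \<subseteq> {0..M}"
proof (rule ccontr)
  assume "\<not> ?thesis"
  then obtain l where l: "complex_of_real l \<in> spectrum (P' o\<^sub>L P)" "l < 0 \<or> l > M" by force
  define A where "A = P' o\<^sub>L P"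
  have M0: "M \<ge> 0" using M zero_le_power2[of "norm P"] by linarith
  \<comment> \<open>\<open>P\<^sup>* P - l\<close> is \<open>d\<close> minus the operator \<open>M/2 - P\<^sup>* P\<close>, whose norm is at most \<open>M/2\<close>\<close>
  define d where "d = M / 2 - l"
  have d: "\<bar>d\<bar> > M / 2" using l(2) M0 by (auto simp: d_def)
  have d0: "d \<noteq> 0" using d M0 by auto
  define B where "B = (1 / d) *\<^sub>R ((M / 2) *\<^sub>R id_blinfun - A)"
  have "norm ((M / 2) *\<^sub>R id_blinfun - A) \<le> M / 2"
  proof (rule norm_blinfun_bound)
    fix x
    let ?y = "blinfun_apply P' (blinfun_apply P x)"
    have i1: "inner x ?y = (norm (blinfun_apply P x))\<^sup>2"
      by (simp add: inner_eq_Re_cinner adj_pairD[OF adj, symmetric] cinner_self)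
    have "norm ?y \<le> norm P * norm (blinfun_apply P x)"
      using norm_blinfun[of P' "blinfun_apply P x"] norm_adj_eq[OF adj] by simp
    then have "(norm ?y)\<^sup>2 \<le> (norm P * norm (blinfun_apply P x))\<^sup>2"
      by (intro power_mono) auto
    also have "\<dots> \<le> M * (norm (blinfun_apply P x))\<^sup>2"
      unfolding power_mult_distrib by (intro mult_right_mono M) auto
    finally have y2: "(norm ?y)\<^sup>2 \<le> M * (norm (blinfun_apply P x))\<^sup>2" .
    have "(norm ((M / 2) *\<^sub>R x - ?y))\<^sup>2
        = (M / 2)\<^sup>2 * (norm x)\<^sup>2 - M * (norm (blinfun_apply P x))\<^sup>2 + (norm ?y)\<^sup>2"
      unfolding power2_norm_eq_inner[of "(M / 2) *\<^sub>R x - ?y"]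
      using power2_norm_eq_inner[of x] power2_norm_eq_inner[of ?y]
      by (simp add: inner_diff_left inner_diff_right i1 inner_commute[of ?y x] power2_eq_square
          algebra_simps)
    also have "\<dots> \<le> (M / 2)\<^sup>2 * (norm x)\<^sup>2" using y2 by simp
    also have "\<dots> = (M / 2 * norm x)\<^sup>2" by (simp only: power_mult_distrib)
    finally have "norm ((M / 2) *\<^sub>R x - ?y) \<le> M / 2 * norm x"
      using M0 by (auto intro: power2_le_imp_le)
    then show "norm (blinfun_apply ((M / 2) *\<^sub>R id_blinfun - A) x) \<le> M / 2 * norm x"
      by (simp add: A_def blinfun.diff_left blinfun.scaleR_left)
  qed (use M0 in auto)
  then have "norm ((M / 2) *\<^sub>R id_blinfun - A) < \<bar>d\<bar>" using d by linarith
  then have "norm B < 1" using d0 unfolding B_def norm_scaleR by (simp add: field_simps)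
  then obtain C where C: "C o\<^sub>L (id_blinfun - B) = id_blinfun" "(id_blinfun - B) o\<^sub>L C = id_blinfun"
    using neumann_inverse by blast
  \<comment> \<open>\<open>A - l = d (1 - B)\<close>\<close>
  have Al: "blinfun_apply A x - complex_of_real l *\<^sub>C x = d *\<^sub>R blinfun_apply (id_blinfun - B) x" for x
  proof -
    have "d *\<^sub>R blinfun_apply B x = (M / 2) *\<^sub>R x - blinfun_apply A x"
      using d0 by (simp add: B_def blinfun.diff_left blinfun.scaleR_left)
    then show ?thesis
      by (simp add: blinfun.diff_left scaleR_diff_right d_def scaleR_diff_left flip: scaleR_scaleC)
  qed
  have "complex_of_real l \<notin> spectrum A"
    unfolding spectrum_def
  proof (simp, intro exI[of _ "(1 / d) *\<^sub>R C"] allI conjI)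
    fix x
    show "blinfun_apply ((1 / d) *\<^sub>R C) (blinfun_apply A x - complex_of_real l *\<^sub>C x) = x"
      unfolding Al using d0 arg_cong[OF C(1), of "\<lambda>T. blinfun_apply T x"]
      by (simp add: blinfun.scaleR_left blinfun.scaleR_right)
    show "blinfun_apply A (blinfun_apply ((1 / d) *\<^sub>R C) x)
        - complex_of_real l *\<^sub>C blinfun_apply ((1 / d) *\<^sub>R C) x = x"
      unfolding Al using d0 arg_cong[OF C(2), of "\<lambda>T. blinfun_apply T x"]
      by (simp add: blinfun.scaleR_left blinfun.scaleR_right)
  qed
  then show False using l(1) by (simp add: A_def)
qed

section \<open>Continuous functional calculus\<close>

lemma weierstrass_complex:
  fixes \<phi> :: "real \<Rightarrow> complex"
  assumes "continuous_on {0..M} \<phi>"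
  shows "\<exists>p :: nat \<Rightarrow> complex poly. uniform_limit {0..M} (\<lambda>n x. poly (p n) (complex_of_real x)) \<phi> sequentially"
proof -
  have re: "\<exists>p :: complex poly. \<forall>x\<in>{0..M}. cmod (poly p (complex_of_real x) - complex_of_real (g x)) < e"
    if g: "continuous_on {0..M} g" "e > 0" for g :: "real \<Rightarrow> real" and e
  proof -
    obtain h where "real_polynomial_function h" and h: "\<And>x. x \<in> {0..M} \<Longrightarrow> \<bar>g x - h x\<bar> < e"
      using Stone_Weierstrass_real_polynomial_function[OF compact_Icc g] by blast
    then obtain a n where ha: "h = (\<lambda>x. \<Sum>i\<le>n. a i * x ^ i)"
      unfolding real_polynomial_function_iff_sum by blast
    define p where "p = (\<Sum>i\<le>n. monom (complex_of_real (a i)) i)"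
    have "poly p (complex_of_real x) = complex_of_real (h x)" for x
      by (simp add: p_def ha poly_sum poly_monom)
    then have "cmod (poly p (complex_of_real x) - complex_of_real (g x)) < e" if "x \<in> {0..M}" for x
      using h[OF that] by (simp add: abs_minus_commute flip: of_real_diff)
    then show ?thesis by blast
  qed
  have "\<exists>p :: complex poly. \<forall>x\<in>{0..M}. cmod (poly p (complex_of_real x) - \<phi> x) < e" if "e > 0" for e
  proof -
    obtain p where p: "\<forall>x\<in>{0..M}. cmod (poly p (complex_of_real x) - complex_of_real (Re (\<phi> x))) < e / 2"
      using re[of "\<lambda>x. Re (\<phi> x)" "e / 2"] assms \<open>e > 0\<close> by (auto intro: continuous_intros)
    obtain q where q: "\<forall>x\<in>{0..M}. cmod (poly q (complex_of_real x) - complex_of_real (Im (\<phi> x))) < e / 2"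
      using re[of "\<lambda>x. Im (\<phi> x)" "e / 2"] assms \<open>e > 0\<close> by (auto intro: continuous_intros)
    have "cmod (poly (p + smult \<i> q) (complex_of_real x) - \<phi> x) < e" if x: "x \<in> {0..M}" for x
    proof -
      have "poly (p + smult \<i> q) (complex_of_real x) - \<phi> x
          = (poly p (complex_of_real x) - complex_of_real (Re (\<phi> x)))
            + \<i> * (poly q (complex_of_real x) - complex_of_real (Im (\<phi> x)))"
        by (subst complex_eq[of "\<phi> x"]) (simp add: algebra_simps)
      also have "cmod \<dots> \<le> cmod (poly p (complex_of_real x) - complex_of_real (Re (\<phi> x)))
            + cmod (poly q (complex_of_real x) - complex_of_real (Im (\<phi> x)))"
        by (rule norm_triangle_le) (simp add: norm_mult)
      also have "\<dots> < e" using p q x by force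
      finally show ?thesis .
    qed
    then show ?thesis by blast
  qed
  then have "\<forall>n. \<exists>p :: complex poly. \<forall>x\<in>{0..M}. cmod (poly p (complex_of_real x) - \<phi> x) < inverse (real (Suc n))"
    by simp
  then obtain p :: "nat \<Rightarrow> complex poly" where
    p: "\<And>n x. x \<in> {0..M} \<Longrightarrow> cmod (poly (p n) (complex_of_real x) - \<phi> x) < inverse (real (Suc n))"
    by metis
  have "uniform_limit {0..M} (\<lambda>n x. poly (p n) (complex_of_real x)) \<phi> sequentially"
  proof (rule uniform_limitI)
    fix e :: real assume "e > 0"
    then have "\<forall>\<^sub>F n in sequentially. inverse (real (Suc n)) < e"
      by (rule order_tendstoD(2)[OF LIMSEQ_inverse_real_of_nat])
    then show "\<forall>\<^sub>F n in sequentially. \<forall>x\<in>{0..M}. dist (poly (p n) (complex_of_real x)) (\<phi> x) < e"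
      by eventually_elim (use p in \<open>force simp: dist_norm intro: less_trans\<close>)
  qed
  then show ?thesis by blast
qed

text \<open>
  The limit does not depend on the approximating polynomials, since by \<open>norm_poly_op_le\<close> two sequences
  with the same uniform limit on the spectrum have the same limit in operator norm.
\<close>

lemma cfc_eqI:
  assumes sa: "adj_pair A A"
    and p: "uniform_limit {x. complex_of_real x \<in> spectrum A}
       (\<lambda>n x. poly (p n) (complex_of_real x)) \<phi> sequentially"
    and B: "(\<lambda>n. poly_op (p n) A) \<longlonglongrightarrow> B"
  shows "cfc \<phi> A = B"
  unfolding cfc_def
proof (rule the_equality)
  show "\<exists>p. uniform_limit {x. complex_of_real x \<in> spectrum A} (\<lambda>n x. poly (p n) (complex_of_real x)) \<phi> sequentially \<and>
      (\<lambda>n. poly_op (p n) A) \<longlonglongrightarrow> B"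
    using p B by blast
  fix C
  assume "\<exists>p. uniform_limit {x. complex_of_real x \<in> spectrum A} (\<lambda>n x. poly (p n) (complex_of_real x)) \<phi> sequentially \<and>
      (\<lambda>n. poly_op (p n) A) \<longlonglongrightarrow> C"
  then obtain q where q: "uniform_limit {x. complex_of_real x \<in> spectrum A}
       (\<lambda>n x. poly (q n) (complex_of_real x)) \<phi> sequentially"
    and C: "(\<lambda>n. poly_op (q n) A) \<longlonglongrightarrow> C" by blast
  have "(\<lambda>n. poly_op (q n) A - poly_op (p n) A) \<longlonglongrightarrow> 0"
  proof (rule tendstoI)
    fix e :: real assume "e > 0"
    have "\<forall>\<^sub>F n in sequentially. \<forall>x\<in>{x. complex_of_real x \<in> spectrum A}. dist (poly (p n) (complex_of_real x)) (\<phi> x) < e / 4"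
      using uniform_limitD[OF p, of "e / 4"] \<open>e > 0\<close> by simp
    moreover have "\<forall>\<^sub>F n in sequentially. \<forall>x\<in>{x. complex_of_real x \<in> spectrum A}. dist (poly (q n) (complex_of_real x)) (\<phi> x) < e / 4"
      using uniform_limitD[OF q, of "e / 4"] \<open>e > 0\<close> by simp
    ultimately show "\<forall>\<^sub>F n in sequentially. dist (poly_op (q n) A - poly_op (p n) A) 0 < e"
    proof eventually_elim
      case (elim n)
      have "norm (poly_op (q n - p n) A) \<le> e / 2"
      proof (rule norm_poly_op_le[OF sa])
        fix r assume r: "complex_of_real r \<in> spectrum A"
        have "dist (poly (q n) (complex_of_real r)) (poly (p n) (complex_of_real r)) < e / 4 + e / 4"
          using r elim by (intro le_less_trans[OF dist_triangle2 add_strict_mono]) auto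
        then show "cmod (poly (q n - p n) (complex_of_real r)) \<le> e / 2"
          by (simp add: dist_norm)
      qed (use \<open>e > 0\<close> in simp)
      then show ?case using \<open>e > 0\<close> by (simp add: poly_op_diff)
    qed
  qed
  from tendsto_diff[OF C B] this have "C - B = 0" by (rule LIMSEQ_unique)
  then show "C = B" by simp
qed

text \<open>
  The functional calculus is used with polynomials that converge on the whole interval \<open>[0, M]\<close>, so the
  exact spectrum never has to be determined.
\<close>

locale bounded_self_adjoint =
  fixes A :: "'a::{complex_inner, banach} \<Rightarrow>\<^sub>L 'a" and M :: real
  assumes sa: "adj_pair A A"
    and spec: "{x. complex_of_real x \<in> spectrum A} \<subseteq> {0..M}"
    and M0: "M \<ge> 0"
begin

lemma norm_poly_le:
  assumes "\<And>x. x \<in> {0..M} \<Longrightarrow> cmod (poly p (complex_of_real x)) \<le> b"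
  shows "norm (poly_op p A) \<le> b"
proof (rule norm_poly_op_le[OF sa])
  show "b \<ge> 0" by (rule order_trans[OF norm_ge_zero assms[of 0]]) (use M0 in auto)
qed (use assms spec in auto)

lemma cfc_LIMSEQ:
  assumes p: "uniform_limit {0..M} (\<lambda>n x. poly (p n) (complex_of_real x)) \<phi> sequentially"
  shows "(\<lambda>n. poly_op (p n) A) \<longlonglongrightarrow> cfc \<phi> A"
proof -
  have "Cauchy (\<lambda>n. poly_op (p n) A)"
  proof (rule metric_CauchyI)
    fix e :: real assume "e > 0"
    then obtain N where N: "\<And>n x. n \<ge> N \<Longrightarrow> x \<in> {0..M} \<Longrightarrow> dist (poly (p n) (complex_of_real x)) (\<phi> x) < e / 4"
      using p unfolding uniform_limit_sequentially_iff by (metis zero_less_divide_iff zero_less_numeral)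
    have "dist (poly_op (p m) A) (poly_op (p n) A) < e" if "m \<ge> N" "n \<ge> N" for m n
    proof -
      have "norm (poly_op (p m - p n) A) \<le> e / 2"
      proof (rule norm_poly_le)
        fix x assume x: "x \<in> {0..M}"
        have "dist (poly (p m) (complex_of_real x)) (poly (p n) (complex_of_real x)) < e / 4 + e / 4"
          using N[OF _ x] that by (intro le_less_trans[OF dist_triangle2 add_strict_mono]) auto
        then show "cmod (poly (p m - p n) (complex_of_real x)) \<le> e / 2" by (simp add: dist_norm)
      qed
      then show ?thesis using \<open>e > 0\<close> by (simp add: poly_op_diff dist_norm)
    qed
    then show "\<exists>N. \<forall>m\<ge>N. \<forall>n\<ge>N. dist (poly_op (p m) A) (poly_op (p n) A) < e" by blast
  qed
  then obtain B where B: "(\<lambda>n. poly_op (p n) A) \<longlonglongrightarrow> B"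
    by (auto simp: Cauchy_convergent_iff convergent_def)
  have "cfc \<phi> A = B"
    by (rule cfc_eqI[OF sa uniform_limit_on_subset[OF p spec] B])
  then show ?thesis using B by simp
qed

lemma cfc_approx:
  assumes "continuous_on {0..M} \<phi>"
  obtains p where "uniform_limit {0..M} (\<lambda>n x. poly (p n) (complex_of_real x)) \<phi> sequentially"
    "(\<lambda>n. poly_op (p n) A) \<longlonglongrightarrow> cfc \<phi> A"
  using weierstrass_complex[OF assms] cfc_LIMSEQ by blast

lemma cfc_poly: "cfc (\<lambda>x. poly p (complex_of_real x)) A = poly_op p A"
  by (rule cfc_eqI[OF sa, where p = "\<lambda>n. p"]) (auto intro: uniform_limit_const)

lemma cfc_cong:
  assumes "continuous_on {0..M} \<phi>" "\<And>x. x \<in> {0..M} \<Longrightarrow> \<phi> x = \<psi> x"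
  shows "cfc \<psi> A = cfc \<phi> A"
proof -
  obtain p where p: "uniform_limit {0..M} (\<lambda>n x. poly (p n) (complex_of_real x)) \<phi> sequentially"
    "(\<lambda>n. poly_op (p n) A) \<longlonglongrightarrow> cfc \<phi> A" by (rule cfc_approx[OF assms(1)])
  have "uniform_limit {0..M} (\<lambda>n x. poly (p n) (complex_of_real x)) \<psi> sequentially"
    using p(1) assms(2) by (simp add: uniform_limit_iff)
  then have "(\<lambda>n. poly_op (p n) A) \<longlonglongrightarrow> cfc \<psi> A" by (rule cfc_LIMSEQ)
  then show ?thesis using p(2) by (rule LIMSEQ_unique)
qed

lemma cfc_const: "cfc (\<lambda>x. c) A = scalar_op c"
  using cfc_poly[of "[:c:]"] by (simp add: poly_op_const)

lemma cfc_add: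
  assumes "continuous_on {0..M} \<phi>" "continuous_on {0..M} \<psi>"
  shows "cfc (\<lambda>x. \<phi> x + \<psi> x) A = cfc \<phi> A + cfc \<psi> A"
proof -
  obtain p where p: "uniform_limit {0..M} (\<lambda>n x. poly (p n) (complex_of_real x)) \<phi> sequentially"
    "(\<lambda>n. poly_op (p n) A) \<longlonglongrightarrow> cfc \<phi> A" by (rule cfc_approx[OF assms(1)])
  obtain q where q: "uniform_limit {0..M} (\<lambda>n x. poly (q n) (complex_of_real x)) \<psi> sequentially"
    "(\<lambda>n. poly_op (q n) A) \<longlonglongrightarrow> cfc \<psi> A" by (rule cfc_approx[OF assms(2)])
  have "uniform_limit {0..M} (\<lambda>n x. poly (p n + q n) (complex_of_real x)) (\<lambda>x. \<phi> x + \<psi> x) sequentially"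
    using uniform_limit_add[OF p(1) q(1)] by simp
  then have "(\<lambda>n. poly_op (p n + q n) A) \<longlonglongrightarrow> cfc (\<lambda>x. \<phi> x + \<psi> x) A" by (rule cfc_LIMSEQ)
  moreover have "(\<lambda>n. poly_op (p n + q n) A) \<longlonglongrightarrow> cfc \<phi> A + cfc \<psi> A"
    unfolding poly_op_add by (intro tendsto_add p q)
  ultimately show ?thesis by (rule LIMSEQ_unique)
qed

lemma cfc_mult:
  assumes "continuous_on {0..M} \<phi>" "continuous_on {0..M} \<psi>"
  shows "cfc (\<lambda>x. \<phi> x * \<psi> x) A = cfc \<phi> A o\<^sub>L cfc \<psi> A"
proof -
  obtain p where p: "uniform_limit {0..M} (\<lambda>n x. poly (p n) (complex_of_real x)) \<phi> sequentially"
    "(\<lambda>n. poly_op (p n) A) \<longlonglongrightarrow> cfc \<phi> A" by (rule cfc_approx[OF assms(1)])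
  obtain q where q: "uniform_limit {0..M} (\<lambda>n x. poly (q n) (complex_of_real x)) \<psi> sequentially"
    "(\<lambda>n. poly_op (q n) A) \<longlonglongrightarrow> cfc \<psi> A" by (rule cfc_approx[OF assms(2)])
  have "bounded (\<phi> ` {0..M})" "bounded (\<psi> ` {0..M})"
    using assms by (auto intro: compact_imp_bounded compact_continuous_image)
  then have "uniform_limit {0..M} (\<lambda>n x. poly (p n * q n) (complex_of_real x)) (\<lambda>x. \<phi> x * \<psi> x) sequentially"
    using uniform_lim_mult[OF p(1) q(1)] by simp
  then have "(\<lambda>n. poly_op (p n * q n) A) \<longlonglongrightarrow> cfc (\<lambda>x. \<phi> x * \<psi> x) A" by (rule cfc_LIMSEQ)
  moreover have "(\<lambda>n. poly_op (p n * q n) A) \<longlonglongrightarrow> (cfc \<phi> A o\<^sub>L cfc \<psi> A)"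
    unfolding poly_op_mult[OF sa]
    by (intro bounded_bilinear.tendsto[OF bounded_bilinear_blinfun_compose] p q)
  ultimately show ?thesis by (rule LIMSEQ_unique)
qed

lemma cfc_cmult:
  assumes "continuous_on {0..M} \<phi>"
  shows "cfc (\<lambda>x. c * \<phi> x) A = scalar_op c o\<^sub>L cfc \<phi> A"
  using cfc_mult[OF continuous_on_const assms, of c] by (simp add: cfc_const)

lemma cfc_diff:
  assumes "continuous_on {0..M} \<phi>" "continuous_on {0..M} \<psi>"
  shows "cfc (\<lambda>x. \<phi> x - \<psi> x) A = cfc \<phi> A - cfc \<psi> A"
proof -
  have "cfc (\<lambda>x. (\<phi> x - \<psi> x) + \<psi> x) A = cfc (\<lambda>x. \<phi> x - \<psi> x) A + cfc \<psi> A"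
    using assms by (intro cfc_add continuous_intros)
  then show ?thesis by simp
qed

lemma adj_pair_cfc:
  assumes "continuous_on {0..M} \<phi>"
  shows "adj_pair (cfc \<phi> A) (cfc (\<lambda>x. cnj (\<phi> x)) A)"
proof -
  obtain p where p: "uniform_limit {0..M} (\<lambda>n x. poly (p n) (complex_of_real x)) \<phi> sequentially"
    "(\<lambda>n. poly_op (p n) A) \<longlonglongrightarrow> cfc \<phi> A" by (rule cfc_approx[OF assms(1)])
  have c: "poly (map_poly cnj q) (complex_of_real r) = cnj (poly q (complex_of_real r))" for q r
    by (induction q) (simp_all add: map_poly_pCons)
  have "uniform_limit {0..M} (\<lambda>n x. poly (map_poly cnj (p n)) (complex_of_real x)) (\<lambda>x. cnj (\<phi> x)) sequentially"
    using p(1) by (simp add: uniform_limit_iff c dist_norm flip: complex_cnj_diff)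
  then have "(\<lambda>n. poly_op (map_poly cnj (p n)) A) \<longlonglongrightarrow> cfc (\<lambda>x. cnj (\<phi> x)) A" by (rule cfc_LIMSEQ)
  then show ?thesis using p(2) by (intro adj_pair_limit[OF adj_pair_poly_op[OF sa]])
qed

lemma norm_cfc_le:
  assumes "continuous_on {0..M} \<phi>" and b: "\<And>x. x \<in> {0..M} \<Longrightarrow> cmod (\<phi> x) \<le> b"
  shows "norm (cfc \<phi> A) \<le> b"
proof (rule field_le_epsilon)
  fix e :: real assume "e > 0"
  obtain p where p: "uniform_limit {0..M} (\<lambda>n x. poly (p n) (complex_of_real x)) \<phi> sequentially"
    "(\<lambda>n. poly_op (p n) A) \<longlonglongrightarrow> cfc \<phi> A" by (rule cfc_approx[OF assms(1)])
  have "\<forall>\<^sub>F n in sequentially. \<forall>x\<in>{0..M}. dist (poly (p n) (complex_of_real x)) (\<phi> x) < e"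
    using p(1) \<open>e > 0\<close> by (auto simp: uniform_limit_iff)
  then have "\<forall>\<^sub>F n in sequentially. norm (poly_op (p n) A) \<le> b + e"
  proof eventually_elim
    case (elim n)
    show ?case
    proof (rule norm_poly_le)
      fix x assume x: "x \<in> {0..M}"
      have "cmod (poly (p n) (complex_of_real x)) \<le> cmod (\<phi> x) + dist (poly (p n) (complex_of_real x)) (\<phi> x)"
        by (simp add: dist_norm norm_triangle_sub)
      also have "\<dots> \<le> b + e" using elim x b[OF x] by (intro add_mono) (auto intro: less_imp_le)
      finally show "cmod (poly (p n) (complex_of_real x)) \<le> b + e" .
    qed
  qed
  then show "norm (cfc \<phi> A) \<le> b + e"
    by (intro tendsto_upperbound[OF tendsto_norm[OF p(2)]]) auto
qed

end

lemma bounded_self_adjoint_positive: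
  fixes P :: "'a::{complex_inner, banach} \<Rightarrow>\<^sub>L 'a"
  assumes adj: "adj_pair P P'" and M: "(norm P)\<^sup>2 \<le> M"
  shows "bounded_self_adjoint (P' o\<^sub>L P) M"
proof
  show "adj_pair (P' o\<^sub>L P) (P' o\<^sub>L P)" by (intro adj_pair_compose adj adj_pair_sym[OF adj])
  show "{x. complex_of_real x \<in> spectrum (P' o\<^sub>L P)} \<subseteq> {0..M}" by (rule spectrum_positive[OF assms])
  show "M \<ge> 0" using M zero_le_power2[of "norm P"] by linarith
qed

section \<open>Orthonormal families\<close>

definition orthonormal :: "'a::complex_inner set \<Rightarrow> bool" where
  "orthonormal F \<longleftrightarrow> (\<forall>x\<in>F. \<forall>y\<in>F. cinner x y = (if x = y then 1 else 0))"

lemma orthonormal_subset: "orthonormal E \<Longrightarrow> F \<subseteq> E \<Longrightarrow> orthonormal F"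
  unfolding orthonormal_def by blast

lemma orthonormal_basis_orthonormal: "orthonormal_basis E \<Longrightarrow> orthonormal E"
  by (simp add: orthonormal_def orthonormal_basis_def)

lemma norm_orthonormal: "orthonormal F \<Longrightarrow> e \<in> F \<Longrightarrow> norm e = 1"
proof -
  assume "orthonormal F" "e \<in> F"
  then have "complex_of_real ((norm e)\<^sup>2) = complex_of_real 1"
    using cinner_self[of e] by (simp add: orthonormal_def)
  then have "(norm e)\<^sup>2 = 1" unfolding of_real_eq_iff .
  then have "sqrt ((norm e)\<^sup>2) = 1" by simp
  then show "norm e = 1" by simp
qed

lemma norm_sum_orthonormal:
  assumes F: "finite F" "orthonormal F"
  shows "(norm (\<Sum>e\<in>F. c e *\<^sub>C e))\<^sup>2 = (\<Sum>e\<in>F. (cmod (c e))\<^sup>2)"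
proof -
  have "complex_of_real ((norm (\<Sum>e\<in>F. c e *\<^sub>C e))\<^sup>2)
      = (\<Sum>e\<in>F. \<Sum>e'\<in>F. c e * (cnj (c e') * cinner e e'))"
    unfolding cinner_self[symmetric] cinner.sum_left cinner.sum_right
    by (subst sum.swap) (simp add: cinner_scaleC_left cinner_scaleC_right mult_ac)
  also have "\<dots> = (\<Sum>e\<in>F. \<Sum>e'\<in>F. if e = e' then c e * cnj (c e) else 0)"
    using F by (intro sum.cong) (auto simp: orthonormal_def)
  also have "\<dots> = (\<Sum>e\<in>F. complex_of_real ((cmod (c e))\<^sup>2))"
    using F by (simp add: complex_norm_square del: of_real_power)
  also have "\<dots> = complex_of_real (\<Sum>e\<in>F. (cmod (c e))\<^sup>2)" by simp
  finally show ?thesis unfolding of_real_eq_iff .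
qed

lemma bessel_finite:
  assumes F: "finite F" "orthonormal F"
  shows "(\<Sum>e\<in>F. (cmod (cinner x e))\<^sup>2) \<le> (norm x)\<^sup>2"
proof -
  define s where "s = (\<Sum>e\<in>F. cinner x e *\<^sub>C e)"
  have 1: "(norm s)\<^sup>2 = (\<Sum>e\<in>F. (cmod (cinner x e))\<^sup>2)"
    unfolding s_def by (rule norm_sum_orthonormal[OF F])
  have "cinner x s = complex_of_real ((norm s)\<^sup>2)"
    unfolding 1 of_real_sum complex_norm_square
    by (simp add: s_def cinner.sum_right cinner_scaleC_right mult.commute)
  then have "inner x s = (norm s)\<^sup>2" by (simp add: inner_eq_Re_cinner del: of_real_power)
  moreover have "inner x s \<le> norm x * norm s" by (rule norm_cauchy_schwarz)
  ultimately have "norm s * norm s \<le> norm x * norm s" by (simp add: power2_eq_square)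
  then have "norm s \<le> norm x" by (metis mult_le_cancel_right norm_ge_zero not_le order_le_less)
  then show ?thesis unfolding 1[symmetric] by (intro power_mono) auto
qed

lemma bessel_summable:
  assumes "orthonormal E"
  shows "(\<lambda>e. (cmod (cinner x e))\<^sup>2) summable_on E"
  by (rule nonneg_bdd_above_summable_on)
    (auto intro!: bdd_aboveI2[of _ _ "(norm x)\<^sup>2"] bessel_finite orthonormal_subset[OF assms])

text \<open>
  By Pythagoras the partial sums are Cauchy; completeness of the space enters here.
\<close>

lemma orthonormal_summable:
  fixes E :: "'a::{complex_inner, banach} set"
  assumes E: "orthonormal E" and c: "(\<lambda>e. (cmod (c e))\<^sup>2) summable_on E"
  shows "(\<lambda>e. c e *\<^sub>C e) summable_on E"
proof -
  define f where "f = (\<lambda>e. c e *\<^sub>C e)"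
  define S where "S = (\<Sum>\<^sub>\<infinity>e\<in>E. (cmod (c e))\<^sup>2)"
  have hs: "((\<lambda>e. (cmod (c e))\<^sup>2) has_sum S) E" using c by (simp add: S_def)
  have "\<exists>P. eventually P (finite_subsets_at_top E) \<and>
      (\<forall>F1 F2. P F1 \<and> P F2 \<longrightarrow> dist (sum f F1) (sum f F2) < e)" if "e > 0" for e
  proof -
    have "\<forall>\<^sub>F F in finite_subsets_at_top E. dist (\<Sum>e\<in>F. (cmod (c e))\<^sup>2) S < (e / 4)\<^sup>2"
      using hs \<open>e > 0\<close> unfolding has_sum_def by (auto elim!: tendstoD)
    then obtain F0 where F0: "finite F0" "F0 \<subseteq> E" "dist (\<Sum>e\<in>F0. (cmod (c e))\<^sup>2) S < (e / 4)\<^sup>2"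
      by (auto simp: eventually_finite_subsets_at_top)
    define P where "P F \<longleftrightarrow> finite F \<and> F0 \<subseteq> F \<and> F \<subseteq> E" for F
    have "eventually P (finite_subsets_at_top E)"
      unfolding P_def eventually_finite_subsets_at_top using F0 by blast
    moreover have near: "dist (sum f F0) (sum f F) \<le> e / 4" if "P F" for F
    proof -
      have F: "finite F" "F0 \<subseteq> F" "F \<subseteq> E" using that by (auto simp: P_def)
      have "(norm (sum f (F - F0)))\<^sup>2 = (\<Sum>e\<in>F - F0. (cmod (c e))\<^sup>2)"
        unfolding f_def using F E by (intro norm_sum_orthonormal) (auto intro: orthonormal_subset)
      also have "\<dots> = (\<Sum>e\<in>F. (cmod (c e))\<^sup>2) - (\<Sum>e\<in>F0. (cmod (c e))\<^sup>2)"
        using F by (simp add: sum_diff)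
      also have "\<dots> \<le> S - (\<Sum>e\<in>F0. (cmod (c e))\<^sup>2)"
        using F hs by (intro diff_right_mono finite_sum_le_has_sum) auto
      also have "\<dots> \<le> (e / 4)\<^sup>2" using F0(3) by (simp add: dist_real_def)
      finally have "norm (sum f (F - F0)) \<le> e / 4"
        using \<open>e > 0\<close> by (auto intro: power2_le_imp_le)
      then show ?thesis using F by (simp add: dist_norm sum_diff norm_minus_commute)
    qed
    moreover have "dist (sum f F1) (sum f F2) < e" if "P F1" "P F2" for F1 F2
    proof -
      have "dist (sum f F1) (sum f F2) \<le> dist (sum f F0) (sum f F1) + dist (sum f F0) (sum f F2)"
        by (rule dist_triangle3)
      also have "\<dots> < e" using near[OF that(1)] near[OF that(2)] \<open>e > 0\<close> by linarith
      finally show ?thesis .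
    qed
    ultimately show ?thesis by blast
  qed
  then have "cauchy_filter (filtermap (sum f) (finite_subsets_at_top E))"
    by (simp add: cauchy_filter_metric_filtermap)
  moreover have "complete (UNIV :: 'a set)"
    by (meson Cauchy_convergent UNIV_I complete_def convergent_def)
  ultimately obtain L where "(sum f \<longlongrightarrow> L) (finite_subsets_at_top E)"
    using complete_uniform[where S = "UNIV :: 'a set"] by (force simp: filterlim_def)
  then show ?thesis by (auto simp: summable_on_def has_sum_def f_def)
qed

lemma orthonormal_basis_expansion:
  fixes E :: "'a::{complex_inner, banach} set"
  assumes E: "orthonormal_basis E"
  shows "((\<lambda>e. cinner x e *\<^sub>C e) has_sum x) E"
proof -
  have on: "orthonormal E" by (rule orthonormal_basis_orthonormal[OF E])
  obtain s where s: "((\<lambda>e. cinner x e *\<^sub>C e) has_sum s) E"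
    using orthonormal_summable[OF on bessel_summable[OF on]] by (auto simp: summable_on_def)
  have "cinner (x - s) e = 0" if e: "e \<in> E" for e
  proof -
    have "((\<lambda>e'. cinner (cinner x e' *\<^sub>C e') e) has_sum cinner s e) E"
      by (rule has_sum_bounded_linear[OF cinner.bounded_linear_left s])
    moreover have "((\<lambda>e'. cinner (cinner x e' *\<^sub>C e') e) has_sum cinner x e) E"
    proof (rule has_sum_cong_neutral[THEN iffD1, rotated -1])
      show "((\<lambda>e'. cinner x e') has_sum cinner x e) {e}"
        using has_sum_finite[of "{e}" "\<lambda>e'. cinner x e'"] by simp
    qed (use on e in \<open>auto simp: orthonormal_def cinner_scaleC_left\<close>)
    ultimately show ?thesis by (simp add: cinner.diff_left has_sum_unique)
  qed
  then have "x - s = 0" using E unfolding orthonormal_basis_def by blast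
  then show ?thesis using s by simp
qed

lemma parseval:
  fixes E :: "'a::{complex_inner, banach} set"
  assumes "orthonormal_basis E"
  shows "((\<lambda>e. cinner x e * cinner e y) has_sum cinner x y) E"
  using has_sum_bounded_linear[OF cinner.bounded_linear_left orthonormal_basis_expansion[OF assms, of x], of y]
  by (simp add: cinner_scaleC_left)

lemma parseval_norm:
  fixes E :: "'a::{complex_inner, banach} set"
  assumes "orthonormal_basis E"
  shows "((\<lambda>e. (cmod (cinner x e))\<^sup>2) has_sum (norm x)\<^sup>2) E"
proof -
  have "cinner x e * cinner e x = complex_of_real ((cmod (cinner x e))\<^sup>2)" for e
    using cinner_commute[of e x] by (simp add: complex_norm_square del: of_real_power)
  then have "((\<lambda>e. complex_of_real ((cmod (cinner x e))\<^sup>2)) has_sum complex_of_real ((norm x)\<^sup>2)) E"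
    using parseval[OF assms, of x x] by (simp add: cinner_self del: of_real_power)
  then show ?thesis by (simp only: has_sum_of_real_iff)
qed

lemma cauchy_schwarz_sum:
  "(\<Sum>i\<in>F. \<bar>f i\<bar> * \<bar>g i\<bar>) \<le> sqrt (\<Sum>i\<in>F. (f i)\<^sup>2) * sqrt (\<Sum>i\<in>F. (g i :: real)\<^sup>2)"
  using L2_set_mult_ineq[of f g F] by (simp add: L2_set_def)

lemma bessel_mixed:
  assumes F: "finite F" "orthonormal F"
  shows "(\<Sum>e\<in>F. cmod (cinner e a) * cmod (cinner b e)) \<le> norm a * norm b"
proof -
  have "(\<Sum>e\<in>F. cmod (cinner e a) * cmod (cinner b e))
      \<le> sqrt (\<Sum>e\<in>F. (cmod (cinner e a))\<^sup>2) * sqrt (\<Sum>e\<in>F. (cmod (cinner b e))\<^sup>2)"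
    using cauchy_schwarz_sum[of "\<lambda>e. cmod (cinner e a)" "\<lambda>e. cmod (cinner b e)" F] by simp
  also have "(\<Sum>e\<in>F. (cmod (cinner e a))\<^sup>2) = (\<Sum>e\<in>F. (cmod (cinner a e))\<^sup>2)"
    by (intro sum.cong refl) (metis cinner_commute complex_mod_cnj)
  also have "sqrt \<dots> * sqrt (\<Sum>e\<in>F. (cmod (cinner b e))\<^sup>2) \<le> norm a * norm b"
    using bessel_finite[OF F] by (intro mult_mono real_le_lsqrt) (auto intro: sum_nonneg)
  finally show ?thesis .
qed

section \<open>Trace norm bounds and traces\<close>

text \<open>
  The trace norm of \<open>D\<close> is at most \<open>C\<close>. By polar decomposition the trace norm is the supremum of these sums
  over contractions \<open>X\<close> and \<open>Y\<close>; taking the inequality as the definition makes the ideal property a matter of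
  substituting \<open>X\<close> and \<open>Y\<close>, and avoids the polar decomposition.
\<close>

definition trace_norm_le :: "('a::complex_inner \<Rightarrow>\<^sub>L 'a) \<Rightarrow> real \<Rightarrow> bool" where
  "trace_norm_le D C \<longleftrightarrow> C \<ge> 0 \<and>
     (\<forall>F X X' Y Y'. finite F \<longrightarrow> orthonormal F \<longrightarrow> adj_pair X X' \<longrightarrow> adj_pair Y Y' \<longrightarrow>
       (\<Sum>e\<in>F. cmod (cinner (blinfun_apply D (blinfun_apply X e)) (blinfun_apply Y e)))
         \<le> C * norm X * norm Y)"

lemma trace_norm_leI:
  assumes "C \<ge> 0"
    "\<And>F X X' Y Y'. finite F \<Longrightarrow> orthonormal F \<Longrightarrow> adj_pair X X' \<Longrightarrow> adj_pair Y Y' \<Longrightarrow>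
       (\<Sum>e\<in>F. cmod (cinner (blinfun_apply D (blinfun_apply X e)) (blinfun_apply Y e)))
         \<le> C * norm X * norm Y"
  shows "trace_norm_le D C"
  unfolding trace_norm_le_def using assms by blast

lemma trace_norm_leD:
  assumes "trace_norm_le D C" "finite F" "orthonormal F" "adj_pair X X'" "adj_pair Y Y'"
  shows "(\<Sum>e\<in>F. cmod (cinner (blinfun_apply D (blinfun_apply X e)) (blinfun_apply Y e)))
         \<le> C * norm X * norm Y"
  using assms unfolding trace_norm_le_def by blast

lemma trace_norm_le_nonneg: "trace_norm_le D C \<Longrightarrow> C \<ge> 0"
  by (simp add: trace_norm_le_def)

lemma trace_norm_le_mono:
  fixes D :: "'a::complex_inner \<Rightarrow>\<^sub>L 'a"
  assumes "trace_norm_le D C" "C \<le> C'"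
  shows "trace_norm_le D C'"
proof (rule trace_norm_leI)
  show "C' \<ge> 0" using trace_norm_le_nonneg[OF assms(1)] assms(2) by linarith
  fix F :: "'a set" and X X' Y Y' :: "'a \<Rightarrow>\<^sub>L 'a" assume *: "finite F" "orthonormal F" "adj_pair X X'" "adj_pair Y Y'"
  have "C * norm X * norm Y \<le> C' * norm X * norm Y"
    by (intro mult_right_mono assms) auto
  with trace_norm_leD[OF assms(1) *]
  show "(\<Sum>e\<in>F. cmod (cinner (blinfun_apply D (blinfun_apply X e)) (blinfun_apply Y e))) \<le> C' * norm X * norm Y"
    by linarith
qed

lemma trace_norm_le_zero: "trace_norm_le 0 0"
  by (rule trace_norm_leI) (simp_all add: cinner.zero_left)

lemma trace_norm_le_add:
  fixes D :: "'a::complex_inner \<Rightarrow>\<^sub>L 'a"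
  assumes "trace_norm_le D C" "trace_norm_le D' C'"
  shows "trace_norm_le (D + D') (C + C')"
proof (rule trace_norm_leI)
  show "C + C' \<ge> 0" using assms trace_norm_le_nonneg by (intro add_nonneg_nonneg) auto
  fix F :: "'a set" and X X' Y Y' :: "'a \<Rightarrow>\<^sub>L 'a" assume *: "finite F" "orthonormal F" "adj_pair X X'" "adj_pair Y Y'"
  have "(\<Sum>e\<in>F. cmod (cinner (blinfun_apply (D + D') (blinfun_apply X e)) (blinfun_apply Y e)))
      \<le> (\<Sum>e\<in>F. cmod (cinner (blinfun_apply D (blinfun_apply X e)) (blinfun_apply Y e)) +
          cmod (cinner (blinfun_apply D' (blinfun_apply X e)) (blinfun_apply Y e)))"
    by (intro sum_mono) (simp add: blinfun.add_left cinner.add_left norm_triangle_ineq)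
  also have "\<dots> \<le> C * norm X * norm Y + C' * norm X * norm Y"
    unfolding sum.distrib by (intro add_mono trace_norm_leD[OF assms(1) *] trace_norm_leD[OF assms(2) *])
  finally show "(\<Sum>e\<in>F. cmod (cinner (blinfun_apply (D + D') (blinfun_apply X e)) (blinfun_apply Y e)))
      \<le> (C + C') * norm X * norm Y" by (simp add: algebra_simps)
qed

lemma trace_norm_le_cmult:
  fixes D :: "'a::complex_inner \<Rightarrow>\<^sub>L 'a"
  assumes "trace_norm_le D C"
  shows "trace_norm_le (scalar_op c o\<^sub>L D) (cmod c * C)"
proof (rule trace_norm_leI)
  show "cmod c * C \<ge> 0" using trace_norm_le_nonneg[OF assms] by simp
  fix F :: "'a set" and X X' Y Y' :: "'a \<Rightarrow>\<^sub>L 'a" assume *: "finite F" "orthonormal F" "adj_pair X X'" "adj_pair Y Y'"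
  show "(\<Sum>e\<in>F. cmod (cinner (blinfun_apply (scalar_op c o\<^sub>L D) (blinfun_apply X e)) (blinfun_apply Y e)))
      \<le> cmod c * C * norm X * norm Y"
    using mult_left_mono[OF trace_norm_leD[OF assms *], of "cmod c"]
    by (simp add: cinner_scaleC_left norm_mult sum_distrib_left[symmetric] mult_ac)
qed

lemma scalar_op_minus_one: "scalar_op (- 1) o\<^sub>L D = - D"
  by (rule blinfun_eqI) (simp add: scaleC_minus_one blinfun.minus_left)

lemma trace_norm_le_uminus: "trace_norm_le D C \<Longrightarrow> trace_norm_le (- D) C"
  using trace_norm_le_cmult[of D C "- 1"] by (simp add: scalar_op_minus_one)

lemma trace_norm_le_diff: "trace_norm_le D C \<Longrightarrow> trace_norm_le D' C' \<Longrightarrow> trace_norm_le (D - D') (C + C')"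
  using trace_norm_le_add[of D C "- D'" C'] trace_norm_le_uminus[of D' C'] by simp

lemma trace_norm_le_sum:
  assumes "\<And>i. i \<in> I \<Longrightarrow> trace_norm_le (D i) (C i)"
  shows "trace_norm_le (\<Sum>i\<in>I. D i) (\<Sum>i\<in>I. C i)"
  using assms by (induction I rule: infinite_finite_induct) (auto intro: trace_norm_le_zero trace_norm_le_add)

lemma trace_norm_le_compose_left:
  fixes D :: "'a::complex_inner \<Rightarrow>\<^sub>L 'a"
  assumes "trace_norm_le D C" "adj_pair L L'"
  shows "trace_norm_le (L o\<^sub>L D) (norm L * C)"
proof (rule trace_norm_leI)
  show "norm L * C \<ge> 0" using trace_norm_le_nonneg[OF assms(1)] by simp
  fix F :: "'a set" and X X' Y Y' :: "'a \<Rightarrow>\<^sub>L 'a" assume *: "finite F" "orthonormal F" "adj_pair X X'" "adj_pair Y Y'"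
  have "(\<Sum>e\<in>F. cmod (cinner (blinfun_apply (L o\<^sub>L D) (blinfun_apply X e)) (blinfun_apply Y e)))
      = (\<Sum>e\<in>F. cmod (cinner (blinfun_apply D (blinfun_apply X e)) (blinfun_apply (L' o\<^sub>L Y) e)))"
    by (simp add: adj_pairD[OF assms(2)])
  also have "\<dots> \<le> C * norm X * norm (L' o\<^sub>L Y)"
    by (rule trace_norm_leD[OF assms(1) *(1-3)]) (rule adj_pair_compose[OF adj_pair_sym[OF assms(2)] *(4)])
  also have "\<dots> \<le> C * norm X * (norm L * norm Y)"
    using norm_blinfun_compose[of L' Y] norm_adj_eq[OF assms(2)] trace_norm_le_nonneg[OF assms(1)]
    by (intro mult_left_mono) auto
  finally show "(\<Sum>e\<in>F. cmod (cinner (blinfun_apply (L o\<^sub>L D) (blinfun_apply X e)) (blinfun_apply Y e)))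
      \<le> norm L * C * norm X * norm Y" by (simp add: mult_ac)
qed

lemma trace_norm_le_compose_right:
  fixes D :: "'a::complex_inner \<Rightarrow>\<^sub>L 'a"
  assumes "trace_norm_le D C" "adj_pair R R'"
  shows "trace_norm_le (D o\<^sub>L R) (C * norm R)"
proof (rule trace_norm_leI)
  show "C * norm R \<ge> 0" using trace_norm_le_nonneg[OF assms(1)] by simp
  fix F :: "'a set" and X X' Y Y' :: "'a \<Rightarrow>\<^sub>L 'a" assume *: "finite F" "orthonormal F" "adj_pair X X'" "adj_pair Y Y'"
  have "(\<Sum>e\<in>F. cmod (cinner (blinfun_apply (D o\<^sub>L R) (blinfun_apply X e)) (blinfun_apply Y e)))
      = (\<Sum>e\<in>F. cmod (cinner (blinfun_apply D (blinfun_apply (R o\<^sub>L X) e)) (blinfun_apply Y e)))"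
    by simp
  also have "\<dots> \<le> C * norm (R o\<^sub>L X) * norm Y"
    by (rule trace_norm_leD[OF assms(1) *(1,2) _ *(4)]) (rule adj_pair_compose[OF assms(2) *(3)])
  also have "\<dots> \<le> C * (norm R * norm X) * norm Y"
    using norm_blinfun_compose[of R X] trace_norm_le_nonneg[OF assms(1)]
    by (intro mult_left_mono mult_right_mono) auto
  finally show "(\<Sum>e\<in>F. cmod (cinner (blinfun_apply (D o\<^sub>L R) (blinfun_apply X e)) (blinfun_apply Y e)))
      \<le> C * norm R * norm X * norm Y" by (simp add: mult_ac)
qed

text \<open>
  Each of the finite sums is continuous in \<open>D\<close>.
\<close>

lemma trace_norm_le_limit:
  fixes D' :: "'a::complex_inner \<Rightarrow>\<^sub>L 'a"
  assumes "\<forall>\<^sub>F n in sequentially. trace_norm_le (D n) (C n)" "D \<longlonglongrightarrow> D'" "C \<longlonglongrightarrow> C'"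
  shows "trace_norm_le D' C'"
proof (rule trace_norm_leI)
  have "\<forall>\<^sub>F n in sequentially. 0 \<le> C n"
    using assms(1) by eventually_elim (rule trace_norm_le_nonneg)
  then show "C' \<ge> 0" by (rule tendsto_lowerbound[OF assms(3)]) simp
  fix F :: "'a set" and X X' Y Y' :: "'a \<Rightarrow>\<^sub>L 'a" assume *: "finite F" "orthonormal F" "adj_pair X X'" "adj_pair Y Y'"
  have "(\<lambda>n. \<Sum>e\<in>F. cmod (cinner (blinfun_apply (D n) (blinfun_apply X e)) (blinfun_apply Y e)))
      \<longlonglongrightarrow> (\<Sum>e\<in>F. cmod (cinner (blinfun_apply D' (blinfun_apply X e)) (blinfun_apply Y e)))"
    by (intro tendsto_sum tendsto_norm cinner.tendsto blinfun.tendsto assms tendsto_const)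
  moreover have "(\<lambda>n. C n * norm X * norm Y) \<longlonglongrightarrow> C' * norm X * norm Y"
    by (intro tendsto_mult assms tendsto_const)
  moreover have "\<forall>\<^sub>F n in sequentially.
      (\<Sum>e\<in>F. cmod (cinner (blinfun_apply (D n) (blinfun_apply X e)) (blinfun_apply Y e))) \<le> C n * norm X * norm Y"
    using assms(1) by eventually_elim (rule trace_norm_leD[OF _ *])
  ultimately show "(\<Sum>e\<in>F. cmod (cinner (blinfun_apply D' (blinfun_apply X e)) (blinfun_apply Y e)))
      \<le> C' * norm X * norm Y"
    by (intro tendsto_le[of sequentially]) auto
qed

lemma trace_norm_le_abs_summable:
  assumes "trace_norm_le D C" "orthonormal E"
  shows "(\<lambda>e. cmod (cinner (blinfun_apply D e) e)) summable_on E"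
    and "(\<Sum>\<^sub>\<infinity>e\<in>E. cmod (cinner (blinfun_apply D e) e)) \<le> C"
proof -
  have *: "(\<Sum>e\<in>F. cmod (cinner (blinfun_apply D e) e)) \<le> C" if "finite F" "F \<subseteq> E" for F
  proof -
    have "(\<Sum>e\<in>F. cmod (cinner (blinfun_apply D e) e))
        \<le> C * norm (id_blinfun :: 'a \<Rightarrow>\<^sub>L 'a) * norm (id_blinfun :: 'a \<Rightarrow>\<^sub>L 'a)"
      using trace_norm_leD[OF assms(1) that(1) orthonormal_subset[OF assms(2) that(2)] adj_pair_id adj_pair_id] by simp
    also have "\<dots> \<le> C * 1 * 1"
      using trace_norm_le_nonneg[OF assms(1)] by (intro mult_mono norm_blinfun_id_le) auto
    finally show ?thesis by simp
  qed
  show "(\<lambda>e. cmod (cinner (blinfun_apply D e) e)) summable_on E"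
    by (rule nonneg_bdd_above_summable_on) (use * in \<open>auto intro!: bdd_aboveI2[of _ _ C]\<close>)
  then show "(\<Sum>\<^sub>\<infinity>e\<in>E. cmod (cinner (blinfun_apply D e) e)) \<le> C"
    by (rule infsum_le_finite_sums) (rule *)
qed

text \<open>
  The trace as a relation, with independence of the basis built in.
\<close>

definition has_tr :: "('a::complex_inner \<Rightarrow>\<^sub>L 'a) \<Rightarrow> complex \<Rightarrow> bool" where
  "has_tr D t \<longleftrightarrow> (\<forall>E. orthonormal_basis E \<longrightarrow> ((\<lambda>e. cinner (blinfun_apply D e) e) has_sum t) E)"

lemma has_tr_zero: "has_tr 0 0"
  by (simp add: has_tr_def cinner.zero_left has_sum_0)

lemma has_tr_add: "has_tr D t \<Longrightarrow> has_tr D' t' \<Longrightarrow> has_tr (D + D') (t + t')"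
  by (auto simp: has_tr_def blinfun.add_left cinner.add_left intro: has_sum_add)

lemma has_tr_cmult: "has_tr D t \<Longrightarrow> has_tr (scalar_op c o\<^sub>L D) (c * t)"
  by (auto simp: has_tr_def cinner_scaleC_left intro: has_sum_cmult_right)

lemma has_tr_uminus: "has_tr D t \<Longrightarrow> has_tr (- D) (- t)"
  using has_tr_cmult[of D t "- 1"] by (simp add: scalar_op_minus_one)

lemma has_tr_diff: "has_tr D t \<Longrightarrow> has_tr D' t' \<Longrightarrow> has_tr (D - D') (t - t')"
  using has_tr_add[of D t "- D'" "- t'"] has_tr_uminus[of D' t'] by simp

lemma trace_op_eq:
  assumes "has_tr (D :: 'a::complex_inner \<Rightarrow>\<^sub>L 'a) t" and ex: "\<exists>E :: 'a set. orthonormal_basis E"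
  shows "trace_op D = t"
  unfolding trace_op_def
proof (rule the_equality)
  show "\<forall>E. orthonormal_basis E \<longrightarrow> ((\<lambda>e. cinner (blinfun_apply D e) e) has_sum t) E"
    using assms by (simp add: has_tr_def)
  show "s = t" if "\<forall>E. orthonormal_basis E \<longrightarrow> ((\<lambda>e. cinner (blinfun_apply D e) e) has_sum s) E" for s
    using that assms ex unfolding has_tr_def by (meson has_sum_unique)
qed

text \<open>
  Convergence in trace norm together with convergence of the traces: in every basis the diagonal sum of the
  limit is within \<open>\<epsilon> n\<close> of \<open>t n\<close>.
\<close>

lemma has_tr_limit:
  fixes D :: "'a::{complex_inner} \<Rightarrow>\<^sub>L 'a"
  assumes tr: "\<And>n. has_tr (D' n) (t n)" and C: "trace_norm_le D C"
    and tc: "\<And>n. trace_norm_le (D - D' n) (\<epsilon> n)" and \<epsilon>: "\<epsilon> \<longlonglongrightarrow> 0" and t: "t \<longlonglongrightarrow> s"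
  shows "has_tr D s"
  unfolding has_tr_def
proof (intro allI impI)
  fix E :: "'a set" assume E: "orthonormal_basis E"
  note on = orthonormal_basis_orthonormal[OF E]
  define T where "T = (\<Sum>\<^sub>\<infinity>e\<in>E. cinner (blinfun_apply D e) e)"
  have T: "((\<lambda>e. cinner (blinfun_apply D e) e) has_sum T) E"
    unfolding T_def using abs_summable_summable[OF trace_norm_le_abs_summable(1)[OF C on]] by simp
  have "cmod (t n - T) \<le> \<epsilon> n" for n
  proof -
    have "((\<lambda>e. cinner (blinfun_apply D e) e - cinner (blinfun_apply (D' n) e) e) has_sum (T - t n)) E"
      using has_sum_add[OF T has_sum_uminusI] tr[of n] E by (simp add: has_tr_def)
    then have "((\<lambda>e. cinner (blinfun_apply (D - D' n) e) e) has_sum (T - t n)) E"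
      by (simp add: blinfun.diff_left cinner.diff_left)
    then have "cmod (T - t n) \<le> (\<Sum>\<^sub>\<infinity>e\<in>E. cmod (cinner (blinfun_apply (D - D' n) e) e))"
      using trace_norm_le_abs_summable(1)[OF tc on] by (intro norm_has_sum_bound[OF has_sum_infsum])
    also have "\<dots> \<le> \<epsilon> n" by (rule trace_norm_le_abs_summable(2)[OF tc on])
    finally show ?thesis by (simp add: norm_minus_commute)
  qed
  then have "(\<lambda>n. t n - T) \<longlonglongrightarrow> 0"
    by (intro Lim_null_comparison[OF _ \<epsilon>] always_eventually allI)
  then have "t \<longlonglongrightarrow> T" by (rule LIM_zero_cancel)
  then have "T = s" using t LIMSEQ_unique by blast
  then show "((\<lambda>e. cinner (blinfun_apply D e) e) has_sum s) E" using T by simp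
qed

section \<open>Operators given by a nuclear series\<close>

lemma has_sum_finite_sum:
  fixes u :: "'i \<Rightarrow> 'k \<Rightarrow> 'b::topological_comm_monoid_add"
  assumes "\<And>i. i \<in> F \<Longrightarrow> (u i has_sum s i) K"
  shows "((\<lambda>k. \<Sum>i\<in>F. u i k) has_sum (\<Sum>i\<in>F. s i)) K"
  using assms by (induction F rule: infinite_finite_induct) (auto intro: has_sum_add)

text \<open>
  \<open>R = \<Sum> \<langle>\<cdot>, a\<^sub>k\<rangle> b\<^sub>k\<close> with \<open>\<Sum> \<parallel>a\<^sub>k\<parallel> \<parallel>b\<^sub>k\<parallel>\<close> finite. Convergence is required in the weak sense only,
  which is the form in which the series arise from Parseval's identity.
\<close>

definition nuclear_series :: "('a::complex_inner \<Rightarrow>\<^sub>L 'a) \<Rightarrow> ('k \<Rightarrow> 'a) \<Rightarrow> ('k \<Rightarrow> 'a) \<Rightarrow> 'k set \<Rightarrow> bool" where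
  "nuclear_series R a b K \<longleftrightarrow> (\<lambda>k. norm (a k) * norm (b k)) summable_on K \<and>
     (\<forall>x y. ((\<lambda>k. cinner x (a k) * cinner (b k) y) has_sum cinner (blinfun_apply R x) y) K)"

text \<open>
  For a rank one operator the bound is Bessel's inequality combined with the Cauchy--Schwarz inequality;
  the series is summed by the triangle inequality.
\<close>

lemma nuclear_trace_norm_le:
  fixes R :: "'a::complex_inner \<Rightarrow>\<^sub>L 'a"
  assumes R: "nuclear_series R a b K"
  shows "trace_norm_le R (\<Sum>\<^sub>\<infinity>k\<in>K. norm (a k) * norm (b k))"
proof (rule trace_norm_leI)
  let ?C = "\<Sum>\<^sub>\<infinity>k\<in>K. norm (a k) * norm (b k)"
  have sm: "(\<lambda>k. norm (a k) * norm (b k)) summable_on K"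
    using R by (simp add: nuclear_series_def)
  show "?C \<ge> 0" by (intro infsum_nonneg) simp
  fix F :: "'a set" and X X' Y Y' :: "'a \<Rightarrow>\<^sub>L 'a" assume F: "finite F" "orthonormal F" and X: "adj_pair X X'" and Y: "adj_pair Y Y'"
  define u where "u e k = cmod (cinner (blinfun_apply X e) (a k)) * cmod (cinner (b k) (blinfun_apply Y e))" for e k
  have us: "u e summable_on K" for e
  proof (rule summable_on_comparison_test)
    show "(\<lambda>k. norm (blinfun_apply X e) * norm (blinfun_apply Y e) * (norm (a k) * norm (b k))) summable_on K"
      by (rule summable_on_cmult_right[OF sm])
    fix k
    have "u e k \<le> (norm (blinfun_apply X e) * norm (a k)) * (norm (b k) * norm (blinfun_apply Y e))"
      unfolding u_def by (intro mult_mono cmod_cinner_le) auto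
    then show "u e k \<le> norm (blinfun_apply X e) * norm (blinfun_apply Y e) * (norm (a k) * norm (b k))"
      by (simp add: mult_ac)
  qed (simp add: u_def)
  have "cmod (cinner (blinfun_apply R (blinfun_apply X e)) (blinfun_apply Y e)) \<le> (\<Sum>\<^sub>\<infinity>k\<in>K. u e k)" for e
  proof (rule norm_has_sum_bound)
    show "((\<lambda>k. cinner (blinfun_apply X e) (a k) * cinner (b k) (blinfun_apply Y e)) has_sum
        cinner (blinfun_apply R (blinfun_apply X e)) (blinfun_apply Y e)) K"
      using R by (simp add: nuclear_series_def)
    show "((\<lambda>k. cmod (cinner (blinfun_apply X e) (a k) * cinner (b k) (blinfun_apply Y e))) has_sum (\<Sum>\<^sub>\<infinity>k\<in>K. u e k)) K"
      using has_sum_infsum[OF us] by (simp add: u_def[abs_def] norm_mult)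
  qed
  then have "(\<Sum>e\<in>F. cmod (cinner (blinfun_apply R (blinfun_apply X e)) (blinfun_apply Y e))) \<le> (\<Sum>e\<in>F. \<Sum>\<^sub>\<infinity>k\<in>K. u e k)"
    by (rule sum_mono)
  also have "\<dots> \<le> norm X * norm Y * ?C"
  proof (rule has_sum_mono)
    show "((\<lambda>k. \<Sum>e\<in>F. u e k) has_sum (\<Sum>e\<in>F. \<Sum>\<^sub>\<infinity>k\<in>K. u e k)) K"
      by (rule has_sum_finite_sum) (use us in auto)
    show "((\<lambda>k. norm X * norm Y * (norm (a k) * norm (b k))) has_sum norm X * norm Y * ?C) K"
      by (rule has_sum_cmult_right[OF has_sum_infsum[OF sm]])
    fix k
    have "(\<Sum>e\<in>F. u e k) = (\<Sum>e\<in>F. cmod (cinner e (blinfun_apply X' (a k))) * cmod (cinner (blinfun_apply Y' (b k)) e))"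
      by (simp add: u_def adj_pairD[OF X] adj_pairD[OF adj_pair_sym[OF Y]])
    also have "\<dots> \<le> norm (blinfun_apply X' (a k)) * norm (blinfun_apply Y' (b k))"
      by (rule bessel_mixed[OF F])
    also have "\<dots> \<le> (norm X * norm (a k)) * (norm Y * norm (b k))"
      using norm_blinfun[of X' "a k"] norm_blinfun[of Y' "b k"] norm_adj_eq[OF X] norm_adj_eq[OF Y]
      by (intro mult_mono) auto
    finally show "(\<Sum>e\<in>F. u e k) \<le> norm X * norm Y * (norm (a k) * norm (b k))" by (simp add: mult_ac)
  qed
  finally show "(\<Sum>e\<in>F. cmod (cinner (blinfun_apply R (blinfun_apply X e)) (blinfun_apply Y e))) \<le> ?C * norm X * norm Y"
    by (simp add: mult_ac)
qed

text \<open>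
  Interchange of the sum over \<open>k\<close> with the sum over the basis, and Parseval's identity for fixed \<open>k\<close>. The
  interchange is legitimate because the double series converges absolutely.
\<close>

lemma nuclear_has_tr:
  fixes R :: "'a::{complex_inner, banach} \<Rightarrow>\<^sub>L 'a"
  assumes R: "nuclear_series R a b K"
  shows "has_tr R (\<Sum>\<^sub>\<infinity>k\<in>K. cinner (b k) (a k))"
  unfolding has_tr_def
proof (intro allI impI)
  fix E :: "'a set" assume E: "orthonormal_basis E"
  note on = orthonormal_basis_orthonormal[OF E]
  have sm: "(\<lambda>k. norm (a k) * norm (b k)) summable_on K"
    using R by (simp add: nuclear_series_def)
  define g where "g = (\<lambda>(k, e). cinner (b k) e * cinner e (a k))"
  have fin: "(\<Sum>e\<in>F. cmod (g (k, e))) \<le> norm (a k) * norm (b k)" if "finite F" "F \<subseteq> E" for k F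
    using bessel_mixed[OF that(1) orthonormal_subset[OF on that(2)], of "a k" "b k"]
    by (simp add: g_def norm_mult mult.commute)
  have k1: "(\<lambda>e. cmod (g (k, e))) summable_on E" for k
    by (rule nonneg_bdd_above_summable_on) (auto intro!: bdd_aboveI2[of _ _ "norm (a k) * norm (b k)"] fin)
  have k2: "(\<Sum>\<^sub>\<infinity>e\<in>E. cmod (g (k, e))) \<le> norm (a k) * norm (b k)" for k
    by (rule infsum_le_finite_sums[OF k1 fin])
  have "(\<lambda>z. norm (g z)) summable_on (K \<times> E)"
    unfolding Infinite_Sum.abs_summable_on_Sigma_iff
  proof (intro conjI ballI k1)
    show "(\<lambda>x. norm (\<Sum>\<^sub>\<infinity>y\<in>E. norm (g (x, y)))) summable_on K"
    proof (rule summable_on_comparison_test[OF sm])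
      fix k
      have "(\<Sum>\<^sub>\<infinity>y\<in>E. norm (g (k, y))) \<ge> 0" by (intro infsum_nonneg) simp
      then show "norm (\<Sum>\<^sub>\<infinity>y\<in>E. norm (g (k, y))) \<le> norm (a k) * norm (b k)" using k2[of k] by simp
    qed simp
  qed
  then have gs: "g summable_on (K \<times> E)" by (rule abs_summable_summable)
  then obtain S where S: "(g has_sum S) (K \<times> E)" by (auto simp: summable_on_def)
  have "((\<lambda>k. cinner (b k) (a k)) has_sum S) K"
    by (rule has_sum_SigmaD[OF S]) (simp add: g_def parseval[OF E])
  then have S_eq: "(\<Sum>\<^sub>\<infinity>k\<in>K. cinner (b k) (a k)) = S" by (rule infsumI)
  have "((\<lambda>e. cinner (blinfun_apply R e) e) has_sum S) E"
  proof (rule has_sum_SigmaD)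
    show "((\<lambda>(e, k). g (k, e)) has_sum S) (E \<times> K)" using S by (simp add: has_sum_swap[of g])
    show "((\<lambda>k. (\<lambda>(e, k). g (k, e)) (e, k)) has_sum cinner (blinfun_apply R e) e) K" for e
      using R by (simp add: g_def nuclear_series_def mult.commute)
  qed
  then show "((\<lambda>e. cinner (blinfun_apply R e) e) has_sum (\<Sum>\<^sub>\<infinity>k\<in>K. cinner (b k) (a k))) E"
    unfolding S_eq .
qed

lemma nuclear_compose:
  assumes R: "nuclear_series R a b K" and L: "adj_pair L L'" and Q: "adj_pair Q Q'"
  shows "nuclear_series (L o\<^sub>L R o\<^sub>L Q) (\<lambda>k. blinfun_apply Q' (a k)) (\<lambda>k. blinfun_apply L (b k)) K"
  unfolding nuclear_series_def
proof (intro conjI allI)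
  have sm: "(\<lambda>k. norm (a k) * norm (b k)) summable_on K"
    using R by (simp add: nuclear_series_def)
  show "(\<lambda>k. norm (blinfun_apply Q' (a k)) * norm (blinfun_apply L (b k))) summable_on K"
  proof (rule summable_on_comparison_test[OF summable_on_cmult_right[OF sm, of "norm Q' * norm L"]])
    fix k
    have "norm (blinfun_apply Q' (a k)) * norm (blinfun_apply L (b k)) \<le> (norm Q' * norm (a k)) * (norm L * norm (b k))"
      by (intro mult_mono norm_blinfun) auto
    then show "norm (blinfun_apply Q' (a k)) * norm (blinfun_apply L (b k)) \<le> norm Q' * norm L * (norm (a k) * norm (b k))"
      by (simp add: mult_ac)
  qed simp
  fix x y
  have "((\<lambda>k. cinner (blinfun_apply Q x) (a k) * cinner (b k) (blinfun_apply L' y)) has_sum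
      cinner (blinfun_apply R (blinfun_apply Q x)) (blinfun_apply L' y)) K"
    using R by (simp add: nuclear_series_def)
  then show "((\<lambda>k. cinner x (blinfun_apply Q' (a k)) * cinner (blinfun_apply L (b k)) y) has_sum
      cinner (blinfun_apply (L o\<^sub>L R o\<^sub>L Q) x) y) K"
    by (simp add: adj_pairD[OF Q] adj_pairD[OF L])
qed

text \<open>
  Trace class together with cyclicity of the trace: the trace of \<open>L R Q\<close> depends on the product \<open>Q L\<close>
  alone. Carrying this property along makes \<open>Tr (L R) = Tr (R L)\<close> available for sums and products without a
  decomposition into nuclear series.
\<close>

definition traceable :: "('a::complex_inner \<Rightarrow>\<^sub>L 'a) \<Rightarrow> bool" where
  "traceable R \<longleftrightarrow> (\<exists>C. trace_norm_le R C) \<and> (\<exists>\<tau>. \<forall>L L' Q Q'. adj_pair L L' \<longrightarrow> adj_pair Q Q' \<longrightarrow>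
     has_tr (L o\<^sub>L R o\<^sub>L Q) (\<tau> (Q o\<^sub>L L)))"

lemma nuclear_traceable:
  fixes R :: "'a::{complex_inner, banach} \<Rightarrow>\<^sub>L 'a"
  assumes R: "nuclear_series R a b K"
  shows "traceable R"
  unfolding traceable_def
proof (intro conjI exI allI impI)
  show "trace_norm_le R (\<Sum>\<^sub>\<infinity>k\<in>K. norm (a k) * norm (b k))" by (rule nuclear_trace_norm_le[OF R])
  fix L L' Q Q' :: "'a \<Rightarrow>\<^sub>L 'a" assume "adj_pair L L'" "adj_pair Q Q'"
  from nuclear_has_tr[OF nuclear_compose[OF R this]]
  show "has_tr (L o\<^sub>L R o\<^sub>L Q) ((\<lambda>X. \<Sum>\<^sub>\<infinity>k\<in>K. cinner (blinfun_apply X (b k)) (a k)) (Q o\<^sub>L L))"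
    by (simp add: adj_pairD[OF \<open>adj_pair Q Q'\<close>])
qed

lemma traceable_add:
  assumes "traceable R" "traceable S"
  shows "traceable (R + S)"
proof -
  obtain C \<tau> where 1: "trace_norm_le R C" "\<And>L L' Q Q'. adj_pair L L' \<Longrightarrow> adj_pair Q Q' \<Longrightarrow> has_tr (L o\<^sub>L R o\<^sub>L Q) (\<tau> (Q o\<^sub>L L))"
    using assms(1) unfolding traceable_def by blast
  obtain C' \<tau>' where 2: "trace_norm_le S C'" "\<And>L L' Q Q'. adj_pair L L' \<Longrightarrow> adj_pair Q Q' \<Longrightarrow> has_tr (L o\<^sub>L S o\<^sub>L Q) (\<tau>' (Q o\<^sub>L L))"
    using assms(2) unfolding traceable_def by blast
  have "L o\<^sub>L (R + S) o\<^sub>L Q = (L o\<^sub>L R o\<^sub>L Q) + (L o\<^sub>L S o\<^sub>L Q)" for L Q :: "'a \<Rightarrow>\<^sub>L 'a"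
    by (rule blinfun_eqI) (simp add: blinfun.add_left blinfun.add_right)
  then have "has_tr (L o\<^sub>L (R + S) o\<^sub>L Q) (\<tau> (Q o\<^sub>L L) + \<tau>' (Q o\<^sub>L L))"
    if "adj_pair L L'" "adj_pair Q Q'" for L L' Q Q'
    using has_tr_add[OF 1(2)[OF that] 2(2)[OF that]] by simp
  then show ?thesis
    unfolding traceable_def using trace_norm_le_add[OF 1(1) 2(1)]
    by (intro conjI exI[of _ "\<lambda>X. \<tau> X + \<tau>' X"]) blast+
qed

lemma traceable_compose:
  assumes "traceable R" and L: "adj_pair L L'" and Q: "adj_pair Q Q'"
  shows "traceable (L o\<^sub>L R o\<^sub>L Q)"
proof -
  obtain C \<tau> where 1: "trace_norm_le R C" "\<And>L L' Q Q'. adj_pair L L' \<Longrightarrow> adj_pair Q Q' \<Longrightarrow> has_tr (L o\<^sub>L R o\<^sub>L Q) (\<tau> (Q o\<^sub>L L))"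
    using assms(1) unfolding traceable_def by blast
  have "has_tr (A o\<^sub>L (L o\<^sub>L R o\<^sub>L Q) o\<^sub>L B) (\<tau> (Q o\<^sub>L (B o\<^sub>L A) o\<^sub>L L))"
    if "adj_pair A A'" "adj_pair B B'" for A A' B B'
  proof -
    have "(A o\<^sub>L L) o\<^sub>L R o\<^sub>L (Q o\<^sub>L B) = A o\<^sub>L (L o\<^sub>L R o\<^sub>L Q) o\<^sub>L B"
      "(Q o\<^sub>L B) o\<^sub>L (A o\<^sub>L L) = Q o\<^sub>L (B o\<^sub>L A) o\<^sub>L L"
      by (rule blinfun_eqI; simp)+
    then show ?thesis
      using 1(2)[OF adj_pair_compose[OF that(1) L] adj_pair_compose[OF Q that(2)]] by simp
  qed
  moreover have "trace_norm_le (L o\<^sub>L R o\<^sub>L Q) (norm L * C * norm Q)"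
    by (rule trace_norm_le_compose_right[OF trace_norm_le_compose_left[OF 1(1) L] Q])
  ultimately show ?thesis
    unfolding traceable_def by (intro conjI exI[of _ "\<lambda>X. \<tau> (Q o\<^sub>L X o\<^sub>L L)"]) blast+
qed

text \<open>
  Both \<open>L R 1\<close> and \<open>1 R L\<close> have product \<open>L\<close> of the outer factors.
\<close>

lemma traceable_commute:
  assumes "traceable R" and L: "adj_pair L L'"
  shows "\<exists>t. has_tr (L o\<^sub>L R) t \<and> has_tr (R o\<^sub>L L) t"
proof -
  obtain \<tau> where 1: "\<And>L L' Q Q'. adj_pair L L' \<Longrightarrow> adj_pair Q Q' \<Longrightarrow> has_tr (L o\<^sub>L R o\<^sub>L Q) (\<tau> (Q o\<^sub>L L))"
    using assms(1) unfolding traceable_def by blast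
  have "L o\<^sub>L R o\<^sub>L id_blinfun = L o\<^sub>L R" "id_blinfun o\<^sub>L L = L"
    "id_blinfun o\<^sub>L R o\<^sub>L L = R o\<^sub>L L" "L o\<^sub>L id_blinfun = L"
    by (rule blinfun_eqI; simp)+
  then show ?thesis
    using 1[OF L adj_pair_id] 1[OF adj_pair_id L] by (intro exI[of _ "\<tau> L"]) simp
qed

section \<open>A criterion for trace class operators\<close>

text \<open>
  Put \<open>S = D\<^sup>* D\<close> and \<open>V = D g(S)\<close> with \<open>g(x) = 1 / sqrt (x + \<epsilon>)\<close>. Then \<open>V\<close> is a contraction that approximates
  the partial isometry of the polar decomposition: the operator \<open>V\<^sup>* D = g(S) S\<close> is within \<open>sqrt \<epsilon>\<close> of
  \<open>sqrt S\<close>, the absolute value of \<open>D\<close>. Hence the diagonal sums of the absolute value over finite sets of basis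
  vectors are bounded by \<open>\<Sum> \<bar>\<langle>D e, V e\<rangle>\<bar> \<le> C\<close> up to an error that can be made arbitrarily small.
\<close>

lemma trace_classI:
  fixes D :: "'a::{complex_inner, banach} \<Rightarrow>\<^sub>L 'a"
  assumes adj: "adj_pair D D'" and tc: "trace_norm_le D C" and E: "orthonormal_basis (E :: 'a set)"
  shows "trace_class D"
proof -
  define M where "M = (norm D)\<^sup>2"
  interpret S: bounded_self_adjoint "D' o\<^sub>L D" M
    by (rule bounded_self_adjoint_positive[OF adj]) (simp add: M_def)
  define B where "B = abs_op D"
  have B: "B = cfc (\<lambda>x. complex_of_real (sqrt x)) (D' o\<^sub>L D)"
    by (simp add: B_def abs_op_def cadjoint_eq[OF adj])
  have bound: "(\<Sum>e\<in>F. cmod (cinner (blinfun_apply B e) e)) \<le> C" if F: "finite F" "F \<subseteq> E" for F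
  proof (rule field_le_epsilon)
    fix r :: real assume "r > 0"
    \<comment> \<open>an error of \<open>r / (card F + 1)\<close> for each element of \<open>F\<close> adds up to less than \<open>r\<close>\<close>
    define \<epsilon> where "\<epsilon> = (r / (card F + 1))\<^sup>2"
    have \<epsilon>: "\<epsilon> > 0" using \<open>r > 0\<close> by (simp add: \<epsilon>_def)
    define g where "g x = complex_of_real (1 / sqrt (x + \<epsilon>))" for x
    have gc: "continuous_on {0..M} g"
      unfolding g_def using \<epsilon> by (intro continuous_intros) auto
    define G where "G = cfc g (D' o\<^sub>L D)"
    have G: "adj_pair G G"
    proof -
      have "(\<lambda>x. cnj (g x)) = g" by (simp add: g_def fun_eq_iff)
      then show ?thesis using S.adj_pair_cfc[OF gc] by (simp add: G_def)
    qed
    define V where "V = D o\<^sub>L G"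
    have V: "adj_pair V (G o\<^sub>L D')" unfolding V_def by (rule adj_pair_compose[OF adj G])
    have idS: "cfc complex_of_real (D' o\<^sub>L D) = D' o\<^sub>L D"
    proof -
      have "poly_op [:0, 1:] (D' o\<^sub>L D) = D' o\<^sub>L D"
        by (rule blinfun_eqI) (simp add: poly_op_pCons_apply)
      then show ?thesis using S.cfc_poly[of "[:0, 1:]"] by simp
    qed
    have cr: "continuous_on {0..M} complex_of_real" by (intro continuous_intros)
    have GS: "cfc (\<lambda>x. g x * complex_of_real x) (D' o\<^sub>L D) = G o\<^sub>L (D' o\<^sub>L D)"
      using S.cfc_mult[OF gc cr] by (simp add: idS G_def)
    have GSG: "cfc (\<lambda>x. g x * complex_of_real x * g x) (D' o\<^sub>L D) = G o\<^sub>L (D' o\<^sub>L D) o\<^sub>L G"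
      using S.cfc_mult[OF continuous_on_mult[OF gc cr] gc] by (simp add: GS flip: G_def)
    have "norm (G o\<^sub>L (D' o\<^sub>L D) o\<^sub>L G) \<le> 1"
      unfolding GSG[symmetric]
    proof (rule S.norm_cfc_le)
      show "continuous_on {0..M} (\<lambda>x. g x * complex_of_real x * g x)"
        by (intro continuous_intros gc)
      fix x assume x: "x \<in> {0..M}"
      have "g x * complex_of_real x * g x = complex_of_real (x / (x + \<epsilon>))"
        using x \<epsilon> by (simp add: g_def flip: of_real_mult) 
      then show "cmod (g x * complex_of_real x * g x) \<le> 1"
        using x \<epsilon> by (simp add: norm_divide del: of_real_divide of_real_add)
    qed
    then have nV: "norm V \<le> 1"
    proof (intro norm_blinfun_bound)
      fix x
      assume le: "norm (G o\<^sub>L (D' o\<^sub>L D) o\<^sub>L G) \<le> 1"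
      have "(norm (blinfun_apply V x))\<^sup>2 = cmod (cinner (blinfun_apply V x) (blinfun_apply V x))"
        unfolding cinner_self norm_of_real by simp
      also have "\<dots> = cmod (cinner x (blinfun_apply (G o\<^sub>L (D' o\<^sub>L D) o\<^sub>L G) x))"
        by (simp add: adj_pairD[OF V]) (simp add: V_def)
      also have "\<dots> \<le> norm x * norm (blinfun_apply (G o\<^sub>L (D' o\<^sub>L D) o\<^sub>L G) x)"
        by (rule cmod_cinner_le)
      also have "\<dots> \<le> norm x * (1 * norm x)"
        by (intro mult_left_mono order_trans[OF norm_blinfun] mult_right_mono le) auto
      finally show "norm (blinfun_apply V x) \<le> 1 * norm x"
        by (simp add: power2_eq_square[symmetric] power_mono_iff)
    qed simp
    have "norm (B - (G o\<^sub>L (D' o\<^sub>L D))) \<le> sqrt \<epsilon>"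
      unfolding B GS[symmetric]
    proof (subst S.cfc_diff[symmetric])
      show c1: "continuous_on {0..M} (\<lambda>x. complex_of_real (sqrt x))" by (intro continuous_intros)
      show c2: "continuous_on {0..M} (\<lambda>x. g x * complex_of_real x)" by (intro continuous_intros gc)
      show "norm (cfc (\<lambda>x. complex_of_real (sqrt x) - g x * complex_of_real x) (D' o\<^sub>L D)) \<le> sqrt \<epsilon>"
      proof (rule S.norm_cfc_le)
        show "continuous_on {0..M} (\<lambda>x. complex_of_real (sqrt x) - g x * complex_of_real x)"
          by (intro continuous_intros gc)
        fix x assume "x \<in> {0..M}"
        then have x: "x \<ge> 0" by simp
        have s: "sqrt (x + \<epsilon>) > 0" using x \<epsilon> by simp
        have "sqrt x - x / sqrt (x + \<epsilon>) = sqrt x / sqrt (x + \<epsilon>) * (sqrt (x + \<epsilon>) - sqrt x)"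
          using s x by (simp add: right_diff_distrib)
        also have "\<bar>\<dots>\<bar> \<le> 1 * (sqrt (x + \<epsilon>) - sqrt x)"
          unfolding abs_mult using s x \<epsilon> by (intro mult_mono) auto
        also have "\<dots> \<le> sqrt \<epsilon>" using sqrt_add_le_add_sqrt[of x \<epsilon>] x \<epsilon> by simp
        finally have "\<bar>sqrt x - x / sqrt (x + \<epsilon>)\<bar> \<le> sqrt \<epsilon>" .
        moreover have "complex_of_real (sqrt x) - g x * complex_of_real x
            = complex_of_real (sqrt x - x / sqrt (x + \<epsilon>))" by (simp add: g_def)
        ultimately show "cmod (complex_of_real (sqrt x) - g x * complex_of_real x) \<le> sqrt \<epsilon>"
          by (simp only: norm_of_real)
      qed
    qed
    then have nB: "norm (B - (G o\<^sub>L (D' o\<^sub>L D))) \<le> r / (card F + 1)"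
      using \<open>r > 0\<close> by (simp add: \<epsilon>_def)
    have "cmod (cinner (blinfun_apply B e) e) \<le> r / (card F + 1) + cmod (cinner (blinfun_apply D e) (blinfun_apply V e))"
      if e: "e \<in> F" for e
    proof -
      have e1: "norm e = 1"
        using F e orthonormal_basis_orthonormal[OF E] norm_orthonormal by blast
      have "cinner (blinfun_apply B e) e = cinner (blinfun_apply (B - (G o\<^sub>L (D' o\<^sub>L D))) e) e
          + cinner (blinfun_apply D e) (blinfun_apply V e)"
        by (simp add: blinfun.diff_left cinner.diff_left adj_pairD[OF adj_pair_sym[OF V], symmetric])
      also have "cmod \<dots> \<le> cmod (cinner (blinfun_apply (B - (G o\<^sub>L (D' o\<^sub>L D))) e) e)
          + cmod (cinner (blinfun_apply D e) (blinfun_apply V e))" by (rule norm_triangle_ineq)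
      also have "cmod (cinner (blinfun_apply (B - (G o\<^sub>L (D' o\<^sub>L D))) e) e) \<le> r / (card F + 1)"
        using cmod_cinner_le[of "blinfun_apply (B - (G o\<^sub>L (D' o\<^sub>L D))) e" e]
          norm_blinfun[of "B - (G o\<^sub>L (D' o\<^sub>L D))" e] nB e1 by simp
      finally show ?thesis by simp
    qed
    then have "(\<Sum>e\<in>F. cmod (cinner (blinfun_apply B e) e))
        \<le> (\<Sum>e\<in>F. r / (card F + 1) + cmod (cinner (blinfun_apply D e) (blinfun_apply V e)))"
      by (rule sum_mono)
    also have "\<dots> = card F * (r / (card F + 1)) + (\<Sum>e\<in>F. cmod (cinner (blinfun_apply D e) (blinfun_apply V e)))"
      by (simp add: sum.distrib)
    also have "(\<Sum>e\<in>F. cmod (cinner (blinfun_apply D e) (blinfun_apply V e))) \<le> C * norm (id_blinfun :: 'a \<Rightarrow>\<^sub>L 'a) * norm V"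
      using trace_norm_leD[OF tc F(1) orthonormal_subset[OF orthonormal_basis_orthonormal[OF E] F(2)] adj_pair_id V] by simp
    also have "\<dots> \<le> C * 1 * 1"
      using trace_norm_le_nonneg[OF tc] nV by (intro mult_mono norm_blinfun_id_le) auto
    also have "card F * (r / (card F + 1)) \<le> r" using \<open>r > 0\<close> by (simp add: field_simps)
    finally show "(\<Sum>e\<in>F. cmod (cinner (blinfun_apply B e) e)) \<le> C + r" by simp
  qed
  have "(\<lambda>e. cmod (cinner (blinfun_apply B e) e)) summable_on E"
    by (rule nonneg_bdd_above_summable_on) (use bound in \<open>auto intro!: bdd_aboveI2[of _ _ C]\<close>)
  then have "(\<lambda>e. cinner (blinfun_apply B e) e) summable_on E" by (rule abs_summable_summable)
  then show ?thesis unfolding trace_class_def B_def using E by blast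
qed

section \<open>Integration over the circle\<close>

lemma circle_measure_density:
  "circle_measure = density lebesgue (\<lambda>t. ennreal (indicator {0..2*pi} t / (2*pi)))"
proof -
  have "emeasure lebesgue {0..2*pi} = ennreal (2*pi)" by simp
  then show ?thesis
    unfolding circle_measure_def uniform_measure_def
    by (intro arg_cong[where f = "density lebesgue"] ext) (auto simp: indicator_def simp flip: divide_ennreal)
qed

lemma borel_measurable_circle_measure:
  "borel_measurable circle_measure = borel_measurable lebesgue"
  by (rule measurable_cong_sets) auto

lemma measurable_indicator_div: "(\<lambda>t. indicator {0..2*pi} t / (2*pi) :: real) \<in> borel_measurable lebesgue"
  by (intro borel_measurable_divide borel_measurable_indicator) auto

lemma integral_circle_measure:
  fixes g :: "real \<Rightarrow> complex"
  assumes "g \<in> borel_measurable lebesgue"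
  shows "(LINT t|circle_measure. g t) = (1 / (2*pi)) * (LINT t:{0..2*pi}|lebesgue. g t)"
proof -
  have "(LINT t|circle_measure. g t) = (LINT t|lebesgue. (indicator {0..2*pi} t / (2*pi)) *\<^sub>R g t)"
    unfolding circle_measure_density by (rule integral_density[OF assms measurable_indicator_div]) auto
  also have "\<dots> = (LINT t|lebesgue. (1 / (2*pi)) *\<^sub>R (indicator {0..2*pi} t *\<^sub>R g t))" by simp
  also have "\<dots> = (1 / (2*pi)) *\<^sub>R (LINT t:{0..2*pi}|lebesgue. g t)"
    unfolding set_lebesgue_integral_def by (rule integral_scaleR_right)
  finally show ?thesis by (simp add: scaleR_conv_of_real)
qed

lemma integrable_circle_measure:
  fixes g :: "real \<Rightarrow> 'b::{banach, second_countable_topology}"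
  assumes "g \<in> borel_measurable lebesgue"
  shows "integrable circle_measure g \<longleftrightarrow> set_integrable lebesgue {0..2*pi} g"
proof -
  have "integrable circle_measure g \<longleftrightarrow> integrable lebesgue (\<lambda>t. (indicator {0..2*pi} t / (2*pi)) *\<^sub>R g t)"
    unfolding circle_measure_density by (rule integrable_density[OF assms measurable_indicator_div]) auto
  also have "\<dots> \<longleftrightarrow> integrable lebesgue (\<lambda>t. (1 / (2*pi)) *\<^sub>R (indicator {0..2*pi} t *\<^sub>R g t))" by simp
  also have "\<dots> \<longleftrightarrow> set_integrable lebesgue {0..2*pi} g"
  proof
    assume "integrable lebesgue (\<lambda>t. (1 / (2*pi)) *\<^sub>R (indicator {0..2*pi} t *\<^sub>R g t))"
    then have "integrable lebesgue (\<lambda>t. (2*pi) *\<^sub>R ((1 / (2*pi)) *\<^sub>R (indicator {0..2*pi} t *\<^sub>R g t)))"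
      by (rule integrable_scaleR_right)
    moreover have "(2*pi) *\<^sub>R ((1 / (2*pi)) *\<^sub>R (indicator {0..2*pi} t *\<^sub>R g t))
        = indicator {0..2*pi} t *\<^sub>R g t" for t by simp
    ultimately show "set_integrable lebesgue {0..2*pi} g" by (simp only: set_integrable_def)
  next
    assume "set_integrable lebesgue {0..2*pi} g"
    then show "integrable lebesgue (\<lambda>t. (1 / (2*pi)) *\<^sub>R (indicator {0..2*pi} t *\<^sub>R g t))"
      unfolding set_integrable_def by (rule integrable_scaleR_right)
  qed
  finally show ?thesis .
qed

lemma AE_circle_measure:
  "(AE t in circle_measure. P t) \<longleftrightarrow> (AE t in lebesgue. t \<in> {0..2*pi} \<longrightarrow> P t)"
  unfolding circle_measure_density
  by (subst AE_density) (use measurable_indicator_div in \<open>auto simp: indicator_def split: if_splits\<close>)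

lemma prob_space_circle_measure: "prob_space circle_measure"
  unfolding circle_measure_def by (rule prob_space_uniform_measure) auto

interpretation circle: prob_space circle_measure
  by (rule prob_space_circle_measure)

lemma AE_circle_interior: "AE t in circle_measure. 0 < t \<and> t < 2*pi"
proof -
  have "{0, 2*pi} \<in> null_sets lebesgue" by (simp add: null_sets_completionI finite_imp_null_set_lborel)
  then have "AE t in lebesgue. t \<notin> {0, 2*pi}" by (rule AE_not_in)
  then show ?thesis unfolding AE_circle_measure by eventually_elim auto
qed

lemma integrable_circle_bounded:
  fixes g :: "real \<Rightarrow> complex"
  assumes "g \<in> borel_measurable lebesgue" "\<And>t. t \<in> {0..2*pi} \<Longrightarrow> cmod (g t) \<le> B"
  shows "integrable circle_measure g"
  by (rule circle.integrable_const_bound[of _ B])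
    (use assms in \<open>auto simp: AE_circle_measure borel_measurable_circle_measure\<close>)

section \<open>Square-integrable functions\<close>

lemma rep_L2T_square_integrable: "square_integrable (rep_L2T x)"
  using Quotient3_rep_reflp[OF Quotient3_L2T, of x] by simp

lemma abs_rep_L2T: "abs_L2T (rep_L2T x) = x"
  by (rule Quotient3_abs_rep[OF Quotient3_L2T])

lemma rep_abs_L2T: "square_integrable f \<Longrightarrow> AE t in circle_measure. rep_L2T (abs_L2T f) t = f t"
  using Quotient3_rep_abs[OF Quotient3_L2T, of f] by simp

lemma abs_L2T_eqI:
  "square_integrable f \<Longrightarrow> square_integrable g \<Longrightarrow> AE t in circle_measure. f t = g t \<Longrightarrow> abs_L2T f = abs_L2T g"
  using Quotient3_rel[OF Quotient3_L2T, of f g] by simp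

lemma abs_L2T_add:
  "square_integrable f \<Longrightarrow> square_integrable g \<Longrightarrow> abs_L2T f + abs_L2T g = abs_L2T (\<lambda>t. f t + g t)"
  by (simp add: plus_L2T.abs_eq)

lemma abs_L2T_scaleC: "square_integrable f \<Longrightarrow> c *\<^sub>C abs_L2T f = abs_L2T (\<lambda>t. c * f t)"
  by (simp add: scaleC_L2T.abs_eq)

lemma abs_L2T_diff:
  "square_integrable f \<Longrightarrow> square_integrable g \<Longrightarrow> abs_L2T f - abs_L2T g = abs_L2T (\<lambda>t. f t - g t)"
  unfolding minus_L2T_def uminus_L2T_def
  by (simp add: abs_L2T_add abs_L2T_scaleC square_integrable_scale[of _ "-1", simplified])

lemma cinner_abs_L2T:
  "square_integrable f \<Longrightarrow> square_integrable g \<Longrightarrow>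
    cinner (abs_L2T f) (abs_L2T g) = (LINT t|circle_measure. f t * cnj (g t))"
  by (simp add: cinner_L2T.abs_eq)

lemma fourier_abs_L2T: "square_integrable f \<Longrightarrow> fourier_L2T (abs_L2T f) n = fourier_coeff f n"
  by (simp add: fourier_L2T.abs_eq)

lemma norm_abs_L2T:
  assumes f: "square_integrable f"
  shows "(norm (abs_L2T f))\<^sup>2 = (LINT t|circle_measure. (cmod (f t))\<^sup>2)"
proof -
  have "complex_of_real ((norm (abs_L2T f))\<^sup>2) = (LINT t|circle_measure. complex_of_real ((cmod (f t))\<^sup>2))"
    unfolding cinner_self[symmetric] cinner_abs_L2T[OF f f] complex_norm_square ..
  also have "\<dots> = complex_of_real (LINT t|circle_measure. (cmod (f t))\<^sup>2)"
    by (rule integral_complex_of_real)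
  finally show ?thesis unfolding of_real_eq_iff .
qed

lemma square_integrable_diff:
  "square_integrable f \<Longrightarrow> square_integrable g \<Longrightarrow> square_integrable (\<lambda>t. f t - g t)"
  using square_integrable_add[of f "\<lambda>t. (-1) * g t"] square_integrable_scale[of g "-1"] by simp

lemma square_integrable_bounded:
  assumes "g \<in> borel_measurable lebesgue" "\<And>t. t \<in> {0..2*pi} \<Longrightarrow> cmod (g t) \<le> B"
  shows "square_integrable g"
proof -
  have [measurable]: "g \<in> borel_measurable circle_measure"
    using assms(1) by (simp add: borel_measurable_circle_measure)
  have "integrable circle_measure (\<lambda>t. (cmod (g t))\<^sup>2)"
  proof (rule circle.integrable_const_bound[of _ "B\<^sup>2"])
    show "AE t in circle_measure. norm ((cmod (g t))\<^sup>2) \<le> B\<^sup>2"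
      unfolding AE_circle_measure using assms(2) by (auto intro!: power_mono)
  qed measurable
  then show ?thesis using assms(1) by (simp add: square_integrable_def borel_measurable_circle_measure)
qed

text \<open>
  The Cauchy--Schwarz inequality on a probability space, in the form \<open>2 \<bar>f\<bar> \<le> \<bar>f\<bar>\<^sup>2 / c + c\<close>.
\<close>

lemma integral_norm_le_L2:
  assumes f: "square_integrable f" and c: "c > 0" "norm (abs_L2T f) \<le> c"
  shows "integrable circle_measure (\<lambda>t. cmod (f t))" "(LINT t|circle_measure. cmod (f t)) \<le> c"
proof -
  note [measurable] = square_integrable_measurable[OF f]
  have i2: "integrable circle_measure (\<lambda>t. (cmod (f t))\<^sup>2)" using f by (simp add: square_integrable_def)
  have le: "cmod (f t) \<le> ((cmod (f t))\<^sup>2 / c + c) / 2" for t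
  proof -
    have "2 * cmod (f t) * c \<le> (cmod (f t))\<^sup>2 + c\<^sup>2" using sum_squares_bound[of "cmod (f t)" c] by simp
    then show ?thesis using c(1) by (simp add: field_simps power2_eq_square)
  qed
  have int: "integrable circle_measure (\<lambda>t. ((cmod (f t))\<^sup>2 / c + c) / 2)"
    using i2 by (intro integrable_divide integrable_add) auto
  show i: "integrable circle_measure (\<lambda>t. cmod (f t))"
    by (rule Bochner_Integration.integrable_bound[OF int]) (use le c in \<open>auto intro: order_trans[OF _ abs_ge_self]\<close>)
  have "(LINT t|circle_measure. cmod (f t)) \<le> (LINT t|circle_measure. ((cmod (f t))\<^sup>2 / c + c) / 2)"
    by (rule integral_mono[OF i int le])
  also have "\<dots> = ((norm (abs_L2T f))\<^sup>2 / c + c) / 2"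
    using i2 circle.prob_space by (simp add: norm_abs_L2T[OF f])
  also have "\<dots> \<le> (c\<^sup>2 / c + c) / 2"
    using c by (intro divide_right_mono add_right_mono power_mono) auto
  also have "\<dots> = c" using c(1) by (simp add: power2_eq_square)
  finally show "(LINT t|circle_measure. cmod (f t)) \<le> c" .
qed

section \<open>Completeness\<close>

text \<open>
  The Riesz--Fischer argument: a rapidly Cauchy subsequence converges almost everywhere, and Fatou's lemma
  shows that its pointwise limit is also the limit in norm.
\<close>

lemma L2T_Cauchy_convergent:
  fixes X :: "nat \<Rightarrow> L2T"
  assumes X: "Cauchy X"
  shows "convergent X"
proof -
  have "\<exists>N. \<forall>m\<ge>N. \<forall>n\<ge>N. dist (X m) (X n) < (1/2) ^ k" for k :: nat
    using X by (auto simp: Cauchy_def)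
  then obtain N where N: "\<And>k m n. m \<ge> N k \<Longrightarrow> n \<ge> N k \<Longrightarrow> dist (X m) (X n) < (1/2) ^ k" by metis
  \<comment> \<open>strictly increasing and above all of \<open>N 0, ..., N k\<close>\<close>
  define r where "r k = k + (\<Sum>j\<le>k. N j)" for k
  have sr: "strict_mono r" unfolding strict_mono_Suc_iff by (simp add: r_def)
  have rN: "r m \<ge> N k" if "m \<ge> k" for m k
  proof -
    have "N k \<le> (\<Sum>j\<le>m. N j)" using that by (intro member_le_sum) auto
    then show ?thesis by (simp add: r_def)
  qed
  define f where "f k = rep_L2T (X (r k))" for k
  have fs: "square_integrable (f k)" for k by (simp add: f_def rep_L2T_square_integrable)
  note [measurable] = square_integrable_measurable[OF fs]
  have fX: "abs_L2T (f k) = X (r k)" for k by (simp add: f_def abs_rep_L2T)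
  have nd: "norm (abs_L2T (\<lambda>t. f m t - f k t)) < (1/2) ^ k" if "m \<ge> k" for m k
    using N[OF rN[OF that] rN[OF order_refl[of k]]]
    by (simp add: abs_L2T_diff[OF fs fs, symmetric] fX dist_norm)
  have "(\<integral>\<^sup>+t. (\<Sum>k. ennreal (cmod (f (Suc k) t - f k t))) \<partial>circle_measure)
      = (\<Sum>k. \<integral>\<^sup>+t. ennreal (cmod (f (Suc k) t - f k t)) \<partial>circle_measure)"
    by (rule nn_integral_suminf) measurable
  also have "\<dots> \<le> (\<Sum>k. ennreal ((1/2) ^ k))"
  proof (intro suminf_le summableI)
    fix k
    have d: "square_integrable (\<lambda>t. f (Suc k) t - f k t)" by (intro square_integrable_diff fs)
    have c: "norm (abs_L2T (\<lambda>t. f (Suc k) t - f k t)) \<le> (1/2) ^ k" using nd[of k "Suc k"] by simp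
    have "(\<integral>\<^sup>+t. ennreal (cmod (f (Suc k) t - f k t)) \<partial>circle_measure)
        = ennreal (LINT t|circle_measure. cmod (f (Suc k) t - f k t))"
      by (rule nn_integral_eq_integral[OF integral_norm_le_L2(1)[OF d _ c]]) auto
    also have "\<dots> \<le> ennreal ((1/2) ^ k)" by (rule ennreal_leI[OF integral_norm_le_L2(2)[OF d _ c]]) simp
    finally show "(\<integral>\<^sup>+t. ennreal (cmod (f (Suc k) t - f k t)) \<partial>circle_measure) \<le> ennreal ((1/2) ^ k)" .
  qed
  also have "\<dots> < \<infinity>"
    by (subst suminf_ennreal2) (auto intro: summable_geometric)
  finally have "AE t in circle_measure. (\<Sum>k. ennreal (cmod (f (Suc k) t - f k t))) \<noteq> \<infinity>"
    by (intro nn_integral_PInf_AE) (auto simp: less_top)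
  then have conv: "AE t in circle_measure. convergent (\<lambda>k. f k t)"
  proof eventually_elim
    case (elim t)
    then have "summable (\<lambda>k. cmod (f (Suc k) t - f k t))"
      by (intro summable_suminf_not_top) auto
    then have "summable (\<lambda>k. f (Suc k) t - f k t)" by (rule summable_norm_cancel)
    then have "convergent (\<lambda>n. \<Sum>k<n. f (Suc k) t - f k t)" by (simp add: summable_iff_convergent)
    then have "convergent (\<lambda>n. f n t - f 0 t)" using sum_lessThan_telescope[of "\<lambda>k. f k t"] by simp
    then have "convergent (\<lambda>n. (f n t - f 0 t) + f 0 t)" by (intro convergent_add convergent_const)
    then show ?case by simp
  qed
  define g where "g t = lim (\<lambda>k. f k t)" for t
  have gm [measurable]: "g \<in> borel_measurable circle_measure"
    unfolding g_def by (rule borel_measurable_lim_metric) measurable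
  have lim: "AE t in circle_measure. (\<lambda>k. f k t) \<longlonglongrightarrow> g t"
    using conv by eventually_elim (simp add: g_def convergent_LIMSEQ_iff)
  have bound: "(\<integral>\<^sup>+t. ennreal ((cmod (g t - f n t))\<^sup>2) \<partial>circle_measure) \<le> ennreal (((1/2) ^ n)\<^sup>2)" for n
  proof -
    have "(\<integral>\<^sup>+t. ennreal ((cmod (g t - f n t))\<^sup>2) \<partial>circle_measure)
        = (\<integral>\<^sup>+t. liminf (\<lambda>k. ennreal ((cmod (f k t - f n t))\<^sup>2)) \<partial>circle_measure)"
    proof (rule nn_integral_cong_AE)
      show "AE t in circle_measure. ennreal ((cmod (g t - f n t))\<^sup>2) = liminf (\<lambda>k. ennreal ((cmod (f k t - f n t))\<^sup>2))"
        using lim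
      proof eventually_elim
        case (elim t)
        have "(\<lambda>k. ennreal ((cmod (f k t - f n t))\<^sup>2)) \<longlonglongrightarrow> ennreal ((cmod (g t - f n t))\<^sup>2)"
          by (intro tendsto_ennrealI tendsto_intros elim)
        then show ?case by (metis lim_imp_Liminf sequentially_bot)
      qed
    qed
    also have "\<dots> \<le> liminf (\<lambda>k. \<integral>\<^sup>+t. ennreal ((cmod (f k t - f n t))\<^sup>2) \<partial>circle_measure)"
      by (rule nn_integral_liminf) measurable
    also have "\<dots> \<le> liminf (\<lambda>k::nat. ennreal (((1/2) ^ n)\<^sup>2))"
    proof (rule Liminf_mono)
      show "\<forall>\<^sub>F k in sequentially. (\<integral>\<^sup>+t. ennreal ((cmod (f k t - f n t))\<^sup>2) \<partial>circle_measure) \<le> ennreal (((1/2) ^ n)\<^sup>2)"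
        using eventually_ge_at_top[of n]
      proof eventually_elim
        case (elim k)
        have d: "square_integrable (\<lambda>t. f k t - f n t)" by (intro square_integrable_diff fs)
        have "(\<integral>\<^sup>+t. ennreal ((cmod (f k t - f n t))\<^sup>2) \<partial>circle_measure)
            = ennreal ((norm (abs_L2T (\<lambda>t. f k t - f n t)))\<^sup>2)"
          unfolding norm_abs_L2T[OF d]
          by (rule nn_integral_eq_integral) (use d in \<open>auto simp: square_integrable_def\<close>)
        also have "\<dots> \<le> ennreal (((1/2) ^ n)\<^sup>2)"
          using nd[OF elim] by (intro ennreal_leI power_mono) auto
        finally show ?case .
      qed
    qed
    also have "\<dots> = ennreal (((1/2) ^ n)\<^sup>2)" by (simp add: Liminf_const)
    finally show ?thesis .
  qed
  have gfs: "square_integrable (\<lambda>t. g t - f n t)" for n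
  proof -
    have "integrable circle_measure (\<lambda>t. (cmod (g t - f n t))\<^sup>2)"
      unfolding integrable_iff_bounded using bound[of n] by (auto intro: le_less_trans)
    then show ?thesis using gm square_integrable_measurable[OF fs[of n]] by (simp add: square_integrable_def)
  qed
  have gs: "square_integrable g" using square_integrable_add[OF gfs[of 0] fs[of 0]] by simp
  have nb: "norm (abs_L2T g - X (r n)) \<le> (1/2) ^ n" for n
  proof -
    have "ennreal ((norm (abs_L2T (\<lambda>t. g t - f n t)))\<^sup>2) \<le> ennreal (((1/2) ^ n)\<^sup>2)"
      using bound[of n] unfolding norm_abs_L2T[OF gfs]
      by (subst (asm) nn_integral_eq_integral) (use gfs[of n] in \<open>auto simp: square_integrable_def\<close>)
    then have "(norm (abs_L2T (\<lambda>t. g t - f n t)))\<^sup>2 \<le> ((1/2) ^ n)\<^sup>2" by (subst (asm) ennreal_le_iff) auto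
    then have "norm (abs_L2T (\<lambda>t. g t - f n t)) \<le> (1/2) ^ n" by (rule power2_le_imp_le) simp
    then show ?thesis by (simp add: abs_L2T_diff[OF gs fs, symmetric] fX)
  qed
  have "(\<lambda>n. X (r n) - abs_L2T g) \<longlonglongrightarrow> 0"
    by (rule Lim_null_comparison[OF always_eventually LIMSEQ_power_zero[of "1/2 :: real"]])
      (use nb in \<open>auto simp: norm_minus_commute\<close>)
  then have "(X \<circ> r) \<longlonglongrightarrow> abs_L2T g" by (simp add: o_def LIM_zero_iff)
  then have "X \<longlonglongrightarrow> abs_L2T g" by (rule Cauchy_converges_subseq[OF X sr])
  then show ?thesis by (auto simp: convergent_def)
qed

instance L2T :: banach
  by standard (rule L2T_Cauchy_convergent)

section \<open>Trigonometric polynomials\<close>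

definition chr :: "int \<Rightarrow> real \<Rightarrow> complex" where
  "chr n t = exp (\<i> * of_int n * of_real t)"

lemma norm_chr [simp]: "cmod (chr n t) = 1"
  by (simp add: chr_def norm_exp_eq_Re)

lemma chr_0 [simp]: "chr 0 t = 1"
  by (simp add: chr_def)

lemma chr_add: "chr (m + n) t = chr m t * chr n t"
  by (simp add: chr_def algebra_simps flip: exp_add)

lemma cnj_chr: "cnj (chr n t) = chr (- n) t"
  by (simp add: chr_def exp_cnj)

lemma continuous_chr: "continuous_on S (chr n)"
  unfolding chr_def by (intro continuous_intros)

lemma measurable_chr [measurable]: "chr n \<in> borel_measurable lebesgue"
  by (intro measurable_completion) (auto intro: borel_measurable_continuous_onI continuous_chr)

lemma square_integrable_chr: "square_integrable (chr n)"
  using square_integrable_character by (simp add: chr_def[abs_def])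

lemma fourier_coeff_chr: "fourier_coeff f n = (LINT t|circle_measure. f t * chr (- n) t)"
  by (simp add: fourier_coeff_def chr_def)

inductive trig_poly :: "(real \<Rightarrow> complex) \<Rightarrow> bool" where
  chr: "trig_poly (chr n)"
| add: "trig_poly u \<Longrightarrow> trig_poly v \<Longrightarrow> trig_poly (\<lambda>t. u t + v t)"
| cmult: "trig_poly u \<Longrightarrow> trig_poly (\<lambda>t. c * u t)"

lemma trig_poly_mult:
  assumes "trig_poly u" "trig_poly v"
  shows "trig_poly (\<lambda>t. u t * v t)"
  using assms(1)
proof induction
  case (chr n)
  show ?case using assms(2)
  proof induction
    case (chr m)
    show ?case using trig_poly.chr[of "n + m"] by (simp add: chr_add[abs_def])
  next
    case (add u v)
    then show ?case using trig_poly.add by (fastforce simp: distrib_left)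
  next
    case (cmult u c)
    then show ?case using trig_poly.cmult[of "\<lambda>t. chr n t * u t" c] by (simp add: mult_ac)
  qed
next
  case (add u w)
  then show ?case using trig_poly.add by (fastforce simp: distrib_right)
next
  case (cmult u c)
  then show ?case using trig_poly.cmult[of "\<lambda>t. u t * v t" c] by (simp add: mult_ac)
qed

lemma trig_poly_const: "trig_poly (\<lambda>t. c)"
  using trig_poly.cmult[OF trig_poly.chr[of 0], of c] by simp

lemma trig_poly_real_polynomial:
  assumes "real_polynomial_function p"
  shows "trig_poly (\<lambda>t. complex_of_real (p (cis t)))"
  using assms
proof induction
  case (linear p)
  then interpret bounded_linear p .
  have "p (cis t) = cos t * p 1 + sin t * p \<i>" for t
  proof -
    have "cis t = cos t *\<^sub>R 1 + sin t *\<^sub>R \<i>" by (simp add: complex_eq_iff)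
    then show ?thesis by (metis add scale real_scaleR_def)
  qed
  then have "complex_of_real (p (cis t))
      = ((complex_of_real (p 1) - \<i> * complex_of_real (p \<i>)) / 2) * chr 1 t
        + ((complex_of_real (p 1) + \<i> * complex_of_real (p \<i>)) / 2) * chr (- 1) t" for t
    by (simp add: chr_def complex_eq_iff exp_eq_polar Re_exp Im_exp field_simps)
  then show ?case
    by (simp only:) (intro trig_poly.intros)
next
  case (const c)
  then show ?case by (rule trig_poly_const)
next
  case (add f g)
  then show ?case using trig_poly.add by fastforce
next
  case (mult f g)
  then show ?case using trig_poly_mult by fastforce
qed

text \<open>
  A continuous periodic function is a continuous function on the unit circle, where real polynomials in two
  variables are dense by the Stone--Weierstrass theorem; restricted to the circle they are trigonometric.
\<close>

lemma trig_poly_approx_real: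
  fixes h :: "real \<Rightarrow> real"
  assumes h: "continuous_on {0..2*pi} h" and per: "h 0 = h (2*pi)" and e: "e > 0"
  shows "\<exists>u. trig_poly u \<and> (\<forall>t\<in>{0..2*pi}. cmod (complex_of_real (h t) - u t) < e)"
proof -
  define H where "H z = h (Arg2pi z)" for z
  have Hcis: "H (cis t) = h t" if "t \<in> {0..2*pi}" for t
  proof (cases "t = 2*pi")
    case True
    then show ?thesis using per by (simp add: H_def cis_2pi Arg2pi_of_real[of 1, simplified])
  next
    case False
    then have "Arg2pi (cis t) = t" using that by (intro Arg2pi_unique[of 1]) (auto simp: cis_conv_exp)
    then show ?thesis by (simp add: H_def)
  qed
  have img: "sphere 0 1 = cis ` {0..2*pi}"
  proof -
    have "z = cis (Arg2pi z)" if "cmod z = 1" for z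
      using that complex_norm_eq_1_exp[of z] by (simp add: cis_conv_exp)
    moreover have "Arg2pi z \<in> {0..2*pi}" for z using Arg2pi[of z] by simp
    ultimately show ?thesis by (force simp: dist_norm)
  qed
  have "continuous_on (sphere 0 1) H"
    unfolding continuous_on_closed_vimage[OF closed_sphere]
  proof (intro allI impI)
    fix B :: "real set" assume B: "closed B"
    have "H -` B \<inter> sphere 0 1 = cis ` ({0..2*pi} \<inter> h -` B)"
      unfolding img using Hcis by (auto simp: image_iff)
    moreover have "compact ({0..2*pi} \<inter> h -` B)"
      using continuous_closed_preimage[OF h closed_atLeastAtMost B]
      by (simp add: compact_eq_bounded_closed bounded_Int)
    ultimately show "closed (H -` B \<inter> sphere 0 1)"
      by (simp add: compact_imp_closed compact_continuous_image continuous_on_cis)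
  qed
  then obtain p where p: "real_polynomial_function p" "\<And>z. z \<in> sphere 0 1 \<Longrightarrow> \<bar>H z - p z\<bar> < e"
    using Stone_Weierstrass_real_polynomial_function[OF compact_sphere _ e] by blast
  have "cmod (complex_of_real (h t) - complex_of_real (p (cis t))) < e" if "t \<in> {0..2*pi}" for t
    using p(2)[of "cis t"] Hcis[OF that] by (simp flip: of_real_diff)
  then show ?thesis using trig_poly_real_polynomial[OF p(1)] by blast
qed

lemma trig_poly_approx:
  fixes h :: "real \<Rightarrow> complex"
  assumes h: "continuous_on {0..2*pi} h" and per: "h 0 = h (2*pi)" and e: "e > 0"
  shows "\<exists>u. trig_poly u \<and> (\<forall>t\<in>{0..2*pi}. cmod (h t - u t) < e)"
proof -
  obtain u where u: "trig_poly u" "\<And>t. t \<in> {0..2*pi} \<Longrightarrow> cmod (complex_of_real (Re (h t)) - u t) < e / 2"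
    using trig_poly_approx_real[of "\<lambda>t. Re (h t)" "e / 2"] assms continuous_on_Re[OF h] by auto
  obtain v where v: "trig_poly v" "\<And>t. t \<in> {0..2*pi} \<Longrightarrow> cmod (complex_of_real (Im (h t)) - v t) < e / 2"
    using trig_poly_approx_real[of "\<lambda>t. Im (h t)" "e / 2"] assms continuous_on_Im[OF h] by auto
  have "cmod (h t - (u t + \<i> * v t)) < e" if t: "t \<in> {0..2*pi}" for t
  proof -
    have "h t - (u t + \<i> * v t) = (complex_of_real (Re (h t)) - u t) + \<i> * (complex_of_real (Im (h t)) - v t)"
      by (subst complex_eq[of "h t"]) (simp add: algebra_simps)
    also have "cmod \<dots> \<le> cmod (complex_of_real (Re (h t)) - u t) + cmod (complex_of_real (Im (h t)) - v t)"
      by (rule norm_triangle_le) (simp add: norm_mult)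
    also have "\<dots> < e" using u(2)[OF t] v(2)[OF t] by simp
    finally show ?thesis .
  qed
  moreover have "trig_poly (\<lambda>t. u t + \<i> * v t)" by (intro trig_poly.intros u v)
  ultimately show ?thesis by blast
qed

lemma trig_poly_bounded_measurable:
  assumes "trig_poly u"
  shows "u \<in> borel_measurable lebesgue \<and> (\<exists>B. \<forall>t. cmod (u t) \<le> B)"
  using assms
proof induction
  case (add u v)
  then obtain B C where "\<forall>t. cmod (u t) \<le> B" "\<forall>t. cmod (v t) \<le> C" by blast
  then have "\<forall>t. cmod (u t + v t) \<le> B + C" by (meson add_mono norm_triangle_le)
  then show ?case using add by (auto intro: borel_measurable_add)
next
  case (cmult u c)
  then obtain B where "\<forall>t. cmod (u t) \<le> B" by blast
  then have "\<forall>t. cmod (c * u t) \<le> cmod c * B" by (simp add: norm_mult mult_left_mono)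
  then show ?case using cmult by (auto intro: borel_measurable_times)
qed (auto intro!: exI[of _ 1])

lemma integrable_circle_mult_bounded:
  fixes f u :: "real \<Rightarrow> complex"
  assumes f: "integrable circle_measure f" and u: "u \<in> borel_measurable lebesgue" "\<And>t. t \<in> {0..2*pi} \<Longrightarrow> cmod (u t) \<le> B"
  shows "integrable circle_measure (\<lambda>t. f t * u t)"
    and "cmod (LINT t|circle_measure. f t * u t) \<le> B * (LINT t|circle_measure. cmod (f t))"
proof -
  have fm: "f \<in> borel_measurable circle_measure" by (rule borel_measurable_integrable[OF f])
  have AE: "AE t in circle_measure. cmod (f t * u t) \<le> B * cmod (f t)"
    unfolding AE_circle_measure
  proof (intro AE_I2 impI)
    fix t assume "t \<in> {0..2*pi}"
    then show "cmod (f t * u t) \<le> B * cmod (f t)"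
      unfolding norm_mult by (subst mult.commute) (intro mult_right_mono u(2), auto)
  qed
  have iB: "integrable circle_measure (\<lambda>t. B * cmod (f t))" using f by auto
  show i: "integrable circle_measure (\<lambda>t. f t * u t)"
  proof (rule Bochner_Integration.integrable_bound[OF iB])
    show "(\<lambda>t. f t * u t) \<in> borel_measurable circle_measure"
      using u(1) by (intro borel_measurable_times fm) (simp add: borel_measurable_circle_measure)
    show "AE t in circle_measure. cmod (f t * u t) \<le> norm (B * cmod (f t))"
      using AE
    proof eventually_elim
      case (elim t)
      also have "B * cmod (f t) \<le> norm (B * cmod (f t))" unfolding real_norm_def by (rule abs_ge_self)
      finally show ?case .
    qed
  qed
  have "cmod (LINT t|circle_measure. f t * u t) \<le> (LINT t|circle_measure. cmod (f t * u t))"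
    by (rule integral_norm_bound)
  also have "\<dots> \<le> (LINT t|circle_measure. B * cmod (f t))"
    by (rule integral_mono_AE) (use i iB AE in auto)
  finally show "cmod (LINT t|circle_measure. f t * u t) \<le> B * (LINT t|circle_measure. cmod (f t))" by simp
qed

text \<open>
  Integrals of \<open>f\<close> against trigonometric polynomials vanish, hence against continuous periodic functions, hence
  over compact sets (limits of such functions) and finally over all measurable sets, which are increasing
  unions of compact sets up to a null set.
\<close>

lemma fourier_unique:
  assumes f: "integrable circle_measure f" and 0: "\<And>n. fourier_coeff f n = 0"
  shows "AE t in circle_measure. f t = 0"
proof -
  have fm [measurable]: "f \<in> borel_measurable circle_measure" by (rule borel_measurable_integrable[OF f])
  have trig: "(LINT t|circle_measure. f t * u t) = 0" if "trig_poly u" for u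
    using that
  proof induction
    case (chr n)
    then show ?case using 0[of "- n"] by (simp add: fourier_coeff_chr)
  next
    case (add u v)
    have "integrable circle_measure (\<lambda>t. f t * w t)" if w: "trig_poly w" for w
      using trig_poly_bounded_measurable[OF w] integrable_circle_mult_bounded(1)[OF f] by blast
    then show ?case using add by (simp add: distrib_left)
  next
    case (cmult u c)
    then show ?case by (simp add: mult.left_commute)
  qed
  have cont: "(LINT t|circle_measure. f t * h t) = 0"
    if h: "continuous_on UNIV h" "h 0 = h (2*pi)" for h :: "real \<Rightarrow> complex"
  proof -
    have hm: "h \<in> borel_measurable lebesgue"
      by (intro measurable_completion) (auto intro: borel_measurable_continuous_onI h)
    define I where "I = (LINT t|circle_measure. cmod (f t))"
    have "compact (h ` {0..2*pi})" using h(1) by (intro compact_continuous_image) (auto intro: continuous_on_subset)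
    from compact_imp_bounded[OF this] obtain B where "\<forall>x\<in>h ` {0..2*pi}. norm x \<le> B"
      unfolding bounded_iff by blast
    then have B: "\<And>t. t \<in> {0..2*pi} \<Longrightarrow> cmod (h t) \<le> B" by simp
    have "cmod (LINT t|circle_measure. f t * h t) \<le> e * I" if "e > 0" for e
    proof -
      obtain u where u: "trig_poly u" "\<And>t. t \<in> {0..2*pi} \<Longrightarrow> cmod (h t - u t) < e"
        using trig_poly_approx[OF continuous_on_subset[OF h(1) subset_UNIV] h(2) \<open>e > 0\<close>] by blast
      obtain C where um: "u \<in> borel_measurable lebesgue" and C: "\<And>t. cmod (u t) \<le> C"
        using trig_poly_bounded_measurable[OF u(1)] by blast
      have "(LINT t|circle_measure. f t * h t) = (LINT t|circle_measure. f t * (h t - u t)) + (LINT t|circle_measure. f t * u t)"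
        using integrable_circle_mult_bounded(1)[OF f hm B] integrable_circle_mult_bounded(1)[OF f um C]
        by (simp add: right_diff_distrib)
      also have "\<dots> = (LINT t|circle_measure. f t * (h t - u t))" by (simp add: trig[OF u(1)])
      also have "cmod \<dots> \<le> e * I"
        unfolding I_def
        by (rule integrable_circle_mult_bounded(2)[OF f borel_measurable_diff[OF hm um] less_imp_le[OF u(2)]])
      finally show ?thesis .
    qed
    note * = this
    have I0: "I \<ge> 0" unfolding I_def by (rule integral_nonneg_AE) simp
    have "cmod (LINT t|circle_measure. f t * h t) \<le> 0"
    proof (rule field_le_epsilon)
      fix e :: real assume "e > 0"
      then have "cmod (LINT t|circle_measure. f t * h t) \<le> e / (I + 1) * I" using I0 by (intro *) simp
      also have "\<dots> \<le> e" using \<open>e > 0\<close> I0 by (simp add: field_simps)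
      finally show "cmod (LINT t|circle_measure. f t * h t) \<le> 0 + e" by simp
    qed
    then show ?thesis by simp
  qed
  have closed0: "(LINT t|circle_measure. f t * indicator K t) = 0" if K: "compact K" for K
  proof (cases "K = {}")
    case False
    \<comment> \<open>a continuous approximation of the indicator of \<open>K\<close>; the second factor forces periodicity\<close>
    define h where "h n t = complex_of_real (max 0 (1 - real n * infdist t K) * min 1 (max 0 (real n * (t * (2*pi - t)))))" for n t
    have "(\<lambda>n. LINT t|circle_measure. f t * h n t) \<longlonglongrightarrow> (LINT t|circle_measure. f t * indicator K t)"
    proof (rule integral_dominated_convergence[where w = "\<lambda>t. cmod (f t)"])
      show "(\<lambda>t. f t * indicator K t) \<in> borel_measurable circle_measure"
        using K by (intro borel_measurable_times fm borel_measurable_indicator) (auto simp: compact_imp_closed)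
      show "(\<lambda>t. f t * h n t) \<in> borel_measurable circle_measure" for n
      proof (intro borel_measurable_times fm)
        have "continuous_on UNIV (h n)" unfolding h_def by (intro continuous_intros)
        then have "h n \<in> borel_measurable lborel" by (simp add: borel_measurable_continuous_onI)
        then show "h n \<in> borel_measurable circle_measure"
          unfolding borel_measurable_circle_measure by (rule measurable_completion)
      qed
      show "integrable circle_measure (\<lambda>t. cmod (f t))" by (rule integrable_norm[OF f])
      show "AE t in circle_measure. norm (f t * h n t) \<le> cmod (f t)" for n
      proof (rule AE_I2)
        fix t
        have "\<bar>max 0 (1 - real n * infdist t K) * min 1 (max 0 (real n * (t * (2*pi - t))))\<bar> \<le> 1 * 1"
          unfolding abs_mult by (intro mult_mono) (auto simp: infdist_nonneg)
        then have "cmod (h n t) \<le> 1" unfolding h_def norm_of_real by simp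
        then show "norm (f t * h n t) \<le> cmod (f t)" by (simp add: norm_mult mult_left_le)
      qed
      show "AE t in circle_measure. (\<lambda>n. f t * h n t) \<longlonglongrightarrow> f t * indicator K t"
        using AE_circle_interior
      proof eventually_elim
        case (elim t)
        have pos: "t * (2*pi - t) > 0" using elim by simp
        obtain N1 where N1: "real N1 * (t * (2*pi - t)) > 1" using reals_Archimedean3[OF pos] by blast
        have w: "min 1 (max 0 (real n * (t * (2*pi - t)))) = 1" if "n \<ge> N1" for n
        proof -
          have "real N1 * (t * (2*pi - t)) \<le> real n * (t * (2*pi - t))"
            using that pos by (intro mult_right_mono) auto
          then show ?thesis using N1 by simp
        qed
        have "\<forall>\<^sub>F n in sequentially. h n t = indicator K t"
        proof (cases "t \<in> K")
          case True
          show ?thesis using eventually_ge_at_top[of N1]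
            by eventually_elim (use w True in \<open>simp add: h_def\<close>)
        next
          case nt: False
          then have "infdist t K > 0"
            using False K by (metis compact_imp_closed in_closed_iff_infdist_zero infdist_nonneg order_le_less)
          then obtain N2 where N2: "real N2 * infdist t K > 1" using reals_Archimedean3 by blast
          show ?thesis using eventually_ge_at_top[of N2]
          proof eventually_elim
            case (elim n)
            have "real N2 * infdist t K \<le> real n * infdist t K" using elim by (intro mult_right_mono infdist_nonneg) auto
            then show ?case using N2 nt by (simp add: h_def)
          qed
        qed
        then have "(\<lambda>n. h n t) \<longlonglongrightarrow> indicator K t" by (rule tendsto_eventually)
        then show ?case by (intro tendsto_intros)
      qed
    qed
    moreover have "(LINT t|circle_measure. f t * h n t) = 0" for n
      by (rule cont) (auto simp: h_def intro!: continuous_intros)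
    ultimately show ?thesis by (simp add: LIMSEQ_const_iff)
  qed simp
  show ?thesis
  proof (rule circle.density_zero[OF f])
    fix A assume "A \<in> sets circle_measure"
    then have "A \<in> sets lebesgue" by simp
    then obtain C T where C: "fsigma C" and T: "T \<in> null_sets lebesgue" and A: "C \<union> T = A"
      using lebesgue_set_almost_fsigma by metis
    obtain F :: "nat \<Rightarrow> real set" where F: "range F \<subseteq> Collect compact" "C = \<Union>(F ` UNIV)"
      using C unfolding fsigma_Union_compact by blast
    define G where "G n = (\<Union>i\<le>n. F i)" for n
    have G: "compact (G n)" for n unfolding G_def using F by (intro compact_UN) auto
    have Am: "A \<in> sets lebesgue" by fact
    have "(\<lambda>n. LINT t|circle_measure. f t * indicator (G n) t) \<longlonglongrightarrow> (LINT t|circle_measure. f t * indicator A t)"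
    proof (rule integral_dominated_convergence[where w = "\<lambda>t. cmod (f t)"])
      show "(\<lambda>t. f t * indicator A t) \<in> borel_measurable circle_measure"
        using Am by (intro borel_measurable_times fm borel_measurable_indicator) auto
      show "(\<lambda>t. f t * indicator (G n) t) \<in> borel_measurable circle_measure" for n
        using G[of n] by (intro borel_measurable_times fm borel_measurable_indicator) (auto simp: compact_imp_closed)
      show "integrable circle_measure (\<lambda>t. cmod (f t))" by (rule integrable_norm[OF f])
      show "AE t in circle_measure. norm (f t * indicator (G n) t) \<le> cmod (f t)" for n
        by (rule AE_I2) (simp add: indicator_def)
      have "AE t in circle_measure. t \<notin> T"
        unfolding AE_circle_measure using AE_not_in[OF T] by eventually_elim auto
      then show "AE t in circle_measure. (\<lambda>n. f t * indicator (G n) t) \<longlonglongrightarrow> f t * indicator A t"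
      proof eventually_elim
        case (elim t)
        have "\<forall>\<^sub>F n in sequentially. indicator (G n) t = (indicator A t :: complex)"
        proof (cases "t \<in> C")
          case True
          then obtain i where i: "t \<in> F i" using F by blast
          show ?thesis using eventually_ge_at_top[of i]
          proof eventually_elim
            case (elim n)
            then have "t \<in> G n" using i by (auto simp: G_def)
            then show ?case using True A by (auto simp: indicator_def)
          qed
        next
          case False
          then have "t \<notin> A" "\<And>n. t \<notin> G n" using elim A F by (auto simp: G_def)
          then show ?thesis by simp
        qed
        then have "(\<lambda>n. indicator (G n) t :: complex) \<longlonglongrightarrow> indicator A t" by (rule tendsto_eventually)
        then show ?case by (intro tendsto_intros)
      qed
    qed
    then have "(LINT t|circle_measure. f t * indicator A t) = 0"
      by (simp add: closed0[OF G] LIMSEQ_const_iff)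
    moreover have "indicator A t *\<^sub>R f t = f t * indicator A t" for t
      by (simp add: indicator_def)
    ultimately show "set_lebesgue_integral circle_measure A f = 0"
      by (simp add: set_lebesgue_integral_def)
  qed
qed

section \<open>The orthonormal basis of characters\<close>

definition L2chr :: "int \<Rightarrow> L2T" where
  "L2chr n = abs_L2T (chr n)"

lemma integral_chr: "(LINT t|circle_measure. chr n t) = (if n = 0 then 1 else 0)"
proof (cases "n = 0")
  case True
  then show ?thesis using circle.prob_space by simp
next
  case False
  define F where "F t = chr n t / (\<i> * of_int n)" for t
  have F: "(F has_vector_derivative chr n t) (at t within {0..2*pi})" for t
    unfolding F_def chr_def using False
    by (auto intro!: derivative_eq_intros has_vector_derivative_real_field simp: field_simps)
  have "(chr n has_integral (F (2*pi) - F 0)) {0..2*pi}"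
    by (rule fundamental_theorem_of_calculus[OF _ F]) simp
  moreover have "F (2*pi) = F 0"
  proof -
    have "exp (\<i> * of_int n * of_real (2*pi)) = 1"
      using exp_integer_2pi[of "of_int n"] by (simp add: mult_ac)
    then show ?thesis by (simp add: F_def chr_def)
  qed
  ultimately have "integral {0..2*pi} (chr n) = 0" by (simp add: integral_unique)
  moreover have "set_integrable lebesgue {0..2*pi} (chr n)"
    using integrable_circle_bounded[OF measurable_chr, of n 1] by (simp add: integrable_circle_measure)
  ultimately have "(LINT t:{0..2*pi}|lebesgue. chr n t) = 0"
    by (simp add: set_lebesgue_integral_eq_integral)
  then show ?thesis using False by (simp add: integral_circle_measure)
qed

lemma cinner_L2chr: "cinner x (L2chr n) = fourier_L2T x n"
proof -
  have "cinner (abs_L2T (rep_L2T x)) (L2chr n) = fourier_coeff (rep_L2T x) n"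
    unfolding L2chr_def cinner_abs_L2T[OF rep_L2T_square_integrable square_integrable_chr]
    by (simp add: fourier_coeff_chr cnj_chr)
  then show ?thesis
    using fourier_abs_L2T[OF rep_L2T_square_integrable[of x]] by (simp add: abs_rep_L2T)
qed

lemma cinner_L2chr_L2chr: "cinner (L2chr m) (L2chr n) = (if m = n then 1 else 0)"
proof -
  have "cinner (L2chr m) (L2chr n) = (LINT t|circle_measure. chr (m - n) t)"
    unfolding L2chr_def cinner_abs_L2T[OF square_integrable_chr square_integrable_chr]
    using chr_add[of m "- n"] by (simp add: cnj_chr)
  then show ?thesis by (simp add: integral_chr)
qed

lemma inj_L2chr: "inj L2chr"
proof (rule injI)
  fix m n assume "L2chr m = L2chr n"
  then show "m = n" using cinner_L2chr_L2chr[of m n] cinner_L2chr_L2chr[of n n] by (simp split: if_splits)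
qed

lemma L2T_eq_zeroI:
  assumes "\<And>n. fourier_L2T x n = 0"
  shows "x = 0"
proof -
  define f where "f = rep_L2T x"
  have f: "square_integrable f" "abs_L2T f = x"
    by (simp_all add: f_def rep_L2T_square_integrable abs_rep_L2T)
  have "integrable circle_measure f"
    using integrable_mult_character[OF f(1), of 0] by simp
  moreover have "fourier_coeff f n = 0" for n
    using assms[of n] fourier_abs_L2T[OF f(1)] f(2) by simp
  ultimately have "AE t in circle_measure. f t = 0" by (rule fourier_unique)
  then have "abs_L2T f = abs_L2T (\<lambda>t. 0)" by (intro abs_L2T_eqI f square_integrable_zero)
  then show ?thesis using f(2) by (simp add: zero_L2T_def)
qed

lemma orthonormal_basis_L2chr: "orthonormal_basis (range L2chr)"
  unfolding orthonormal_basis_def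
proof (intro conjI ballI allI impI)
  show "cinner x y = (if x = y then 1 else 0)" if "x \<in> range L2chr" "y \<in> range L2chr" for x y
    using that inj_L2chr by (auto simp: cinner_L2chr_L2chr inj_eq)
  show "x = 0" if "\<forall>e\<in>range L2chr. cinner x e = 0" for x
    using that by (intro L2T_eq_zeroI) (auto simp flip: cinner_L2chr)
qed

lemma parseval_L2chr: "((\<lambda>n. cinner x (L2chr n) * cinner (L2chr n) y) has_sum cinner x y) UNIV"
  using parseval[OF orthonormal_basis_L2chr, of x y] has_sum_reindex[OF inj_L2chr, of _ "cinner x y"]
  by (simp add: o_def)

lemma parseval_norm_L2chr: "((\<lambda>n. (cmod (cinner x (L2chr n)))\<^sup>2) has_sum (norm x)\<^sup>2) UNIV"
  using parseval_norm[OF orthonormal_basis_L2chr, of x] has_sum_reindex[OF inj_L2chr, of _ "(norm x)\<^sup>2"]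
  by (simp add: o_def)

section \<open>The Hardy space\<close>

lemma Rep_H2_fourier: "n < 0 \<Longrightarrow> fourier_L2T (Rep_H2 h) n = 0"
  using Rep_H2[of h] by simp

lemma cinner_H2: "cinner h k = cinner (Rep_H2 h) (Rep_H2 k)"
  by (rule cinner_H2.rep_eq)

lemma norm_H2: "norm h = norm (Rep_H2 h)"
  by (rule norm_H2.rep_eq)

lemma bounded_linear_Rep_H2: "bounded_linear Rep_H2"
  by (rule bounded_linear_intro[of _ 1]) (simp_all add: plus_H2.rep_eq scaleR_H2.rep_eq norm_H2)

lemma H2_Cauchy_convergent:
  fixes X :: "nat \<Rightarrow> H2"
  assumes X: "Cauchy X"
  shows "convergent X"
proof -
  have "dist (Rep_H2 a) (Rep_H2 b) = dist a b" for a b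
    by (simp add: dist_norm norm_H2 minus_H2.rep_eq)
  then have "Cauchy (\<lambda>n. Rep_H2 (X n))" using X by (simp add: Cauchy_def)
  then obtain x where x: "(\<lambda>n. Rep_H2 (X n)) \<longlonglongrightarrow> x"
    using L2T_Cauchy_convergent by (auto simp: convergent_def)
  have f0: "fourier_L2T x n = 0" if "n < 0" for n
  proof -
    have "(\<lambda>k. cinner (Rep_H2 (X k)) (L2chr n)) \<longlonglongrightarrow> cinner x (L2chr n)"
      by (intro cinner.tendsto x tendsto_const)
    then show ?thesis using that by (simp add: cinner_L2chr Rep_H2_fourier LIMSEQ_const_iff)
  qed
  obtain h where h: "x = Rep_H2 h" by (rule Rep_H2_cases[of x]) (use f0 in auto)
  have "(\<lambda>n. norm (X n - h)) = (\<lambda>n. norm (Rep_H2 (X n) - x))"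
    by (simp add: h norm_H2 minus_H2.rep_eq)
  moreover have "(\<lambda>n. norm (Rep_H2 (X n) - x)) \<longlonglongrightarrow> 0"
    using x by (simp add: LIM_zero_iff tendsto_norm_zero_iff)
  ultimately have "X \<longlonglongrightarrow> h" by (metis LIM_zero_iff tendsto_norm_zero_iff)
  then show ?thesis by (auto simp: convergent_def)
qed

instance H2 :: banach
  by standard (rule H2_Cauchy_convergent)

definition H2chr :: "nat \<Rightarrow> H2" where
  "H2chr n = Abs_H2 (L2chr (int n))"

lemma fourier_L2chr: "fourier_L2T (L2chr m) n = (if m = n then 1 else 0)"
  by (simp add: cinner_L2chr_L2chr flip: cinner_L2chr)

lemma Rep_H2chr: "Rep_H2 (H2chr n) = L2chr (int n)"
  unfolding H2chr_def by (rule Abs_H2_inverse) (simp add: fourier_L2chr)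

lemma orthonormal_basis_H2chr: "orthonormal_basis (range H2chr)"
  unfolding orthonormal_basis_def
proof (intro conjI ballI allI impI)
  have "inj H2chr" using inj_L2chr by (auto intro!: injI simp: inj_eq dest!: arg_cong[of _ _ Rep_H2] simp: Rep_H2chr)
  then show "cinner x y = (if x = y then 1 else 0)" if "x \<in> range H2chr" "y \<in> range H2chr" for x y
    using that by (auto simp: cinner_H2 Rep_H2chr cinner_L2chr_L2chr inj_eq)
  show "x = 0" if x: "\<forall>e\<in>range H2chr. cinner x e = 0" for x
  proof -
    have "fourier_L2T (Rep_H2 x) n = 0" for n
    proof (cases "n < 0")
      case False
      then have "n = int (nat n)" by simp
      then show ?thesis using x by (metis cinner_H2 cinner_L2chr Rep_H2chr rangeI)
    qed (rule Rep_H2_fourier)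
    then have "Rep_H2 x = 0" by (rule L2T_eq_zeroI)
    then show ?thesis by (metis Rep_H2_inject zero_H2.rep_eq)
  qed
qed

text \<open>
  The projection is the partial Fourier series \<open>\<Sum> \<langle>g, \<chi>\<^sub>n\<rangle> \<chi>\<^sub>n\<close> over \<open>n \<ge> 0\<close>, where \<open>\<chi>\<^sub>n\<close> are the
  characters.
\<close>

lemma P_plus_ex1: "\<exists>!h. \<forall>k::H2. cinner (g - Rep_H2 h) (Rep_H2 k) = 0"
proof -
  define E where "E = L2chr ` {0..}"
  have on: "orthonormal E"
    by (rule orthonormal_subset[OF orthonormal_basis_orthonormal[OF orthonormal_basis_L2chr]]) (auto simp: E_def)
  obtain s where s: "((\<lambda>e. cinner g e *\<^sub>C e) has_sum s) E"
    using orthonormal_summable[OF on bessel_summable[OF on]] by (auto simp: summable_on_def)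
  have cs: "cinner s (L2chr n) = (if n \<ge> 0 then cinner g (L2chr n) else 0)" for n
  proof -
    have 1: "((\<lambda>e. cinner (cinner g e *\<^sub>C e) (L2chr n)) has_sum cinner s (L2chr n)) E"
      by (rule has_sum_bounded_linear[OF cinner.bounded_linear_left s])
    have "((\<lambda>e. cinner (cinner g e *\<^sub>C e) (L2chr n)) has_sum (if n \<ge> 0 then cinner g (L2chr n) else 0)) E"
    proof (cases "n \<ge> 0")
      case True
      have "((\<lambda>e. cinner (cinner g e *\<^sub>C e) (L2chr n)) has_sum cinner g (L2chr n)) {L2chr n}"
        using has_sum_finite[of "{L2chr n}" "\<lambda>e. cinner (cinner g e *\<^sub>C e) (L2chr n)"]
        by (simp add: cinner_scaleC_left cinner_L2chr_L2chr)
      moreover have "L2chr n \<in> E" using True by (simp add: E_def)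
      ultimately have "((\<lambda>e. cinner (cinner g e *\<^sub>C e) (L2chr n)) has_sum cinner g (L2chr n)) E"
        by (elim has_sum_cong_neutral[THEN iffD1, rotated -1])
          (auto simp: E_def cinner_scaleC_left cinner_L2chr_L2chr split: if_split_asm)
      then show ?thesis using True by simp
    next
      case False
      then have "cinner (cinner g e *\<^sub>C e) (L2chr n) = 0" if "e \<in> E" for e
        using that by (auto simp: E_def cinner_scaleC_left cinner_L2chr_L2chr)
      then show ?thesis using False has_sum_0[of E "\<lambda>e. cinner (cinner g e *\<^sub>C e) (L2chr n)"] by simp
    qed
    with 1 show ?thesis by (rule has_sum_unique)
  qed
  then have "\<forall>n<0. fourier_L2T s n = 0" by (simp flip: cinner_L2chr)
  then obtain h where h: "s = Rep_H2 h" by (elim Rep_H2_cases[of s, rotated]) auto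
  have orth: "cinner (g - Rep_H2 h) (Rep_H2 k) = 0" for k
  proof -
    have "cinner (g - Rep_H2 h) (L2chr n) * cinner (L2chr n) (Rep_H2 k) = 0" for n
    proof (cases "n \<ge> 0")
      case True
      then show ?thesis using cs[of n] by (simp add: cinner.diff_left h)
    next
      case False
      have "cinner (L2chr n) (Rep_H2 k) = cnj (cinner (Rep_H2 k) (L2chr n))" by (rule cinner_commute)
      then show ?thesis using False by (simp add: cinner_L2chr Rep_H2_fourier)
    qed
    then have "(\<lambda>n. cinner (g - Rep_H2 h) (L2chr n) * cinner (L2chr n) (Rep_H2 k)) = (\<lambda>n. 0)" by (rule ext)
    then have "((\<lambda>n. 0) has_sum cinner (g - Rep_H2 h) (Rep_H2 k)) (UNIV :: int set)"
      using parseval_L2chr[of "g - Rep_H2 h" "Rep_H2 k"] by (simp only:)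
    then show ?thesis by (rule has_sum_unique) (rule has_sum_0, rule refl)
  qed
  show ?thesis
  proof (rule ex1I[of _ h])
    show "\<forall>k. cinner (g - Rep_H2 h) (Rep_H2 k) = 0" using orth by blast
    fix h' assume h': "\<forall>k. cinner (g - Rep_H2 h') (Rep_H2 k) = 0"
    have "cinner (h' - h) k = 0" for k
    proof -
      have "cinner (h' - h) k = cinner (g - Rep_H2 h) (Rep_H2 k) - cinner (g - Rep_H2 h') (Rep_H2 k)"
        by (simp add: cinner_H2 minus_H2.rep_eq cinner.diff_left)
      then show ?thesis using orth h' by simp
    qed
    then have "h' - h = 0" by (rule cinner_eq_zeroI)
    then show "h' = h" by simp
  qed
qed

lemma cinner_P_plus: "cinner (P_plus g) k = cinner g (Rep_H2 k)"
proof -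
  have "\<forall>k. cinner (g - Rep_H2 (P_plus g)) (Rep_H2 k) = 0"
    unfolding P_plus_def by (rule theI'[OF P_plus_ex1])
  then show ?thesis by (simp add: cinner_H2 cinner.diff_left)
qed

lemma P_plus_add: "P_plus (g + h) = P_plus g + P_plus h"
  by (rule cinner_ext) (simp add: cinner_P_plus cinner.add_left)

lemma P_plus_scaleC: "P_plus (c *\<^sub>C g) = c *\<^sub>C P_plus g"
  by (rule cinner_ext) (simp add: cinner_P_plus cinner_scaleC_left)

lemma norm_P_plus_le: "norm (P_plus g) \<le> norm g"
proof -
  have "(norm (P_plus g))\<^sup>2 = cmod (cinner g (Rep_H2 (P_plus g)))"
    unfolding cinner_P_plus[symmetric] cinner_self norm_of_real by simp
  also have "\<dots> \<le> norm g * norm (P_plus g)" using cmod_cinner_le by (simp add: norm_H2)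
  finally have "norm (P_plus g) * norm (P_plus g) \<le> norm g * norm (P_plus g)"
    by (simp add: power2_eq_square)
  then show ?thesis by (metis mult_right_le_imp_le norm_ge_zero order_le_less)
qed

lemma bounded_linear_P_plus: "bounded_linear P_plus"
  by (rule bounded_linear_intro[of _ 1]) (simp_all add: P_plus_add scaleR_scaleC P_plus_scaleC norm_P_plus_le)

lemma P_plus_Rep_H2: "P_plus (Rep_H2 h) = h"
  by (rule cinner_ext) (simp only: cinner_P_plus flip: cinner_H2)

section \<open>Multiplication and Toeplitz operators\<close>

text \<open>
  Boundedness is asked everywhere on the period rather than almost everywhere; all symbols that occur are
  continuous there.
\<close>

definition bounded_symbol :: "(real \<Rightarrow> complex) \<Rightarrow> bool" where
  "bounded_symbol f \<longleftrightarrow> f \<in> borel_measurable lebesgue \<and> (\<exists>B. \<forall>t\<in>{0..2*pi}. cmod (f t) \<le> B)"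

lemma bounded_symbolE:
  assumes "bounded_symbol f"
  obtains B where "\<And>t. t \<in> {0..2*pi} \<Longrightarrow> cmod (f t) \<le> B"
  using assms unfolding bounded_symbol_def by blast

lemma bounded_symbol_measurable: "bounded_symbol f \<Longrightarrow> f \<in> borel_measurable lebesgue"
  by (simp add: bounded_symbol_def)

lemma bounded_symbol_cnj: "bounded_symbol f \<Longrightarrow> bounded_symbol (\<lambda>t. cnj (f t))"
  by (auto simp: bounded_symbol_def)

lemma bounded_symbol_mult:
  assumes "bounded_symbol f" "bounded_symbol g"
  shows "bounded_symbol (\<lambda>t. f t * g t)"
proof -
  obtain B where B: "\<forall>t\<in>{0..2*pi}. cmod (f t) \<le> B" using assms by (auto simp: bounded_symbol_def)
  obtain C where C: "\<forall>t\<in>{0..2*pi}. cmod (g t) \<le> C" using assms by (auto simp: bounded_symbol_def)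
  have "cmod (f t * g t) \<le> B * C" if t: "t \<in> {0..2*pi}" for t
    unfolding norm_mult using B C t order_trans[OF norm_ge_zero, of "f t" B]
    by (intro mult_mono) auto
  then show ?thesis using assms unfolding bounded_symbol_def by (blast intro: borel_measurable_times)
qed

lemma square_integrable_symbol_mult:
  assumes f: "f \<in> borel_measurable lebesgue" "\<And>t. t \<in> {0..2*pi} \<Longrightarrow> cmod (f t) \<le> B"
    and g: "square_integrable g"
  shows "square_integrable (\<lambda>t. f t * g t)"
    and "norm (abs_L2T (\<lambda>t. f t * g t)) \<le> B * norm (abs_L2T g)"
proof -
  have fm [measurable]: "f \<in> borel_measurable circle_measure"
    using f(1) by (simp add: borel_measurable_circle_measure)
  note [measurable] = square_integrable_measurable[OF g]
  have B0: "B \<ge> 0" using order_trans[OF norm_ge_zero f(2)[of 0]] by simp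
  have i: "integrable circle_measure (\<lambda>t. B\<^sup>2 * (cmod (g t))\<^sup>2)"
    using g by (simp add: square_integrable_def)
  have AE: "AE t in circle_measure. (cmod (f t * g t))\<^sup>2 \<le> B\<^sup>2 * (cmod (g t))\<^sup>2"
    unfolding AE_circle_measure
  proof (intro AE_I2 impI)
    fix t assume t: "t \<in> {0..2*pi}"
    show "(cmod (f t * g t))\<^sup>2 \<le> B\<^sup>2 * (cmod (g t))\<^sup>2"
      unfolding norm_mult power_mult_distrib using f(2)[OF t] by (intro mult_right_mono power_mono) auto
  qed
  have i2: "integrable circle_measure (\<lambda>t. (cmod (f t * g t))\<^sup>2)"
  proof (rule Bochner_Integration.integrable_bound[OF i])
    show "AE t in circle_measure. norm ((cmod (f t * g t))\<^sup>2) \<le> norm (B\<^sup>2 * (cmod (g t))\<^sup>2)"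
      using AE by eventually_elim simp
  qed measurable
  then show si: "square_integrable (\<lambda>t. f t * g t)" by (simp add: square_integrable_def)
  have "(norm (abs_L2T (\<lambda>t. f t * g t)))\<^sup>2 \<le> (LINT t|circle_measure. B\<^sup>2 * (cmod (g t))\<^sup>2)"
    unfolding norm_abs_L2T[OF si] by (rule integral_mono_AE[OF i2 i AE])
  also have "\<dots> = (B * norm (abs_L2T g))\<^sup>2"
    by (simp add: norm_abs_L2T[OF g] power_mult_distrib)
  finally show "norm (abs_L2T (\<lambda>t. f t * g t)) \<le> B * norm (abs_L2T g)"
    by (rule power2_le_imp_le) (simp add: B0)
qed

lemma square_integrable_bounded_symbol_mult:
  "bounded_symbol f \<Longrightarrow> square_integrable g \<Longrightarrow> square_integrable (\<lambda>t. f t * g t)"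
  by (rule bounded_symbolE, assumption) (rule square_integrable_symbol_mult(1)[OF bounded_symbol_measurable], auto)

lemma mult_L2T_abs:
  assumes f: "bounded_symbol f" and g: "square_integrable g"
  shows "mult_L2T f (abs_L2T g) = abs_L2T (\<lambda>t. f t * g t)"
  unfolding mult_L2T_def
proof (rule abs_L2T_eqI)
  show "AE t in circle_measure. f t * rep_L2T (abs_L2T g) t = f t * g t"
    using rep_abs_L2T[OF g] by eventually_elim simp
qed (intro square_integrable_bounded_symbol_mult f g rep_L2T_square_integrable)+

lemma mult_L2T_add:
  assumes f: "bounded_symbol f"
  shows "mult_L2T f (x + y) = mult_L2T f x + mult_L2T f y"
proof -
  note sx = rep_L2T_square_integrable[of x] and sy = rep_L2T_square_integrable[of y]
  have "mult_L2T f (abs_L2T (rep_L2T x) + abs_L2T (rep_L2T y))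
      = mult_L2T f (abs_L2T (rep_L2T x)) + mult_L2T f (abs_L2T (rep_L2T y))"
    using f sx sy
    by (simp add: abs_L2T_add mult_L2T_abs square_integrable_add square_integrable_bounded_symbol_mult
        distrib_left)
  then show ?thesis by (simp add: abs_rep_L2T)
qed

lemma mult_L2T_scaleC:
  assumes f: "bounded_symbol f"
  shows "mult_L2T f (c *\<^sub>C x) = c *\<^sub>C mult_L2T f x"
proof -
  note sx = rep_L2T_square_integrable[of x]
  have "mult_L2T f (c *\<^sub>C abs_L2T (rep_L2T x)) = c *\<^sub>C mult_L2T f (abs_L2T (rep_L2T x))"
    using f sx
    by (simp add: abs_L2T_scaleC mult_L2T_abs square_integrable_scale square_integrable_bounded_symbol_mult
        mult.left_commute)
  then show ?thesis by (simp add: abs_rep_L2T)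
qed

lemma norm_mult_L2T_le:
  assumes f: "bounded_symbol f" and B: "\<And>t. t \<in> {0..2*pi} \<Longrightarrow> cmod (f t) \<le> B"
  shows "norm (mult_L2T f x) \<le> B * norm x"
  using square_integrable_symbol_mult(2)[OF _ B rep_L2T_square_integrable[of x]] f
  by (simp add: mult_L2T_def abs_rep_L2T bounded_symbol_def)

lemma cinner_mult_L2T:
  assumes f: "bounded_symbol f"
  shows "cinner (mult_L2T f x) y = cinner x (mult_L2T (\<lambda>t. cnj (f t)) y)"
proof -
  note sx = rep_L2T_square_integrable[of x] and sy = rep_L2T_square_integrable[of y]
  have "cinner (mult_L2T f (abs_L2T (rep_L2T x))) (abs_L2T (rep_L2T y))
      = cinner (abs_L2T (rep_L2T x)) (mult_L2T (\<lambda>t. cnj (f t)) (abs_L2T (rep_L2T y)))"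
    using f sx sy bounded_symbol_cnj[OF f]
    by (simp add: mult_L2T_abs cinner_abs_L2T square_integrable_bounded_symbol_mult mult_ac)
  then show ?thesis by (simp add: abs_rep_L2T)
qed

lemma mult_L2T_mult:
  assumes f: "bounded_symbol f" and g: "bounded_symbol g"
  shows "mult_L2T (\<lambda>t. f t * g t) x = mult_L2T f (mult_L2T g x)"
proof -
  note sx = rep_L2T_square_integrable[of x]
  have "mult_L2T (\<lambda>t. f t * g t) (abs_L2T (rep_L2T x)) = mult_L2T f (mult_L2T g (abs_L2T (rep_L2T x)))"
    using f g sx
    by (simp add: mult_L2T_abs bounded_symbol_mult square_integrable_bounded_symbol_mult mult.assoc)
  then show ?thesis by (simp add: abs_rep_L2T)
qed

lemma cinner_mult_L2chr:
  assumes f: "bounded_symbol f"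
  shows "cinner (mult_L2T f (L2chr n)) (L2chr m) = fourier_coeff f (m - n)"
proof -
  have "fourier_L2T (mult_L2T f (L2chr n)) m = fourier_coeff (\<lambda>t. f t * chr n t) m"
    unfolding L2chr_def mult_L2T_abs[OF f square_integrable_chr]
    by (rule fourier_abs_L2T[OF square_integrable_bounded_symbol_mult[OF f square_integrable_chr]])
  also have "\<dots> = fourier_coeff f (m - n)"
    using chr_add[of n "- m"] by (simp add: fourier_coeff_chr mult.assoc)
  finally show ?thesis by (simp add: cinner_L2chr)
qed

definition mult_op :: "(real \<Rightarrow> complex) \<Rightarrow> L2T \<Rightarrow>\<^sub>L L2T" where
  "mult_op f = Blinfun (mult_L2T f)"

lemma mult_op_apply:
  assumes "bounded_symbol f"
  shows "blinfun_apply (mult_op f) x = mult_L2T f x"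
proof -
  obtain B where B: "\<And>t. t \<in> {0..2*pi} \<Longrightarrow> cmod (f t) \<le> B" using assms by (rule bounded_symbolE) blast
  have "bounded_linear (mult_L2T f)"
  proof (rule bounded_linear_intro[of _ B])
    show "norm (mult_L2T f x) \<le> norm x * B" for x
      by (subst mult.commute) (rule norm_mult_L2T_le[OF assms B])
  qed (simp_all add: mult_L2T_add[OF assms] scaleR_scaleC mult_L2T_scaleC[OF assms])
  then show ?thesis by (simp add: mult_op_def bounded_linear_Blinfun_apply)
qed

lemma adj_pair_mult_op: "bounded_symbol f \<Longrightarrow> adj_pair (mult_op f) (mult_op (\<lambda>t. cnj (f t)))"
  by (simp add: adj_pair_def mult_op_apply bounded_symbol_cnj cinner_mult_L2T)

text \<open>
  The projection onto the Hardy space as an operator of the ambient space, so that it can be composed with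
  multiplication operators.
\<close>

definition hardy_proj :: "L2T \<Rightarrow>\<^sub>L L2T" where
  "hardy_proj = Blinfun (\<lambda>x. Rep_H2 (P_plus x))"

lemma hardy_proj_apply: "blinfun_apply hardy_proj x = Rep_H2 (P_plus x)"
  unfolding hardy_proj_def
  by (simp add: bounded_linear_Blinfun_apply bounded_linear_compose[OF bounded_linear_Rep_H2 bounded_linear_P_plus])

lemma adj_pair_hardy_proj: "adj_pair hardy_proj hardy_proj"
  unfolding adj_pair_def hardy_proj_apply
proof (intro allI)
  fix x y
  have "cinner (Rep_H2 (P_plus x)) y = cnj (cinner (P_plus y) (P_plus x))"
    by (subst cinner_commute) (simp add: cinner_P_plus)
  also have "\<dots> = cinner (P_plus x) (P_plus y)" by (rule cinner_commute[symmetric])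
  also have "\<dots> = cinner x (Rep_H2 (P_plus y))" by (rule cinner_P_plus)
  finally show "cinner (Rep_H2 (P_plus x)) y = cinner x (Rep_H2 (P_plus y))" .
qed

lemma hardy_proj_L2chr: "blinfun_apply hardy_proj (L2chr n) = (if n \<ge> 0 then L2chr n else 0)"
proof (cases "n \<ge> 0")
  case True
  then have "L2chr n = Rep_H2 (H2chr (nat n))" by (simp add: Rep_H2chr)
  then show ?thesis using True by (simp add: hardy_proj_apply P_plus_Rep_H2)
next
  case False
  have "P_plus (L2chr n) = 0"
  proof (rule cinner_eq_zeroI)
    fix k
    have "cinner (P_plus (L2chr n)) k = cnj (cinner (Rep_H2 k) (L2chr n))"
      unfolding cinner_P_plus by (rule cinner_commute)
    then show "cinner (P_plus (L2chr n)) k = 0" using False by (simp add: cinner_L2chr Rep_H2_fourier)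
  qed
  then show ?thesis using False by (simp add: hardy_proj_apply zero_H2.rep_eq)
qed

lemma bounded_linear_toeplitz:
  assumes "bounded_symbol f"
  shows "bounded_linear (\<lambda>h. P_plus (mult_L2T f (Rep_H2 h)))"
  unfolding mult_op_apply[OF assms, symmetric]
  by (intro bounded_linear_compose[OF bounded_linear_P_plus] bounded_linear_compose[OF blinfun.bounded_linear_right]
      bounded_linear_Rep_H2)

lemma toeplitz_apply:
  "bounded_symbol f \<Longrightarrow> blinfun_apply (toeplitz f) h = P_plus (mult_L2T f (Rep_H2 h))"
  by (simp add: toeplitz_def bounded_linear_Blinfun_apply bounded_linear_toeplitz)

lemma cinner_toeplitz:
  "bounded_symbol f \<Longrightarrow> cinner (blinfun_apply (toeplitz f) h) k = cinner (mult_L2T f (Rep_H2 h)) (Rep_H2 k)"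
  by (simp add: toeplitz_apply cinner_P_plus)

lemma adj_pair_toeplitz:
  assumes f: "bounded_symbol f"
  shows "adj_pair (toeplitz f) (toeplitz (\<lambda>t. cnj (f t)))"
  unfolding adj_pair_def
proof (intro allI)
  fix h k
  have "cinner h (blinfun_apply (toeplitz (\<lambda>t. cnj (f t))) k)
      = cnj (cinner (mult_L2T (\<lambda>t. cnj (f t)) (Rep_H2 k)) (Rep_H2 h))"
    by (subst cinner_commute) (simp add: cinner_toeplitz[OF bounded_symbol_cnj[OF f]])
  also have "\<dots> = cinner (mult_L2T f (Rep_H2 h)) (Rep_H2 k)"
    by (simp add: cinner_mult_L2T[OF f] flip: cinner_commute)
  finally show "cinner (blinfun_apply (toeplitz f) h) k = cinner h (blinfun_apply (toeplitz (\<lambda>t. cnj (f t))) k)"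
    by (simp add: cinner_toeplitz[OF f])
qed

lemma norm_toeplitz_le:
  assumes f: "bounded_symbol f" and B: "\<And>t. t \<in> {0..2*pi} \<Longrightarrow> cmod (f t) \<le> B"
  shows "norm (toeplitz f) \<le> B"
proof (rule norm_blinfun_bound)
  show "B \<ge> 0" using order_trans[OF norm_ge_zero B[of 0]] by simp
  fix h
  have "norm (blinfun_apply (toeplitz f) h) \<le> norm (mult_L2T f (Rep_H2 h))"
    unfolding toeplitz_apply[OF f] by (rule norm_P_plus_le)
  also have "\<dots> \<le> B * norm h" using norm_mult_L2T_le[OF f B] by (simp add: norm_H2)
  finally show "norm (blinfun_apply (toeplitz f) h) \<le> B * norm h" .
qed

section \<open>Hilbert--Schmidt commutators\<close>

text \<open>
  Square summability along the basis of characters, in which the commutators below have explicit matrices.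
\<close>

definition hilbert_schmidt :: "(L2T \<Rightarrow>\<^sub>L L2T) \<Rightarrow> bool" where
  "hilbert_schmidt X \<longleftrightarrow> (\<lambda>n. (norm (blinfun_apply X (L2chr n)))\<^sup>2) summable_on UNIV"

lemma hilbert_schmidt_iff:
  "hilbert_schmidt X \<longleftrightarrow> (\<lambda>(n, m). (cmod (cinner (blinfun_apply X (L2chr n)) (L2chr m)))\<^sup>2) summable_on UNIV \<times> UNIV"
proof -
  let ?a = "\<lambda>n m. (cmod (cinner (blinfun_apply X (L2chr n)) (L2chr m)))\<^sup>2"
  have row: "(\<Sum>\<^sub>\<infinity>m. ?a n m) = (norm (blinfun_apply X (L2chr n)))\<^sup>2" "?a n summable_on UNIV" for n
    using parseval_norm_L2chr[of "blinfun_apply X (L2chr n)"] by (auto simp: infsumI summable_on_def)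
  have "(\<lambda>z. norm (case z of (n, m) \<Rightarrow> ?a n m)) summable_on UNIV \<times> UNIV \<longleftrightarrow>
      (\<forall>n\<in>UNIV. (\<lambda>m. norm (case (n, m) of (n, m) \<Rightarrow> ?a n m)) summable_on UNIV) \<and>
      (\<lambda>n. norm (\<Sum>\<^sub>\<infinity>m. norm (case (n, m) of (n, m) \<Rightarrow> ?a n m))) summable_on UNIV"
    by (rule Infinite_Sum.abs_summable_on_Sigma_iff)
  then show ?thesis using row by (simp add: hilbert_schmidt_def case_prod_unfold)
qed

lemma hilbert_schmidt_adj:
  assumes "adj_pair X X'" "hilbert_schmidt X"
  shows "hilbert_schmidt X'"
proof -
  have "cmod (cinner (blinfun_apply X' (L2chr n)) (L2chr m)) = cmod (cinner (blinfun_apply X (L2chr m)) (L2chr n))" for n m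
    unfolding adj_pairD[OF assms(1)] by (metis cinner_commute complex_mod_cnj)
  then show ?thesis
    using assms(2) unfolding hilbert_schmidt_iff by (subst summable_on_swap) (simp add: case_prod_unfold)
qed

lemma hilbert_schmidt_compose_left:
  assumes "hilbert_schmidt X"
  shows "hilbert_schmidt (L o\<^sub>L X)"
  unfolding hilbert_schmidt_def
proof (rule summable_on_comparison_test)
  show "(\<lambda>n. (norm L)\<^sup>2 * (norm (blinfun_apply X (L2chr n)))\<^sup>2) summable_on UNIV"
    using assms unfolding hilbert_schmidt_def by (rule summable_on_cmult_right)
  show "(norm (blinfun_apply (L o\<^sub>L X) (L2chr n)))\<^sup>2 \<le> (norm L)\<^sup>2 * (norm (blinfun_apply X (L2chr n)))\<^sup>2" for n
    unfolding power_mult_distrib[symmetric] by (intro power_mono) (simp_all add: norm_blinfun)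
qed simp

lemma hilbert_schmidt_compose_right:
  assumes "adj_pair X X'" "adj_pair R R'" "hilbert_schmidt X"
  shows "hilbert_schmidt (X o\<^sub>L R)"
proof -
  have "hilbert_schmidt (R' o\<^sub>L X')" by (intro hilbert_schmidt_compose_left hilbert_schmidt_adj[OF assms(1,3)])
  moreover have "adj_pair (R' o\<^sub>L X') (X o\<^sub>L R)"
    by (rule adj_pair_compose[OF adj_pair_sym[OF assms(2)] adj_pair_sym[OF assms(1)]])
  ultimately show ?thesis by (blast intro: hilbert_schmidt_adj)
qed

lemma hilbert_schmidt_add:
  assumes "hilbert_schmidt X" "hilbert_schmidt Y"
  shows "hilbert_schmidt (X + Y)"
  unfolding hilbert_schmidt_def
proof (rule summable_on_comparison_test)
  show "(\<lambda>n. 2 * (norm (blinfun_apply X (L2chr n)))\<^sup>2 + 2 * (norm (blinfun_apply Y (L2chr n)))\<^sup>2) summable_on UNIV"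
    using assms unfolding hilbert_schmidt_def by (intro summable_on_add summable_on_cmult_right)
  fix n
  let ?x = "blinfun_apply X (L2chr n)" and ?y = "blinfun_apply Y (L2chr n)"
  have "(norm (?x + ?y))\<^sup>2 \<le> (norm ?x + norm ?y)\<^sup>2" by (intro power_mono norm_triangle_ineq) auto
  also have "\<dots> \<le> 2 * (norm ?x)\<^sup>2 + 2 * (norm ?y)\<^sup>2"
    using sum_squares_bound[of "norm ?x" "norm ?y"] by (simp add: power2_sum)
  finally show "(norm (blinfun_apply (X + Y) (L2chr n)))\<^sup>2 \<le> 2 * (norm ?x)\<^sup>2 + 2 * (norm ?y)\<^sup>2"
    by (simp add: blinfun.add_left)
qed simp

text \<open>
  With respect to the Hardy projection \<open>P\<close>, the two off-diagonal blocks are, up to sign, the Hankel operator with symbol \<open>f\<close> and the adjoint of the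
  Hankel operator whose symbol is the conjugate of \<open>f\<close>.
\<close>

definition comm :: "(real \<Rightarrow> complex) \<Rightarrow> L2T \<Rightarrow>\<^sub>L L2T" where
  "comm f = (hardy_proj o\<^sub>L mult_op f) - (mult_op f o\<^sub>L hardy_proj)"

lemma comm_apply:
  "bounded_symbol f \<Longrightarrow> blinfun_apply (comm f) x = blinfun_apply hardy_proj (mult_L2T f x) - mult_L2T f (blinfun_apply hardy_proj x)"
  by (simp add: comm_def blinfun.diff_left mult_op_apply)

lemma adj_pair_comm:
  assumes "bounded_symbol f"
  shows "adj_pair (comm f) (- comm (\<lambda>t. cnj (f t)))"
proof -
  have "adj_pair (comm f) ((mult_op (\<lambda>t. cnj (f t)) o\<^sub>L hardy_proj) - (hardy_proj o\<^sub>L mult_op (\<lambda>t. cnj (f t))))"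
    unfolding comm_def by (intro adj_pair_diff adj_pair_compose adj_pair_hardy_proj adj_pair_mult_op assms)
  then show ?thesis by (simp add: comm_def)
qed

lemma hilbert_schmidt_comm_cnj:
  assumes "bounded_symbol f" "hilbert_schmidt (comm f)"
  shows "hilbert_schmidt (comm (\<lambda>t. cnj (f t)))"
proof -
  have "hilbert_schmidt (- comm (\<lambda>t. cnj (f t)))" by (rule hilbert_schmidt_adj[OF adj_pair_comm assms(2)]) (rule assms(1))
  then show ?thesis by (simp add: hilbert_schmidt_def blinfun.minus_left)
qed

text \<open>
  The commutator is a derivation: \<open>[P, fg] = [P, f] g + f [P, g]\<close>. In this way smoothness of order one half
  passes from \<open>f\<close> to the symbols \<open>f\<^sup>* \<bar>f\<bar>\<^sup>2\<^sup>n\<close>, where \<open>f\<^sup>*\<close> is the complex conjugate.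
\<close>

lemma hilbert_schmidt_comm_mult:
  assumes f: "bounded_symbol f" "hilbert_schmidt (comm f)" and g: "bounded_symbol g" "hilbert_schmidt (comm g)"
  shows "hilbert_schmidt (comm (\<lambda>t. f t * g t))"
proof -
  have "comm (\<lambda>t. f t * g t) = (comm f o\<^sub>L mult_op g) + (mult_op f o\<^sub>L comm g)"
    using f g
    by (intro blinfun_eqI)
      (simp add: comm_apply bounded_symbol_mult blinfun.add_left mult_L2T_mult mult_op_apply
        blinfun.diff_right[of "mult_op f", simplified mult_op_apply[OF f(1)]])
  then show ?thesis
    using hilbert_schmidt_add[OF hilbert_schmidt_compose_right[OF adj_pair_comm[OF f(1)] adj_pair_mult_op[OF g(1)] f(2)] hilbert_schmidt_compose_left[OF g(2)]]
    by simp
qed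

lemma mult_L2T_zero: "bounded_symbol f \<Longrightarrow> mult_L2T f 0 = 0"
  using mult_L2T_scaleC[of f 0 0] by simp

lemma cinner_comm_L2chr:
  assumes "bounded_symbol f"
  shows "cinner (blinfun_apply (comm f) (L2chr n)) (L2chr m)
    = (if (m \<ge> 0) = (n \<ge> 0) then 0 else if m \<ge> 0 then fourier_coeff f (m - n) else - fourier_coeff f (m - n))"
proof -
  have "cinner (blinfun_apply (comm f) (L2chr n)) (L2chr m)
      = cinner (mult_L2T f (L2chr n)) (blinfun_apply hardy_proj (L2chr m)) - cinner (mult_L2T f (blinfun_apply hardy_proj (L2chr n))) (L2chr m)"
    by (simp add: comm_apply[OF assms] cinner.diff_left adj_pairD[OF adj_pair_hardy_proj])
  moreover have "mult_L2T f 0 = 0" by (rule mult_L2T_zero[OF assms])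
  ultimately show ?thesis
    by (simp add: hardy_proj_L2chr cinner_mult_L2chr[OF assms] cinner.zero_left cinner.zero_right)
qed

text \<open>
  In the matrix of the commutator, the entry \<open>f\<^sub>k\<close> occurs at the positions \<open>(n, n + k)\<close> for which exactly one
  of \<open>n\<close>, \<open>n + k\<close> is negative, that is, \<open>\<bar>k\<bar>\<close> times.
\<close>

lemma hilbert_schmidt_comm_iff:
  assumes f: "bounded_symbol f"
  shows "hilbert_schmidt (comm f) \<longleftrightarrow> (\<lambda>k::int. \<bar>of_int k\<bar> * (cmod (fourier_coeff f k))\<^sup>2) summable_on UNIV"
proof -
  define N where "N k = {n::int. (k + n \<ge> 0) \<noteq> (n \<ge> 0)}" for k
  have N: "N k = (if k \<ge> 0 then {-k..<0} else {0..<-k})" for k by (auto simp: N_def)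
  have fN: "finite (N k)" and cN: "real (card (N k)) = \<bar>of_int k\<bar>" for k by (auto simp: N)
  define a where "a k = (cmod (fourier_coeff f k))\<^sup>2" for k
  have bij: "bij_betw (\<lambda>(k, n). (n, k + n)) (Sigma UNIV N) {(n, m). (m \<ge> 0) \<noteq> (n \<ge> (0::int))}"
    by (rule bij_betwI[of _ _ _ "\<lambda>(n, m). (m - n, n)"]) (auto simp: N_def)
  have "hilbert_schmidt (comm f) \<longleftrightarrow> (\<lambda>(n, m). a (m - n)) summable_on {(n, m). (m \<ge> 0) \<noteq> (n \<ge> (0::int))}"
    unfolding hilbert_schmidt_iff
    by (rule summable_on_cong_neutral) (auto simp: cinner_comm_L2chr[OF f] a_def split: if_split_asm)
  also have "\<dots> \<longleftrightarrow> (\<lambda>z. norm (a (fst z))) summable_on (Sigma UNIV N)"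
    using summable_on_reindex_bij_betw[OF bij, of "\<lambda>(n, m). a (m - n)"]
    by (simp add: case_prod_unfold a_def)
  also have "\<dots> \<longleftrightarrow> (\<lambda>k. norm (\<Sum>\<^sub>\<infinity>y\<in>N k. norm (a (fst (k, y))))) summable_on UNIV"
    unfolding Infinite_Sum.abs_summable_on_Sigma_iff by (auto intro: summable_on_finite fN)
  also have "(\<lambda>k. norm (\<Sum>\<^sub>\<infinity>y\<in>N k. norm (a (fst (k, y))))) = (\<lambda>k. \<bar>of_int k\<bar> * a k)"
    using fN cN by (simp add: a_def)
  finally show ?thesis by (simp add: a_def)
qed

lemma hilbert_schmidt_comm_W_half:
  assumes f: "bounded_symbol f" and W: "f \<in> W_half_2"
  shows "hilbert_schmidt (comm f)"
  unfolding hilbert_schmidt_comm_iff[OF f]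
proof (rule summable_on_comparison_test)
  show "(\<lambda>k::int. (1 + \<bar>of_int k\<bar>) * (cmod (fourier_coeff f k))\<^sup>2) summable_on UNIV"
    using W by (simp add: W_half_2_def)
qed (auto intro!: mult_right_mono)

lemma summable_fourier_product:
  assumes g: "bounded_symbol g" "hilbert_schmidt (comm g)" and u: "bounded_symbol u" "hilbert_schmidt (comm u)"
  shows "(\<lambda>k::int. \<bar>of_int k\<bar> * cmod (fourier_coeff g k * fourier_coeff u (- k))) summable_on UNIV"
proof (rule summable_on_comparison_test)
  have "(\<lambda>k::int. \<bar>of_int k\<bar> * (cmod (fourier_coeff u k))\<^sup>2) summable_on UNIV"
    using u hilbert_schmidt_comm_iff by blast
  then have "(\<lambda>k::int. \<bar>of_int (- k)\<bar> * (cmod (fourier_coeff u (- k)))\<^sup>2) summable_on UNIV"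
    using summable_on_reindex_bij_betw[of uminus UNIV UNIV "\<lambda>k::int. \<bar>of_int k\<bar> * (cmod (fourier_coeff u k))\<^sup>2"]
    by (simp add: bij_uminus)
  then show "(\<lambda>k::int. \<bar>of_int k\<bar> * (cmod (fourier_coeff g k))\<^sup>2 + \<bar>of_int k\<bar> * (cmod (fourier_coeff u (- k)))\<^sup>2) summable_on UNIV"
    using g by (intro summable_on_add) (auto simp: hilbert_schmidt_comm_iff)
  fix k :: int
  have "cmod (fourier_coeff g k * fourier_coeff u (- k)) \<le> (cmod (fourier_coeff g k))\<^sup>2 + (cmod (fourier_coeff u (- k)))\<^sup>2"
    using sum_squares_bound[of "cmod (fourier_coeff g k)" "cmod (fourier_coeff u (- k))"]
      mult_nonneg_nonneg[OF norm_ge_zero[of "fourier_coeff g k"] norm_ge_zero[of "fourier_coeff u (- k)"]]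
    unfolding norm_mult by linarith
  then show "\<bar>of_int k\<bar> * cmod (fourier_coeff g k * fourier_coeff u (- k))
      \<le> \<bar>of_int k\<bar> * (cmod (fourier_coeff g k))\<^sup>2 + \<bar>of_int k\<bar> * (cmod (fourier_coeff u (- k)))\<^sup>2"
    unfolding distrib_left[symmetric] by (rule mult_left_mono) simp
qed simp

section \<open>Products of Toeplitz operators\<close>

lemma norm_P_plus_mult_L2chr:
  assumes "bounded_symbol g" "m < 0"
  shows "norm (P_plus (mult_L2T g (L2chr m))) = norm (blinfun_apply (comm g) (L2chr m))"
proof -
  have "mult_L2T g 0 = 0" by (rule mult_L2T_zero[OF assms(1)])
  then show ?thesis using assms by (simp add: norm_H2 comm_apply hardy_proj_L2chr) (simp add: hardy_proj_apply)
qed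

text \<open>
  The defect is \<open>P g (1 - P) u P\<close>; expanding \<open>1 - P\<close> in the characters with negative index gives a
  series of rank one operators whose factors are images of characters under Hilbert--Schmidt operators.
\<close>

lemma toeplitz_nuclear:
  assumes g: "bounded_symbol g" "hilbert_schmidt (comm g)" and u: "bounded_symbol u" "hilbert_schmidt (comm u)"
  shows "nuclear_series (toeplitz (\<lambda>t. g t * u t) - (toeplitz g o\<^sub>L toeplitz u))
     (\<lambda>m. P_plus (mult_L2T (\<lambda>t. cnj (u t)) (L2chr m))) (\<lambda>m. P_plus (mult_L2T g (L2chr m))) {..<0}"
  unfolding nuclear_series_def
proof (intro conjI allI)
  note uc = bounded_symbol_cnj[OF u(1)] and gc = bounded_symbol_cnj[OF g(1)] and gu = bounded_symbol_mult[OF g(1) u(1)]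
  have sm: "(\<lambda>m. (norm (blinfun_apply (comm (\<lambda>t. cnj (u t))) (L2chr m)))\<^sup>2
      + (norm (blinfun_apply (comm g) (L2chr m)))\<^sup>2) summable_on {..<0}"
    using hilbert_schmidt_comm_cnj[OF u] g(2) unfolding hilbert_schmidt_def
    by (intro summable_on_add) (auto intro: summable_on_subset)
  show "(\<lambda>m. norm (P_plus (mult_L2T (\<lambda>t. cnj (u t)) (L2chr m))) * norm (P_plus (mult_L2T g (L2chr m)))) summable_on {..<0}"
  proof (rule summable_on_comparison_test[OF sm])
    fix m :: int assume "m \<in> {..<0}"
    then have m: "m < 0" by simp
    show "norm (P_plus (mult_L2T (\<lambda>t. cnj (u t)) (L2chr m))) * norm (P_plus (mult_L2T g (L2chr m)))
      \<le> (norm (blinfun_apply (comm (\<lambda>t. cnj (u t))) (L2chr m)))\<^sup>2 + (norm (blinfun_apply (comm g) (L2chr m)))\<^sup>2"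
      unfolding norm_P_plus_mult_L2chr[OF uc m] norm_P_plus_mult_L2chr[OF g(1) m]
      using sum_squares_bound[of "norm (blinfun_apply (comm (\<lambda>t. cnj (u t))) (L2chr m))" "norm (blinfun_apply (comm g) (L2chr m))"]
        mult_nonneg_nonneg[OF norm_ge_zero[of "blinfun_apply (comm (\<lambda>t. cnj (u t))) (L2chr m)"] norm_ge_zero[of "blinfun_apply (comm g) (L2chr m)"]]
      by linarith
  qed simp
  fix x y
  define p where "p = mult_L2T u (Rep_H2 x)"
  define q where "q = mult_L2T (\<lambda>t. cnj (g t)) (Rep_H2 y)"
  have "cinner (blinfun_apply (toeplitz (\<lambda>t. g t * u t) - (toeplitz g o\<^sub>L toeplitz u)) x) y
      = cinner p q - cinner (blinfun_apply hardy_proj p) q"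
    by (simp add: blinfun.diff_left cinner.diff_left cinner_toeplitz[OF gu] cinner_toeplitz[OF g(1)] p_def q_def
        mult_L2T_mult[OF g(1) u(1)] cinner_mult_L2T[OF g(1)] toeplitz_apply[OF u(1)] hardy_proj_apply)
  also have "\<dots> = cinner (p - blinfun_apply hardy_proj p) q" by (simp add: cinner.diff_left)
  finally have eq: "cinner (blinfun_apply (toeplitz (\<lambda>t. g t * u t) - (toeplitz g o\<^sub>L toeplitz u)) x) y
      = cinner (p - blinfun_apply hardy_proj p) q" .
  have c: "cinner (p - blinfun_apply hardy_proj p) (L2chr m) = (if m < 0 then cinner p (L2chr m) else 0)" for m
    by (simp add: cinner.diff_left adj_pairD[OF adj_pair_hardy_proj] hardy_proj_L2chr cinner.zero_right)
  have "((\<lambda>m. cinner (p - blinfun_apply hardy_proj p) (L2chr m) * cinner (L2chr m) q) has_sum cinner (p - blinfun_apply hardy_proj p) q) UNIV"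
    by (rule parseval_L2chr)
  then have "((\<lambda>m. cinner p (L2chr m) * cinner (L2chr m) q) has_sum cinner (p - blinfun_apply hardy_proj p) q) {..<0}"
    by (rule has_sum_cong_neutral[THEN iffD1, rotated -1]) (auto simp: c)
  moreover have "cinner p (L2chr m) = cinner x (P_plus (mult_L2T (\<lambda>t. cnj (u t)) (L2chr m)))" for m
  proof -
    have "cinner x (P_plus (mult_L2T (\<lambda>t. cnj (u t)) (L2chr m))) = cnj (cinner (mult_L2T (\<lambda>t. cnj (u t)) (L2chr m)) (Rep_H2 x))"
      by (subst cinner_commute) (simp add: cinner_P_plus)
    also have "\<dots> = cinner (Rep_H2 x) (mult_L2T (\<lambda>t. cnj (u t)) (L2chr m))" by (rule cinner_commute[symmetric])
    finally show ?thesis by (simp add: p_def cinner_mult_L2T[OF u(1)])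
  qed
  moreover have "cinner (L2chr m) q = cinner (P_plus (mult_L2T g (L2chr m))) y" for m
    by (simp add: q_def cinner_P_plus cinner_mult_L2T[OF g(1)])
  ultimately show "((\<lambda>m. cinner x (P_plus (mult_L2T (\<lambda>t. cnj (u t)) (L2chr m))) * cinner (P_plus (mult_L2T g (L2chr m))) y) has_sum
      cinner (blinfun_apply (toeplitz (\<lambda>t. g t * u t) - (toeplitz g o\<^sub>L toeplitz u)) x) y) {..<0}"
    unfolding eq by simp
qed

text \<open>
  There are \<open>k\<close> pairs \<open>m < 0 \<le> n\<close> with \<open>n - m = k\<close>.
\<close>

lemma has_sum_pairs_difference:
  fixes a :: "int \<Rightarrow> complex"
  assumes "(\<lambda>k. \<bar>of_int k\<bar> * cmod (a k)) summable_on UNIV"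
  shows "((\<lambda>(m, n). a (n - m)) has_sum (\<Sum>\<^sub>\<infinity>k\<in>{0<..}. of_int k * a k)) ({..<0} \<times> {0..})"
proof -
  define N where "N k = {0..<k}" for k :: int
  have sm: "(\<lambda>k. \<bar>of_int k\<bar> * cmod (a k)) summable_on {0<..}"
    by (rule summable_on_subset[OF assms]) simp
  have "(\<lambda>z. norm (a (fst z))) summable_on (Sigma {0<..} N)"
    unfolding Infinite_Sum.abs_summable_on_Sigma_iff
  proof (intro conjI ballI)
    show "(\<lambda>y. norm (a (fst (k, y)))) summable_on N k" for k by (intro summable_on_finite) (simp add: N_def)
    show "(\<lambda>k. norm (\<Sum>\<^sub>\<infinity>y\<in>N k. norm (a (fst (k, y))))) summable_on {0<..}"
      by (rule summable_on_cong[THEN iffD1, OF _ sm]) (simp add: N_def)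
  qed
  then have "(\<lambda>z. a (fst z)) summable_on (Sigma {0<..} N)" by (rule abs_summable_summable)
  then obtain S where S: "((\<lambda>z. a (fst z)) has_sum S) (Sigma {0<..} N)" by (auto simp: summable_on_def)
  have "((\<lambda>k. of_int k * a k) has_sum S) {0<..}"
  proof (rule has_sum_SigmaD[OF S])
    fix k :: int assume "k \<in> {0<..}"
    then show "((\<lambda>y. a (fst (k, y))) has_sum of_int k * a k) (N k)"
      using has_sum_finite[of "N k" "\<lambda>y. a (fst (k, y))"] by (simp add: N_def)
  qed
  then have S_eq: "(\<Sum>\<^sub>\<infinity>k\<in>{0<..}. of_int k * a k) = S" by (rule infsumI)
  have bij: "bij_betw (\<lambda>(k, n). (n - k, n)) (Sigma {0<..} N) ({..<0} \<times> {0..})"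
    by (rule bij_betwI[of _ _ _ "\<lambda>(m, n). (n - m, n)"]) (auto simp: N_def)
  show ?thesis
    using S has_sum_reindex_bij_betw[OF bij, of "\<lambda>(m, n). a (n - m)" S]
    unfolding S_eq by (simp add: case_prod_unfold)
qed

lemma cinner_P_plus_mult_L2chr:
  assumes g: "bounded_symbol g" and u: "bounded_symbol u"
  shows "((\<lambda>n. fourier_coeff g (n - m) * fourier_coeff u (m - n)) has_sum
    cinner (P_plus (mult_L2T g (L2chr m))) (P_plus (mult_L2T (\<lambda>t. cnj (u t)) (L2chr m)))) {0..}"
proof -
  define p where "p = mult_L2T g (L2chr m)"
  define q where "q = mult_L2T (\<lambda>t. cnj (u t)) (L2chr m)"
  have "((\<lambda>n. cinner p (L2chr n) * cinner (L2chr n) (blinfun_apply hardy_proj q)) has_sum cinner p (blinfun_apply hardy_proj q)) UNIV"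
    by (rule parseval_L2chr)
  then have "((\<lambda>n. fourier_coeff g (n - m) * fourier_coeff u (m - n)) has_sum cinner p (blinfun_apply hardy_proj q)) {0..}"
  proof (rule has_sum_cong_neutral[THEN iffD1, rotated -1])
    fix n :: int
    have pn: "cinner (L2chr n) (blinfun_apply hardy_proj q) = cinner (blinfun_apply hardy_proj (L2chr n)) q"
      by (rule adj_pairD[OF adj_pair_hardy_proj, symmetric])
    show "cinner p (L2chr n) * cinner (L2chr n) (blinfun_apply hardy_proj q) = 0" if "n \<in> UNIV - {0..}"
      using that by (simp add: pn hardy_proj_L2chr cinner.zero_left)
    have "cinner (L2chr n) q = fourier_coeff u (m - n)"
      using cinner_mult_L2T[OF u, of "L2chr n" "L2chr m"] cinner_mult_L2chr[OF u, of n m] by (simp add: q_def)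
    then show "cinner p (L2chr n) * cinner (L2chr n) (blinfun_apply hardy_proj q) = fourier_coeff g (n - m) * fourier_coeff u (m - n)"
      if "n \<in> UNIV \<inter> {0..}"
      using that by (simp add: pn hardy_proj_L2chr p_def cinner_mult_L2chr[OF g])
  qed auto
  then show ?thesis by (simp add: p_def q_def cinner_P_plus hardy_proj_apply)
qed

text \<open>
  The trace of the nuclear series is the double sum of \<open>g\<close> at \<open>n - m\<close> times \<open>u\<close> at \<open>m - n\<close> over
  \<open>m < 0 \<le> n\<close>, which is grouped according to the difference \<open>n - m\<close>.
\<close>

lemma toeplitz_defect_trace:
  assumes g: "bounded_symbol g" "hilbert_schmidt (comm g)" and u: "bounded_symbol u" "hilbert_schmidt (comm u)"
  shows "has_tr (toeplitz (\<lambda>t. g t * u t) - (toeplitz g o\<^sub>L toeplitz u))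
    (\<Sum>\<^sub>\<infinity>k\<in>{0<..}. of_int k * (fourier_coeff g k * fourier_coeff u (- k)))"
proof -
  let ?S = "\<Sum>\<^sub>\<infinity>k\<in>{0<..}. of_int k * (fourier_coeff g k * fourier_coeff u (- k))"
  have "((\<lambda>m. cinner (P_plus (mult_L2T g (L2chr m))) (P_plus (mult_L2T (\<lambda>t. cnj (u t)) (L2chr m)))) has_sum ?S) {..<0}"
    by (rule has_sum_SigmaD[OF has_sum_pairs_difference[OF summable_fourier_product[OF g u]]])
      (use cinner_P_plus_mult_L2chr[OF g(1) u(1)] in \<open>simp add: minus_diff_eq\<close>)
  then show ?thesis
    using nuclear_has_tr[OF toeplitz_nuclear[OF g u]] by (simp add: infsumI)
qed

lemma toeplitz_defect_traceable:
  assumes g: "bounded_symbol g" "hilbert_schmidt (comm g)" and u: "bounded_symbol u" "hilbert_schmidt (comm u)"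
  shows "traceable (toeplitz (\<lambda>t. g t * u t) - (toeplitz g o\<^sub>L toeplitz u))"
  by (rule nuclear_traceable[OF toeplitz_nuclear[OF assms]])

section \<open>Absolutely continuous functions on an interval\<close>

text \<open>
  Absolute continuity phrased with divisions, the language of the gauge integral. The sums are taken over
  the intervals themselves, whose end points are recovered as infimum and supremum.
\<close>

definition ac_real :: "real \<Rightarrow> real \<Rightarrow> (real \<Rightarrow> real) \<Rightarrow> bool" where
  "ac_real a b g \<longleftrightarrow> (\<forall>\<epsilon>>0. \<exists>\<delta>>0. \<forall>D. D division_of \<Union>D \<longrightarrow> \<Union>D \<subseteq> {a..b} \<longrightarrow>
     (\<Sum>K\<in>D. Sup K - Inf K) < \<delta> \<longrightarrow> (\<Sum>K\<in>D. \<bar>g (Sup K) - g (Inf K)\<bar>) < \<epsilon>)"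

lemma division_of_interval:
  fixes D :: "real set set"
  assumes "D division_of S" "K \<in> D"
  shows "K = {Inf K..Sup K}" "Inf K \<le> Sup K" "K \<subseteq> S"
proof -
  obtain u v where uv: "K = {u..v}" and "K \<noteq> {}" "K \<subseteq> S"
    using division_ofD(2,3,4)[OF assms(1)] assms(2) by (metis box_real(2))
  then have "u \<le> v" by simp
  then show "K = {Inf K..Sup K}" "Inf K \<le> Sup K" using uv by auto
  show "K \<subseteq> S" by fact
qed

lemma abs_continuous_on_division:
  fixes f :: "real \<Rightarrow> complex"
  assumes f: "abs_continuous_on a b f" and "\<epsilon> > 0"
  shows "\<exists>\<delta>>0. \<forall>D. D division_of \<Union>D \<longrightarrow> \<Union>D \<subseteq> {a..b} \<longrightarrow>
     (\<Sum>K\<in>D. Sup K - Inf K) < \<delta> \<longrightarrow> (\<Sum>K\<in>D. cmod (f (Sup K) - f (Inf K))) < \<epsilon>"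
proof -
  obtain \<delta> where \<delta>: "\<delta> > 0" and I: "\<And>I. finite I \<Longrightarrow> (\<forall>(x, y)\<in>I. a \<le> x \<and> x \<le> y \<and> y \<le> b) \<Longrightarrow>
        pairwise (\<lambda>(x, y) (x', y'). {x<..<y} \<inter> {x'<..<y'} = {}) I \<Longrightarrow>
        (\<Sum>(x, y)\<in>I. y - x) < \<delta> \<Longrightarrow> (\<Sum>(x, y)\<in>I. cmod (f y - f x)) < \<epsilon>"
    using f \<open>\<epsilon> > 0\<close> unfolding abs_continuous_on_def by blast
  have "(\<Sum>K\<in>D. cmod (f (Sup K) - f (Inf K))) < \<epsilon>"
    if D: "D division_of \<Union>D" and sub: "\<Union>D \<subseteq> {a..b}" and len: "(\<Sum>K\<in>D. Sup K - Inf K) < \<delta>" for D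
  proof -
    define h where "h K = (Inf K, Sup K)" for K :: "real set"
    note DI = division_of_interval[OF D]
    have inj: "inj_on h D" by (rule inj_onI) (metis DI(1) h_def prod.inject)
    have int: "interior K = {Inf K<..<Sup K}" if "K \<in> D" for K
      by (metis DI(1)[OF that] interior_atLeastAtMost_real)
    have "(\<Sum>(x, y)\<in>h ` D. cmod (f y - f x)) < \<epsilon>"
    proof (rule I)
      show "finite (h ` D)" using D by auto
      show "\<forall>(x, y)\<in>h ` D. a \<le> x \<and> x \<le> y \<and> y \<le> b"
      proof (clarsimp simp: h_def)
        fix K assume K: "K \<in> D"
        have "{Inf K..Sup K} \<subseteq> {a..b}" using DI(1)[OF K] sub K by blast
        then show "a \<le> Inf K \<and> Inf K \<le> Sup K \<and> Sup K \<le> b" using DI(2)[OF K] by simp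
      qed
      show "pairwise (\<lambda>(x, y) (x', y'). {x<..<y} \<inter> {x'<..<y'} = {}) (h ` D)"
      proof (rule pairwiseI)
        fix z z' assume "z \<in> h ` D" "z' \<in> h ` D" "z \<noteq> z'"
        then obtain K K' where K: "K \<in> D" "K' \<in> D" "z = h K" "z' = h K'" "K \<noteq> K'" by auto
        then have "interior K \<inter> interior K' = {}" using division_ofD(5)[OF D] by blast
        then have "{Inf K<..<Sup K} \<inter> {Inf K'<..<Sup K'} = {}" by (simp only: int[OF K(1)] int[OF K(2)])
        then show "(\<lambda>(x, y) (x', y'). {x<..<y} \<inter> {x'<..<y'} = {}) z z'"
          by (simp add: K h_def)
      qed
      show "(\<Sum>(x, y)\<in>h ` D. y - x) < \<delta>"
        unfolding sum.reindex[OF inj] using len by (simp add: h_def)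
    qed
    then show ?thesis unfolding sum.reindex[OF inj] by (simp add: h_def)
  qed
  then show ?thesis using \<delta> by blast
qed

lemma abs_continuous_on_ac_real:
  fixes f :: "real \<Rightarrow> complex"
  assumes f: "abs_continuous_on a b f" and g: "\<And>x y. \<bar>g x - g y\<bar> \<le> cmod (f x - f y)"
  shows "ac_real a b g"
  unfolding ac_real_def
proof (intro allI impI)
  fix \<epsilon> :: real assume "\<epsilon> > 0"
  then obtain \<delta> where \<delta>: "\<delta> > 0" and *: "\<And>D. D division_of \<Union>D \<Longrightarrow> \<Union>D \<subseteq> {a..b} \<Longrightarrow>
     (\<Sum>K\<in>D. Sup K - Inf K) < \<delta> \<Longrightarrow> (\<Sum>K\<in>D. cmod (f (Sup K) - f (Inf K))) < \<epsilon>"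
    using abs_continuous_on_division[OF f] by blast
  have "(\<Sum>K\<in>D. \<bar>g (Sup K) - g (Inf K)\<bar>) < \<epsilon>"
    if "D division_of \<Union>D" "\<Union>D \<subseteq> {a..b}" "(\<Sum>K\<in>D. Sup K - Inf K) < \<delta>" for D
    using *[OF that] by (rule le_less_trans[rotated]) (intro sum_mono g)
  then show "\<exists>\<delta>>0. \<forall>D. D division_of \<Union>D \<longrightarrow> \<Union>D \<subseteq> {a..b} \<longrightarrow>
     (\<Sum>K\<in>D. Sup K - Inf K) < \<delta> \<longrightarrow> (\<Sum>K\<in>D. \<bar>g (Sup K) - g (Inf K)\<bar>) < \<epsilon>"
    using \<delta> by blast
qed

section \<open>A finite Vitali covering lemma\<close>

definition nondeg :: "real set \<Rightarrow> bool" where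
  "nondeg K \<longleftrightarrow> (\<exists>u v. u < v \<and> K = {u..v})"

lemma nondegD:
  assumes "nondeg K"
  shows "K = {Inf K..Sup K}" "Inf K < Sup K" "K \<in> lmeasurable" "measure lebesgue K = Sup K - Inf K"
  using assms by (auto simp: nondeg_def)

text \<open>
  Vitali's covering theorem gives a countable disjoint family; a finite part of it covers all but a set of
  small measure, because the total length is finite.
\<close>

lemma vitali_finite:
  assumes K: "\<And>K. K \<in> \<K> \<Longrightarrow> nondeg K" "\<And>K. K \<in> \<K> \<Longrightarrow> K \<subseteq> {a..b}"
    and cover: "\<And>x d. x \<in> E \<Longrightarrow> d > 0 \<Longrightarrow> \<exists>K\<in>\<K>. x \<in> K \<and> Sup K - Inf K < d"
    and \<eta>: "\<eta> > 0"
  obtains F W where "finite F" "F \<subseteq> \<K>" "pairwise disjnt F" "W \<in> lmeasurable" "measure lebesgue W < \<eta>"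
    "E \<subseteq> \<Union>F \<union> W"
proof -
  define c where "c K = (Inf K + Sup K) / 2" for K :: "real set"
  define r where "r K = (Sup K - Inf K) / 2" for K :: "real set"
  have ball: "cball (c K) (r K) = K" if "K \<in> \<K>" for K
  proof -
    have "cball (c K) (r K) = {Inf K..Sup K}" by (simp add: c_def r_def cball_eq_atLeastAtMost field_simps)
    then show ?thesis using nondegD(1)[OF K(1)[OF that]] by simp
  qed
  have cov: "\<exists>K. K \<in> \<K> \<and> x \<in> cball (c K) (r K) \<and> r K < d" if x: "x \<in> E" "d > 0" for x d
  proof -
    obtain K where "K \<in> \<K>" "x \<in> K" "Sup K - Inf K < d" using cover[OF x] by blast
    moreover from this have "Inf K < Sup K" using nondegD(2)[OF K(1)] by blast
    ultimately show ?thesis using ball by (intro exI[of _ K]) (simp add: r_def)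
  qed
  have r0: "0 < r K" if "K \<in> \<K>" for K using nondegD(2)[OF K(1)[OF that]] by (simp add: r_def)
  obtain C where C: "countable C" "C \<subseteq> \<K>"
    and dis: "pairwise (\<lambda>i j. disjnt (cball (c i) (r i)) (cball (c j) (r j))) C"
    and neg: "negligible (E - (\<Union>i\<in>C. cball (c i) (r i)))"
    using Vitali_covering_theorem_cballs[of \<K> r E c, OF r0 cov] by blast
  have dis: "pairwise disjnt C" using dis C(2) ball unfolding pairwise_def by (metis subsetD)
  have "(\<Union>i\<in>C. cball (c i) (r i)) = (\<Union>i\<in>C. i)" using C(2) by (intro SUP_cong refl ball) blast
  then have "(\<Union>i\<in>C. cball (c i) (r i)) = \<Union>C" by simp
  then have neg: "negligible (E - \<Union>C)" using neg by simp
  show thesis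
  proof (cases "C = {}")
    case True
    then show ?thesis using neg \<eta>
      by (intro that[of "{}" E]) (auto simp: negligible_imp_measurable negligible_imp_measure0)
  next
    case False
    define k where "k = from_nat_into C"
    have rk: "range k = C" using False C(1) by (simp add: k_def range_from_nat_into)
    define G where "G n = (\<Union>i<n. k i)" for n
    have Gm: "G n \<in> lmeasurable" for n
      unfolding G_def by (rule fmeasurable.finite_UN) (use rk C(2) K(1) nondegD(3) in auto)
    have UG: "(\<Union>n. G n) = \<Union>C"
    proof (intro equalityI subsetI)
      show "x \<in> \<Union>C" if "x \<in> (\<Union>n. G n)" for x using that rk by (auto simp: G_def)
      fix x assume "x \<in> \<Union>C"
      then obtain i where "x \<in> k i" using rk by blast
      then have "x \<in> G (Suc i)" by (auto simp: G_def)
      then show "x \<in> (\<Union>n. G n)" by blast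
    qed
    have Um: "\<Union>C \<in> lmeasurable"
    proof (rule fmeasurableI2[of "{a..b}"])
      show "\<Union>C \<in> sets lebesgue" unfolding UG[symmetric] using Gm by (intro sets.countable_UN) auto
    qed (use C(2) K(2) in auto)
    have "(\<lambda>n. measure lebesgue (G n)) \<longlonglongrightarrow> measure lebesgue (\<Union>n. G n)"
    proof (rule Lim_measure_incseq)
      show "range G \<subseteq> sets lebesgue" using Gm by auto
      show "incseq G" by (rule incseq_SucI) (auto simp: G_def less_Suc_eq)
      show "emeasure lebesgue (\<Union>n. G n) \<noteq> \<infinity>" using Um unfolding UG by (auto simp: fmeasurable_def)
    qed
    then have "\<forall>\<^sub>F n in sequentially. measure lebesgue (\<Union>C) - \<eta> < measure lebesgue (G n)"
      unfolding UG using \<eta> by (intro order_tendstoD) auto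
    then obtain n where n: "measure lebesgue (\<Union>C) - \<eta> < measure lebesgue (G n)"
      by (auto simp: eventually_sequentially)
    define W where "W = (\<Union>C - G n) \<union> (E - \<Union>C)"
    have GU: "G n \<subseteq> \<Union>C" using UG by blast
    have d: "\<Union>C - G n \<in> lmeasurable" "measure lebesgue (\<Union>C - G n) < \<eta>"
    proof -
      show "\<Union>C - G n \<in> lmeasurable" by (rule fmeasurable.Diff[OF Um Gm])
      show "measure lebesgue (\<Union>C - G n) < \<eta>"
        using n measurable_measure_Diff[OF Um fmeasurableD[OF Gm] GU] by simp
    qed
    show ?thesis
    proof (rule that[of "k ` {..<n}" W])
      show "W \<in> lmeasurable"
        unfolding W_def by (rule fmeasurable.Un[OF d(1) negligible_imp_measurable[OF neg]])
      have "measure lebesgue W \<le> measure lebesgue (\<Union>C - G n) + measure lebesgue (E - \<Union>C)"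
        unfolding W_def using d neg by (intro measure_Un_le) (auto simp: negligible_imp_sets fmeasurableD)
      then show "measure lebesgue W < \<eta>" using d(2) negligible_imp_measure0[OF neg] by linarith
      show "pairwise disjnt (k ` {..<n})" by (rule pairwise_subset[OF dis]) (use rk in auto)
      show "k ` {..<n} \<subseteq> \<K>" using rk C(2) by auto
      show "E \<subseteq> \<Union>(k ` {..<n}) \<union> W" by (auto simp: W_def G_def)
    qed simp
  qed
qed

section \<open>Increments over gaps\<close>

lemma division_increment:
  fixes h :: "real \<Rightarrow> real"
  assumes D: "D division_of {u..v}" and "u \<le> v"
  shows "(\<Sum>K\<in>D. h (Sup K) - h (Inf K)) = h v - h u"
proof -
  define p where "p = (\<lambda>K. (Inf K, K)) ` D"
  note DI = division_of_interval[OF D]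
  have "p tagged_division_of {u..v}"
    unfolding tagged_division_of
  proof (intro conjI allI impI)
    show "finite p" using D by (auto simp: p_def)
    fix x K assume "(x, K) \<in> p"
    then have K: "K \<in> D" "x = Inf K" by (auto simp: p_def)
    show "x \<in> K" using DI(1,2)[OF K(1)] K(2) by (metis atLeastAtMost_iff order_refl)
    show "K \<subseteq> {u..v}" by (rule DI(3)[OF K(1)])
    show "\<exists>a b. K = cbox a b" using division_ofD(4)[OF D K(1)] .
  next
    fix x1 K1 x2 K2 assume "(x1, K1) \<in> p \<and> (x2, K2) \<in> p \<and> (x1, K1) \<noteq> (x2, K2)"
    then show "interior K1 \<inter> interior K2 = {}" using division_ofD(5)[OF D] by (auto simp: p_def)
  next
    have "{K. \<exists>x. (x, K) \<in> p} = D" by (auto simp: p_def)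
    then show "\<Union>{K. \<exists>x. (x, K) \<in> p} = {u..v}" using division_ofD(6)[OF D] by simp
  qed
  from additive_tagged_division_1[OF \<open>u \<le> v\<close> this, of h]
  show ?thesis unfolding p_def by (subst (asm) sum.reindex) (auto simp: inj_on_def)
qed

text \<open>
  The intervals of \<open>H\<close> are the gaps left by \<open>G\<close> inside \<open>F\<close>. The identity holds for every function \<open>h\<close> with
  the same \<open>H\<close>: for the identity function it measures the total length of the gaps, for an absolutely continuous
  function it then bounds the difference of the increments over \<open>F\<close> and over \<open>G\<close>.
\<close>

lemma division_gaps:
  assumes F: "finite F" "pairwise disjnt F" "\<And>K. K \<in> F \<Longrightarrow> nondeg K"
    and G: "finite G" "pairwise disjnt G" "\<And>K. K \<in> G \<Longrightarrow> nondeg K \<and> (\<exists>L\<in>F. K \<subseteq> L)"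
  obtains H where "H division_of \<Union>H" "\<Union>H \<subseteq> \<Union>F"
    "\<forall>h :: real \<Rightarrow> real. (\<Sum>K\<in>H. h (Sup K) - h (Inf K))
      = (\<Sum>K\<in>F. h (Sup K) - h (Inf K)) - (\<Sum>K\<in>G. h (Sup K) - h (Inf K))"
proof -
  define GL where "GL L = {K \<in> G. K \<subseteq> L}" for L
  have GLdiv: "GL L division_of \<Union>(GL L)" for L
    unfolding division_of_def
  proof (intro conjI ballI impI)
    show "finite (GL L)" using G(1) by (simp add: GL_def)
    fix K assume "K \<in> GL L"
    then have "nondeg K" using G(3) by (simp add: GL_def)
    then obtain u v where "u < v" "K = {u..v}" by (auto simp: nondeg_def)
    then show "K \<noteq> {}" by simp
    show "\<exists>a b. K = cbox a b" using \<open>K = {u..v}\<close> by (metis box_real(2))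
    show "K \<subseteq> \<Union>(GL L)" using \<open>K \<in> GL L\<close> by blast
    fix K' assume "K' \<in> GL L" "K \<noteq> K'"
    then have "disjnt K K'" using G(2) \<open>K \<in> GL L\<close> by (auto simp: GL_def pairwise_def)
    then show "interior K \<inter> interior K' = {}" using interior_subset by (fastforce simp: disjnt_def)
  qed simp
  have "\<exists>q. GL L \<subseteq> q \<and> q division_of L" if LF: "L \<in> F" for L
  proof -
    obtain u v where "L = cbox u v" using F(3)[OF LF] by (auto simp: nondeg_def simp flip: box_real(2))
    moreover have "\<Union>(GL L) \<subseteq> L" by (auto simp: GL_def)
    ultimately show ?thesis using partial_division_extend_interval[OF GLdiv[of L]] by metis
  qed
  then obtain q where q: "\<And>L. L \<in> F \<Longrightarrow> GL L \<subseteq> q L" "\<And>L. L \<in> F \<Longrightarrow> q L division_of L" by metis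
  define H where "H = (\<Union>L\<in>F. q L - GL L)"
  have qsub: "K \<subseteq> L" "K \<noteq> {}" if "L \<in> F" "K \<in> q L" for K L
    using division_ofD(2,3)[OF q(2)[OF that(1)]] that by auto
  have Feq: "L = L'" if "L \<in> F" "L' \<in> F" "K \<subseteq> L" "K \<subseteq> L'" "K \<noteq> {}" for K L L'
  proof (rule ccontr)
    assume "L \<noteq> L'"
    then have "L \<inter> L' = {}" using F(2) that(1,2) by (auto simp: pairwise_def disjnt_def)
    then show False using that(3-5) by blast
  qed
  have qdis: "q L \<inter> q L' = {}" if "L \<in> F" "L' \<in> F" "L \<noteq> L'" for L L'
  proof (rule ccontr)
    assume "q L \<inter> q L' \<noteq> {}"
    then obtain K where K: "K \<in> q L" "K \<in> q L'" by blast
    have "L = L'"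
      by (rule Feq[OF that(1,2) qsub(1)[OF that(1) K(1)] qsub(1)[OF that(2) K(2)] qsub(2)[OF that(1) K(1)]])
    then show False using that(3) by simp
  qed
  have G_eq: "G = (\<Union>L\<in>F. GL L)" using G(3) by (auto simp: GL_def)
  show thesis
  proof (rule that[of H])
    show "H division_of \<Union>H"
      unfolding division_of_def
    proof (intro conjI ballI impI)
      show "finite H" unfolding H_def using F(1) q(2) by (auto dest: division_of_finite)
      fix K assume "K \<in> H"
      then obtain L where L: "L \<in> F" "K \<in> q L" by (auto simp: H_def)
      show "K \<noteq> {}" "\<exists>a b. K = cbox a b" using division_ofD(3,4)[OF q(2)[OF L(1)]] L by auto
      show "K \<subseteq> \<Union>H" using \<open>K \<in> H\<close> by blast
      fix K' assume "K' \<in> H" "K \<noteq> K'"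
      then obtain L' where L': "L' \<in> F" "K' \<in> q L'" by (auto simp: H_def)
      show "interior K \<inter> interior K' = {}"
      proof (cases "L = L'")
        case True
        then show ?thesis using division_ofD(5)[OF q(2)[OF L(1)]] L L' \<open>K \<noteq> K'\<close> by blast
      next
        case False
        then have "L \<inter> L' = {}" using F(2) L L' by (auto simp: pairwise_def disjnt_def)
        then show ?thesis using qsub(1)[OF L] qsub(1)[OF L'] interior_subset[of K] interior_subset[of K'] by blast
      qed
    qed simp
    show "\<Union>H \<subseteq> \<Union>F" using qsub(1) by (auto simp: H_def)
  next
    show "\<forall>h :: real \<Rightarrow> real. (\<Sum>K\<in>H. h (Sup K) - h (Inf K))
      = (\<Sum>K\<in>F. h (Sup K) - h (Inf K)) - (\<Sum>K\<in>G. h (Sup K) - h (Inf K))"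
    proof
    fix h :: "real \<Rightarrow> real"
    let ?h = "\<lambda>K. h (Sup K) - h (Inf K)"
    have fq: "finite (q L)" if "L \<in> F" for L using q(2)[OF that] by (rule division_of_finite)
    have "(\<Sum>K\<in>H. ?h K) = (\<Sum>L\<in>F. \<Sum>K\<in>q L - GL L. ?h K)"
      unfolding H_def using F(1) fq qdis by (intro sum.UNION_disjoint) auto
    also have "\<dots> = (\<Sum>L\<in>F. ?h L - (\<Sum>K\<in>GL L. ?h K))"
    proof (rule sum.cong[OF refl])
      fix L assume L: "L \<in> F"
      obtain u v where uv: "u < v" "L = {u..v}" using F(3)[OF L] by (auto simp: nondeg_def)
      then have "(\<Sum>K\<in>q L. ?h K) = ?h L" using division_increment[of "q L" u v h] q(2)[OF L] by simp
      then show "(\<Sum>K\<in>q L - GL L. ?h K) = ?h L - (\<Sum>K\<in>GL L. ?h K)"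
        using q(1)[OF L] fq[OF L] by (simp add: sum_diff)
    qed
    also have "\<dots> = (\<Sum>L\<in>F. ?h L) - (\<Sum>L\<in>F. \<Sum>K\<in>GL L. ?h K)" by (rule sum_subtractf)
    also have "(\<Sum>L\<in>F. \<Sum>K\<in>GL L. ?h K) = (\<Sum>K\<in>G. ?h K)"
    proof -
      have "GL L \<inter> GL L' = {}" if "L \<in> F" "L' \<in> F" "L \<noteq> L'" for L L'
        using qdis[OF that] q(1) that by blast
      then show ?thesis
        unfolding G_eq using F(1) G(1) by (intro sum.UNION_disjoint[symmetric]) (auto simp: GL_def)
    qed
    finally show "(\<Sum>K\<in>H. ?h K) = (\<Sum>K\<in>F. ?h K) - (\<Sum>K\<in>G. ?h K)" .
    qed
  qed
qed

lemma measure_disjoint_intervals: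
  assumes "finite F" "pairwise disjnt F" "\<And>K. K \<in> F \<Longrightarrow> nondeg K"
  shows "\<Union>F \<in> lmeasurable" "measure lebesgue (\<Union>F) = (\<Sum>K\<in>F. Sup K - Inf K)"
proof -
  show "\<Union>F \<in> lmeasurable" using assms nondegD(3) by (intro fmeasurable.finite_Union) auto
  have "measure lebesgue (\<Union>F) = (\<Sum>K\<in>F. measure lebesgue K)"
    using assms nondegD(3)
    by (intro measure_negligible_finite_Union) (auto simp: pairwise_def disjnt_def)
  then show "measure lebesgue (\<Union>F) = (\<Sum>K\<in>F. Sup K - Inf K)" using assms nondegD(4) by simp
qed

section \<open>Almost everywhere differentiability\<close>

text \<open>
  The intervals with property \<open>P\<close> that contain \<open>x\<close> form a Vitali cover at \<open>x\<close>.
\<close>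

definition fine_cover :: "(real set \<Rightarrow> bool) \<Rightarrow> real \<Rightarrow> real \<Rightarrow> real \<Rightarrow> bool" where
  "fine_cover P a b x \<longleftrightarrow> (\<forall>d>0. \<exists>K. nondeg K \<and> K \<subseteq> {a<..<b} \<and> x \<in> K \<and> Sup K - Inf K < d \<and> P K)"

lemma fine_cover_restrict:
  assumes x: "fine_cover P a b x" "open U" "x \<in> U" "d > 0"
  shows "\<exists>K. nondeg K \<and> K \<subseteq> {a<..<b} \<and> x \<in> K \<and> Sup K - Inf K < d \<and> P K \<and> K \<subseteq> U"
proof -
  obtain r where r: "r > 0" "ball x r \<subseteq> U" using x(2,3) by (auto simp: open_contains_ball)
  obtain K where K: "nondeg K" "K \<subseteq> {a<..<b}" "x \<in> K" "Sup K - Inf K < min d r" "P K"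
    using x(1,4) r(1) unfolding fine_cover_def by (metis min_less_iff_conj)
  have "K \<subseteq> ball x r"
  proof
    fix y assume "y \<in> K"
    then have "Inf K \<le> y" "y \<le> Sup K" "Inf K \<le> x" "x \<le> Sup K" using nondegD(1)[OF K(1)] K(3) by (metis atLeastAtMost_iff)+
    then show "y \<in> ball x r" using K(4) by (auto simp: dist_real_def abs_less_iff)
  qed
  then show ?thesis using K r by (intro exI[of _ K]) auto
qed

text \<open>
  Let \<open>s\<close> be the outer measure of the set. Vitali's theorem provides disjoint intervals \<open>F\<close> of slope below
  \<open>p\<close> that fill the set up to measure \<open>\<eta>\<close>, and inside them disjoint intervals \<open>G\<close> of slope above \<open>q\<close> doing the
  same; both families have total length close to \<open>s\<close>. The gaps therefore have small total length, and by
  absolute continuity \<open>g\<close> increases over \<open>F\<close> and over \<open>G\<close> by nearly the same amount. But these amounts are at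
  most about \<open>p s\<close> and at least about \<open>q s\<close>, so \<open>s = 0\<close>.
\<close>

lemma ac_real_slope_gap:
  assumes ac: "ac_real a b g" and pq: "p < q"
  shows "negligible {x \<in> {a<..<b}. fine_cover (\<lambda>K. g (Sup K) - g (Inf K) < p * (Sup K - Inf K)) a b x
      \<and> fine_cover (\<lambda>K. g (Sup K) - g (Inf K) > q * (Sup K - Inf K)) a b x}" (is "negligible ?E")
proof -
  define P where "P K \<longleftrightarrow> g (Sup K) - g (Inf K) < p * (Sup K - Inf K)" for K
  define Q where "Q K \<longleftrightarrow> g (Sup K) - g (Inf K) > q * (Sup K - Inf K)" for K
  define E where "E = ?E"
  have EP: "fine_cover P a b x" and EQ: "fine_cover Q a b x" and Eab: "x \<in> {a<..<b}" if "x \<in> E" for x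
    using that by (auto simp: E_def P_def[abs_def] Q_def[abs_def])
  \<comment> \<open>outer measure, since measurability of the exceptional set is not known in advance\<close>
  define ms where "ms = measure lebesgue ` {W \<in> lmeasurable. E \<subseteq> W}"
  have ne: "ms \<noteq> {}" and bb: "bdd_below ms"
    unfolding ms_def using Eab by (auto intro!: exI[of _ "{a<..<b}"] bdd_belowI[of _ 0])
  define s where "s = Inf ms"
  have s_le: "s \<le> measure lebesgue W" if "W \<in> lmeasurable" "E \<subseteq> W" for W
    unfolding s_def using bb that by (intro cInf_lower) (auto simp: ms_def)
  have s_ex: "\<exists>W\<in>lmeasurable. E \<subseteq> W \<and> measure lebesgue W < s + e" if "e > 0" for e
  proof -
    have "Inf ms < s + e" using that by (simp add: s_def)
    then show ?thesis using cInf_lessD[OF ne] by (auto simp: ms_def)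
  qed
  have "s \<le> 0"
  proof (rule ccontr)
    assume "\<not> s \<le> 0"
    then have s: "s > 0" by simp
    define \<epsilon> where "\<epsilon> = (q - p) * s / 4"
    have \<epsilon>: "\<epsilon> > 0" using pq s by (simp add: \<epsilon>_def)
    obtain \<delta> where \<delta>: "\<delta> > 0" and small: "\<And>D. D division_of \<Union>D \<Longrightarrow> \<Union>D \<subseteq> {a..b} \<Longrightarrow>
       (\<Sum>K\<in>D. Sup K - Inf K) < \<delta> \<Longrightarrow> (\<Sum>K\<in>D. \<bar>g (Sup K) - g (Inf K)\<bar>) < \<epsilon>"
      using ac \<epsilon> unfolding ac_real_def by blast
    define \<eta> where "\<eta> = min (\<delta> / 4) (\<epsilon> / (2 * \<bar>p\<bar> + 2 * \<bar>q\<bar> + 1))"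
    have \<eta>: "\<eta> > 0" "4 * \<eta> \<le> \<delta>" using \<delta> \<epsilon> by (auto simp: \<eta>_def)
    have \<eta>2: "\<eta> * (2 * \<bar>p\<bar> + 2 * \<bar>q\<bar>) \<le> \<epsilon>"
    proof -
      have "\<eta> * (2 * \<bar>p\<bar> + 2 * \<bar>q\<bar> + 1) \<le> \<epsilon>"
        using pos_le_divide_eq[of "2 * \<bar>p\<bar> + 2 * \<bar>q\<bar> + 1" \<eta> \<epsilon>] by (simp add: \<eta>_def)
      moreover have "\<eta> * (2 * \<bar>p\<bar> + 2 * \<bar>q\<bar>) \<le> \<eta> * (2 * \<bar>p\<bar> + 2 * \<bar>q\<bar> + 1)" using \<eta>(1) by (intro mult_left_mono) auto
      ultimately show ?thesis by linarith
    qed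
    obtain W0 where W0: "W0 \<in> lmeasurable" "E \<subseteq> W0" "measure lebesgue W0 < s + \<eta>" using s_ex[OF \<eta>(1)] by blast
    obtain U where U: "open U" "W0 \<subseteq> U" "U - W0 \<in> lmeasurable" "emeasure lebesgue (U - W0) < ennreal \<eta>"
      using sets_lebesgue_outer_open[OF fmeasurableD[OF W0(1)] \<eta>(1)] by blast
    have UW: "measure lebesgue (U - W0) < \<eta>"
      using U(3,4) \<eta>(1) by (simp add: emeasure_eq_measure2 ennreal_less_iff)
    have Um: "U \<in> lmeasurable"
      using fmeasurable.Un[OF W0(1) U(3)] U(2) by (simp add: Un_absorb1)
    have mU: "measure lebesgue U < s + 2 * \<eta>"
    proof -
      have "measure lebesgue U \<le> measure lebesgue W0 + measure lebesgue (U - W0)"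
        using measure_Un_le[of W0 lebesgue "U - W0"] W0 U by (simp add: Un_absorb1 fmeasurableD)
      then show ?thesis using UW W0(3) by linarith
    qed
    define KP where "KP = {K. nondeg K \<and> K \<subseteq> {a<..<b} \<and> P K \<and> K \<subseteq> U}"
    obtain F W1 where F: "finite F" "F \<subseteq> KP" "pairwise disjnt F" and W1: "W1 \<in> lmeasurable" "measure lebesgue W1 < \<eta>"
      and EF: "E \<subseteq> \<Union>F \<union> W1"
    proof (rule vitali_finite[of KP a b E \<eta>])
      show "nondeg K" "K \<subseteq> {a..b}" if "K \<in> KP" for K using that by (auto simp: KP_def)
      show "\<exists>K\<in>KP. x \<in> K \<and> Sup K - Inf K < d" if "x \<in> E" "d > 0" for x d
        using fine_cover_restrict[OF EP[OF that(1)] U(1) _ that(2)] that W0(2) U(2) unfolding KP_def by blast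
    qed (use \<eta> in auto)
    have Fn: "nondeg K" "P K" "K \<subseteq> {a<..<b}" "K \<subseteq> U" if "K \<in> F" for K using that F(2) by (auto simp: KP_def)
    have mF: "\<Union>F \<in> lmeasurable" "measure lebesgue (\<Union>F) = (\<Sum>K\<in>F. Sup K - Inf K)"
      using measure_disjoint_intervals[OF F(1,3)] Fn(1) by auto
    define V where "V = (\<Union>K\<in>F. interior K)"
    define KQ where "KQ = {J. nondeg J \<and> J \<subseteq> {a<..<b} \<and> Q J \<and> (\<exists>K\<in>F. J \<subseteq> K)}"
    obtain G W2 where G: "finite G" "G \<subseteq> KQ" "pairwise disjnt G" and W2: "W2 \<in> lmeasurable" "measure lebesgue W2 < \<eta>"
      and EG: "E \<inter> V \<subseteq> \<Union>G \<union> W2"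
    proof (rule vitali_finite[of KQ a b "E \<inter> V" \<eta>])
      show "nondeg K" "K \<subseteq> {a..b}" if "K \<in> KQ" for K using that by (auto simp: KQ_def)
      show "\<exists>K\<in>KQ. x \<in> K \<and> Sup K - Inf K < d" if x: "x \<in> E \<inter> V" "d > 0" for x d
      proof -
        obtain K where K: "K \<in> F" "x \<in> interior K" using x by (auto simp: V_def)
        have "x \<in> E" using x by blast
        from fine_cover_restrict[OF EQ[OF this] open_interior K(2) x(2)]
        show ?thesis using K interior_subset[of K] unfolding KQ_def by blast
      qed
    qed (use \<eta> in auto)
    have Gn: "nondeg K" "Q K" "\<exists>L\<in>F. K \<subseteq> L" if "K \<in> G" for K using that G(2) by (auto simp: KQ_def)
    have mG: "\<Union>G \<in> lmeasurable" "measure lebesgue (\<Union>G) = (\<Sum>K\<in>G. Sup K - Inf K)"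
      using measure_disjoint_intervals[OF G(1,3)] Gn(1) by auto
    define N where "N = (\<Union>K\<in>F. {Inf K, Sup K})"
    have N: "finite N" using F(1) by (simp add: N_def)
    have FV: "\<Union>F \<subseteq> V \<union> N"
    proof
      fix x assume "x \<in> \<Union>F"
      then obtain K where K: "K \<in> F" "x \<in> K" by blast
      then have "x \<in> {Inf K..Sup K}" using nondegD(1)[OF Fn(1)] by blast
      moreover have "interior K = {Inf K<..<Sup K}" by (metis nondegD(1)[OF Fn(1)[OF K(1)]] interior_atLeastAtMost_real)
      ultimately show "x \<in> V \<union> N" using K(1) by (force simp: V_def N_def)
    qed
    define lF where "lF = (\<Sum>K\<in>F. Sup K - Inf K)"
    define lG where "lG = (\<Sum>K\<in>G. Sup K - Inf K)"
    have lF1: "lF < s + 2 * \<eta>"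
    proof -
      have "lF \<le> measure lebesgue U"
        unfolding lF_def mF(2)[symmetric] using Fn(4) mF(1) Um by (intro measure_mono_fmeasurable) (auto simp: fmeasurableD)
      then show ?thesis using mU by linarith
    qed
    have lF2: "s - 2 * \<eta> < lF"
    proof -
      have "s \<le> measure lebesgue (\<Union>F \<union> W1)" using EF mF(1) W1(1) by (intro s_le fmeasurable.Un)
      also have "\<dots> \<le> lF + measure lebesgue W1"
        unfolding lF_def mF(2)[symmetric] using mF(1) W1(1) by (intro measure_Un_le) (auto simp: fmeasurableD)
      finally show ?thesis using W1(2) \<eta>(1) by linarith
    qed
    have lG2: "s - 2 * \<eta> < lG"
    proof -
      have Nm: "N \<in> lmeasurable" "measure lebesgue N = 0"
        using negligible_finite[OF N] by (auto simp: negligible_imp_measurable negligible_imp_measure0)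
      have "E \<subseteq> \<Union>G \<union> (W2 \<union> (W1 \<union> N))" using EF FV EG by blast
      then have "s \<le> measure lebesgue (\<Union>G \<union> (W2 \<union> (W1 \<union> N)))"
        using mG(1) W1(1) W2(1) Nm by (intro s_le fmeasurable.Un)
      also have "\<dots> \<le> lG + measure lebesgue (W2 \<union> (W1 \<union> N))"
        unfolding lG_def mG(2)[symmetric] using mG(1) W1(1) W2(1) Nm by (intro measure_Un_le) (auto simp: fmeasurableD)
      also have "measure lebesgue (W2 \<union> (W1 \<union> N)) \<le> measure lebesgue W2 + measure lebesgue (W1 \<union> N)"
        using W1(1) W2(1) Nm by (intro measure_Un_le) (auto simp: fmeasurableD)
      also have "measure lebesgue (W1 \<union> N) \<le> measure lebesgue W1 + measure lebesgue N"
        using W1(1) Nm by (intro measure_Un_le) (auto simp: fmeasurableD)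
      finally show ?thesis using W1(2) W2(2) Nm(2) by linarith
    qed
    have lG1: "lG \<le> lF"
      unfolding lF_def lG_def mF(2)[symmetric] mG(2)[symmetric]
      using Gn(3) mF(1) mG(1) by (intro measure_mono_fmeasurable) (auto simp: fmeasurableD)
    have Fn1: "nondeg K" if "K \<in> F" for K by (rule Fn(1)[OF that])
    have Gn1: "nondeg K \<and> (\<exists>L\<in>F. K \<subseteq> L)" if "K \<in> G" for K using Gn(1,3)[OF that] by blast
    obtain H where H: "H division_of \<Union>H" "\<Union>H \<subseteq> \<Union>F"
      and Hs0: "\<forall>h :: real \<Rightarrow> real. (\<Sum>K\<in>H. h (Sup K) - h (Inf K))
      = (\<Sum>K\<in>F. h (Sup K) - h (Inf K)) - (\<Sum>K\<in>G. h (Sup K) - h (Inf K))"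
      by (rule division_gaps[OF F(1,3) Fn1 G(1,3) Gn1])
    note Hs = Hs0[rule_format]
    have "(\<Sum>K\<in>H. \<bar>g (Sup K) - g (Inf K)\<bar>) < \<epsilon>"
    proof (rule small[OF H(1)])
      show "\<Union>H \<subseteq> {a..b}" using H(2) Fn(3) by force
      show "(\<Sum>K\<in>H. Sup K - Inf K) < \<delta>"
        using Hs[of "\<lambda>x. x"] lF1 lG2 \<eta>(2) by (simp add: lF_def lG_def)
    qed
    moreover have "\<bar>\<Sum>K\<in>H. g (Sup K) - g (Inf K)\<bar> \<le> (\<Sum>K\<in>H. \<bar>g (Sup K) - g (Inf K)\<bar>)" by (rule sum_abs)
    ultimately have "- \<epsilon> < (\<Sum>K\<in>F. g (Sup K) - g (Inf K)) - (\<Sum>K\<in>G. g (Sup K) - g (Inf K))"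
      using Hs[of g] by linarith
    moreover have "(\<Sum>K\<in>F. g (Sup K) - g (Inf K)) \<le> p * lF"
      unfolding lF_def sum_distrib_left using Fn(2) by (intro sum_mono) (auto simp: P_def intro: less_imp_le)
    moreover have "q * lG \<le> (\<Sum>K\<in>G. g (Sup K) - g (Inf K))"
      unfolding lG_def sum_distrib_left using Gn(2) by (intro sum_mono) (auto simp: Q_def intro: less_imp_le)
    ultimately have "q * lG - p * lF < \<epsilon>" by linarith
    moreover have "q * (lG - s) \<ge> - (\<bar>q\<bar> * (2 * \<eta>))"
    proof -
      have "\<bar>q * (lG - s)\<bar> \<le> \<bar>q\<bar> * (2 * \<eta>)"
        unfolding abs_mult using lG1 lG2 lF1 by (intro mult_left_mono) auto
      then show ?thesis by linarith
    qed
    moreover have "p * (lF - s) \<le> \<bar>p\<bar> * (2 * \<eta>)"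
    proof -
      have "\<bar>p * (lF - s)\<bar> \<le> \<bar>p\<bar> * (2 * \<eta>)"
        unfolding abs_mult using lF1 lF2 by (intro mult_left_mono) auto
      then show ?thesis by linarith
    qed
    ultimately have "(q - p) * s - \<eta> * (2 * \<bar>p\<bar> + 2 * \<bar>q\<bar>) < \<epsilon>" by (simp add: algebra_simps)
    moreover have "(q - p) * s = 4 * \<epsilon>" by (simp add: \<epsilon>_def)
    ultimately show False using \<eta>2 \<epsilon> by linarith
  qed
  have "\<exists>T. E \<subseteq> T \<and> T \<in> lmeasurable \<and> measure lebesgue T < e" if e: "e > 0" for e
  proof -
    obtain W where "W \<in> lmeasurable" "E \<subseteq> W" "measure lebesgue W < s + e" using s_ex[OF e] by blast
    then show ?thesis using \<open>s \<le> 0\<close> by (intro exI[of _ W]) auto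
  qed
  then show ?thesis unfolding negligible_outer E_def by blast
qed

lemma ac_realD:
  assumes "ac_real a b g" "\<epsilon> > 0"
  obtains \<delta> where "\<delta> > 0" "\<forall>D. D division_of \<Union>D \<longrightarrow> \<Union>D \<subseteq> {a..b} \<longrightarrow>
     (\<Sum>K\<in>D. Sup K - Inf K) < \<delta> \<longrightarrow> (\<Sum>K\<in>D. \<bar>g (Sup K) - g (Inf K)\<bar>) < \<epsilon>"
  using assms unfolding ac_real_def by blast

lemma ac_real_subinterval:
  assumes "ac_real a b g" "{c..d} \<subseteq> {a..b}"
  shows "ac_real c d g"
  unfolding ac_real_def
proof (intro allI impI)
  fix \<epsilon> :: real assume "\<epsilon> > 0"
  then obtain \<delta> where "\<delta> > 0" and small0: "\<forall>D. D division_of \<Union>D \<longrightarrow> \<Union>D \<subseteq> {a..b} \<longrightarrow>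
     (\<Sum>K\<in>D. Sup K - Inf K) < \<delta> \<longrightarrow> (\<Sum>K\<in>D. \<bar>g (Sup K) - g (Inf K)\<bar>) < \<epsilon>"
    by (rule ac_realD[OF assms(1)])
  then show "\<exists>\<delta>>0. \<forall>D. D division_of \<Union>D \<longrightarrow> \<Union>D \<subseteq> {c..d} \<longrightarrow>
     (\<Sum>K\<in>D. Sup K - Inf K) < \<delta> \<longrightarrow> (\<Sum>K\<in>D. \<bar>g (Sup K) - g (Inf K)\<bar>) < \<epsilon>"
    using assms(2) by (meson subset_trans)
qed

lemma disjoint_intervals_division:
  assumes "finite F" "pairwise disjnt F" "\<And>K. K \<in> F \<Longrightarrow> nondeg K"
  shows "F division_of \<Union>F"
  unfolding division_of_def
proof (intro conjI ballI impI)
  fix K assume K: "K \<in> F"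
  obtain u v where uv: "u < v" "K = {u..v}" using assms(3)[OF K] unfolding nondeg_def by blast
  then show "K \<noteq> {}" by simp
  show "\<exists>a b. K = cbox a b" using uv(2) by (metis box_real(2))
  show "K \<subseteq> \<Union>F" using K by blast
  fix K' assume "K' \<in> F" "K \<noteq> K'"
  then have "K \<inter> K' = {}" using assms(2) K by (auto simp: pairwise_def disjnt_def)
  then show "interior K \<inter> interior K' = {}" using interior_subset[of K] interior_subset[of K'] by blast
qed (use assms in auto)

text \<open>
  Locally, a disjoint family of intervals of slope above \<open>n\<close> has increments summing to less than \<open>1\<close> by
  absolute continuity, hence total length below \<open>1/n\<close>.
\<close>

lemma ac_real_infinite_slope:
  assumes ac: "ac_real a b g"
  shows "negligible {x \<in> {a<..<b}. \<forall>n::nat. fine_cover (\<lambda>K. \<bar>g (Sup K) - g (Inf K)\<bar> > real n * (Sup K - Inf K)) a b x}"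
    (is "negligible ?E")
proof (rule locally_negligible_alt[THEN iffD2], rule ballI)
  define P where "P n K \<longleftrightarrow> \<bar>g (Sup K) - g (Inf K)\<bar> > real n * (Sup K - Inf K)" for n :: nat and K
  fix x0 assume x0: "x0 \<in> ?E"
  obtain \<delta> where \<delta>: "\<delta> > 0" and small0: "\<forall>D. D division_of \<Union>D \<longrightarrow> \<Union>D \<subseteq> {a..b} \<longrightarrow>
     (\<Sum>K\<in>D. Sup K - Inf K) < \<delta> \<longrightarrow> (\<Sum>K\<in>D. \<bar>g (Sup K) - g (Inf K)\<bar>) < 1"
    by (rule ac_realD[OF ac zero_less_one])
  note small = small0[rule_format]
  define U where "U = ball x0 (\<delta> / 4)"
  have Um: "U \<in> lmeasurable" "measure lebesgue U < \<delta>"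
    using \<delta> by (auto simp: U_def ball_eq_greaterThanLessThan)
  define E where "E = ?E \<inter> U"
  have fc: "fine_cover (P n) a b x" if "x \<in> E" for x n
    using that by (auto simp: E_def P_def[abs_def])
  have "negligible E"
    unfolding negligible_outer_le
  proof (intro allI impI)
    fix e :: real assume "e > 0"
    then obtain n0 :: nat where "1 / (e / 2) < real n0" using reals_Archimedean2 by blast
    then have n0e: "2 < e * real n0" using \<open>e > 0\<close> by (simp add: field_simps)
    then have n: "n0 > 0" by (auto intro!: gr0I)
    then have n: "1 / real n0 \<le> e / 2" "n0 > 0" using n0e by (simp_all add: field_simps)
    define KS where "KS = {K. nondeg K \<and> K \<subseteq> {a<..<b} \<and> P n0 K \<and> K \<subseteq> U}"
    have e2: "e / 2 > 0" using \<open>e > 0\<close> by simp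
    have c1: "nondeg K" "K \<subseteq> {a..b}" if "K \<in> KS" for K using that by (auto simp: KS_def)
    have c2: "\<exists>K\<in>KS. x \<in> K \<and> Sup K - Inf K < d" if x: "x \<in> E" "d > 0" for x d
    proof -
      have "x \<in> U" "open U" using x by (auto simp: E_def U_def)
      from fine_cover_restrict[OF fc[OF x(1)] this(2,1) x(2)]
      show ?thesis unfolding KS_def by blast
    qed
    obtain F W where F: "finite F" "F \<subseteq> KS" "pairwise disjnt F" and W: "W \<in> lmeasurable" "measure lebesgue W < e / 2"
      and EF: "E \<subseteq> \<Union>F \<union> W"
      by (rule vitali_finite[OF c1 c2 e2])
    have Fn: "nondeg K" "P n0 K" "K \<subseteq> {a<..<b}" "K \<subseteq> U" if "K \<in> F" for K using that F(2) by (auto simp: KS_def)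
    have mF: "\<Union>F \<in> lmeasurable" "measure lebesgue (\<Union>F) = (\<Sum>K\<in>F. Sup K - Inf K)"
      using measure_disjoint_intervals[OF F(1,3)] Fn(1) by auto
    have "measure lebesgue (\<Union>F) \<le> measure lebesgue U"
      using Fn(4) mF(1) Um by (intro measure_mono_fmeasurable) (auto simp: fmeasurableD)
    then have "(\<Sum>K\<in>F. Sup K - Inf K) < \<delta>" using Um(2) mF(2) by linarith
    moreover have "F division_of \<Union>F" using disjoint_intervals_division[OF F(1,3)] Fn(1) by blast
    moreover have "\<Union>F \<subseteq> {a..b}" using Fn(3) by force
    ultimately have "(\<Sum>K\<in>F. \<bar>g (Sup K) - g (Inf K)\<bar>) < 1" using small by blast
    moreover have "real n0 * (\<Sum>K\<in>F. Sup K - Inf K) \<le> (\<Sum>K\<in>F. \<bar>g (Sup K) - g (Inf K)\<bar>)"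
      unfolding sum_distrib_left using Fn(2) by (intro sum_mono) (auto simp: P_def intro: less_imp_le)
    ultimately have "measure lebesgue (\<Union>F) \<le> 1 / real n0"
      using n(2) unfolding mF(2) by (simp add: field_simps)
    then have "measure lebesgue (\<Union>F) \<le> e / 2" using n(1) by linarith
    moreover have "measure lebesgue (\<Union>F \<union> W) \<le> measure lebesgue (\<Union>F) + measure lebesgue W"
      using mF(1) W(1) by (intro measure_Un_le) (auto simp: fmeasurableD)
    ultimately have "measure lebesgue (\<Union>F \<union> W) \<le> e" using W(2) by linarith
    then show "\<exists>T. E \<subseteq> T \<and> T \<in> lmeasurable \<and> measure lebesgue T \<le> e"
      using EF mF(1) W(1) by (intro exI[of _ "\<Union>F \<union> W"]) (auto intro: fmeasurable.Un)
  qed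
  moreover have "openin (top_of_set ?E) E" unfolding E_def U_def by (simp add: openin_open_Int)
  moreover have "x0 \<in> E" using x0 \<delta> by (simp add: E_def U_def)
  ultimately show "\<exists>U. openin (top_of_set ?E) U \<and> x0 \<in> U \<and> negligible U" by blast
qed

lemma frequently_slope_fine_cover:
  assumes x: "x \<in> {a<..<b}" and fr: "\<exists>\<^sub>F y in at x. P ((g y - g x) / (y - x))"
  shows "fine_cover (\<lambda>K. P ((g (Sup K) - g (Inf K)) / (Sup K - Inf K))) a b x"
  unfolding fine_cover_def
proof (intro allI impI)
  fix d :: real assume "d > 0"
  have ev: "\<forall>\<^sub>F y in at x. y \<in> {a<..<b} \<and> dist y x < d \<and> y \<noteq> x"
    using x \<open>d > 0\<close>
    by (intro eventually_conj eventually_at_in_open' eventually_neq_at_within)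
      (auto simp: eventually_at intro!: exI[of _ d])
  obtain y where y: "y \<in> {a<..<b}" "dist y x < d" "y \<noteq> x" "P ((g y - g x) / (y - x))"
    using frequently_ex[OF frequently_eventually_conj[OF fr ev]] by blast
  define K where "K = {min x y..max x y}"
  have IS: "Inf K = min x y" "Sup K = max x y" by (simp_all add: K_def)
  have "(g (Sup K) - g (Inf K)) / (Sup K - Inf K) = (g y - g x) / (y - x)"
    unfolding IS using y(3) minus_divide_divide[of "g x - g y" "x - y"] by (cases "x < y") auto
  moreover have "nondeg K" unfolding nondeg_def K_def using y(3) by (intro exI[of _ "min x y"] exI[of _ "max x y"]) auto
  moreover have "K \<subseteq> {a<..<b}" using x y(1) by (auto simp: K_def)
  moreover have "Sup K - Inf K < d" unfolding IS using y(2) by (auto simp: dist_real_def)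
  moreover have "x \<in> K" by (simp add: K_def)
  ultimately show "\<exists>K. nondeg K \<and> K \<subseteq> {a<..<b} \<and> x \<in> K \<and> Sup K - Inf K < d \<and>
      P ((g (Sup K) - g (Inf K)) / (Sup K - Inf K))"
    using y(4) by (intro exI[of _ K]) simp
qed

lemma fine_cover_cong:
  assumes "\<And>K. nondeg K \<Longrightarrow> P K \<longleftrightarrow> Q K"
  shows "fine_cover P a b x \<longleftrightarrow> fine_cover Q a b x"
  unfolding fine_cover_def using assms by metis

text \<open>
  Outside the union of the exceptional sets for rational \<open>p < q\<close> the difference quotient cannot oscillate, and
  outside the set of infinite slope it is bounded; so it converges.
\<close>

lemma ac_real_differentiable_AE:
  assumes ac: "ac_real a b g"
  obtains N h where "negligible N" "\<forall>x\<in>{a<..<b} - N. (g has_real_derivative h x) (at x)"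
proof -
  define Eg where "Eg p q = {x \<in> {a<..<b}. fine_cover (\<lambda>K. g (Sup K) - g (Inf K) < p * (Sup K - Inf K)) a b x
      \<and> fine_cover (\<lambda>K. g (Sup K) - g (Inf K) > q * (Sup K - Inf K)) a b x}" for p q
  define Ei where "Ei = {x \<in> {a<..<b}. \<forall>n::nat. fine_cover (\<lambda>K. \<bar>g (Sup K) - g (Inf K)\<bar> > real n * (Sup K - Inf K)) a b x}"
  define N where "N = Ei \<union> (\<Union>z\<in>{z\<in>\<rat> \<times> \<rat>. fst z < snd z}. Eg (fst z) (snd z))"
  have N: "negligible N"
    unfolding N_def
  proof (intro negligible_Un negligible_countable_Union)
    show "negligible Ei" unfolding Ei_def by (rule ac_real_infinite_slope[OF ac])
    show "countable ((\<lambda>z. Eg (fst z) (snd z)) ` {z\<in>\<rat> \<times> \<rat>. fst z < snd z})"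
      by (intro countable_image countable_subset[OF _ countable_SIGMA[OF countable_rat countable_rat]]) auto
    show "negligible S" if "S \<in> (\<lambda>z. Eg (fst z) (snd z)) ` {z\<in>\<rat> \<times> \<rat>. fst z < snd z}" for S
      using that ac_real_slope_gap[OF ac] by (auto simp: Eg_def)
  qed
  have "\<exists>L. (g has_real_derivative L) (at x)" if x: "x \<in> {a<..<b} - N" for x
  proof -
    define Q where "Q y = (g y - g x) / (y - x)" for y
    have xab: "x \<in> {a<..<b}" using x by simp
    have gap: "(\<forall>\<^sub>F y in at x. Q y \<ge> p) \<or> (\<forall>\<^sub>F y in at x. Q y \<le> q)" if pq: "p \<in> \<rat>" "q \<in> \<rat>" "p < q" for p q
    proof (rule ccontr)
      assume "\<not> ?thesis"
      then have "\<exists>\<^sub>F y in at x. Q y < p" "\<exists>\<^sub>F y in at x. Q y > q"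
        by (auto simp: not_eventually not_le)
      then have "fine_cover (\<lambda>K. (g (Sup K) - g (Inf K)) / (Sup K - Inf K) < p) a b x"
        "fine_cover (\<lambda>K. (g (Sup K) - g (Inf K)) / (Sup K - Inf K) > q) a b x"
        unfolding Q_def
        using frequently_slope_fine_cover[OF xab, where P = "\<lambda>s. s < p"]
          frequently_slope_fine_cover[OF xab, where P = "\<lambda>s. s > q"] by auto
      moreover have "fine_cover (\<lambda>K. (g (Sup K) - g (Inf K)) / (Sup K - Inf K) < p) a b x
          \<longleftrightarrow> fine_cover (\<lambda>K. g (Sup K) - g (Inf K) < p * (Sup K - Inf K)) a b x"
        by (rule fine_cover_cong) (simp add: pos_divide_less_eq nondegD(2))
      moreover have "fine_cover (\<lambda>K. (g (Sup K) - g (Inf K)) / (Sup K - Inf K) > q) a b x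
          \<longleftrightarrow> fine_cover (\<lambda>K. g (Sup K) - g (Inf K) > q * (Sup K - Inf K)) a b x"
        by (rule fine_cover_cong) (simp add: pos_less_divide_eq nondegD(2))
      ultimately have "x \<in> Eg p q" unfolding Eg_def using xab by simp
      then show False using x pq by (force simp: N_def)
    qed
    have "x \<notin> Ei" using x by (simp add: N_def)
    then obtain n :: nat where n: "\<not> fine_cover (\<lambda>K. \<bar>g (Sup K) - g (Inf K)\<bar> > real n * (Sup K - Inf K)) a b x"
      using xab by (auto simp: Ei_def)
    have bdd: "\<forall>\<^sub>F y in at x. \<bar>Q y\<bar> \<le> real n"
    proof (rule ccontr)
      assume "\<not> ?thesis"
      then have "\<exists>\<^sub>F y in at x. \<bar>Q y\<bar> > real n" by (simp add: not_eventually not_le)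
      then have "fine_cover (\<lambda>K. \<bar>(g (Sup K) - g (Inf K)) / (Sup K - Inf K)\<bar> > real n) a b x"
        unfolding Q_def using frequently_slope_fine_cover[OF xab, where P = "\<lambda>s. \<bar>s\<bar> > real n"] by auto
      moreover have "fine_cover (\<lambda>K. \<bar>(g (Sup K) - g (Inf K)) / (Sup K - Inf K)\<bar> > real n) a b x
          \<longleftrightarrow> fine_cover (\<lambda>K. \<bar>g (Sup K) - g (Inf K)\<bar> > real n * (Sup K - Inf K)) a b x"
      proof (rule fine_cover_cong)
        fix K assume "nondeg K"
        then have "Sup K - Inf K > 0" using nondegD(2) by simp
        then show "(\<bar>(g (Sup K) - g (Inf K)) / (Sup K - Inf K)\<bar> > real n)
            \<longleftrightarrow> (\<bar>g (Sup K) - g (Inf K)\<bar> > real n * (Sup K - Inf K))"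
          by (simp add: abs_divide pos_less_divide_eq)
      qed
      ultimately show False using n by simp
    qed
    define S where "S = {p. p \<in> \<rat> \<and> (\<forall>\<^sub>F y in at x. Q y \<ge> p)}"
    have Sn: "- real n \<in> S"
      using bdd by (auto simp: S_def elim!: eventually_mono)
    have Sb: "p \<le> real n" if "p \<in> S" for p
    proof -
      have "\<forall>\<^sub>F y in at x. p \<le> Q y \<and> \<bar>Q y\<bar> \<le> real n" using that bdd by (intro eventually_conj) (auto simp: S_def)
      then have "\<exists>y. p \<le> Q y \<and> \<bar>Q y\<bar> \<le> real n" using eventually_happens trivial_limit_at by blast
      then show ?thesis by auto
    qed
    define L where "L = Sup S"
    have bS: "bdd_above S" by (rule bdd_aboveI[OF Sb])
    have "(Q \<longlongrightarrow> L) (at x)"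
    proof (rule order_tendstoI)
      fix l assume "l < L"
      then obtain p where p: "p \<in> S" "l < p" using less_cSupD[of S l] Sn by (auto simp: L_def)
      then have "\<forall>\<^sub>F y in at x. Q y \<ge> p" by (simp add: S_def)
      then show "\<forall>\<^sub>F y in at x. l < Q y" by eventually_elim (use p in simp)
    next
      fix u assume "L < u"
      then obtain q where q: "q \<in> \<rat>" "L < q" "q < u" using Rats_dense_in_real by blast
      obtain p where p: "p \<in> \<rat>" "L < p" "p < q" using Rats_dense_in_real[OF q(2)] by blast
      have "\<not> (\<forall>\<^sub>F y in at x. Q y \<ge> p)"
        using p cSup_upper[OF _ bS, of p] by (auto simp: S_def L_def)
      then have "\<forall>\<^sub>F y in at x. Q y \<le> q" using gap[OF p(1) q(1) p(3)] by blast
      then show "\<forall>\<^sub>F y in at x. Q y < u" by eventually_elim (use q in simp)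
    qed
    then show ?thesis unfolding has_field_derivative_iff Q_def by blast
  qed
  then obtain h where "\<And>x. x \<in> {a<..<b} - N \<Longrightarrow> (g has_real_derivative h x) (at x)" by metis
  then show thesis using N that by blast
qed

section \<open>The fundamental theorem of calculus\<close>

text \<open>
  A gauge is chosen so that at points of differentiability the Riemann sum reproduces the increments up to
  \<open>\<eta>\<close> times the length, while intervals tagged in the null set \<open>N\<close> lie in an open set of small measure, where
  the increments are small by absolute continuity and the integrand is \<open>0\<close>.
\<close>

lemma ac_real_FTC:
  assumes ac: "ac_real a b g" and "a \<le> b" and N: "negligible N"
    and der: "\<And>x. x \<in> {a..b} - N \<Longrightarrow> (g has_real_derivative h x) (at x within {a..b})"
    and zero: "\<And>x. x \<in> N \<Longrightarrow> h x = 0"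
  shows "(h has_integral (g b - g a)) {a..b}"
  unfolding has_integral_real
proof (intro allI impI)
  fix \<epsilon> :: real assume "\<epsilon> > 0"
  then have e2: "\<epsilon> / 2 > 0" by simp
  obtain \<delta> where \<delta>: "\<delta> > 0" and small0: "\<forall>D. D division_of \<Union>D \<longrightarrow> \<Union>D \<subseteq> {a..b} \<longrightarrow>
     (\<Sum>K\<in>D. Sup K - Inf K) < \<delta> \<longrightarrow> (\<Sum>K\<in>D. \<bar>g (Sup K) - g (Inf K)\<bar>) < \<epsilon> / 2"
    by (rule ac_realD[OF ac e2])
  note small = small0[rule_format]
  obtain U where U: "open U" "N \<subseteq> U" "U \<in> lmeasurable" "measure lebesgue U < \<delta>"
  proof -
    obtain U where "open U" "N \<subseteq> U" "U - N \<in> lmeasurable" "emeasure lebesgue (U - N) < ennreal \<delta>"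
      using sets_lebesgue_outer_open[OF negligible_imp_sets[OF N] \<delta>] by blast
    moreover from this have "U = (U - N) \<union> N" by blast
    moreover have "measure lebesgue ((U - N) \<union> N) \<le> measure lebesgue (U - N) + measure lebesgue N"
      using calculation N by (intro measure_Un_le) (auto simp: fmeasurableD negligible_imp_sets)
    ultimately show ?thesis
      using \<delta> N fmeasurable.Un[OF _ negligible_imp_measurable[OF N], of "U - N"]
      by (intro that[of U]) (auto simp: emeasure_eq_measure2 ennreal_less_iff negligible_imp_measure0)
  qed
  define \<eta> where "\<eta> = \<epsilon> / (2 * (b - a + 1))"
  have \<eta>: "\<eta> > 0" using \<open>\<epsilon> > 0\<close> \<open>a \<le> b\<close> by (simp add: \<eta>_def)
  have \<eta>b: "\<eta> * (b - a) < \<epsilon> / 2"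
  proof -
    have "\<eta> * (b - a + 1) = \<epsilon> / 2" using \<open>a \<le> b\<close> by (simp add: \<eta>_def field_simps)
    then show ?thesis using \<eta> by (simp add: distrib_left)
  qed
  have "\<exists>d>0. \<forall>y\<in>{a..b}. \<bar>y - x\<bar> < d \<longrightarrow> \<bar>g y - g x - (y - x) * h x\<bar> \<le> \<eta> * \<bar>y - x\<bar>"
    if x: "x \<in> {a..b} - N" for x
    using der[OF x] \<eta> unfolding has_field_derivative_def has_derivative_within_alt
    by (auto simp: mult.commute)
  then obtain d where d: "\<And>x. x \<in> {a..b} - N \<Longrightarrow> d x > 0"
    "\<And>x y. x \<in> {a..b} - N \<Longrightarrow> y \<in> {a..b} \<Longrightarrow> \<bar>y - x\<bar> < d x \<Longrightarrow> \<bar>g y - g x - (y - x) * h x\<bar> \<le> \<eta> * \<bar>y - x\<bar>"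
    by metis
  \<comment> \<open>tags in the null set are confined to the small open set \<open>U\<close>\<close>
  define \<gamma> where "\<gamma> x = (if x \<in> N then U else if x \<in> {a..b} then ball x (d x) else ball x 1)" for x
  have gg: "gauge \<gamma>" unfolding gauge_def \<gamma>_def using U(1,2) d(1) by auto
  have main: "norm ((\<Sum>(x, k)\<in>p. measure lborel k *\<^sub>R h x) - (g b - g a)) < \<epsilon>"
    if p: "p tagged_division_of {a..b}" and fine: "\<gamma> fine p" for p
  proof -
    have fp: "finite p" using p by auto
    have pK: "K = {Inf K..Sup K}" "Inf K \<le> Sup K" "x \<in> {Inf K..Sup K}" "{Inf K..Sup K} \<subseteq> {a..b}" "K \<subseteq> \<gamma> x"
        "measure lborel K = Sup K - Inf K" if xK: "(x, K) \<in> p" for x K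
    proof -
      obtain u v where uv: "K = {u..v}" using tagged_division_ofD(4)[OF p xK] by (metis box_real(2))
      have "x \<in> K" "K \<subseteq> {a..b}" using tagged_division_ofD(2,3)[OF p xK] by auto
      moreover from this uv have "u \<le> v" by simp
      ultimately show "K = {Inf K..Sup K}" "Inf K \<le> Sup K" "x \<in> {Inf K..Sup K}" "{Inf K..Sup K} \<subseteq> {a..b}"
        "measure lborel K = Sup K - Inf K" using uv by auto
      show "K \<subseteq> \<gamma> x" using fine xK by (auto simp: fine_def)
    qed
    define err where "err z = (case z of (x, K) \<Rightarrow> measure lborel K * h x - (g (Sup K) - g (Inf K)))" for z
    define pN where "pN = {z \<in> p. fst z \<in> N}"
    have "(\<Sum>(x, k)\<in>p. measure lborel k *\<^sub>R h x) - (g b - g a) = (\<Sum>z\<in>p. err z)"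
      unfolding additive_tagged_division_1[OF \<open>a \<le> b\<close> p, of g, symmetric] sum_subtractf[symmetric] err_def
      by (intro sum.cong) auto
    also have "\<dots> = (\<Sum>z\<in>pN. err z) + (\<Sum>z\<in>p - pN. err z)"
      using fp by (intro sum.subset_diff[THEN trans[OF _ add.commute]]) (auto simp: pN_def)
    finally have eq: "(\<Sum>(x, k)\<in>p. measure lborel k *\<^sub>R h x) - (g b - g a) = (\<Sum>z\<in>pN. err z) + (\<Sum>z\<in>p - pN. err z)" .
    have "\<bar>\<Sum>z\<in>p - pN. err z\<bar> \<le> (\<Sum>z\<in>p - pN. \<eta> * (measure lborel (snd z)))"
    proof (rule order_trans[OF sum_abs sum_mono])
      fix z assume "z \<in> p - pN"
      then obtain x K where z: "z = (x, K)" "(x, K) \<in> p" "x \<notin> N" by (cases z) (auto simp: pN_def)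
      note K = pK[OF z(2)]
      have x: "x \<in> {a..b} - N" using K z(3) by auto
      have "K \<subseteq> ball x (d x)" using K(5) x by (simp add: \<gamma>_def)
      then have "Inf K \<in> ball x (d x)" "Sup K \<in> ball x (d x)" using K(1,2) by (metis atLeastAtMost_iff order_refl subsetD)+
      then have near: "\<bar>Inf K - x\<bar> < d x" "\<bar>Sup K - x\<bar> < d x" by (simp_all add: dist_real_def abs_minus_commute)
      have mem: "Inf K \<in> {a..b}" "Sup K \<in> {a..b}" using K(2,4) by auto
      have 1: "\<bar>g (Inf K) - g x - (Inf K - x) * h x\<bar> \<le> \<eta> * \<bar>Inf K - x\<bar>"
        "\<bar>g (Sup K) - g x - (Sup K - x) * h x\<bar> \<le> \<eta> * \<bar>Sup K - x\<bar>"
        by (rule d(2)[OF x mem(1) near(1)], rule d(2)[OF x mem(2) near(2)])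
      have "err z = (g (Inf K) - g x - (Inf K - x) * h x) - (g (Sup K) - g x - (Sup K - x) * h x)"
        by (simp add: err_def z K(6) algebra_simps)
      then have "\<bar>err z\<bar> \<le> \<eta> * \<bar>Inf K - x\<bar> + \<eta> * \<bar>Sup K - x\<bar>" using 1 by linarith
      also have "\<dots> = \<eta> * (Sup K - Inf K)" using K(3) by (simp add: algebra_simps)
      finally show "\<bar>err z\<bar> \<le> \<eta> * measure lborel (snd z)" by (simp add: z K(6))
    qed
    also have "\<dots> \<le> (\<Sum>z\<in>p. \<eta> * measure lborel (snd z))"
      using fp \<eta> by (intro sum_mono2) auto
    also have "\<dots> = \<eta> * (b - a)"
      using additive_content_tagged_division[of p a b] p \<open>a \<le> b\<close>
      by (simp add: sum_distrib_left[symmetric] case_prod_unfold)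
    finally have part1: "\<bar>\<Sum>z\<in>p - pN. err z\<bar> < \<epsilon> / 2" using \<eta>b by linarith
    have part2: "\<bar>\<Sum>z\<in>pN. err z\<bar> < \<epsilon> / 2"
    proof -
      define D where "D = snd ` {z \<in> pN. measure lborel (snd z) \<noteq> 0}"
      have fpN: "finite pN" using fp by (simp add: pN_def)
      have sub: "(x, K) \<in> p" "x \<in> N" if "(x, K) \<in> pN" for x K using that by (auto simp: pN_def)
      have nd: "nondeg K" if "(x, K) \<in> pN" "measure lborel K \<noteq> 0" for x K
        unfolding nondeg_def using pK(1,2,6)[OF sub(1)[OF that(1)]] that(2)
        by (intro exI[of _ "Inf K"] exI[of _ "Sup K"]) auto
      have int: "interior K \<inter> interior K' = {}" if "(x, K) \<in> pN" "(x', K') \<in> pN" "(x, K) \<noteq> (x', K')" for x K x' K'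
        using tagged_division_ofD(5)[OF p sub(1)[OF that(1)] sub(1)[OF that(2)] that(3)] .
      have ndint: "interior K \<noteq> {}" if "nondeg K" for K
        using that by (auto simp: nondeg_def interior_atLeastAtMost_real)
      have inj: "inj_on snd {z \<in> pN. measure lborel (snd z) \<noteq> 0}"
      proof (rule inj_onI, clarsimp)
        fix x K x' assume "(x, K) \<in> pN" "(x', K) \<in> pN" "measure lborel K \<noteq> 0"
        then show "x = x'" using int[of x K x' K] ndint[OF nd] by auto
      qed
      have Ddiv: "D division_of \<Union>D"
        unfolding division_of_def
      proof (intro conjI ballI impI)
        show "finite D" using fpN by (simp add: D_def)
        fix K assume "K \<in> D"
        then obtain x where xK: "(x, K) \<in> pN" "measure lborel K \<noteq> 0" by (auto simp: D_def)
        show "K \<noteq> {}" using xK by auto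
        show "\<exists>a b. K = cbox a b" using tagged_division_ofD(4)[OF p sub(1)[OF xK(1)]] .
        show "K \<subseteq> \<Union>D" using \<open>K \<in> D\<close> by blast
        fix K' assume "K' \<in> D" "K \<noteq> K'"
        from \<open>K' \<in> D\<close> obtain x' where "(x', K') \<in> pN" unfolding D_def by force
        then show "interior K \<inter> interior K' = {}" using int[OF xK(1), of x' K'] \<open>K \<noteq> K'\<close> by blast
      qed simp
      have DU: "\<Union>D \<subseteq> U" using pK(5) sub by (force simp: D_def \<gamma>_def)
      have "(\<Sum>K\<in>D. Sup K - Inf K) = (\<Sum>K\<in>D. measure lborel K)"
      proof (rule sum.cong[OF refl])
        fix K assume "K \<in> D"
        then obtain x where "(x, K) \<in> pN" by (auto simp: D_def)
        then show "Sup K - Inf K = measure lborel K" using pK(6)[OF sub(1)] by simp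
      qed
      also have "\<dots> = (\<Sum>K\<in>D. measure lebesgue K)"
        using Ddiv by (intro sum.cong refl) (auto simp: measure_completion dest!: division_ofD(4))
      also have "\<dots> = measure lebesgue (\<Union>D)"
      proof (rule measure_negligible_finite_Union[symmetric])
        show "finite D" using Ddiv by auto
        show "S \<in> lmeasurable" if "S \<in> D" for S using division_ofD(4)[OF Ddiv that] by auto
        show "pairwise (\<lambda>S T. negligible (S \<inter> T)) D"
        proof (rule pairwiseI)
          fix S T assume ST: "S \<in> D" "T \<in> D" "S \<noteq> T"
          have "convex (S \<inter> T)"
            using division_ofD(4)[OF Ddiv ST(1)] division_ofD(4)[OF Ddiv ST(2)] by (auto intro: convex_Int convex_box)
          then show "negligible (S \<inter> T)"
            using division_ofD(5)[OF Ddiv ST] by (simp add: negligible_convex_interior)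
        qed
      qed
      also have "\<dots> \<le> measure lebesgue U"
      proof (rule measure_mono_fmeasurable[OF DU _ U(3)])
        show "\<Union>D \<in> sets lebesgue"
          using Ddiv division_ofD(4)[OF Ddiv] by (intro sets.finite_Union) (auto dest: division_of_finite)
      qed
      also have "\<dots> < \<delta>" by (rule U(4))
      finally have len: "(\<Sum>K\<in>D. Sup K - Inf K) < \<delta>" .
      have "\<Union>D \<subseteq> {a..b}"
      proof
        fix y assume "y \<in> \<Union>D"
        then obtain x K where "(x, K) \<in> pN" "y \<in> K" by (auto simp: D_def)
        then show "y \<in> {a..b}" using pK(1,4)[OF sub(1)] by blast
      qed
      then have "(\<Sum>K\<in>D. \<bar>g (Sup K) - g (Inf K)\<bar>) < \<epsilon> / 2" using small[OF Ddiv] len by blast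
      moreover have "\<bar>\<Sum>z\<in>pN. err z\<bar> \<le> (\<Sum>K\<in>D. \<bar>g (Sup K) - g (Inf K)\<bar>)"
      proof -
        have "\<bar>\<Sum>z\<in>pN. err z\<bar> \<le> (\<Sum>z\<in>pN. \<bar>err z\<bar>)" by (rule sum_abs)
        also have "\<dots> = (\<Sum>z\<in>{z \<in> pN. measure lborel (snd z) \<noteq> 0}. \<bar>err z\<bar>)"
        proof (rule sum.mono_neutral_right[OF fpN])
          show "\<forall>z\<in>pN - {z \<in> pN. measure lborel (snd z) \<noteq> 0}. \<bar>err z\<bar> = 0"
          proof
            fix z assume "z \<in> pN - {z \<in> pN. measure lborel (snd z) \<noteq> 0}"
            then obtain x K where z: "z = (x, K)" "(x, K) \<in> pN" "measure lborel K = 0" by (cases z) auto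
            then have "Sup K = Inf K" using pK(6)[OF sub(1)[OF z(2)]] by simp
            then show "\<bar>err z\<bar> = 0" using z by (simp add: err_def)
          qed
        qed auto
        also have "\<dots> = (\<Sum>z\<in>{z \<in> pN. measure lborel (snd z) \<noteq> 0}. \<bar>g (Sup (snd z)) - g (Inf (snd z))\<bar>)"
          using zero sub(2) by (intro sum.cong) (auto simp: err_def)
        also have "\<dots> = (\<Sum>K\<in>D. \<bar>g (Sup K) - g (Inf K)\<bar>)"
          unfolding D_def by (simp add: sum.reindex[OF inj])
        finally show ?thesis .
      qed
      ultimately show ?thesis by linarith
    qed
    show ?thesis unfolding eq real_norm_def using part1 part2 by linarith
  qed
  show "\<exists>\<gamma>. gauge \<gamma> \<and> (\<forall>\<D>. \<D> tagged_division_of {a..b} \<and> \<gamma> fine \<D> \<longrightarrow>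
      norm ((\<Sum>(x, k)\<in>\<D>. measure lborel k *\<^sub>R h x) - (g b - g a)) < \<epsilon>)"
    by (rule exI[of _ \<gamma>], rule conjI, rule gg, intro allI impI, elim conjE) (rule main)
qed

text \<open>
  Absolute continuity bounds the variation of the indefinite integral on intervals shorter than \<open>\<delta>\<close>; finitely
  many of them cover \<open>[a, b]\<close>.
\<close>

lemma ac_real_absolutely_integrable:
  assumes ac: "ac_real a b g" and "a \<le> b" and N: "negligible N"
    and der: "\<And>x. x \<in> {a..b} - N \<Longrightarrow> (g has_real_derivative h x) (at x within {a..b})"
    and zero: "\<And>x. x \<in> N \<Longrightarrow> h x = 0"
  shows "h absolutely_integrable_on {a..b}"
proof -
  obtain \<delta> where \<delta>: "\<delta> > 0" and small0: "\<forall>D. D division_of \<Union>D \<longrightarrow> \<Union>D \<subseteq> {a..b} \<longrightarrow>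
     (\<Sum>K\<in>D. Sup K - Inf K) < \<delta> \<longrightarrow> (\<Sum>K\<in>D. \<bar>g (Sup K) - g (Inf K)\<bar>) < 1"
    by (rule ac_realD[OF ac zero_less_one])
  note small = small0[rule_format]
  have FTC: "(h has_integral (g d - g c)) {c..d}" if "c \<le> d" "{c..d} \<subseteq> {a..b}" for c d
  proof (rule ac_real_FTC[OF ac_real_subinterval[OF ac that(2)] that(1) N])
    show "(g has_real_derivative h x) (at x within {c..d})" if "x \<in> {c..d} - N" for x
      using der[of x] that \<open>{c..d} \<subseteq> {a..b}\<close> by (auto intro: DERIV_subset)
  qed (rule zero)
  have short: "h absolutely_integrable_on {c..d}" if cd: "c \<le> d" "{c..d} \<subseteq> {a..b}" "d - c < \<delta>" for c d
    unfolding box_real(2)[symmetric]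
  proof (rule bounded_variation_absolutely_integrable_interval)
    show "h integrable_on cbox c d" using FTC[OF cd(1,2)] by (auto simp: integrable_on_def)
    fix D assume "D division_of cbox c d"
    then have D: "D division_of {c..d}" by simp
    then have UD: "\<Union>D = {c..d}" by (rule division_ofD(6))
    have "(\<Sum>K\<in>D. norm (integral K h)) = (\<Sum>K\<in>D. \<bar>g (Sup K) - g (Inf K)\<bar>)"
    proof (rule sum.cong[OF refl])
      fix K assume K: "K \<in> D"
      note KD = division_of_interval[OF D K]
      have "(h has_integral (g (Sup K) - g (Inf K))) {Inf K..Sup K}"
        using KD cd(2) by (intro FTC) auto
      then have "(h has_integral (g (Sup K) - g (Inf K))) K" using KD(1) by simp
      then show "norm (integral K h) = \<bar>g (Sup K) - g (Inf K)\<bar>" by (simp add: integral_unique)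
    qed
    also have "\<dots> < 1"
    proof (rule small)
      show "D division_of \<Union>D" using D UD by simp
      show "\<Union>D \<subseteq> {a..b}" using UD cd(2) by simp
      show "(\<Sum>K\<in>D. Sup K - Inf K) < \<delta>" using division_increment[OF D cd(1), of "\<lambda>x. x"] cd(3) by simp
    qed
    finally show "(\<Sum>K\<in>D. norm (integral K h)) \<le> 1" by simp
  qed
  define r where "r = \<delta> / 2"
  have r: "r > 0" using \<delta> by (simp add: r_def)
  have "h absolutely_integrable_on {a..min b (a + real n * r)}" for n
  proof (induction n)
    case 0
    then show ?case using short[of a a] \<open>a \<le> b\<close> \<delta> by (simp add: min_absorb2)
  next
    case (Suc n)
    define c where "c = min b (a + real n * r)"
    define d where "d = min b (a + real (Suc n) * r)"
    have "c \<le> d" "a \<le> c" "d \<le> b" "d - c \<le> r"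
      using r \<open>a \<le> b\<close> by (auto simp: c_def d_def min_def algebra_simps)
    then have "h absolutely_integrable_on {c..d}" using \<delta> by (intro short) (auto simp: r_def)
    then have "h absolutely_integrable_on ({a..c} \<union> {c..d})"
      using Suc by (intro absolutely_integrable_Un) (auto simp: c_def)
    moreover have "{a..c} \<union> {c..d} = {a..d}" using \<open>c \<le> d\<close> \<open>a \<le> c\<close> by auto
    ultimately show ?case by (simp add: d_def)
  qed
  moreover obtain n :: nat where "b - a \<le> real n * r"
    using reals_Archimedean3[OF r] less_imp_le by blast
  then have "min b (a + real n * r) = b" by simp
  ultimately show ?thesis by metis
qed

theorem ac_FTC_complex:
  fixes f :: "real \<Rightarrow> complex"
  assumes f: "abs_continuous_on a b f" and ab: "a \<le> b"
  shows "set_integrable lebesgue {a..b} (\<lambda>t. vector_derivative f (at t))"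
    and "(LINT t:{a..b}|lebesgue. vector_derivative f (at t)) = f b - f a"
    and "\<exists>N. negligible N \<and> (\<forall>t\<in>{a..b} - N. (f has_vector_derivative vector_derivative f (at t)) (at t))"
proof -
  have acR: "ac_real a b (\<lambda>t. Re (f t))"
    by (rule abs_continuous_on_ac_real[OF f]) (metis abs_Re_le_cmod minus_complex.simps(1))
  have acI: "ac_real a b (\<lambda>t. Im (f t))"
    by (rule abs_continuous_on_ac_real[OF f]) (metis abs_Im_le_cmod minus_complex.simps(2))
  obtain N1 h1 where N1: "negligible N1" "\<forall>x\<in>{a<..<b} - N1. ((\<lambda>t. Re (f t)) has_real_derivative h1 x) (at x)"
    by (rule ac_real_differentiable_AE[OF acR])
  obtain N2 h2 where N2: "negligible N2" "\<forall>x\<in>{a<..<b} - N2. ((\<lambda>t. Im (f t)) has_real_derivative h2 x) (at x)"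
    by (rule ac_real_differentiable_AE[OF acI])
  \<comment> \<open>at the end points two-sided differentiability may fail\<close>
  define N where "N = N1 \<union> N2 \<union> {a, b}"
  have N: "negligible N" using N1(1) N2(1) by (simp add: N_def)
  define k1 where "k1 x = (if x \<in> N then 0 else h1 x)" for x
  define k2 where "k2 x = (if x \<in> N then 0 else h2 x)" for x
  have d1: "((\<lambda>t. Re (f t)) has_real_derivative k1 x) (at x)" "((\<lambda>t. Im (f t)) has_real_derivative k2 x) (at x)"
    if "x \<in> {a..b} - N" for x
    using that N1(2) N2(2) by (auto simp: N_def k1_def k2_def)
  have w1: "((\<lambda>t. Re (f t)) has_real_derivative k1 x) (at x within {a..b})" "((\<lambda>t. Im (f t)) has_real_derivative k2 x) (at x within {a..b})"
    if "x \<in> {a..b} - N" for x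
    using d1[OF that] by (auto intro: has_field_derivative_at_within)
  have i1: "k1 absolutely_integrable_on {a..b}" "k2 absolutely_integrable_on {a..b}"
    by (rule ac_real_absolutely_integrable[OF acR ab N w1(1)], assumption, simp add: k1_def)
      (rule ac_real_absolutely_integrable[OF acI ab N w1(2)], assumption, simp add: k2_def)
  have I1: "(k1 has_integral (Re (f b) - Re (f a))) {a..b}" "(k2 has_integral (Im (f b) - Im (f a))) {a..b}"
    by (rule ac_real_FTC[OF acR ab N w1(1)], assumption, simp add: k1_def)
      (rule ac_real_FTC[OF acI ab N w1(2)], assumption, simp add: k2_def)
  define k where "k x = Complex (k1 x) (k2 x)" for x
  have kk: "k x = complex_of_real (k1 x) + \<i> * complex_of_real (k2 x)" for x
    by (simp add: k_def complex_eq_iff)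
  have kd: "(f has_vector_derivative k x) (at x)" if "x \<in> {a..b} - N" for x
  proof -
    have "((\<lambda>t. complex_of_real (Re (f t)) + \<i> * complex_of_real (Im (f t))) has_vector_derivative k x) (at x)"
      unfolding kk
      by (intro has_vector_derivative_add has_vector_derivative_mult_right has_vector_derivative_of_real d1[OF that])
    then show ?thesis by (simp flip: complex_eq)
  qed
  then have vd: "vector_derivative f (at x) = k x" if "x \<in> {a..b} - N" for x
    using that by (simp add: vector_derivative_at)
  define J where "J r = \<i> * complex_of_real r" for r
  have bJ: "bounded_linear J" unfolding J_def
    by (intro bounded_linear_compose[OF bounded_linear_mult_right bounded_linear_of_real])
  have kJ: "k = (\<lambda>x. (complex_of_real \<circ> k1) x + (J \<circ> k2) x)" by (simp add: fun_eq_iff kk J_def)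
  have ki: "k absolutely_integrable_on {a..b}"
    unfolding kJ
    by (intro set_integral_add(1) absolutely_integrable_linear[OF i1(1) bounded_linear_of_real]
        absolutely_integrable_linear[OF i1(2) bJ])
  then show s: "set_integrable lebesgue {a..b} (\<lambda>t. vector_derivative f (at t))"
    by (rule absolutely_integrable_spike[OF _ N]) (rule vd)
  have "(k has_integral (f b - f a)) {a..b}"
  proof -
    have "f b - f a = complex_of_real (Re (f b) - Re (f a)) + J (Im (f b) - Im (f a))"
      by (simp add: J_def complex_eq_iff)
    then show ?thesis
      unfolding kJ
      using has_integral_add[OF has_integral_linear[OF I1(1) bounded_linear_of_real] has_integral_linear[OF I1(2) bJ]]
      by simp
  qed
  then have "((\<lambda>t. vector_derivative f (at t)) has_integral (f b - f a)) {a..b}"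
    by (rule has_integral_spike[OF N _, rotated]) (rule vd)
  then show "(LINT t:{a..b}|lebesgue. vector_derivative f (at t)) = f b - f a"
    using s by (simp add: set_lebesgue_integral_eq_integral integral_unique)
  show "\<exists>N. negligible N \<and> (\<forall>t\<in>{a..b} - N. (f has_vector_derivative vector_derivative f (at t)) (at t))"
    using N kd vd by (intro exI[of _ N]) auto
qed

section \<open>Cesaro means of Fourier coefficients\<close>

text \<open>
  The double sum contains \<open>c\<^sub>k\<close> with multiplicity \<open>N - \<bar>k\<bar>\<close>, so this is Cesaro summation of the two-sided
  series.
\<close>

lemma cesaro_double_sum:
  fixes c :: "int \<Rightarrow> complex"
  assumes c: "(\<lambda>k. cmod (c k)) summable_on UNIV"
  shows "(\<lambda>N. (\<Sum>j<N. \<Sum>l<N. c (int j - int l)) / of_nat N) \<longlonglongrightarrow> infsum c UNIV"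
proof (rule LIMSEQ_I)
  fix e :: real assume "e > 0"
  define S where "S = infsum c UNIV"
  define C where "C = (\<Sum>\<^sub>\<infinity>k. cmod (c k))"
  have hs: "(c has_sum S) UNIV" unfolding S_def using abs_summable_summable[OF c] by simp
  have part: "cmod (\<Sum>k\<in>G. c k) \<le> C" if "finite G" for G
  proof -
    have "cmod (\<Sum>k\<in>G. c k) \<le> (\<Sum>k\<in>G. cmod (c k))" by (rule norm_sum)
    also have "\<dots> \<le> C" unfolding C_def by (rule finite_sum_le_infsum[OF c that]) auto
    finally show ?thesis .
  qed
  have SC: "cmod S \<le> C" unfolding C_def by (rule norm_has_sum_bound[OF has_sum_infsum[OF c] hs])
  have C0: "C \<ge> 0" using SC norm_ge_zero[of S] by linarith
  have "\<forall>\<^sub>F G in finite_subsets_at_top UNIV. dist (sum c G) S < e / 2"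
    by (rule tendstoD[OF hs[unfolded has_sum_def]]) (use \<open>e > 0\<close> in simp)
  then obtain F where F: "finite F" "\<And>G. finite G \<Longrightarrow> F \<subseteq> G \<Longrightarrow> dist (sum c G) S < e / 2"
    unfolding eventually_finite_subsets_at_top by auto
  define K where "K = nat (Max (insert 0 (abs ` F)))"
  have K: "\<bar>k\<bar> \<le> int K" if "k \<in> F" for k
    unfolding K_def using F(1) that by (subst nat_0_le) (auto intro: Max_ge)
  define a where "a N j = (\<Sum>l<N. c (int j - int l))" for N j :: nat
  have a_eq: "a N j = sum c ((\<lambda>l. int j - int l) ` {..<N})" for N j
    unfolding a_def by (subst sum.reindex) (auto simp: inj_on_def)
  have good: "cmod (a N j - S) \<le> e / 2" if "K \<le> j" "j + K < N" for N j
  proof -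
    have "k \<in> (\<lambda>l. int j - int l) ` {..<N}" if "k \<in> F" for k
      using K[OF that] \<open>K \<le> j\<close> \<open>j + K < N\<close> by (intro image_eqI[of _ _ "nat (int j - k)"]) auto
    then have "F \<subseteq> (\<lambda>l. int j - int l) ` {..<N}" by blast
    then show ?thesis using F(2)[of "(\<lambda>l. int j - int l) ` {..<N}"] by (simp add: a_eq dist_norm)
  qed
  have bad: "cmod (a N j - S) \<le> 2 * C" for N j
  proof -
    have "cmod (a N j - S) \<le> cmod (a N j) + cmod S" by (rule norm_triangle_ineq4)
    also have "\<dots> \<le> C + C" unfolding a_eq by (intro add_mono part SC) simp
    finally show ?thesis by simp
  qed
  obtain N0 :: nat where N0: "8 * real (K + 1) * (C + 1) / e < real N0" using reals_Archimedean2 by blast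
  have "cmod ((\<Sum>j<N. a N j) / of_nat N - S) < e" if N: "N \<ge> N0 + 1" for N
  proof -
    have Npos: "N > 0" using N by simp
    have le: "cmod (a N j - S) \<le> e / 2 + (if j < K \<or> N \<le> j + K then 2 * C else 0)" for j
      using good[of j N] bad[of N j] \<open>e > 0\<close> C0 by (cases "j < K \<or> N \<le> j + K") auto
    have "(\<Sum>j<N. a N j) - of_nat N * S = (\<Sum>j<N. a N j - S)" by (simp add: sum_subtractf)
    also have "cmod \<dots> \<le> (\<Sum>j<N. e / 2 + (if j < K \<or> N \<le> j + K then 2 * C else 0))"
      by (rule order_trans[OF norm_sum sum_mono[OF le]])
    also have "\<dots> = real N * (e / 2) + (\<Sum>j\<in>{j\<in>{..<N}. j < K \<or> N \<le> j + K}. 2 * C)"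
      by (simp add: sum.distrib sum.inter_filter[symmetric])
    also have "\<dots> \<le> real N * (e / 2) + 2 * real K * (2 * C)"
    proof -
      have "card {j\<in>{..<N}. j < K \<or> N \<le> j + K} \<le> card ({..<K} \<union> {N - K..<N})"
        by (intro card_mono) auto
      also have "\<dots> \<le> K + K" by (rule order_trans[OF card_Un_le]) simp
      finally have "real (card {j\<in>{..<N}. j < K \<or> N \<le> j + K}) \<le> 2 * real K" by simp
      then have "real (card {j\<in>{..<N}. j < K \<or> N \<le> j + K}) * (2 * C) \<le> 2 * real K * (2 * C)"
        using C0 by (intro mult_right_mono) auto
      then show ?thesis unfolding sum_constant by linarith
    qed
    also have "\<dots> < real N * e"
    proof -
      have "8 * real (K + 1) * (C + 1) < real N0 * e" using N0 \<open>e > 0\<close> by (simp add: pos_divide_less_eq)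
      also have "\<dots> \<le> real N * e" using N \<open>e > 0\<close> by (intro mult_right_mono) auto
      finally have "8 * real (K + 1) * (C + 1) < real N * e" .
      moreover have "real K * C \<le> real (K + 1) * (C + 1)" using C0 by (intro mult_mono) auto
      moreover have "8 * real (K + 1) * (C + 1) = 8 * (real (K + 1) * (C + 1))"
        "2 * real K * (2 * C) = 4 * (real K * C)" "real N * (e / 2) = real N * e / 2" by simp_all
      ultimately show ?thesis by linarith
    qed
    finally have "cmod ((\<Sum>j<N. a N j) - of_nat N * S) < real N * e" .
    moreover have "(\<Sum>j<N. a N j) / of_nat N - S = ((\<Sum>j<N. a N j) - of_nat N * S) / of_nat N"
      using Npos by (simp add: field_simps)
    ultimately show ?thesis using Npos by (simp add: norm_divide pos_divide_less_eq mult.commute)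
  qed
  then show "\<exists>N0. \<forall>N\<ge>N0. cmod ((\<Sum>j<N. \<Sum>l<N. c (int j - int l)) / of_nat N - infsum c UNIV) < e"
    unfolding a_def S_def by blast
qed

text \<open>
  The \<open>N\<close>-th Cesaro mean of the formal series \<open>\<Sum> g\<^sub>k h\<^sub>-\<^sub>k\<close>, as a double sum over \<open>k = j - l\<close>.
\<close>

definition cesaro :: "(real \<Rightarrow> complex) \<Rightarrow> (real \<Rightarrow> complex) \<Rightarrow> nat \<Rightarrow> complex" where
  "cesaro g h N = (\<Sum>j<N. \<Sum>l<N. fourier_coeff g (int j - int l) * fourier_coeff h (int l - int j)) / of_nat N"

lemma integrable_mult_chr:
  "integrable circle_measure f \<Longrightarrow> integrable circle_measure (\<lambda>t. f t * chr n t)"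
  by (rule integrable_circle_mult_bounded(1)[of _ _ 1]) (auto intro: measurable_chr)

text \<open>
  The Fejer kernel is a square of an absolute value, hence nonnegative.
\<close>

lemma fejer_kernel:
  "(\<Sum>j<N. \<Sum>l<N. chr (int j - int l) s * chr (int l - int j) t)
    = complex_of_real ((cmod (\<Sum>j<N. chr (int j) s * chr (- int j) t))\<^sup>2)"
proof -
  have "chr (int j - int l) s * chr (int l - int j) t
      = (chr (int j) s * chr (- int j) t) * cnj (chr (int l) s * chr (- int l) t)" for j l
    using chr_add[of "int j" "- int l" s] chr_add[of "int l" "- int j" t] by (simp add: cnj_chr mult_ac)
  then show ?thesis
    unfolding complex_norm_square by (simp add: sum_product)
qed

text \<open>
  The means are integrals of \<open>g\<close> against the Fejer means of \<open>h\<close>, which are averages of \<open>h\<close> with respect to a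
  nonnegative kernel of integral \<open>1\<close> and therefore bounded by \<open>B\<close>.
\<close>

lemma norm_cesaro_le:
  assumes g: "integrable circle_measure g" and h: "h \<in> borel_measurable lebesgue" "\<And>t. t \<in> {0..2*pi} \<Longrightarrow> cmod (h t) \<le> B"
  shows "cmod (cesaro g h N) \<le> B * (LINT t|circle_measure. cmod (g t))"
proof (cases "N = 0")
  case True
  have "B \<ge> 0" using order_trans[OF norm_ge_zero h(2)[of 0]] by simp
  then show ?thesis using True by (simp add: cesaro_def)
next
  case False
  have hi: "integrable circle_measure h" by (rule integrable_circle_bounded[OF h])
  have [measurable]: "h \<in> borel_measurable circle_measure" using h(1) by (simp add: borel_measurable_circle_measure)
  define H where "H t = (\<Sum>j<N. \<Sum>l<N. fourier_coeff h (int l - int j) * chr (int l - int j) t) / of_nat N" for t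
  have Hm: "H \<in> borel_measurable lebesgue" unfolding H_def by measurable
  have HB: "cmod (H t) \<le> B" for t
  proof -
    \<comment> \<open>the Fejer kernel centred at \<open>t\<close>\<close>
    define k where "k s = (cmod (\<Sum>j<N. chr (int j) s * chr (- int j) t))\<^sup>2 / real N" for s
    have keq: "complex_of_real (k s) = (\<Sum>j<N. \<Sum>l<N. chr (int j - int l) s * chr (int l - int j) t) / of_nat N" for s
      unfolding k_def fejer_kernel by simp
    have chi: "integrable circle_measure (\<lambda>s. chr m s * z)" for m z
      using integrable_circle_bounded[OF measurable_chr, of m 1] by simp
    have ki: "integrable circle_measure (\<lambda>s. complex_of_real (k s))"
      unfolding keq by (intro integrable_divide Bochner_Integration.integrable_sum chi)
    have "(LINT s|circle_measure. complex_of_real (k s)) = (\<Sum>j<N. \<Sum>l<N. (LINT s|circle_measure. chr (int j - int l) s * chr (int l - int j) t)) / of_nat N"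
      unfolding keq using chi by (simp add: Bochner_Integration.integral_sum Bochner_Integration.integrable_sum)
    also have "\<dots> = (\<Sum>j<N. \<Sum>l<N. if j = l then 1 else 0) / of_nat N"
      by (intro arg_cong2[where f = "(/)"] sum.cong refl) (auto simp: integral_chr)
    also have "\<dots> = 1" using False by simp
    finally have k1: "(LINT s|circle_measure. k s) = 1" by simp
    have kr: "integrable circle_measure k" using integrable_Re[OF ki] by simp
    have "H t = (\<Sum>j<N. \<Sum>l<N. (LINT s|circle_measure. h s * chr (int j - int l) s * chr (int l - int j) t)) / of_nat N"
      unfolding H_def fourier_coeff_chr by simp
    also have "\<dots> = (LINT s|circle_measure. (\<Sum>j<N. \<Sum>l<N. h s * chr (int j - int l) s * chr (int l - int j) t) / of_nat N)"
      using integrable_mult_chr[OF hi] by (simp add: Bochner_Integration.integral_sum Bochner_Integration.integrable_sum)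
    also have "\<dots> = (LINT s|circle_measure. h s * complex_of_real (k s))"
      unfolding keq by (simp add: sum_distrib_left mult.assoc)
    also have "cmod \<dots> \<le> (LINT s|circle_measure. cmod (h s * complex_of_real (k s)))"
      by (rule integral_norm_bound)
    also have "\<dots> \<le> (LINT s|circle_measure. B * k s)"
    proof (rule integral_mono_AE)
      have AE: "AE s in circle_measure. cmod (h s * complex_of_real (k s)) \<le> B * k s"
        unfolding AE_circle_measure
      proof (intro AE_I2 impI)
        fix s assume "s \<in> {0..2*pi}"
        then have "cmod (h s) \<le> B" by (rule h(2))
        moreover have k0: "k s \<ge> 0" by (simp add: k_def)
        ultimately show "cmod (h s * complex_of_real (k s)) \<le> B * k s"
          unfolding norm_mult norm_of_real abs_of_nonneg[OF k0] by (rule mult_right_mono)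
      qed
      then show "AE s in circle_measure. cmod (h s * complex_of_real (k s)) \<le> B * k s" .
      show "integrable circle_measure (\<lambda>s. B * k s)" using kr by simp
      show "integrable circle_measure (\<lambda>s. cmod (h s * complex_of_real (k s)))"
      proof (rule integrable_norm, subst mult.commute, rule integrable_circle_mult_bounded(1)[OF ki h(1)])
        show "cmod (h t) \<le> B" if "t \<in> {0..2*pi}" for t by (rule h(2)[OF that])
      qed
    qed
    also have "\<dots> = B" by (simp add: k1)
    finally show ?thesis .
  qed
  have "cesaro g h N = (\<Sum>j<N. \<Sum>l<N. (LINT t|circle_measure. g t * chr (int l - int j) t * fourier_coeff h (int l - int j))) / of_nat N"
    unfolding cesaro_def by (simp add: fourier_coeff_chr[of g])
  also have "\<dots> = (LINT t|circle_measure. (\<Sum>j<N. \<Sum>l<N. g t * chr (int l - int j) t * fourier_coeff h (int l - int j)) / of_nat N)"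
    using integrable_mult_chr[OF g] by (simp add: Bochner_Integration.integral_sum Bochner_Integration.integrable_sum)
  also have "\<dots> = (LINT t|circle_measure. g t * H t)"
    unfolding H_def by (simp add: sum_distrib_left mult_ac)
  finally show ?thesis
    using integrable_circle_mult_bounded(2)[OF g Hm HB] by simp
qed

lemma fourier_coeff_add:
  "integrable circle_measure u \<Longrightarrow> integrable circle_measure v \<Longrightarrow>
    fourier_coeff (\<lambda>t. u t + v t) k = fourier_coeff u k + fourier_coeff v k"
  by (simp add: fourier_coeff_chr distrib_right integrable_mult_chr)

lemma fourier_coeff_cmult: "fourier_coeff (\<lambda>t. c * u t) k = c * fourier_coeff u k"
  by (simp add: fourier_coeff_chr mult.assoc)

lemma fourier_coeff_chr_chr: "fourier_coeff (chr m) k = (if m = k then 1 else 0)"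
  unfolding fourier_coeff_chr chr_add[symmetric] by (simp add: integral_chr)

lemma trig_poly_integrable: "trig_poly u \<Longrightarrow> integrable circle_measure u"
  using trig_poly_bounded_measurable integrable_circle_bounded by blast

lemma cesaro_trig_poly:
  assumes g: "integrable circle_measure g" and "trig_poly u"
  shows "cesaro g u \<longlonglongrightarrow> (LINT t|circle_measure. g t * u t)"
  using assms(2)
proof induction
  case (chr m)
  define c where "c k = fourier_coeff g k * fourier_coeff (chr m) (- k)" for k
  have c0: "c k = (if k = - m then fourier_coeff g (- m) else 0)" for k
    by (auto simp: c_def fourier_coeff_chr_chr)
  have "(c has_sum fourier_coeff g (- m)) {- m}"
    using has_sum_finite[of "{- m}" c] by (simp add: c0)
  then have hs: "(c has_sum fourier_coeff g (- m)) UNIV"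
    by (rule has_sum_cong_neutral[THEN iffD1, rotated -1]) (auto simp: c0)
  have "(\<lambda>k. cmod (c k)) summable_on {- m}" by (rule summable_on_finite) simp
  then have "(\<lambda>k. cmod (c k)) summable_on UNIV"
    by (rule summable_on_cong_neutral[THEN iffD1, rotated -1]) (auto simp: c0)
  then have "(\<lambda>N. (\<Sum>j<N. \<Sum>l<N. c (int j - int l)) / of_nat N) \<longlonglongrightarrow> infsum c UNIV"
    by (rule cesaro_double_sum)
  moreover have "infsum c UNIV = (LINT t|circle_measure. g t * chr m t)"
    using hs by (simp add: infsumI fourier_coeff_chr)
  moreover have "(\<lambda>N. (\<Sum>j<N. \<Sum>l<N. c (int j - int l)) / of_nat N) = cesaro g (chr m)"
    by (simp add: fun_eq_iff cesaro_def c_def)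
  ultimately show ?case by simp
next
  case (add u v)
  have ui: "integrable circle_measure (\<lambda>t. g t * u t)" "integrable circle_measure (\<lambda>t. g t * v t)"
    using trig_poly_bounded_measurable add.hyps integrable_circle_mult_bounded(1)[OF g] by blast+
  have "cesaro g (\<lambda>t. u t + v t) = (\<lambda>N. cesaro g u N + cesaro g v N)"
    using trig_poly_integrable add.hyps
    by (simp add: fun_eq_iff cesaro_def fourier_coeff_add distrib_left sum.distrib add_divide_distrib)
  then show ?case using tendsto_add[OF add.IH] ui by (simp add: distrib_left)
next
  case (cmult u c)
  have "cesaro g (\<lambda>t. c * u t) = (\<lambda>N. c * cesaro g u N)"
    by (simp add: fun_eq_iff cesaro_def fourier_coeff_cmult sum_distrib_left mult.left_commute)
  then show ?case using tendsto_mult[OF tendsto_const cmult.IH, of c] by (simp add: mult.left_commute)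
qed

lemma cesaro_tendsto:
  assumes g: "integrable circle_measure g"
    and h: "h \<in> borel_measurable lebesgue" "continuous_on {0..2*pi} h" "h 0 = h (2*pi)"
  shows "cesaro g h \<longlonglongrightarrow> (LINT t|circle_measure. g t * h t)"
proof (rule LIMSEQ_I)
  fix e :: real assume "e > 0"
  define I where "I = (LINT t|circle_measure. cmod (g t))"
  have I0: "I \<ge> 0" unfolding I_def by (rule integral_nonneg_AE) simp
  define d where "d = e / (4 * (I + 1))"
  have d: "d > 0" using \<open>e > 0\<close> I0 by (simp add: d_def)
  have dI: "d * I \<le> e / 4"
  proof -
    have "d * I \<le> d * (I + 1)" using d by (intro mult_left_mono) auto
    also have "\<dots> = e / 4" using I0 by (simp add: d_def field_simps)
    finally show ?thesis .
  qed
  obtain u where u: "trig_poly u" and hu: "\<And>t. t \<in> {0..2*pi} \<Longrightarrow> cmod (h t - u t) < d"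
    using trig_poly_approx[OF h(2,3) d] by blast
  obtain C where um: "u \<in> borel_measurable lebesgue" and C: "\<And>t. cmod (u t) \<le> C"
    using trig_poly_bounded_measurable[OF u] by blast
  define w where "w t = h t - u t" for t
  have wm: "w \<in> borel_measurable lebesgue" unfolding w_def by (rule borel_measurable_diff[OF h(1) um])
  have wd: "cmod (w t) \<le> d" if "t \<in> {0..2*pi}" for t using hu[OF that] by (simp add: w_def)
  have h_eq: "h = (\<lambda>t. u t + w t)" by (simp add: w_def)
  have wi: "integrable circle_measure w" by (rule integrable_circle_bounded[OF wm wd])
  have gi: "integrable circle_measure (\<lambda>t. g t * u t)" "integrable circle_measure (\<lambda>t. g t * w t)"
    using integrable_circle_mult_bounded(1)[OF g um C] integrable_circle_mult_bounded(1)[OF g wm wd] by auto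
  have ce: "cesaro g h N = cesaro g u N + cesaro g w N" for N
    unfolding h_eq using trig_poly_integrable[OF u] wi
    by (simp add: cesaro_def fourier_coeff_add distrib_left sum.distrib add_divide_distrib)
  have ie: "(LINT t|circle_measure. g t * h t) = (LINT t|circle_measure. g t * u t) + (LINT t|circle_measure. g t * w t)"
    unfolding h_eq using gi by (simp add: distrib_left)
  have cw: "cmod (cesaro g w N) \<le> e / 4" for N
    using norm_cesaro_le[OF g wm wd, of N] dI by (simp add: I_def)
  have iw: "cmod (LINT t|circle_measure. g t * w t) \<le> e / 4"
    using integrable_circle_mult_bounded(2)[OF g wm wd] dI by (simp add: I_def)
  obtain N0 where N0: "\<And>N. N \<ge> N0 \<Longrightarrow> cmod (cesaro g u N - (LINT t|circle_measure. g t * u t)) < e / 2"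
    using LIMSEQ_D[OF cesaro_trig_poly[OF g u], of "e / 2"] \<open>e > 0\<close> by auto
  have "cmod (cesaro g h N - (LINT t|circle_measure. g t * h t)) < e" if "N \<ge> N0" for N
  proof -
    have "cesaro g h N - (LINT t|circle_measure. g t * h t)
        = (cesaro g u N - (LINT t|circle_measure. g t * u t)) + (cesaro g w N - (LINT t|circle_measure. g t * w t))"
      unfolding ce ie by simp
    also have "cmod \<dots> \<le> cmod (cesaro g u N - (LINT t|circle_measure. g t * u t))
        + (cmod (cesaro g w N) + cmod (LINT t|circle_measure. g t * w t))"
      by (rule norm_triangle_le[OF add_left_mono[OF norm_triangle_ineq4]])
    also have "\<dots> < e" using N0[OF that] cw[of N] iw by linarith
    finally show ?thesis .
  qed
  then show "\<exists>N0. \<forall>N\<ge>N0. cmod (cesaro g h N - (LINT t|circle_measure. g t * h t)) < e" by blast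
qed

text \<open>
  Parseval's formula for integrable \<open>g\<close> and continuous \<open>h\<close>. The Fourier series of \<open>g\<close> and \<open>h\<close> may diverge, but
  the Cesaro means of the products of coefficients converge to the integral, and absolute summability identifies
  their limit with the sum.
\<close>

lemma parseval_summable:
  assumes g: "integrable circle_measure g"
    and h: "h \<in> borel_measurable lebesgue" "continuous_on {0..2*pi} h" "h 0 = h (2*pi)"
    and sm: "(\<lambda>k. cmod (fourier_coeff g k * fourier_coeff h (- k))) summable_on UNIV"
  shows "(\<Sum>\<^sub>\<infinity>k. fourier_coeff g k * fourier_coeff h (- k)) = (LINT t|circle_measure. g t * h t)"
proof -
  have "(\<lambda>N. (\<Sum>j<N. \<Sum>l<N. fourier_coeff g (int j - int l) * fourier_coeff h (- (int j - int l))) / of_nat N)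
      \<longlonglongrightarrow> (\<Sum>\<^sub>\<infinity>k. fourier_coeff g k * fourier_coeff h (- k))"
    by (rule cesaro_double_sum[OF sm])
  then have "cesaro g h \<longlonglongrightarrow> (\<Sum>\<^sub>\<infinity>k. fourier_coeff g k * fourier_coeff h (- k))"
    by (simp add: cesaro_def[abs_def])
  then show ?thesis using cesaro_tendsto[OF g h] by (rule LIMSEQ_unique)
qed

section \<open>Fourier coefficients of the derivative\<close>

lemma abs_continuous_on_mult_chr:
  assumes f: "abs_continuous_on a b f" and B: "\<And>t. t \<in> {a..b} \<Longrightarrow> cmod (f t) \<le> B"
  shows "abs_continuous_on a b (\<lambda>t. f t * chr n t)"
  unfolding abs_continuous_on_def
proof (intro allI impI)
  fix \<epsilon> :: real assume e: "\<epsilon> > 0"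
  then have "\<epsilon> / 2 > 0" by simp
  then obtain \<delta> where \<delta>: "\<delta> > 0" and I: "\<And>I. finite I \<Longrightarrow> (\<forall>(x, y)\<in>I. a \<le> x \<and> x \<le> y \<and> y \<le> b) \<Longrightarrow>
        pairwise (\<lambda>(x, y) (x', y'). {x<..<y} \<inter> {x'<..<y'} = {}) I \<Longrightarrow>
        (\<Sum>(x, y)\<in>I. y - x) < \<delta> \<Longrightarrow> (\<Sum>(x, y)\<in>I. cmod (f y - f x)) < \<epsilon> / 2"
    using f unfolding abs_continuous_on_def by blast
  define L where "L = (\<bar>B\<bar> + 1) * (\<bar>real_of_int n\<bar> + 1)"
  have L: "L > 0" by (simp add: L_def)
  have lip: "cmod (chr n y - chr n x) \<le> \<bar>real_of_int n\<bar> * \<bar>y - x\<bar>" for x y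
  proof -
    have "chr n y - chr n x = chr n x * (exp (\<i> * of_real (of_int n * (y - x))) - 1)"
      unfolding right_diff_distrib by (simp add: chr_def algebra_simps flip: exp_add)
    then have "cmod (chr n y - chr n x) = 2 * \<bar>sin (of_int n * (y - x) / 2)\<bar>"
      by (simp only: norm_mult norm_chr dist_exp_i_1)
    also have "\<dots> \<le> 2 * \<bar>of_int n * (y - x) / 2\<bar>"
      by (intro mult_left_mono abs_sin_x_le_abs_x) simp
    finally show ?thesis by (simp add: abs_mult)
  qed
  show "\<exists>\<delta>>0. \<forall>I. finite I \<longrightarrow> (\<forall>(x, y)\<in>I. a \<le> x \<and> x \<le> y \<and> y \<le> b) \<longrightarrow>
        pairwise (\<lambda>(x, y) (x', y'). {x<..<y} \<inter> {x'<..<y'} = {}) I \<longrightarrow>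
        (\<Sum>(x, y)\<in>I. y - x) < \<delta> \<longrightarrow> (\<Sum>(x, y)\<in>I. cmod (f y * chr n y - f x * chr n x)) < \<epsilon>"
  proof (intro exI[of _ "min \<delta> (\<epsilon> / (2 * L))"] conjI allI impI)
    show "min \<delta> (\<epsilon> / (2 * L)) > 0" using \<delta> e L by simp
    fix I :: "(real \<times> real) set"
    assume fin: "finite I" and ab: "\<forall>(x, y)\<in>I. a \<le> x \<and> x \<le> y \<and> y \<le> b"
      and pw: "pairwise (\<lambda>(x, y) (x', y'). {x<..<y} \<inter> {x'<..<y'} = {}) I"
      and len: "(\<Sum>(x, y)\<in>I. y - x) < min \<delta> (\<epsilon> / (2 * L))"
    have 1: "(\<Sum>(x, y)\<in>I. cmod (f y - f x)) < \<epsilon> / 2" using I[OF fin ab pw] len by simp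
    have "(\<Sum>(x, y)\<in>I. cmod (f y * chr n y - f x * chr n x)) \<le> (\<Sum>(x, y)\<in>I. cmod (f y - f x) + L * (y - x))"
    proof (rule sum_mono, clarsimp)
      fix x y assume xy: "(x, y) \<in> I"
      then have ord: "a \<le> x" "x \<le> y" "y \<le> b" using ab by auto
      have "f y * chr n y - f x * chr n x = (f y - f x) * chr n y + f x * (chr n y - chr n x)"
        by (simp add: algebra_simps)
      also have "cmod \<dots> \<le> cmod (f y - f x) + cmod (f x) * cmod (chr n y - chr n x)"
        by (rule norm_triangle_le) (simp add: norm_mult)
      also have "cmod (f x) * cmod (chr n y - chr n x) \<le> (\<bar>B\<bar> + 1) * ((\<bar>real_of_int n\<bar> + 1) * (y - x))"
      proof (rule mult_mono)
        show "cmod (f x) \<le> \<bar>B\<bar> + 1" using B[of x] ord by simp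
        have "cmod (chr n y - chr n x) \<le> \<bar>real_of_int n\<bar> * (y - x)" using lip[of y x] ord by simp
        also have "\<dots> \<le> (\<bar>real_of_int n\<bar> + 1) * (y - x)" using ord by (intro mult_right_mono) auto
        finally show "cmod (chr n y - chr n x) \<le> (\<bar>real_of_int n\<bar> + 1) * (y - x)" .
      qed (use ord in auto)
      finally show "cmod (f y * chr n y - f x * chr n x) \<le> cmod (f y - f x) + L * (y - x)"
        by (simp add: L_def mult.assoc)
    qed
    also have "\<dots> = (\<Sum>(x, y)\<in>I. cmod (f y - f x)) + L * (\<Sum>(x, y)\<in>I. y - x)"
      by (simp add: case_prod_unfold sum.distrib sum_distrib_left)
    also have "L * (\<Sum>(x, y)\<in>I. y - x) < \<epsilon> / 2"
      using len L by (simp add: field_simps)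
    finally show "(\<Sum>(x, y)\<in>I. cmod (f y * chr n y - f x * chr n x)) < \<epsilon>" using 1 by linarith
  qed
qed

lemma abs_continuous_on_continuous:
  assumes f: "abs_continuous_on a b f"
  shows "continuous_on {a..b} f"
  unfolding continuous_on_iff
proof (intro ballI allI impI)
  fix x e assume x: "x \<in> {a..b}" and "e > (0::real)"
  then obtain \<delta> where \<delta>: "\<delta> > 0" and I: "\<And>I. finite I \<Longrightarrow> (\<forall>(x, y)\<in>I. a \<le> x \<and> x \<le> y \<and> y \<le> b) \<Longrightarrow>
        pairwise (\<lambda>(x, y) (x', y'). {x<..<y} \<inter> {x'<..<y'} = {}) I \<Longrightarrow>
        (\<Sum>(x, y)\<in>I. y - x) < \<delta> \<Longrightarrow> (\<Sum>(x, y)\<in>I. cmod (f y - f x)) < e"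
    using f unfolding abs_continuous_on_def by blast
  have "dist (f y) (f x) < e" if y: "y \<in> {a..b}" "dist y x < \<delta>" for y
    using I[of "{(min x y, max x y)}"] x y by (cases "x \<le> y") (auto simp: dist_norm norm_minus_commute)
  then show "\<exists>d>0. \<forall>x'\<in>{a..b}. dist x' x < d \<longrightarrow> dist (f x') (f x) < e" using \<delta> by blast
qed

text \<open>
  Cut off outside the period, a null set for \<open>circle_measure\<close>, so that Lebesgue measurability on the whole line
  follows from absolute continuity on \<open>[0, 2\<pi>]\<close>.
\<close>

definition circle_deriv :: "(real \<Rightarrow> complex) \<Rightarrow> real \<Rightarrow> complex" where
  "circle_deriv f t = indicator {0..2*pi} t *\<^sub>R vector_derivative f (at t)"

lemma W_1_1D:
  assumes "f \<in> W_1_1"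
  shows "abs_continuous_on 0 (2*pi) f" "f 0 = f (2*pi)" "continuous_on {0..2*pi} f"
proof -
  show ac: "abs_continuous_on 0 (2*pi) f" using assms by (simp add: W_1_1_def)
  have "f (0 + 2*pi) = f 0" using assms by (simp only: W_1_1_def mem_Collect_eq)
  then show "f 0 = f (2*pi)" by simp
  show "continuous_on {0..2*pi} f" by (rule abs_continuous_on_continuous[OF ac])
qed

lemma integrable_circle_deriv:
  assumes "f \<in> W_1_1"
  shows "integrable circle_measure (circle_deriv f)" "circle_deriv f \<in> borel_measurable lebesgue"
proof -
  have i: "integrable lebesgue (circle_deriv f)"
    using ac_FTC_complex(1)[OF W_1_1D(1)[OF assms]] by (simp add: set_integrable_def circle_deriv_def[abs_def])
  then show m: "circle_deriv f \<in> borel_measurable lebesgue" by (rule borel_measurable_integrable)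
  have "(\<lambda>t. indicator {0..2*pi} t *\<^sub>R circle_deriv f t) = circle_deriv f"
    by (auto simp: circle_deriv_def indicator_def)
  then show "integrable circle_measure (circle_deriv f)"
    using i by (simp add: integrable_circle_measure[OF m] set_integrable_def)
qed

text \<open>
  Integration by parts, that is, the fundamental theorem of calculus for \<open>f(t) exp(-\<i>kt)\<close>, whose values at
  the two ends of the period agree.
\<close>

lemma fourier_coeff_derivative:
  assumes f: "f \<in> W_1_1" and fm: "f \<in> borel_measurable lebesgue"
  shows "fourier_coeff (circle_deriv f) k = \<i> * of_int k * fourier_coeff f k"
proof -
  note ac = W_1_1D(1)[OF f] and per = W_1_1D(2)[OF f]
  let ?f' = "\<lambda>t. vector_derivative f (at t)"
  have "compact (f ` {0..2*pi})" by (rule compact_continuous_image[OF W_1_1D(3)[OF f] compact_Icc])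
  from compact_imp_bounded[OF this] obtain B where "\<forall>x\<in>f ` {0..2*pi}. norm x \<le> B"
    unfolding bounded_iff by blast
  then have B: "\<And>t. t \<in> {0..2*pi} \<Longrightarrow> cmod (f t) \<le> B" by simp
  have fi: "integrable circle_measure f" by (rule integrable_circle_bounded[OF fm B])
  define g where "g t = f t * chr (- k) t" for t
  have gac: "abs_continuous_on 0 (2*pi) g" unfolding g_def by (rule abs_continuous_on_mult_chr[OF ac B])
  have pi0: "0 \<le> 2 * pi" by simp
  obtain N where N: "negligible N" and Nd: "\<And>t. t \<in> {0..2*pi} - N \<Longrightarrow> (f has_vector_derivative ?f' t) (at t)"
    using ac_FTC_complex(3)[OF ac pi0] by blast
  have gd: "vector_derivative g (at t) = ?f' t * chr (- k) t + (- \<i> * of_int k) * (f t * chr (- k) t)"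
    if t: "t \<in> {0..2*pi} - N" for t
  proof -
    have "(chr (- k) has_vector_derivative (- \<i> * of_int k * chr (- k) t)) (at t)"
      unfolding chr_def by (auto intro!: derivative_eq_intros has_vector_derivative_real_field)
    from has_vector_derivative_mult[OF Nd[OF t] this]
    show ?thesis unfolding g_def by (intro vector_derivative_at) (simp add: algebra_simps)
  qed
  have chr2: "chr (- k) (2*pi) = chr (- k) 0"
    using exp_integer_2pi[of "of_int (- k)"] by (simp add: chr_def mult_ac)
  have i1: "integrable circle_measure (\<lambda>t. circle_deriv f t * chr (- k) t)"
    by (rule integrable_mult_chr[OF integrable_circle_deriv(1)[OF f]])
  have i2: "integrable circle_measure (\<lambda>t. f t * chr (- k) t)" by (rule integrable_mult_chr[OF fi])
  have gm: "circle_deriv g \<in> borel_measurable lebesgue"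
    using ac_FTC_complex(1)[OF gac pi0]
    by (simp add: set_integrable_def circle_deriv_def[abs_def] borel_measurable_integrable)
  have "0 = (LINT t:{0..2*pi}|lebesgue. vector_derivative g (at t))"
    using ac_FTC_complex(2)[OF gac pi0] per chr2 by (simp add: g_def)
  also have "\<dots> = (LINT t:{0..2*pi}|lebesgue. circle_deriv g t)"
    unfolding set_lebesgue_integral_def by (intro Bochner_Integration.integral_cong refl) (simp add: circle_deriv_def indicator_def)
  finally have "0 = (LINT t|circle_measure. circle_deriv g t)"
    by (simp add: integral_circle_measure[OF gm])
  also have "\<dots> = (LINT t|circle_measure. circle_deriv f t * chr (- k) t + (- \<i> * of_int k) * (f t * chr (- k) t))"
  proof (rule integral_cong_AE)
    have "AE t in lebesgue. t \<notin> N" using N by (simp add: negligible_iff_null_sets AE_not_in)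
    then show "AE t in circle_measure. circle_deriv g t = circle_deriv f t * chr (- k) t + (- \<i> * of_int k) * (f t * chr (- k) t)"
      unfolding AE_circle_measure by eventually_elim (simp add: gd circle_deriv_def)
    show "circle_deriv g \<in> borel_measurable circle_measure" using gm by (simp add: borel_measurable_circle_measure)
    show "(\<lambda>t. circle_deriv f t * chr (- k) t + (- \<i> * of_int k) * (f t * chr (- k) t)) \<in> borel_measurable circle_measure"
      by (intro borel_measurable_add borel_measurable_times borel_measurable_const borel_measurable_integrable[OF i1]
          borel_measurable_integrable[OF i2])
  qed
  also have "\<dots> = (LINT t|circle_measure. circle_deriv f t * chr (- k) t) + (- \<i> * of_int k) * (LINT t|circle_measure. f t * chr (- k) t)"
    using i1 i2 by simp
  finally show ?thesis by (simp add: fourier_coeff_chr)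
qed

lemma traceable_uminus:
  assumes "traceable R"
  shows "traceable (- R)"
proof -
  have "scalar_op (- 1) o\<^sub>L R o\<^sub>L id_blinfun = - R"
    by (rule blinfun_eqI) (simp add: scaleC_minus_one blinfun.minus_left)
  then show ?thesis using traceable_compose[OF assms adj_pair_scalar_op[of "- 1"] adj_pair_id] by simp
qed

lemma poly_op_monom_Suc:
  assumes "adj_pair X X'"
  shows "poly_op (monom 1 (Suc n)) X = X o\<^sub>L poly_op (monom 1 n) X"
    and "poly_op (monom 1 (Suc n)) X = poly_op (monom 1 n) X o\<^sub>L X"
proof -
  have X: "poly_op [:0, 1:] X = X"
    by (rule blinfun_eqI) (simp add: poly_op_pCons_apply)
  have m: "monom 1 (Suc n) = [:0, 1:] * monom (1 :: complex) n" by (simp add: monom_Suc)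
  show "poly_op (monom 1 (Suc n)) X = X o\<^sub>L poly_op (monom 1 n) X"
    unfolding m poly_op_mult[OF assms] X ..
  show "poly_op (monom 1 (Suc n)) X = poly_op (monom 1 n) X o\<^sub>L X"
    unfolding m mult.commute[of "[:0, 1:]"] poly_op_mult[OF assms] X ..
qed

lemma poly_op_one: "poly_op 1 X = id_blinfun"
  by (rule blinfun_eqI) (simp add: one_pCons poly_op_const)

section \<open>The trace of a commutator of Toeplitz operators\<close>

text \<open>
  The terms with negative index are reflected, which changes the sign of the factor \<open>k\<close>.
\<close>

lemma infsum_symmetric_split:
  fixes a :: "int \<Rightarrow> complex"
  assumes "(\<lambda>k. of_int k * a k) summable_on UNIV"
  shows "(\<Sum>\<^sub>\<infinity>k\<in>{0<..}. of_int k * a k) - (\<Sum>\<^sub>\<infinity>k\<in>{0<..}. of_int k * a (- k)) = (\<Sum>\<^sub>\<infinity>k. of_int k * a k)"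
proof -
  have s: "(\<lambda>k. of_int k * a k) summable_on S" for S by (rule summable_on_subset[OF assms]) simp
  have bij: "bij_betw uminus {0<..} {..<(0::int)}"
    by (rule bij_betwI[of _ _ _ uminus]) auto
  have "(\<Sum>\<^sub>\<infinity>k\<in>{0<..}. of_int k * a (- k)) = (\<Sum>\<^sub>\<infinity>k\<in>{0<..}. - (of_int (- k) * a (- k)))" by simp
  also have "\<dots> = - (\<Sum>\<^sub>\<infinity>k\<in>{0<..}. of_int (- k) * a (- k))" by (rule infsum_uminus)
  also have "(\<Sum>\<^sub>\<infinity>k\<in>{0<..}. of_int (- k) * a (- k)) = (\<Sum>\<^sub>\<infinity>k\<in>{..<0}. of_int k * a k)"
    by (rule infsum_reindex_bij_betw[OF bij])
  finally have neg: "(\<Sum>\<^sub>\<infinity>k\<in>{0<..}. of_int k * a (- k)) = - (\<Sum>\<^sub>\<infinity>k\<in>{..<0}. of_int k * a k)" .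
  have "(\<Sum>\<^sub>\<infinity>k. of_int k * a k) = (\<Sum>\<^sub>\<infinity>k\<in>{0<..} \<union> {..<0}. of_int k * a k)"
    by (rule infsum_cong_neutral) auto
  also have "\<dots> = (\<Sum>\<^sub>\<infinity>k\<in>{0<..}. of_int k * a k) + (\<Sum>\<^sub>\<infinity>k\<in>{..<0}. of_int k * a k)"
    by (rule infsum_Un_disjoint[OF s s]) auto
  finally show ?thesis using neg by simp
qed

text \<open>
  \<open>[T\<^sub>h, T\<^sub>f]\<close> is the difference of the defects \<open>T\<^sub>h\<^sub>f - T\<^sub>f T\<^sub>h\<close> and \<open>T\<^sub>h\<^sub>f - T\<^sub>h T\<^sub>f\<close>. Their traces are the
  sums of \<open>k f\<^sub>k h\<^sub>-\<^sub>k\<close> over positive and, after reflection, over negative \<open>k\<close>.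
\<close>

theorem toeplitz_commutator_trace:
  assumes f: "bounded_symbol f" "hilbert_schmidt (comm f)" "f \<in> W_1_1"
    and h: "bounded_symbol h" "hilbert_schmidt (comm h)" "continuous_on {0..2*pi} h" "h 0 = h (2*pi)"
  shows "has_tr ((toeplitz h o\<^sub>L toeplitz f) - (toeplitz f o\<^sub>L toeplitz h))
    (1 / \<i> * (LINT t|circle_measure. circle_deriv f t * h t))"
proof -
  define a where "a k = fourier_coeff f k * fourier_coeff h (- k)" for k
  have sm: "(\<lambda>k. \<bar>of_int k\<bar> * cmod (a k)) summable_on UNIV"
    unfolding a_def by (rule summable_fourier_product[OF f(1,2) h(1,2)])
  have na: "cmod (of_int k * a k) = \<bar>of_int k\<bar> * cmod (a k)" for k by (simp add: norm_mult)
  have sa: "(\<lambda>k. of_int k * a k) summable_on UNIV"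
    by (rule abs_summable_summable) (use sm in \<open>simp add: norm_mult\<close>)
  have fc: "fourier_coeff (circle_deriv f) k * fourier_coeff h (- k) = \<i> * (of_int k * a k)" for k
    using fourier_coeff_derivative[OF f(3) bounded_symbol_measurable[OF f(1)], of k] by (simp add: a_def)
  have "(\<Sum>\<^sub>\<infinity>k. fourier_coeff (circle_deriv f) k * fourier_coeff h (- k)) = (LINT t|circle_measure. circle_deriv f t * h t)"
    by (rule parseval_summable[OF integrable_circle_deriv(1)[OF f(3)] bounded_symbol_measurable[OF h(1)] h(3,4)])
      (use sm in \<open>simp add: fc norm_mult\<close>)
  then have "\<i> * (\<Sum>\<^sub>\<infinity>k. of_int k * a k) = (LINT t|circle_measure. circle_deriv f t * h t)"
    unfolding fc by (simp add: infsum_cmult_right[OF sa])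
  then have S: "(\<Sum>\<^sub>\<infinity>k. of_int k * a k) = 1 / \<i> * (LINT t|circle_measure. circle_deriv f t * h t)"
    by (metis complex_i_not_zero mult.commute nonzero_mult_div_cancel_left times_divide_eq_right mult.right_neutral)
  have c: "(\<lambda>t. f t * h t) = (\<lambda>t. h t * f t)" by (simp add: mult.commute)
  have 1: "has_tr (toeplitz (\<lambda>t. h t * f t) - (toeplitz f o\<^sub>L toeplitz h)) (\<Sum>\<^sub>\<infinity>k\<in>{0<..}. of_int k * a k)"
    using toeplitz_defect_trace[OF f(1,2) h(1,2)] by (simp add: a_def c)
  have 2: "has_tr (toeplitz (\<lambda>t. h t * f t) - (toeplitz h o\<^sub>L toeplitz f)) (\<Sum>\<^sub>\<infinity>k\<in>{0<..}. of_int k * a (- k))"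
    using toeplitz_defect_trace[OF h(1,2) f(1,2)] by (simp add: a_def mult.commute)
  have "(toeplitz h o\<^sub>L toeplitz f) - (toeplitz f o\<^sub>L toeplitz h)
      = (toeplitz (\<lambda>t. h t * f t) - (toeplitz f o\<^sub>L toeplitz h)) - (toeplitz (\<lambda>t. h t * f t) - (toeplitz h o\<^sub>L toeplitz f))"
    by simp
  then show ?thesis using has_tr_diff[OF 1 2] unfolding infsum_symmetric_split[OF sa] S by simp
qed

section \<open>Traces of differences of powers\<close>

text \<open>
  \<open>M\<close> is the right end point of the interval in the theorem; it bounds the spectra of \<open>A\<close> and \<open>B\<close>.
\<close>

locale krein_symbol =
  fixes f :: "real \<Rightarrow> complex"
  assumes W_half: "f \<in> W_half_2" and W_11: "f \<in> W_1_1"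
begin

abbreviation "fc \<equiv> (\<lambda>t. cnj (f t))"
abbreviation "T \<equiv> toeplitz f"
abbreviation "T' \<equiv> toeplitz fc"
abbreviation "A \<equiv> T' o\<^sub>L T"
abbreviation "B \<equiv> T o\<^sub>L T'"
abbreviation "M \<equiv> (Linf_norm f)\<^sup>2"

lemma f_measurable: "f \<in> borel_measurable lebesgue"
  using W_half by (simp add: W_half_2_def square_integrable_def borel_measurable_circle_measure)

text \<open>
  For a continuous function the essential supremum is a genuine upper bound: a larger value would persist on
  an interval, which is not a null set.
\<close>

lemma f_le_Linf:
  assumes t: "t \<in> {0..2*pi}"
  shows "cmod (f t) \<le> Linf_norm f"
proof (rule ccontr)
  define m where "m = esssup circle_measure (\<lambda>t. ereal (cmod (f t)))"
  have meas: "(\<lambda>t. ereal (cmod (f t))) \<in> borel_measurable circle_measure"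
    using f_measurable by (simp add: borel_measurable_circle_measure)
  have AE: "AE t in circle_measure. ereal (cmod (f t)) \<le> m"
    unfolding m_def by (rule esssup_AE)
  have "compact (f ` {0..2*pi})" by (rule compact_continuous_image[OF W_1_1D(3)[OF W_11] compact_Icc])
  from compact_imp_bounded[OF this] obtain C where "\<forall>x\<in>f ` {0..2*pi}. norm x \<le> C"
    unfolding bounded_iff by blast
  then have C: "\<And>t. t \<in> {0..2*pi} \<Longrightarrow> cmod (f t) \<le> C" by simp
  have "m \<le> ereal C"
    unfolding m_def by (rule esssup_I[OF meas]) (use C in \<open>auto simp: AE_circle_measure\<close>)
  moreover have "m \<ge> 0"
  proof -
    have "\<exists>t. ereal (cmod (f t)) \<le> m"
    proof (rule ccontr)
      assume "\<not> ?thesis"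
      then have "\<not> ereal (cmod (f t)) \<le> m" for t by blast
      then have "AE t in circle_measure. False" by (intro eventually_mono[OF AE]) blast
      then show False by simp
    qed
    then obtain t where "ereal (cmod (f t)) \<le> m" by blast
    moreover have "0 \<le> ereal (cmod (f t))" by simp
    ultimately show ?thesis by (rule order_trans[rotated])
  qed
  ultimately have m: "m = ereal (Linf_norm f)"
    unfolding Linf_norm_def m_def[symmetric] by (cases m) auto
  assume "\<not> cmod (f t) \<le> Linf_norm f"
  then have gt: "cmod (f t) > Linf_norm f" by simp
  have "continuous_on {0..2*pi} (\<lambda>t. cmod (f t))" by (intro continuous_on_norm W_1_1D(3)[OF W_11])
  then obtain d where d: "d > 0" "\<And>s. s \<in> {0..2*pi} \<Longrightarrow> dist s t < d \<Longrightarrow> dist (cmod (f s)) (cmod (f t)) < cmod (f t) - Linf_norm f"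
    using t gt unfolding continuous_on_iff by (metis diff_gt_0_iff_gt)
  define a where "a = max 0 (t - d / 2)"
  define b where "b = min (2*pi) (t + d / 2)"
  have ab: "a < b" using t d(1) pi_gt_zero by (auto simp: a_def b_def min_def max_def)
  have J: "cmod (f s) > Linf_norm f \<and> s \<in> {0..2*pi}" if "s \<in> {a..b}" for s
  proof -
    have "s \<in> {0..2*pi}" "dist s t < d" using that d(1) by (auto simp: a_def b_def dist_real_def)
    from d(2)[OF this] this(1) show ?thesis by (auto simp: dist_real_def)
  qed
  have "AE s in lebesgue. s \<notin> {a..b}"
    using AE unfolding AE_circle_measure
  proof eventually_elim
    case (elim s)
    show ?case
    proof
      assume "s \<in> {a..b}"
      then show False using elim J[of s] by (auto simp: m)
    qed
  qed
  then have "{a..b} \<in> null_sets lebesgue" by (subst AE_iff_null_sets) auto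
  then have "measure lebesgue {a..b} = 0" by (rule measure_eq_0_null_sets)
  then show False using ab by simp
qed

lemma f_bounded_symbol: "bounded_symbol f"
  unfolding bounded_symbol_def using f_measurable f_le_Linf by blast

lemma fc_bounded_symbol: "bounded_symbol fc"
  by (rule bounded_symbol_cnj[OF f_bounded_symbol])

lemma hilbert_schmidt_f: "hilbert_schmidt (comm f)"
  by (rule hilbert_schmidt_comm_W_half[OF f_bounded_symbol W_half])

lemma hilbert_schmidt_fc: "hilbert_schmidt (comm fc)"
  by (rule hilbert_schmidt_comm_cnj[OF f_bounded_symbol hilbert_schmidt_f])

lemma adj_T: "adj_pair T T'"
  by (rule adj_pair_toeplitz[OF f_bounded_symbol])

lemma adj_T': "adj_pair T' T"
  by (rule adj_pair_sym[OF adj_T])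

lemma norm_T_le: "(norm T)\<^sup>2 \<le> M" "(norm T')\<^sup>2 \<le> M"
  using norm_toeplitz_le[OF f_bounded_symbol f_le_Linf] norm_adj_eq[OF adj_T] by (auto intro: power_mono)

lemma cadjoint_T: "cadjoint T = T'"
  by (rule cadjoint_eq[OF adj_T])

sublocale A: bounded_self_adjoint A M
  by (rule bounded_self_adjoint_positive[OF adj_T norm_T_le(1)])

sublocale B: bounded_self_adjoint B M
  by (rule bounded_self_adjoint_positive[OF adj_T' norm_T_le(2)])

definition power_symbol :: "nat \<Rightarrow> real \<Rightarrow> complex" where
  "power_symbol n t = cnj (f t) * complex_of_real ((cmod (f t))\<^sup>2) ^ n"

lemma power_symbol_Suc: "power_symbol (Suc n) = (\<lambda>t. (power_symbol n t * f t) * cnj (f t))"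
  by (rule ext) (simp add: power_symbol_def complex_norm_square mult_ac del: of_real_power)

lemma power_symbol_0: "power_symbol 0 = fc"
  by (simp add: power_symbol_def fun_eq_iff)

lemma power_symbol_symbol: "bounded_symbol (power_symbol n) \<and> hilbert_schmidt (comm (power_symbol n))"
proof (induction n)
  case 0
  then show ?case using fc_bounded_symbol hilbert_schmidt_fc by (simp add: power_symbol_0)
next
  case (Suc n)
  then show ?case
    unfolding power_symbol_Suc
    by (intro conjI bounded_symbol_mult hilbert_schmidt_comm_mult f_bounded_symbol fc_bounded_symbol hilbert_schmidt_f hilbert_schmidt_fc) auto
qed

lemma power_symbol_continuous: "continuous_on {0..2*pi} (power_symbol n)" "power_symbol n 0 = power_symbol n (2*pi)"
  unfolding power_symbol_def using W_1_1D(2,3)[OF W_11] by (auto intro!: continuous_intros)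

text \<open>
  Induction on \<open>n\<close>: modulo operators with the cyclic trace property, multiplication of symbols corresponds to
  multiplication of Toeplitz operators, and each further factor \<open>B = T T\<^sup>*\<close> multiplies the symbol by \<open>f f\<^sup>*\<close>.
\<close>

lemma power_symbol_traceable: "traceable ((T' o\<^sub>L poly_op (monom 1 n) B) - toeplitz (power_symbol n))"
proof (induction n)
  case 0
  have "(T' o\<^sub>L poly_op (monom 1 0) B) - toeplitz (power_symbol 0) = 0"
    by (rule blinfun_eqI) (simp add: poly_op_one power_symbol_0 blinfun.diff_left)
  moreover have "traceable (0 :: H2 \<Rightarrow>\<^sub>L H2)"
    unfolding traceable_def
    by (intro conjI exI[of _ 0] exI[of _ "\<lambda>_. 0"]) (auto simp: trace_norm_le_zero has_tr_zero)
  ultimately show ?case by simp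
next
  case (Suc n)
  note s = power_symbol_symbol[of n, THEN conjunct1] power_symbol_symbol[of n, THEN conjunct2]
  define u where "u t = power_symbol n t * f t" for t
  have u: "bounded_symbol u" "hilbert_schmidt (comm u)"
    unfolding u_def by (intro bounded_symbol_mult hilbert_schmidt_comm_mult f_bounded_symbol hilbert_schmidt_f s)+
  define S where "S = T' o\<^sub>L poly_op (monom 1 n) B"
  have BSuc: "poly_op (monom 1 (Suc n)) B = poly_op (monom 1 n) B o\<^sub>L B"
    by (rule poly_op_monom_Suc(2)[OF B.sa])
  have "(T' o\<^sub>L poly_op (monom 1 (Suc n)) B) - toeplitz (power_symbol (Suc n))
      = (id_blinfun o\<^sub>L (S - toeplitz (power_symbol n)) o\<^sub>L B)
        + ((- (id_blinfun o\<^sub>L (toeplitz u - (toeplitz (power_symbol n) o\<^sub>L T)) o\<^sub>L T'))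
        + (- (toeplitz (\<lambda>t. u t * cnj (f t)) - (toeplitz u o\<^sub>L T'))))"
    unfolding BSuc power_symbol_Suc u_def[symmetric] S_def
    by (rule blinfun_eqI) (simp add: blinfun.diff_left blinfun.add_left blinfun.minus_left)
  moreover have "traceable (id_blinfun o\<^sub>L (S - toeplitz (power_symbol n)) o\<^sub>L B)"
    using Suc unfolding S_def by (rule traceable_compose[OF _ adj_pair_id B.sa])
  moreover have "traceable (- (id_blinfun o\<^sub>L (toeplitz u - (toeplitz (power_symbol n) o\<^sub>L T)) o\<^sub>L T'))"
    unfolding u_def
    by (intro traceable_uminus traceable_compose[OF _ adj_pair_id adj_T'] toeplitz_defect_traceable s f_bounded_symbol hilbert_schmidt_f)
  moreover have "traceable (- (toeplitz (\<lambda>t. u t * cnj (f t)) - (toeplitz u o\<^sub>L T')))"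
    by (intro traceable_uminus toeplitz_defect_traceable u fc_bounded_symbol hilbert_schmidt_fc)
  ultimately show ?case by (simp only: traceable_add)
qed

text \<open>
  Both differences of powers thus become commutators of \<open>T\<^sup>* B\<^sup>n\<close> with \<open>T\<close>.
\<close>

lemma power_intertwine: "T' o\<^sub>L poly_op (monom 1 n) B o\<^sub>L T = poly_op (monom 1 (Suc n)) A"
    "T o\<^sub>L (T' o\<^sub>L poly_op (monom 1 n) B) = poly_op (monom 1 (Suc n)) B"
proof -
  have BT: "poly_op (monom 1 n) B o\<^sub>L T = T o\<^sub>L poly_op (monom 1 n) A" for n
  proof (induction n)
    case 0
    show ?case by (rule blinfun_eqI) (simp add: poly_op_one)
  next
    case (Suc n)
    have "poly_op (monom 1 (Suc n)) B o\<^sub>L T = B o\<^sub>L (poly_op (monom 1 n) B o\<^sub>L T)"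
      unfolding poly_op_monom_Suc(1)[OF B.sa] by (rule blinfun_eqI) simp
    also have "\<dots> = T o\<^sub>L (A o\<^sub>L poly_op (monom 1 n) A)"
      unfolding Suc by (rule blinfun_eqI) simp
    finally show ?case unfolding poly_op_monom_Suc(1)[OF A.sa] .
  qed
  have "T' o\<^sub>L poly_op (monom 1 n) B o\<^sub>L T = T' o\<^sub>L (poly_op (monom 1 n) B o\<^sub>L T)"
    by (rule blinfun_eqI) simp
  also have "\<dots> = A o\<^sub>L poly_op (monom 1 n) A"
    unfolding BT by (rule blinfun_eqI) simp
  finally show "T' o\<^sub>L poly_op (monom 1 n) B o\<^sub>L T = poly_op (monom 1 (Suc n)) A"
    unfolding poly_op_monom_Suc(1)[OF A.sa] .
  show "T o\<^sub>L (T' o\<^sub>L poly_op (monom 1 n) B) = poly_op (monom 1 (Suc n)) B"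
    unfolding poly_op_monom_Suc(1)[OF B.sa] by (rule blinfun_eqI) simp
qed

text \<open>
  \<open>T\<^sup>* B\<^sup>n\<close> is the sum of a Toeplitz operator, whose commutator with \<open>T\<close> has the stated trace, and of \<open>R\<close>,
  whose commutator with \<open>T\<close> has trace \<open>0\<close>.
\<close>

lemma trace_monom:
  "has_tr (poly_op (monom 1 (Suc n)) A - poly_op (monom 1 (Suc n)) B)
     (1 / \<i> * (LINT t|circle_measure. circle_deriv f t * power_symbol n t))"
proof -
  define S where "S = T' o\<^sub>L poly_op (monom 1 n) B"
  define R where "R = S - toeplitz (power_symbol n)"
  have tr: "traceable R" unfolding R_def S_def by (rule power_symbol_traceable)
  obtain t where t: "has_tr (T o\<^sub>L R) t" "has_tr (R o\<^sub>L T) t"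
    using traceable_commute[OF tr adj_T] by blast
  have 0: "has_tr ((R o\<^sub>L T) - (T o\<^sub>L R)) 0" using has_tr_diff[OF t(2,1)] by simp
  have 1: "has_tr ((toeplitz (power_symbol n) o\<^sub>L T) - (T o\<^sub>L toeplitz (power_symbol n)))
      (1 / \<i> * (LINT t|circle_measure. circle_deriv f t * power_symbol n t))"
    by (intro toeplitz_commutator_trace f_bounded_symbol hilbert_schmidt_f W_11 power_symbol_continuous
        power_symbol_symbol[THEN conjunct1] power_symbol_symbol[THEN conjunct2])
  have "poly_op (monom 1 (Suc n)) A - poly_op (monom 1 (Suc n)) B
      = ((R o\<^sub>L T) - (T o\<^sub>L R)) + ((toeplitz (power_symbol n) o\<^sub>L T) - (T o\<^sub>L toeplitz (power_symbol n)))"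
    unfolding power_intertwine[symmetric] S_def[symmetric] R_def
    by (rule blinfun_eqI) (simp add: blinfun.diff_left blinfun.add_left blinfun.diff_right)
  then show ?thesis using has_tr_add[OF 0 1] by simp
qed

lemma self_commutator_trace_norm_le: "\<exists>c. trace_norm_le (A - B) c"
proof -
  have "traceable (toeplitz (\<lambda>t. f t * cnj (f t)) - B)"
    by (rule toeplitz_defect_traceable[OF f_bounded_symbol hilbert_schmidt_f fc_bounded_symbol hilbert_schmidt_fc])
  then obtain c where c: "trace_norm_le (toeplitz (\<lambda>t. f t * cnj (f t)) - B) c" by (auto simp: traceable_def)
  have "traceable (toeplitz (\<lambda>t. cnj (f t) * f t) - A)"
    by (rule toeplitz_defect_traceable[OF fc_bounded_symbol hilbert_schmidt_fc f_bounded_symbol hilbert_schmidt_f])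
  then obtain c' where c': "trace_norm_le (toeplitz (\<lambda>t. f t * cnj (f t)) - A) c'"
    by (auto simp: traceable_def mult.commute)
  have "A - B = (toeplitz (\<lambda>t. f t * cnj (f t)) - B) - (toeplitz (\<lambda>t. f t * cnj (f t)) - A)" by simp
  then show ?thesis using trace_norm_le_diff[OF c c'] by metis
qed

end

section \<open>Tails of the exponential series\<close>

definition exp_tail :: "nat \<Rightarrow> real \<Rightarrow> real" where
  "exp_tail n r = (\<Sum>k. r ^ (k + n) / fact (k + n))"

lemma summable_exp_real: "summable (\<lambda>k. (r::real) ^ k / fact k)"
  using summable_exp[of r] by (simp add: field_simps)

lemma summable_exp_tail: "summable (\<lambda>k. (r::real) ^ (k + n) / fact (k + n))"
  using summable_exp_real by (rule summable_ignore_initial_segment)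

lemma sum_le_exp_tail:
  assumes "r \<ge> 0"
  shows "(\<Sum>k\<in>{n..<m}. r ^ k / fact k) \<le> exp_tail n r"
proof (cases "n \<le> m")
  case True
  have "(\<Sum>k\<in>{n..<m}. r ^ k / fact k) = (\<Sum>k<m - n. r ^ (k + n) / fact (k + n))"
    using True by (intro sum.reindex_bij_witness[of _ "\<lambda>k. k + n" "\<lambda>k. k - n"]) auto
  also have "\<dots> \<le> exp_tail n r"
    unfolding exp_tail_def using assms by (intro sum_le_suminf summable_exp_tail) auto
  finally show ?thesis .
next
  case False
  then show ?thesis unfolding exp_tail_def using assms by (auto intro!: suminf_nonneg summable_exp_tail)
qed

lemma exp_tail_nonneg: "r \<ge> 0 \<Longrightarrow> exp_tail n r \<ge> 0"
  unfolding exp_tail_def by (intro suminf_nonneg summable_exp_tail) auto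

lemma exp_tail_mono: "0 \<le> r \<Longrightarrow> r \<le> r' \<Longrightarrow> exp_tail n r \<le> exp_tail n r'"
  unfolding exp_tail_def by (intro suminf_le summable_exp_tail divide_right_mono power_mono) auto

lemma exp_tail_0: "exp_tail 0 r = exp r"
  unfolding exp_tail_def exp_def by (simp add: field_simps)

lemma exp_tail_small:
  assumes "e > 0"
  shows "\<exists>n0. \<forall>n\<ge>n0. exp_tail n r < e"
proof -
  obtain n0 where "\<forall>n\<ge>n0. norm (\<Sum>k. r ^ (k + n) / fact (k + n)) < e"
    using suminf_exist_split[OF assms summable_exp_real] by blast
  then show ?thesis unfolding exp_tail_def by (auto simp: abs_less_iff)
qed

section \<open>Krein's estimate\<close>

text \<open>
  Polynomials without constant term, \<open>\<Sum> a\<^sub>k x\<close> to the power \<open>k + 1\<close>. The shift by one matches the power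
  differences and symbols above, and the vanishing at \<open>0\<close> cancels the denominator of \<open>f'/f\<close>.
\<close>

definition odd_poly :: "(nat \<Rightarrow> complex) \<Rightarrow> nat \<Rightarrow> complex poly" where
  "odd_poly a n = (\<Sum>k<n. monom (a k) (Suc k))"

lemma poly_odd_poly: "poly (odd_poly a n) x = (\<Sum>k<n. a k * x ^ Suc k)"
  by (simp add: odd_poly_def poly_sum poly_monom)

text \<open>
  A weak integral of operators; the bound is the triangle inequality for integrals, applied to each of the
  finite sums defining the trace norm bound.
\<close>

lemma trace_norm_le_integral:
  fixes D :: "real \<Rightarrow> 'a::complex_inner \<Rightarrow>\<^sub>L 'a"
  assumes int: "\<And>x y. integrable N (\<lambda>s. cinner (blinfun_apply (D s) x) y)"
    and D': "\<And>x y. cinner (blinfun_apply D' x) y = (LINT s|N. cinner (blinfun_apply (D s) x) y)"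
    and tc: "\<And>s. trace_norm_le (D s) (b s)" and b: "integrable N b"
  shows "trace_norm_le D' (LINT s|N. b s)"
proof (rule trace_norm_leI)
  show "(LINT s|N. b s) \<ge> 0" using trace_norm_le_nonneg[OF tc] by (intro integral_nonneg_AE) auto
  fix F :: "'a set" and X X' Y Y' :: "'a \<Rightarrow>\<^sub>L 'a"
  assume *: "finite F" "orthonormal F" "adj_pair X X'" "adj_pair Y Y'"
  let ?g = "\<lambda>s e. cmod (cinner (blinfun_apply (D s) (blinfun_apply X e)) (blinfun_apply Y e))"
  have "(\<Sum>e\<in>F. cmod (cinner (blinfun_apply D' (blinfun_apply X e)) (blinfun_apply Y e))) \<le> (\<Sum>e\<in>F. (LINT s|N. ?g s e))"
    unfolding D' by (intro sum_mono integral_norm_bound)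
  also have "\<dots> = (LINT s|N. (\<Sum>e\<in>F. ?g s e))"
    using int by (intro Bochner_Integration.integral_sum[symmetric]) auto
  also have "\<dots> \<le> (LINT s|N. b s * norm X * norm Y)"
  proof (rule integral_mono)
    show "integrable N (\<lambda>s. \<Sum>e\<in>F. ?g s e)" using int by (intro Bochner_Integration.integrable_sum) auto
    show "integrable N (\<lambda>s. b s * norm X * norm Y)" using b by auto
    show "(\<Sum>e\<in>F. ?g s e) \<le> b s * norm X * norm Y" for s by (rule trace_norm_leD[OF tc *])
  qed
  also have "\<dots> = (LINT s|N. b s) * norm X * norm Y" by simp
  finally show "(\<Sum>e\<in>F. cmod (cinner (blinfun_apply D' (blinfun_apply X e)) (blinfun_apply Y e)))
    \<le> (LINT s|N. b s) * norm X * norm Y" .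
qed

text \<open>
  The coefficients of \<open>(exp(\<i>sx) - 1)/(\<i>s) = \<Sum> (\<i>s)\<^sup>k x\<close> to the power \<open>k + 1\<close> \<open>/ (k + 1)!\<close>.
\<close>

definition exp_coeff :: "real \<Rightarrow> nat \<Rightarrow> complex" where
  "exp_coeff s k = (\<i> * complex_of_real s) ^ k / fact (Suc k)"

definition imag_exp :: "real \<Rightarrow> real \<Rightarrow> complex" where
  "imag_exp s x = exp (\<i> * complex_of_real (s * x))"

lemma imag_exp_continuous: "continuous_on S (imag_exp s)"
  unfolding imag_exp_def by (intro continuous_intros)

lemma norm_imag_exp: "cmod (imag_exp s x) = 1"
  unfolding imag_exp_def by (rule norm_exp_i_times)

context krein_symbol
begin

text \<open>
  A fixed bound for the trace norm of the self-commutator, in place of the trace norm itself.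
\<close>

definition comm_bound :: real where "comm_bound = (SOME c. trace_norm_le (A - B) c)"

lemma trace_norm_le_comm_bound: "trace_norm_le (A - B) comm_bound"
  unfolding comm_bound_def using self_commutator_trace_norm_le by (rule someI_ex)

lemma comm_bound_nonneg: "comm_bound \<ge> 0"
  by (rule trace_norm_le_nonneg[OF trace_norm_le_comm_bound])

definition power_diff :: "nat \<Rightarrow> H2 \<Rightarrow>\<^sub>L H2" where
  "power_diff k = poly_op (monom 1 (Suc k)) A - poly_op (monom 1 (Suc k)) B"

text \<open>
  Telescoping: \<open>A\<close> to the power \<open>k + 1\<close> minus \<open>B\<close> to the power \<open>k + 1\<close> is a sum of \<open>k + 1\<close> terms
  \<open>A\<^sup>j (A - B) B\<^sup>k\<^sup>-\<^sup>j\<close>.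
\<close>

lemma trace_norm_le_power_diff: "trace_norm_le (power_diff k) (real (Suc k) * M ^ k * comm_bound)"
proof (induction k)
  case 0
  have "power_diff 0 = A - B"
    unfolding power_diff_def poly_op_monom_Suc(1)[OF A.sa] poly_op_monom_Suc(1)[OF B.sa]
    by (rule blinfun_eqI) (simp add: poly_op_one blinfun.diff_left)
  then show ?case using trace_norm_le_comm_bound by simp
next
  case (Suc k)
  have pw: "norm (poly_op (monom 1 n) B) \<le> M ^ n" for n
    by (rule B.norm_poly_le) (auto simp: poly_monom norm_power intro!: power_mono)
  have "norm (poly_op [:0, 1:] A) \<le> M"
    by (rule A.norm_poly_le) auto
  moreover have "poly_op [:0, 1:] A = A"
    by (rule blinfun_eqI) (simp add: poly_op_pCons_apply)
  ultimately have nA: "norm A \<le> M" by simp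
  have "power_diff (Suc k) = (A o\<^sub>L power_diff k) + ((A - B) o\<^sub>L poly_op (monom 1 (Suc k)) B)"
    unfolding power_diff_def poly_op_monom_Suc(1)[OF A.sa, of "Suc k"] poly_op_monom_Suc(1)[OF B.sa, of "Suc k"]
    by (rule blinfun_eqI) (simp add: blinfun.diff_left blinfun.add_left blinfun.diff_right)
  moreover have "trace_norm_le ((A o\<^sub>L power_diff k) + ((A - B) o\<^sub>L poly_op (monom 1 (Suc k)) B))
      (norm A * (real (Suc k) * M ^ k * comm_bound) + comm_bound * norm (poly_op (monom 1 (Suc k)) B))"
    by (intro trace_norm_le_add trace_norm_le_compose_left[OF Suc A.sa] trace_norm_le_compose_right[OF trace_norm_le_comm_bound adj_pair_poly_op[OF B.sa]])
  moreover have le: "norm A * (real (Suc k) * M ^ k * comm_bound) + comm_bound * norm (poly_op (monom 1 (Suc k)) B)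
      \<le> M * (real (Suc k) * M ^ k * comm_bound) + comm_bound * M ^ Suc k"
    by (intro add_mono mult_right_mono[OF nA] mult_left_mono[OF pw] mult_nonneg_nonneg zero_le_power A.M0 comm_bound_nonneg) auto
  moreover have eq: "M * (real (Suc k) * M ^ k * comm_bound) + comm_bound * M ^ Suc k = real (Suc (Suc k)) * M ^ Suc k * comm_bound"
    by (simp add: algebra_simps)
  ultimately have "trace_norm_le (power_diff (Suc k)) (norm A * (real (Suc k) * M ^ k * comm_bound) + comm_bound * norm (poly_op (monom 1 (Suc k)) B))"
    by (simp only:)
  then show ?case by (rule trace_norm_le_mono) (simp only: le eq[symmetric])
qed

text \<open>
  \<open>p(A) - p(B)\<close> for \<open>p = odd_poly a n\<close>, as a linear expression in the coefficients, so that it can be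
  integrated with respect to a parameter in \<open>a\<close>.
\<close>

definition odd_poly_diff :: "(nat \<Rightarrow> complex) \<Rightarrow> nat \<Rightarrow> H2 \<Rightarrow>\<^sub>L H2" where
  "odd_poly_diff a n = (\<Sum>k<n. scalar_op (a k) o\<^sub>L power_diff k)"

lemma poly_op_odd_poly_diff: "poly_op (odd_poly a n) A - poly_op (odd_poly a n) B = odd_poly_diff a n"
proof -
  have m: "monom z (Suc k) = smult z (monom 1 (Suc k))" for z :: complex and k by (simp add: smult_monom)
  have "poly_op (odd_poly a n) X = (\<Sum>k<n. scalar_op (a k) o\<^sub>L poly_op (monom 1 (Suc k)) X)" for X :: "H2 \<Rightarrow>\<^sub>L H2"
    unfolding odd_poly_def poly_op_sum by (rule sum.cong[OF refl]) (subst m, rule poly_op_smult)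
  then show ?thesis
    unfolding odd_poly_diff_def power_diff_def
    by (simp add: sum_subtractf[symmetric] bounded_bilinear.diff_right[OF bounded_bilinear_blinfun_compose])
qed

lemma trace_norm_le_odd_poly_diff: "trace_norm_le (odd_poly_diff a n) (\<Sum>k<n. cmod (a k) * (real (Suc k) * M ^ k * comm_bound))"
  unfolding odd_poly_diff_def by (intro trace_norm_le_sum trace_norm_le_cmult trace_norm_le_power_diff)

lemma cinner_odd_poly_diff: "cinner (blinfun_apply (odd_poly_diff a n) x) y = (\<Sum>k<n. a k * cinner (blinfun_apply (power_diff k) x) y)"
  by (simp add: odd_poly_diff_def blinfun.sum_left cinner.sum_left cinner_scaleC_left)

lemma odd_poly_diff_diff: "n \<le> m \<Longrightarrow> odd_poly_diff a m - odd_poly_diff a n = (\<Sum>k\<in>{n..<m}. scalar_op (a k) o\<^sub>L power_diff k)"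
  unfolding odd_poly_diff_def by (simp add: sum_diff_nat_ivl flip: atLeast0LessThan)

lemma odd_poly_diff_cmult: "odd_poly_diff (\<lambda>k. c * a k) n = scalar_op c o\<^sub>L odd_poly_diff a n"
  by (rule blinfun_eqI) (simp add: odd_poly_diff_def blinfun.sum_left scaleC.sum_right scaleC_scaleC)

lemma norm_exp_coeff: "cmod (exp_coeff s k) * (real (Suc k) * M ^ k * comm_bound) = comm_bound * ((\<bar>s\<bar> * M) ^ k / fact k)"
proof -
  have "cmod (exp_coeff s k) = \<bar>s\<bar> ^ k / (real (Suc k) * fact k)"
    by (simp add: exp_coeff_def norm_divide norm_power norm_mult norm_fact del: of_nat_Suc)
  then show ?thesis by (simp add: power_mult_distrib field_simps del: of_nat_Suc)
qed

lemma trace_norm_le_exp_coeff_diff: "n \<le> m \<Longrightarrow> trace_norm_le (odd_poly_diff (exp_coeff s) m - odd_poly_diff (exp_coeff s) n) (comm_bound * exp_tail n (\<bar>s\<bar> * M))"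
proof -
  assume "n \<le> m"
  have "trace_norm_le (odd_poly_diff (exp_coeff s) m - odd_poly_diff (exp_coeff s) n) (\<Sum>k\<in>{n..<m}. cmod (exp_coeff s k) * (real (Suc k) * M ^ k * comm_bound))"
    unfolding odd_poly_diff_diff[OF \<open>n \<le> m\<close>] by (intro trace_norm_le_sum trace_norm_le_cmult trace_norm_le_power_diff)
  moreover have "(\<Sum>k\<in>{n..<m}. cmod (exp_coeff s k) * (real (Suc k) * M ^ k * comm_bound)) \<le> comm_bound * exp_tail n (\<bar>s\<bar> * M)"
    unfolding norm_exp_coeff sum_distrib_left[symmetric]
    by (intro mult_left_mono sum_le_exp_tail comm_bound_nonneg) simp
  ultimately show ?thesis by (rule trace_norm_le_mono)
qed

definition exp_diff :: "real \<Rightarrow> H2 \<Rightarrow>\<^sub>L H2" where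
  "exp_diff s = cfc (imag_exp s) A - cfc (imag_exp s) B"

text \<open>
  The Taylor series of \<open>exp(\<i>sx)\<close>, written through the quotient \<open>(exp(\<i>sx) - 1)/(\<i>s)\<close>.
\<close>

lemma imag_exp_uniform_limit:
  "uniform_limit {0..M} (\<lambda>n x. poly (1 + smult (\<i> * complex_of_real s) (odd_poly (exp_coeff s) n)) (complex_of_real x)) (imag_exp s) sequentially"
proof -
  define g where "g k x = (\<i> * complex_of_real (s * x)) ^ Suc k / fact (Suc k)" for k x
  have sums: "(\<lambda>k. g k x) sums (imag_exp s x - 1)" for x
  proof -
    have "(\<lambda>k. (\<i> * complex_of_real (s * x)) ^ k / fact k) sums imag_exp s x"
      unfolding imag_exp_def using exp_converges[of "\<i> * complex_of_real (s * x)"]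
      by (simp add: scaleR_conv_of_real divide_inverse mult.commute)
    then show ?thesis unfolding g_def by (subst sums_Suc_iff) simp
  qed
  have "uniform_limit {0..M} (\<lambda>n x. \<Sum>k<n. g k x) (\<lambda>x. suminf (\<lambda>k. g k x)) sequentially"
  proof (rule Weierstrass_m_test)
    show "summable (\<lambda>k. (\<bar>s\<bar> * M) ^ Suc k / fact (Suc k))"
      using summable_exp_real[of "\<bar>s\<bar> * M"] by (subst summable_Suc_iff)
    fix k x assume x: "x \<in> {0..M}"
    have "\<bar>s\<bar> * \<bar>x\<bar> \<le> \<bar>s\<bar> * M" using x by (intro mult_left_mono) auto
    then show "norm (g k x) \<le> (\<bar>s\<bar> * M) ^ Suc k / fact (Suc k)"
      unfolding g_def norm_divide norm_power norm_fact norm_mult norm_of_real abs_mult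
      by (intro divide_right_mono power_mono) auto
  qed
  moreover have "(\<lambda>x. suminf (\<lambda>k. g k x)) = (\<lambda>x. imag_exp s x - 1)" using sums by (simp add: sums_iff)
  ultimately have "uniform_limit {0..M} (\<lambda>n x. 1 + (\<Sum>k<n. g k x)) (\<lambda>x. 1 + (imag_exp s x - 1)) sequentially"
    by (intro uniform_limit_add uniform_limit_const) simp
  moreover have "poly (1 + smult (\<i> * complex_of_real s) (odd_poly (exp_coeff s) n)) (complex_of_real x) = 1 + (\<Sum>k<n. g k x)" for n x
    by (simp add: poly_odd_poly exp_coeff_def g_def sum_distrib_left power_mult_distrib mult_ac)
  ultimately show ?thesis by simp
qed

lemma exp_diff_LIMSEQ: "(\<lambda>n. scalar_op (\<i> * complex_of_real s) o\<^sub>L odd_poly_diff (exp_coeff s) n) \<longlonglongrightarrow> exp_diff s"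
proof -
  have "poly_op (1 + smult z p) A - poly_op (1 + smult z p) B = scalar_op z o\<^sub>L (poly_op p A - poly_op p B)" for z p
    by (rule blinfun_eqI) (simp add: poly_op_add poly_op_smult poly_op_one blinfun.diff_left blinfun.add_left scaleC.diff_right)
  then have "scalar_op (\<i> * complex_of_real s) o\<^sub>L odd_poly_diff (exp_coeff s) n
      = poly_op (1 + smult (\<i> * complex_of_real s) (odd_poly (exp_coeff s) n)) A
        - poly_op (1 + smult (\<i> * complex_of_real s) (odd_poly (exp_coeff s) n)) B" for n
    by (simp add: poly_op_odd_poly_diff)
  then show ?thesis
    unfolding exp_diff_def
    using tendsto_diff[OF A.cfc_LIMSEQ[OF imag_exp_uniform_limit] B.cfc_LIMSEQ[OF imag_exp_uniform_limit]] by simp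
qed

text \<open>
  The term-by-term bound of the Taylor series. It has the right order for small \<open>s\<close> only, which suffices
  because of the next two lemmas.
\<close>

lemma trace_norm_le_exp_diff_small: "trace_norm_le (exp_diff s) (\<bar>s\<bar> * (comm_bound * exp (\<bar>s\<bar> * M)))"
proof (rule trace_norm_le_limit[OF always_eventually exp_diff_LIMSEQ tendsto_const], rule allI)
  fix n
  have "trace_norm_le (odd_poly_diff (exp_coeff s) n - odd_poly_diff (exp_coeff s) 0) (comm_bound * exp_tail 0 (\<bar>s\<bar> * M))" by (rule trace_norm_le_exp_coeff_diff) simp
  then have "trace_norm_le (odd_poly_diff (exp_coeff s) n) (comm_bound * exp (\<bar>s\<bar> * M))" by (simp add: odd_poly_diff_def exp_tail_0)
  from trace_norm_le_cmult[OF this, of "\<i> * complex_of_real s"]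
  show "trace_norm_le (scalar_op (\<i> * complex_of_real s) o\<^sub>L odd_poly_diff (exp_coeff s) n) (\<bar>s\<bar> * (comm_bound * exp (\<bar>s\<bar> * M)))"
    by (simp add: norm_mult)
qed

text \<open>
  \<open>U\<^sub>s\<^sub>+\<^sub>t - V\<^sub>s\<^sub>+\<^sub>t = (U\<^sub>s - V\<^sub>s) V\<^sub>t + U\<^sub>s (U\<^sub>t - V\<^sub>t)\<close> for the groups \<open>U\<close>, \<open>V\<close> generated by \<open>A\<close> and \<open>B\<close>, whose
  members have norm at most \<open>1\<close>.
\<close>

lemma trace_norm_le_exp_diff_add:
  assumes "trace_norm_le (exp_diff s) C" "trace_norm_le (exp_diff t) D"
  shows "trace_norm_le (exp_diff (s + t)) (C + D)"
proof -
  have e: "imag_exp (s + t) = (\<lambda>x. imag_exp s x * imag_exp t x)"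
    by (simp add: imag_exp_def fun_eq_iff distrib_right distrib_left flip: exp_add)
  have nA: "norm (cfc (imag_exp s) A) \<le> 1" by (rule A.norm_cfc_le[OF imag_exp_continuous]) (simp add: norm_imag_exp)
  have nB: "norm (cfc (imag_exp t) B) \<le> 1" by (rule B.norm_cfc_le[OF imag_exp_continuous]) (simp add: norm_imag_exp)
  have "exp_diff (s + t) = (exp_diff s o\<^sub>L cfc (imag_exp t) B) + (cfc (imag_exp s) A o\<^sub>L exp_diff t)"
    unfolding exp_diff_def e A.cfc_mult[OF imag_exp_continuous imag_exp_continuous] B.cfc_mult[OF imag_exp_continuous imag_exp_continuous]
    by (rule blinfun_eqI) (simp add: blinfun.diff_left blinfun.add_left blinfun.diff_right)
  moreover have "trace_norm_le ((exp_diff s o\<^sub>L cfc (imag_exp t) B) + (cfc (imag_exp s) A o\<^sub>L exp_diff t))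
      (C * norm (cfc (imag_exp t) B) + norm (cfc (imag_exp s) A) * D)"
    by (intro trace_norm_le_add trace_norm_le_compose_left[OF assms(2) A.adj_pair_cfc[OF imag_exp_continuous]]
        trace_norm_le_compose_right[OF assms(1) B.adj_pair_cfc[OF imag_exp_continuous]])
  moreover have "C * norm (cfc (imag_exp t) B) + norm (cfc (imag_exp s) A) * D \<le> C * 1 + 1 * D"
    using nA nB trace_norm_le_nonneg[OF assms(1)] trace_norm_le_nonneg[OF assms(2)]
    by (intro add_mono mult_left_mono mult_right_mono) auto
  ultimately show ?thesis by (simp only: mult_1 mult.right_neutral) (rule trace_norm_le_mono)
qed

lemma trace_norm_le_exp_diff_multiple: "trace_norm_le (exp_diff s) C \<Longrightarrow> trace_norm_le (exp_diff (real (Suc n) * s)) (real (Suc n) * C)"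
proof (induction n)
  case (Suc n)
  from trace_norm_le_exp_diff_add[OF Suc.IH[OF Suc.prems] Suc.prems] show ?case by (simp add: algebra_simps)
qed simp

text \<open>
  Krein's estimate. Subadditivity lets \<open>s\<close> be replaced by \<open>s/n\<close> in the exponential factor of the Taylor
  bound, and the factor tends to \<open>1\<close>.
\<close>

theorem trace_norm_le_exp_diff: "trace_norm_le (exp_diff s) (\<bar>s\<bar> * comm_bound)"
proof -
  have "trace_norm_le (exp_diff s) (\<bar>s\<bar> * (comm_bound * exp (\<bar>s\<bar> * M / real (Suc n))))" for n
  proof -
    have "trace_norm_le (exp_diff (real (Suc n) * (s / real (Suc n))))
        (real (Suc n) * (\<bar>s / real (Suc n)\<bar> * (comm_bound * exp (\<bar>s / real (Suc n)\<bar> * M))))"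
      by (rule trace_norm_le_exp_diff_multiple[OF trace_norm_le_exp_diff_small])
    then show ?thesis by (simp del: of_nat_Suc)
  qed
  moreover have "(\<lambda>n. \<bar>s\<bar> * (comm_bound * exp (\<bar>s\<bar> * M / real (Suc n)))) \<longlonglongrightarrow> \<bar>s\<bar> * (comm_bound * exp 0)"
    by (intro tendsto_intros LIMSEQ_Suc[OF lim_const_over_n])
  ultimately show ?thesis
    using trace_norm_le_limit[OF always_eventually[OF allI] tendsto_const,
        of "exp_diff s" "\<lambda>n. \<bar>s\<bar> * (comm_bound * exp (\<bar>s\<bar> * M / real (Suc n)))" "\<bar>s\<bar> * (comm_bound * exp 0)"]
    by simp
qed

text \<open>
  The full series has trace norm at most \<open>comm_bound\<close>, by Krein's estimate after division by \<open>\<i>s\<close>; the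
  partial sum differs from it by the tail of the series. At \<open>s = 0\<close> the series is the single term \<open>A - B\<close>.
\<close>

lemma trace_norm_le_exp_coeff: "trace_norm_le (odd_poly_diff (exp_coeff s) n) (comm_bound + comm_bound * exp_tail n (\<bar>s\<bar> * M))"
proof (cases "s = 0")
  case True
  have "odd_poly_diff (exp_coeff 0) n = (if n = 0 then 0 else power_diff 0)"
  proof (cases n)
    case (Suc m)
    then show ?thesis
      by (intro blinfun_eqI)
        (simp add: odd_poly_diff_def exp_coeff_def blinfun.sum_left sum.lessThan_Suc_shift blinfun.add_left del: sum.lessThan_Suc)
  qed (simp add: odd_poly_diff_def)
  moreover have "trace_norm_le 0 (comm_bound + comm_bound * exp_tail n (\<bar>s\<bar> * M))" "trace_norm_le (power_diff 0) (comm_bound + comm_bound * exp_tail n (\<bar>s\<bar> * M))"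
    using comm_bound_nonneg exp_tail_nonneg[of "\<bar>s\<bar> * M" n]
    by (auto intro!: trace_norm_le_mono[OF trace_norm_le_zero] trace_norm_le_mono[OF trace_norm_le_power_diff[of 0]])
  ultimately show ?thesis using True by auto
next
  case False
  define z where "z = \<i> * complex_of_real s"
  have z: "z \<noteq> 0" "cmod z = \<bar>s\<bar>" using False by (auto simp: z_def norm_mult)
  have "trace_norm_le (exp_diff s - (scalar_op z o\<^sub>L odd_poly_diff (exp_coeff s) n)) (\<bar>s\<bar> * (comm_bound * exp_tail n (\<bar>s\<bar> * M)))"
  proof (rule trace_norm_le_limit[OF _ _ tendsto_const])
    show "(\<lambda>m. (scalar_op z o\<^sub>L odd_poly_diff (exp_coeff s) m) - (scalar_op z o\<^sub>L odd_poly_diff (exp_coeff s) n)) \<longlonglongrightarrow> exp_diff s - (scalar_op z o\<^sub>L odd_poly_diff (exp_coeff s) n)"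
      unfolding z_def by (intro tendsto_diff exp_diff_LIMSEQ tendsto_const)
    show "\<forall>\<^sub>F m in sequentially. trace_norm_le ((scalar_op z o\<^sub>L odd_poly_diff (exp_coeff s) m) - (scalar_op z o\<^sub>L odd_poly_diff (exp_coeff s) n)) (\<bar>s\<bar> * (comm_bound * exp_tail n (\<bar>s\<bar> * M)))"
      using eventually_ge_at_top[of n]
    proof eventually_elim
      case (elim m)
      have "(scalar_op z o\<^sub>L odd_poly_diff (exp_coeff s) m) - (scalar_op z o\<^sub>L odd_poly_diff (exp_coeff s) n) = scalar_op z o\<^sub>L (odd_poly_diff (exp_coeff s) m - odd_poly_diff (exp_coeff s) n)"
        by (rule blinfun_eqI) (simp add: blinfun.diff_left scaleC.diff_right)
      then show ?case using trace_norm_le_cmult[OF trace_norm_le_exp_coeff_diff[OF elim], of z] z(2) by simp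
    qed
  qed
  from trace_norm_le_diff[OF trace_norm_le_exp_diff[of s] this]
  have "trace_norm_le (scalar_op z o\<^sub>L odd_poly_diff (exp_coeff s) n) (\<bar>s\<bar> * comm_bound + \<bar>s\<bar> * (comm_bound * exp_tail n (\<bar>s\<bar> * M)))" by simp
  from trace_norm_le_cmult[OF this, of "1 / z"]
  moreover have "cmod (1 / z) * (\<bar>s\<bar> * comm_bound + \<bar>s\<bar> * (comm_bound * exp_tail n (\<bar>s\<bar> * M))) = comm_bound + comm_bound * exp_tail n (\<bar>s\<bar> * M)"
    using z False by (simp add: norm_divide field_simps)
  ultimately have "trace_norm_le (scalar_op (1 / z) o\<^sub>L (scalar_op z o\<^sub>L odd_poly_diff (exp_coeff s) n)) (comm_bound + comm_bound * exp_tail n (\<bar>s\<bar> * M))"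
    by (simp only:)
  moreover have "scalar_op (1 / z) o\<^sub>L (scalar_op z o\<^sub>L odd_poly_diff (exp_coeff s) n) = odd_poly_diff (exp_coeff s) n"
    using z(1) by (intro blinfun_eqI) (simp add: scaleC_scaleC)
  ultimately show ?thesis by simp
qed

end

section \<open>Integrals against complex measures\<close>

text \<open>
  \<open>P - R = S - Q\<close> as signed measures, written without subtraction so that the standard induction over
  nonnegative measurable functions applies.
\<close>

lemma nn_integral_eq_of_measure_eq:
  fixes P Q R S :: "real measure"
  assumes sets: "sets P = sets borel" "sets Q = sets borel" "sets R = sets borel" "sets S = sets borel"
    and eq: "\<And>A. A \<in> sets borel \<Longrightarrow> emeasure P A + emeasure Q A = emeasure R A + emeasure S A"
    and u: "u \<in> borel_measurable borel"
  shows "nn_integral P u + nn_integral Q u = nn_integral R u + nn_integral S u"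
  using u
proof (induction u rule: borel_measurable_induct)
  case (cong f g)
  then have "f = g" by (auto simp: fun_eq_iff)
  then show ?case using cong by simp
next
  case (set A)
  then show ?case using eq[OF set] by (simp add: sets)
next
  case (mult u c)
  have m: "u \<in> borel_measurable X" if "sets X = sets borel" for X
    using mult(2) that by (simp cong: measurable_cong_sets)
  from mult show ?case
    by (simp add: nn_integral_cmult m sets flip: distrib_left)
next
  case (add u v)
  have m: "u \<in> borel_measurable X" "v \<in> borel_measurable X" if "sets X = sets borel" for X
    using add that by (simp_all cong: measurable_cong_sets)
  have "(\<integral>\<^sup>+ x. v x + u x \<partial>X) = nn_integral X v + nn_integral X u" if "sets X = sets borel" for X
    using m[OF that] by (rule nn_integral_add[rotated])
  then show ?case using add by (simp add: sets) (metis (no_types, lifting) add.assoc add.left_commute)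
next
  case (seq U)
  have m: "U i \<in> borel_measurable X" if "sets X = sets borel" for X i
    using seq(1) that by (simp cong: measurable_cong_sets)
  have S: "(\<integral>\<^sup>+ x. (SUP i. U i) x \<partial>X) = (SUP i. nn_integral X (U i))" if "sets X = sets borel" for X
    using nn_integral_monotone_convergence_SUP[OF seq(3) m[OF that]] by (simp add: image_image)
  have inc: "incseq (\<lambda>i. nn_integral X (U i))" for X :: "real measure"
    using seq(3) by (auto simp: incseq_def le_fun_def intro!: nn_integral_mono)
  show ?case
    unfolding S[OF sets(1)] S[OF sets(2)] S[OF sets(3)] S[OF sets(4)]
      ennreal_SUP_add[OF inc inc, symmetric] using seq by simp
qed

text \<open>
  Bounded functions become nonnegative after adding a constant, which changes the two sides by the same
  amount.
\<close>

lemma integral_eq_of_measure_eq: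
  fixes g :: "real \<Rightarrow> complex"
  assumes fin: "finite_measure P" "finite_measure Q" "finite_measure R" "finite_measure S"
    and sets: "sets P = sets borel" "sets Q = sets borel" "sets R = sets borel" "sets S = sets borel"
    and eq: "\<And>A. A \<in> sets borel \<Longrightarrow> measure P A + measure Q A = measure R A + measure S A"
    and g: "g \<in> borel_measurable borel" and b: "\<And>x. cmod (g x) \<le> b"
  shows "(LINT x|P. g x) + (LINT x|Q. g x) = (LINT x|R. g x) + (LINT x|S. g x)"
proof -
  have em: "emeasure P A + emeasure Q A = emeasure R A + emeasure S A" if "A \<in> sets borel" for A
    using eq[OF that] fin by (simp add: finite_measure.emeasure_eq_measure flip: ennreal_plus)
  have int: "integrable X h" if "finite_measure X" "sets X = sets borel" "h \<in> borel_measurable borel" "\<And>x. norm (h x) \<le> c"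
    for X :: "real measure" and h :: "real \<Rightarrow> 'x::{banach, second_countable_topology}" and c
    using finite_measure.integrable_const_bound[OF that(1), of h c] that by (simp cong: measurable_cong_sets)
  have sp: "space X = UNIV" if "sets X = sets borel" for X :: "real measure"
    using sets_eq_imp_space_eq[OF that] by simp
  have pos: "(LINT x|P. h x) + (LINT x|Q. h x) = (LINT x|R. h x) + (LINT x|S. h x)"
    if h: "h \<in> borel_measurable borel" "\<And>x. 0 \<le> h x" "\<And>x. h x \<le> c" for h :: "real \<Rightarrow> real" and c
  proof -
    have i: "integrable X h" if "finite_measure X" "sets X = sets borel" for X
      by (rule int[OF that h(1), of c]) (use h in auto)
    have n: "nn_integral X (\<lambda>x. ennreal (h x)) = ennreal (LINT x|X. h x)" if "finite_measure X" "sets X = sets borel" for X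
      by (rule nn_integral_eq_integral[OF i[OF that]]) (use h in auto)
    have p: "(LINT x|X. h x) \<ge> 0" for X by (rule integral_nonneg_AE) (use h in auto)
    have "ennreal ((LINT x|P. h x) + (LINT x|Q. h x)) = ennreal ((LINT x|R. h x) + (LINT x|S. h x))"
      using nn_integral_eq_of_measure_eq[OF sets em, of "\<lambda>x. ennreal (h x)"] h(1) p
      by (simp add: n fin sets)
    then show ?thesis by (rule iffD1[OF ennreal_inj, rotated 2]) (use p in auto)
  qed
  have rl: "(LINT x|P. h x) + (LINT x|Q. h x) = (LINT x|R. h x) + (LINT x|S. h x)"
    if h: "h \<in> borel_measurable borel" "\<And>x. \<bar>h x\<bar> \<le> c" for h :: "real \<Rightarrow> real" and c
  proof -
    have a: "0 \<le> h x + c" "h x + c \<le> 2 * c" for x using h(2)[of x] by auto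
    have "(LINT x|X. h x + c) = (LINT x|X. h x) + measure X UNIV * c" if "finite_measure X" "sets X = sets borel" for X
      using int[OF that h(1), of c] h(2) finite_measure.integrable_const[OF that(1), of c] by (simp add: sp[OF that(2)])
    with pos[of "\<lambda>x. h x + c", OF _ a] h(1)
    have "(LINT x|P. h x) + measure P UNIV * c + ((LINT x|Q. h x) + measure Q UNIV * c)
        = (LINT x|R. h x) + measure R UNIV * c + ((LINT x|S. h x) + measure S UNIV * c)"
      by (simp add: fin sets)
    moreover have "measure P UNIV * c + measure Q UNIV * c = measure R UNIV * c + measure S UNIV * c"
      unfolding distrib_right[symmetric] by (simp add: eq)
    ultimately show ?thesis by linarith
  qed
  have ig: "integrable X g" if "finite_measure X" "sets X = sets borel" for X by (rule int[OF that g b])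
  have re: "\<bar>Re (g x)\<bar> \<le> b" and im: "\<bar>Im (g x)\<bar> \<le> b" for x
    by (rule order_trans[OF abs_Re_le_cmod b] order_trans[OF abs_Im_le_cmod b])+
  show ?thesis
  proof (rule complex_eqI)
    show "Re ((LINT x|P. g x) + (LINT x|Q. g x)) = Re ((LINT x|R. g x) + (LINT x|S. g x))"
      using rl[of "\<lambda>x. Re (g x)", OF measurable_compose[OF g borel_measurable_Re] re]
      by (simp only: integral_Re ig fin sets plus_complex.sel)
    show "Im ((LINT x|P. g x) + (LINT x|Q. g x)) = Im ((LINT x|R. g x) + (LINT x|S. g x))"
      using rl[of "\<lambda>x. Im (g x)", OF measurable_compose[OF g borel_measurable_Im] im]
      by (simp only: integral_Im ig fin sets plus_complex.sel)
  qed
qed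

section \<open>The primitive of a Fourier transform\<close>

text \<open>
  \<open>(exp(\<i>sx) - 1)/(\<i>s)\<close>, continued to \<open>s = 0\<close> by its limit.
\<close>

definition exp_quot :: "real \<Rightarrow> real \<Rightarrow> complex" where
  "exp_quot s x = (if s = 0 then complex_of_real x else (imag_exp s x - 1) / (\<i> * complex_of_real s))"

lemma exp_quot_0: "exp_quot s 0 = 0"
  by (simp add: exp_quot_def imag_exp_def)

lemma exp_quot_derivative: "(exp_quot s has_vector_derivative imag_exp s x) (at x within S)"
proof (cases "s = 0")
  case True
  then have "exp_quot s = complex_of_real" "imag_exp s x = 1" by (auto simp: exp_quot_def imag_exp_def fun_eq_iff)
  then show ?thesis using has_vector_derivative_of_real[of "\<lambda>x. x" 1 "at x within S"] by simp
next
  case False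
  have "((\<lambda>z. (exp (\<i> * complex_of_real s * z) - 1) / (\<i> * complex_of_real s)) has_field_derivative
      exp (\<i> * complex_of_real s * complex_of_real x)) (at (complex_of_real x))"
    using False by (auto intro!: derivative_eq_intros)
  from has_vector_derivative_real_field[OF this, of S] show ?thesis
    using False by (simp add: exp_quot_def[abs_def] imag_exp_def mult.assoc)
qed

lemma exp_quot_lipschitz: "cmod (exp_quot s x - exp_quot s y) \<le> \<bar>x - y\<bar>"
proof -
  have "norm (exp_quot s x - exp_quot s y) \<le> 1 * norm (x - y)"
  proof (rule differentiable_bound[of UNIV])
    show "(exp_quot s has_derivative (\<lambda>h. h *\<^sub>R imag_exp s z)) (at z within UNIV)" for z
      using exp_quot_derivative[of s z UNIV] by (simp add: has_vector_derivative_def)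
    show "onorm (\<lambda>h::real. h *\<^sub>R imag_exp s z) \<le> 1" for z
      by (rule onorm_le) (simp add: norm_imag_exp)
  qed auto
  then show ?thesis by simp
qed

lemma norm_exp_quot_le: "cmod (exp_quot s x) \<le> \<bar>x\<bar>"
  using exp_quot_lipschitz[of s x 0] by (simp add: exp_quot_0)

lemma exp_quot_sums: "(\<lambda>k. exp_coeff s k * complex_of_real x ^ Suc k) sums exp_quot s x"
proof (cases "s = 0")
  case True
  have "(\<lambda>k. if k = 0 then complex_of_real x else 0) sums complex_of_real x"
    using sums_single[of 0 "\<lambda>_. complex_of_real x"] by simp
  then show ?thesis using True by (auto simp: exp_quot_def exp_coeff_def elim!: sums_cong[THEN iffD1, rotated])
next
  case False
  define z where "z = \<i> * complex_of_real s"
  have z: "z \<noteq> 0" using False by (simp add: z_def)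
  have "(\<lambda>k. (z * complex_of_real x) ^ k / fact k) sums imag_exp s x"
    unfolding imag_exp_def z_def using exp_converges[of "\<i> * complex_of_real (s * x)"]
    by (simp add: scaleR_conv_of_real divide_inverse mult_ac)
  then have "(\<lambda>k. (z * complex_of_real x) ^ Suc k / fact (Suc k)) sums (imag_exp s x - 1)" by (subst sums_Suc_iff) simp
  from sums_divide[OF this, of z]
  show ?thesis using False z by (simp add: exp_quot_def exp_coeff_def z_def[symmetric] power_mult_distrib field_simps del: fact_Suc)
qed

text \<open>
  The remainder is bounded with the factor \<open>x\<close> in front, not merely uniformly: this is what makes the integrals
  against \<open>f'/f\<close> converge.
\<close>

lemma exp_quot_partial_sum:
  assumes "x \<ge> 0"
  shows "cmod (exp_quot s x - (\<Sum>k<n. exp_coeff s k * complex_of_real x ^ Suc k)) \<le> x * exp_tail n (\<bar>s\<bar> * x)"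
proof -
  let ?g = "\<lambda>k. exp_coeff s k * complex_of_real x ^ Suc k"
  have b: "cmod (?g (k + n)) \<le> x * ((\<bar>s\<bar> * x) ^ (k + n) / fact (k + n))" for k
  proof -
    have "cmod (?g (k + n)) = x * ((\<bar>s\<bar> * x) ^ (k + n) / fact (Suc (k + n)))"
      using assms by (simp add: exp_coeff_def norm_mult norm_divide norm_power norm_fact power_mult_distrib del: fact_Suc)
    also have "\<dots> \<le> x * ((\<bar>s\<bar> * x) ^ (k + n) / fact (k + n))"
      using assms by (intro mult_left_mono divide_left_mono fact_mono) auto
    finally show ?thesis .
  qed
  have sb: "summable (\<lambda>k. x * ((\<bar>s\<bar> * x) ^ (k + n) / fact (k + n)))" by (intro summable_mult summable_exp_tail)
  have "(\<lambda>k. ?g (k + n)) sums (exp_quot s x - (\<Sum>k<n. ?g k))"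
    by (rule sums_split_initial_segment[OF exp_quot_sums])
  then have "exp_quot s x - (\<Sum>k<n. ?g k) = (\<Sum>k. ?g (k + n))" by (simp add: sums_iff)
  also have "cmod \<dots> \<le> (\<Sum>k. cmod (?g (k + n)))"
    by (rule summable_norm) (rule summable_comparison_test'[OF sb, of 0], use b in simp)
  also have "\<dots> \<le> (\<Sum>k. x * ((\<bar>s\<bar> * x) ^ (k + n) / fact (k + n)))"
    by (rule suminf_le[OF b _ sb]) (rule summable_comparison_test'[OF sb, of 0], use b in simp)
  also have "\<dots> = x * exp_tail n (\<bar>s\<bar> * x)"
    unfolding exp_tail_def by (rule suminf_mult[OF summable_exp_tail])
  finally show ?thesis .
qed

lemma measurable_imag_exp [measurable]: "(\<lambda>s. imag_exp s x) \<in> borel_measurable borel"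
  unfolding imag_exp_def by measurable

lemma measurable_exp_quot [measurable]: "(\<lambda>s. exp_quot s x) \<in> borel_measurable borel"
  unfolding exp_quot_def by measurable

lemma measurable_exp_coeff [measurable]: "(\<lambda>s. exp_coeff s k) \<in> borel_measurable borel"
  unfolding exp_coeff_def by measurable

text \<open>
  The primitive, vanishing at \<open>0\<close>, of the Fourier transform of \<open>N\<close>.
\<close>

definition primitive :: "real measure \<Rightarrow> real \<Rightarrow> complex" where
  "primitive N x = (LINT s|N. exp_quot s x)"

locale finite_borel_measure = finite_measure N for N :: "real measure" +
  assumes sets_N [measurable_cong, simp]: "sets N = sets borel"
begin

lemma space_N [simp]: "space N = UNIV"
  using sets_eq_imp_space_eq[OF sets_N] by simp

lemma integrable_exp_quot: "integrable N (\<lambda>s. exp_quot s x)"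
  by (rule integrable_const_bound[of _ "\<bar>x\<bar>"]) (auto simp: norm_exp_quot_le)

lemma integrable_imag_exp: "integrable N (\<lambda>s. imag_exp s x)"
  by (rule integrable_const_bound[of _ 1]) (auto simp: norm_imag_exp)

lemma primitive_0: "primitive N 0 = 0"
  by (simp add: primitive_def exp_quot_0)

text \<open>
  Differentiation under the integral sign; the quotients are dominated by \<open>2\<close> since both \<open>exp_quot s\<close> and its
  linearization are Lipschitz with constant \<open>1\<close>.
\<close>

lemma primitive_derivative: "(primitive N has_vector_derivative (LINT s|N. imag_exp s x)) (at x)"
  unfolding has_vector_derivative_def has_derivative_at2
proof (intro conjI bounded_linear_scaleR_left, subst tendsto_at_iff_sequentially, intro allI impI)
  fix X :: "nat \<Rightarrow> real" assume X: "\<forall>i. X i \<in> UNIV - {x}" "X \<longlonglongrightarrow> x"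
  define q where "q y s = (1 / norm (y - x)) *\<^sub>R (exp_quot s y - (exp_quot s x + (y - x) *\<^sub>R imag_exp s x))" for y s
  have "(1 / norm (y - x)) *\<^sub>R (primitive N y - (primitive N x + (y - x) *\<^sub>R (LINT s|N. imag_exp s x))) = (LINT s|N. q y s)" for y
    unfolding q_def primitive_def by (simp add: integrable_exp_quot integrable_imag_exp)
  moreover have "(\<lambda>n. LINT s|N. q (X n) s) \<longlonglongrightarrow> (LINT s|N. 0)"
  proof (rule integral_dominated_convergence)
    show "(\<lambda>s. 0::complex) \<in> borel_measurable N" by simp
    show "(\<lambda>s. q (X n) s) \<in> borel_measurable N" for n unfolding q_def by measurable
    show "integrable N (\<lambda>s. 2 :: real)" by simp
    show "AE s in N. (\<lambda>n. q (X n) s) \<longlonglongrightarrow> 0"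
    proof (rule AE_I2)
      fix s
      have "((\<lambda>y. q y s) \<longlongrightarrow> 0) (at x)"
        using exp_quot_derivative[of s x UNIV] unfolding has_vector_derivative_def has_derivative_at2 q_def by simp
      then show "(\<lambda>n. q (X n) s) \<longlonglongrightarrow> 0"
        using X unfolding tendsto_at_iff_sequentially comp_def by blast
    qed
    show "AE s in N. norm (q (X n) s) \<le> 2" for n
    proof (rule AE_I2)
      fix s
      define v where "v = exp_quot s (X n) - (exp_quot s x + (X n - x) *\<^sub>R imag_exp s x)"
      have "norm v
          \<le> norm (exp_quot s (X n) - exp_quot s x) + norm ((X n - x) *\<^sub>R imag_exp s x)"
        unfolding v_def diff_diff_eq[symmetric] by (rule norm_triangle_ineq4)
      also have "\<dots> \<le> 2 * norm (X n - x)" using exp_quot_lipschitz[of s "X n" x] by (simp add: norm_imag_exp)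
      finally show "norm (q (X n) s) \<le> 2" using X(1) unfolding q_def v_def[symmetric] by (simp add: divide_le_eq)
    qed
  qed
  ultimately show "((\<lambda>y. (1 / norm (y - x)) *\<^sub>R (primitive N y - (primitive N x + (y - x) *\<^sub>R (LINT s|N. imag_exp s x)))) \<circ> X) \<longlonglongrightarrow> 0"
    by (simp add: comp_def)
qed

lemma primitive_continuous: "continuous_on S (primitive N)"
  by (rule continuous_on_vector_derivative) (rule has_vector_derivative_at_within[OF primitive_derivative])

end

text \<open>
  The decomposition of \<open>\<mu>\<close> into positive measures may vary with the point at which the Fourier transform is
  evaluated. The one belonging to the point \<open>0\<close> serves for all points, because the integral of a bounded function
  is determined by \<open>\<mu>\<close>. Both sides then have the same derivative.
\<close>

lemma W1_line_representation:
  assumes "\<psi> \<in> W1_line"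
  shows "\<exists>N1 N2 N3 N4. (\<forall>N\<in>{N1, N2, N3, N4}. finite_borel_measure N) \<and>
    (\<forall>x. \<psi> x = \<psi> 0 + (primitive N1 x - primitive N2 x + \<i> * (primitive N3 x - primitive N4 x)))"
proof -
  obtain \<psi>' where \<psi>': "\<And>x. (\<psi> has_vector_derivative \<psi>' x) (at x)"
    using assms unfolding W1_line_def C1_on_def by auto
  obtain \<mu> where mu: "\<And>x. has_complex_measure_integral \<mu> (\<lambda>y. exp (\<i> * of_real x * of_real y)) (\<psi>' x)"
    using assms unfolding W1_line_def by (auto simp: vector_derivative_at[OF \<psi>'])
  obtain N1 N2 N3 N4 where N: "\<forall>M\<in>{N1, N2, N3, N4}. finite_measure M \<and> sets M = sets borel"
    and muN: "\<forall>A\<in>sets borel. \<mu> A = complex_of_real (measure N1 A - measure N2 A) + \<i> * complex_of_real (measure N3 A - measure N4 A)"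
    using mu[of 0] unfolding has_complex_measure_integral_def by auto
  have fb: "\<forall>N\<in>{N1, N2, N3, N4}. finite_borel_measure N"
    using N by (auto simp: finite_borel_measure_def finite_borel_measure_axioms_def)
  have d: "\<psi>' x = (LINT s|N1. imag_exp s x) - (LINT s|N2. imag_exp s x) + \<i> * ((LINT s|N3. imag_exp s x) - (LINT s|N4. imag_exp s x))" for x
  proof -
    have e: "exp (\<i> * of_real x * of_real y) = imag_exp y x" for y by (simp add: imag_exp_def mult_ac)
    obtain M1 M2 M3 M4 where M: "\<forall>M\<in>{M1, M2, M3, M4}. finite_measure M \<and> sets M = sets borel"
      and muM: "\<forall>A\<in>sets borel. \<mu> A = complex_of_real (measure M1 A - measure M2 A) + \<i> * complex_of_real (measure M3 A - measure M4 A)"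
      and I: "\<psi>' x = (LINT s|M1. imag_exp s x) - (LINT s|M2. imag_exp s x) + \<i> * ((LINT s|M3. imag_exp s x) - (LINT s|M4. imag_exp s x))"
      using mu[of x] unfolding has_complex_measure_integral_def e by auto
    have "measure M1 A - measure M2 A = measure N1 A - measure N2 A" "measure M3 A - measure M4 A = measure N3 A - measure N4 A"
      if "A \<in> sets borel" for A
      using muM[rule_format, OF that] muN[rule_format, OF that] by (simp_all add: complex_eq_iff)
    then have "measure M1 A + measure N2 A = measure N1 A + measure M2 A" "measure M3 A + measure N4 A = measure N3 A + measure M4 A"
      if "A \<in> sets borel" for A using that by (force simp: algebra_simps)+
    then have "(LINT s|M1. imag_exp s x) + (LINT s|N2. imag_exp s x) = (LINT s|N1. imag_exp s x) + (LINT s|M2. imag_exp s x)"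
      "(LINT s|M3. imag_exp s x) + (LINT s|N4. imag_exp s x) = (LINT s|N3. imag_exp s x) + (LINT s|M4. imag_exp s x)"
      using M N by (intro integral_eq_of_measure_eq[where b = 1]; simp add: norm_imag_exp)+
    then have "(LINT s|M1. imag_exp s x) - (LINT s|M2. imag_exp s x) = (LINT s|N1. imag_exp s x) - (LINT s|N2. imag_exp s x)"
      "(LINT s|M3. imag_exp s x) - (LINT s|M4. imag_exp s x) = (LINT s|N3. imag_exp s x) - (LINT s|N4. imag_exp s x)"
      by (simp_all add: algebra_simps)
    then show ?thesis unfolding I by simp
  qed
  have p: "(primitive N has_vector_derivative (LINT s|N. imag_exp s x)) (at x)" if "N \<in> {N1, N2, N3, N4}" for N x
    using fb that by (intro finite_borel_measure.primitive_derivative) auto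
  define h where "h x = \<psi> x - (primitive N1 x - primitive N2 x + \<i> * (primitive N3 x - primitive N4 x))" for x
  have "(h has_vector_derivative 0) (at x within UNIV)" for x
  proof -
    have "(h has_vector_derivative \<psi>' x - ((LINT s|N1. imag_exp s x) - (LINT s|N2. imag_exp s x) + \<i> * ((LINT s|N3. imag_exp s x) - (LINT s|N4. imag_exp s x)))) (at x)"
      unfolding h_def by (intro has_vector_derivative_diff has_vector_derivative_add has_vector_derivative_mult_right \<psi>' p) auto
    then show ?thesis by (simp add: d)
  qed
  then obtain c where c: "\<And>x. h x = c" using has_vector_derivative_zero_constant[of UNIV h] by auto
  have p0: "primitive N 0 = 0" if "N \<in> {N1, N2, N3, N4}" for N
    using fb that finite_borel_measure.primitive_0 by blast
  have "h 0 = \<psi> 0" by (simp add: h_def p0)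
  then have "\<psi> x = \<psi> 0 + (primitive N1 x - primitive N2 x + \<i> * (primitive N3 x - primitive N4 x))" for x
    using c[of x] c[of 0] by (simp add: h_def algebra_simps)
  then show ?thesis using fb by blast
qed

section \<open>The trace formula for the class of Krein\<close>

context krein_symbol
begin

text \<open>
  Outside the period this is \<open>0\<close>, and it is \<open>0\<close> at the zeros of \<open>f\<close> because division by \<open>0\<close> gives \<open>0\<close>.
\<close>

definition integrand :: "(real \<Rightarrow> complex) \<Rightarrow> real \<Rightarrow> complex" where
  "integrand \<phi> t = (\<phi> ((cmod (f t))\<^sup>2) - \<phi> 0) * (circle_deriv f t / f t)"

text \<open>
  The right-hand side of the trace formula; the normalization \<open>1/2\<pi>\<close> is part of the measure. If \<open>f\<close> has no
  zeros and \<open>\<phi>\<close> vanishes at \<open>0\<close> and equals \<open>1\<close> on the range of \<open>\<bar>f\<bar>\<^sup>2\<close>, this is the winding number of \<open>f\<close>.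
\<close>

definition winding_integral :: "(real \<Rightarrow> complex) \<Rightarrow> complex" where
  "winding_integral \<phi> = 1 / \<i> * (LINT t|circle_measure. integrand \<phi> t)"

text \<open>
  Besides the identity itself, the conditions that make its two sides meaningful and stable under linear
  combinations.
\<close>

definition trace_formula :: "(real \<Rightarrow> complex) \<Rightarrow> bool" where
  "trace_formula \<phi> \<longleftrightarrow> continuous_on {0..M} \<phi> \<and> (\<exists>C. trace_norm_le (cfc \<phi> A - cfc \<phi> B) C) \<and>
     integrable circle_measure (integrand \<phi>) \<and> has_tr (cfc \<phi> A - cfc \<phi> B) (winding_integral \<phi>)"

lemma circle_deriv_outside: "t \<notin> {0..2*pi} \<Longrightarrow> circle_deriv f t = 0"
  by (simp add: circle_deriv_def)

lemma range_f: "t \<in> {0..2*pi} \<Longrightarrow> (cmod (f t))\<^sup>2 \<in> {0..M}"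
  using f_le_Linf by (auto intro: power_mono)

lemma integrand_cong:
  assumes "\<And>x. x \<in> {0..M} \<Longrightarrow> \<phi> x = \<psi> x"
  shows "integrand \<phi> = integrand \<psi>"
proof
  fix t
  have "\<phi> 0 = \<psi> 0" by (rule assms) (use A.M0 in auto)
  then show "integrand \<phi> t = integrand \<psi> t"
    using assms[OF range_f, of t] circle_deriv_outside[of t] by (cases "t \<in> {0..2*pi}") (auto simp: integrand_def)
qed

lemma trace_formula_cong:
  assumes "trace_formula \<phi>" "\<And>x. x \<in> {0..M} \<Longrightarrow> \<phi> x = \<psi> x"
  shows "trace_formula \<psi>"
proof -
  have c: "continuous_on {0..M} \<phi>" using assms(1) by (simp add: trace_formula_def)
  have "continuous_on {0..M} \<psi>" by (rule continuous_on_eq[OF c assms(2)])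
  then show ?thesis
    using assms(1) integrand_cong[OF assms(2)] A.cfc_cong[OF c assms(2)] B.cfc_cong[OF c assms(2)]
    by (simp add: trace_formula_def winding_integral_def)
qed

lemma trace_formula_const: "trace_formula (\<lambda>x. c)"
proof -
  have i: "integrand (\<lambda>x. c) = (\<lambda>t. 0)" by (simp add: integrand_def fun_eq_iff)
  show ?thesis
    unfolding trace_formula_def winding_integral_def i A.cfc_const B.cfc_const using trace_norm_le_zero by (auto intro: has_tr_zero)
qed

lemma trace_formula_add:
  assumes "trace_formula \<phi>" "trace_formula \<psi>"
  shows "trace_formula (\<lambda>x. \<phi> x + \<psi> x)"
proof -
  note 1 = assms(1)[unfolded trace_formula_def] and 2 = assms(2)[unfolded trace_formula_def]
  have c: "continuous_on {0..M} \<phi>" "continuous_on {0..M} \<psi>" using 1 2 by auto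
  have i: "integrand (\<lambda>x. \<phi> x + \<psi> x) = (\<lambda>t. integrand \<phi> t + integrand \<psi> t)"
    unfolding integrand_def distrib_right[symmetric] by (rule ext) (simp only: add_diff_add)
  have d: "cfc (\<lambda>x. \<phi> x + \<psi> x) A - cfc (\<lambda>x. \<phi> x + \<psi> x) B = (cfc \<phi> A - cfc \<phi> B) + (cfc \<psi> A - cfc \<psi> B)"
    unfolding A.cfc_add[OF c] B.cfc_add[OF c] by simp
  have r: "winding_integral (\<lambda>x. \<phi> x + \<psi> x) = winding_integral \<phi> + winding_integral \<psi>"
    unfolding winding_integral_def i using 1 2 by (simp add: distrib_left)
  show ?thesis
    unfolding trace_formula_def d r using 1 2
    by (auto simp: i intro!: continuous_intros has_tr_add dest: trace_norm_le_add)
qed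

lemma trace_formula_cmult:
  assumes "trace_formula \<phi>"
  shows "trace_formula (\<lambda>x. c * \<phi> x)"
proof -
  note 1 = assms[unfolded trace_formula_def]
  have c: "continuous_on {0..M} \<phi>" using 1 by auto
  have i: "integrand (\<lambda>x. c * \<phi> x) = (\<lambda>t. c * integrand \<phi> t)"
    by (simp add: integrand_def fun_eq_iff algebra_simps)
  have d: "cfc (\<lambda>x. c * \<phi> x) A - cfc (\<lambda>x. c * \<phi> x) B = scalar_op c o\<^sub>L (cfc \<phi> A - cfc \<phi> B)"
    unfolding A.cfc_cmult[OF c] B.cfc_cmult[OF c]
    by (rule blinfun_eqI) (simp add: blinfun.diff_left scaleC.diff_right)
  have r: "winding_integral (\<lambda>x. c * \<phi> x) = c * winding_integral \<phi>"
    unfolding winding_integral_def i by simp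
  show ?thesis
    unfolding trace_formula_def d r using 1
    by (auto simp: i intro!: continuous_intros has_tr_cmult dest: trace_norm_le_cmult)
qed

abbreviation "odd_fun a n \<equiv> (\<lambda>x. poly (odd_poly a n) (complex_of_real x))"

text \<open>
  \<open>\<bar>f\<bar>\<^sup>2\<close> to the power \<open>k + 1\<close> contains the factor \<open>f\<close>, which cancels against the denominator; where \<open>f\<close>
  vanishes both sides are \<open>0\<close>.
\<close>

lemma integrand_odd_poly: "integrand (odd_fun a n) t = (\<Sum>k<n. a k * (circle_deriv f t * power_symbol k t))"
proof (cases "f t = 0")
  case True
  then show ?thesis by (simp add: integrand_def power_symbol_def)
next
  case False
  have "complex_of_real ((cmod (f t))\<^sup>2) ^ Suc k * (circle_deriv f t / f t) = circle_deriv f t * power_symbol k t" for k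
  proof -
    have "complex_of_real ((cmod (f t))\<^sup>2) ^ Suc k = f t * power_symbol k t"
      unfolding power_Suc power_symbol_def complex_norm_square by (simp only: mult.assoc)
    then show ?thesis using False by simp
  qed
  moreover have "integrand (odd_fun a n) t
      = (\<Sum>k<n. a k * complex_of_real ((cmod (f t))\<^sup>2) ^ Suc k) * (circle_deriv f t / f t)"
    by (simp add: integrand_def poly_odd_poly)
  ultimately show ?thesis by (simp only: sum_distrib_right mult.assoc)
qed

lemma integrable_deriv_power_symbol: "integrable circle_measure (\<lambda>t. circle_deriv f t * power_symbol k t)"
proof -
  obtain b where b: "power_symbol k \<in> borel_measurable lebesgue" "\<And>t. t \<in> {0..2*pi} \<Longrightarrow> cmod (power_symbol k t) \<le> b"
    using power_symbol_symbol[of k] unfolding bounded_symbol_def by blast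
  show ?thesis by (rule integrable_circle_mult_bounded(1)[OF integrable_circle_deriv(1)[OF W_11] b])
qed

lemma integrable_integrand_odd: "integrable circle_measure (integrand (odd_fun a n))"
  unfolding integrand_odd_poly[abs_def] by (intro Bochner_Integration.integrable_sum integrable_mult_right integrable_deriv_power_symbol)

lemma has_tr_odd_poly_diff: "has_tr (odd_poly_diff a n) (winding_integral (odd_fun a n))"
proof -
  have "winding_integral (odd_fun a n) = (\<Sum>k<n. a k * (1 / \<i> * (LINT t|circle_measure. circle_deriv f t * power_symbol k t)))"
    unfolding winding_integral_def integrand_odd_poly
    by (subst Bochner_Integration.integral_sum)
      (auto intro!: integrable_mult_right integrable_deriv_power_symbol simp: sum_distrib_left mult_ac)
  moreover have "has_tr (\<Sum>k<n. scalar_op (a k) o\<^sub>L power_diff k) (\<Sum>k<n. a k * (1 / \<i> * (LINT t|circle_measure. circle_deriv f t * power_symbol k t)))"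
  proof (induction n)
    case (Suc n)
    then show ?case
      unfolding sum.lessThan_Suc using trace_monom[of n] by (intro has_tr_add has_tr_cmult) (auto simp: power_diff_def)
  qed (simp add: has_tr_zero)
  ultimately show ?thesis by (simp add: odd_poly_diff_def)
qed

text \<open>
  The assumption on \<open>\<epsilon>\<close> controls the functional calculus and, since \<open>\<bar>f\<bar>\<^sup>2 / \<bar>f\<bar> = \<bar>f\<bar>\<close> is bounded, the
  integrals; the assumption on \<open>\<eta>\<close> controls the trace.
\<close>

lemma trace_formula_limit:
  fixes a :: "nat \<Rightarrow> nat \<Rightarrow> complex" and K :: "nat \<Rightarrow> nat"
  assumes cont: "continuous_on {0..M} \<phi>"
    and approx: "\<And>n x. x \<in> {0..M} \<Longrightarrow> cmod (odd_fun (a n) (K n) x - (\<phi> x - \<phi> 0)) \<le> x * \<epsilon> n"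
    and \<epsilon>: "\<epsilon> \<longlonglongrightarrow> 0" "\<And>n. \<epsilon> n \<ge> 0"
    and cauchy: "\<And>n m. n \<le> m \<Longrightarrow> trace_norm_le (odd_poly_diff (a m) (K m) - odd_poly_diff (a n) (K n)) (\<eta> n)" and \<eta>: "\<eta> \<longlonglongrightarrow> 0"
  shows "trace_formula \<phi>"
proof -
  define D where "D n = odd_poly_diff (a n) (K n)" for n
  have "uniform_limit {0..M} (\<lambda>n x. poly ([:\<phi> 0:] + odd_poly (a n) (K n)) (complex_of_real x)) \<phi> sequentially"
  proof (rule uniform_limitI)
    fix e :: real assume "e > 0"
    have "(\<lambda>n. M * \<epsilon> n) \<longlonglongrightarrow> M * 0" by (intro tendsto_mult tendsto_const \<epsilon>)
    then have "\<forall>\<^sub>F n in sequentially. M * \<epsilon> n < e" by (rule order_tendstoD) (use \<open>e > 0\<close> in simp)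
    then show "\<forall>\<^sub>F n in sequentially. \<forall>x\<in>{0..M}. dist (poly ([:\<phi> 0:] + odd_poly (a n) (K n)) (complex_of_real x)) (\<phi> x) < e"
    proof eventually_elim
      case (elim n)
      show ?case
      proof
        fix x assume x: "x \<in> {0..M}"
        have "x * \<epsilon> n \<le> M * \<epsilon> n" using x \<epsilon>(2) by (intro mult_right_mono) auto
        with approx[OF x, of n] elim
        show "dist (poly ([:\<phi> 0:] + odd_poly (a n) (K n)) (complex_of_real x)) (\<phi> x) < e"
          by (simp add: dist_norm algebra_simps)
      qed
    qed
  qed
  from tendsto_diff[OF A.cfc_LIMSEQ[OF this] B.cfc_LIMSEQ[OF this]]
  have lim: "D \<longlonglongrightarrow> cfc \<phi> A - cfc \<phi> B"
    by (simp add: poly_op_add poly_op_const poly_op_odd_poly_diff D_def[abs_def])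
  have tD: "trace_norm_le ((cfc \<phi> A - cfc \<phi> B) - D n) (\<eta> n)" for n
  proof (rule trace_norm_le_limit[OF _ tendsto_diff[OF lim tendsto_const] tendsto_const])
    show "\<forall>\<^sub>F m in sequentially. trace_norm_le (D m - D n) (\<eta> n)"
      using eventually_ge_at_top[of n] by eventually_elim (simp add: D_def cauchy)
  qed
  have trace_norm_le: "trace_norm_le (cfc \<phi> A - cfc \<phi> B) (\<eta> 0 + (\<Sum>k<K 0. cmod (a 0 k) * (real (Suc k) * M ^ k * comm_bound)))"
    using trace_norm_le_add[OF tD[of 0] trace_norm_le_odd_poly_diff[of "a 0" "K 0"]] by (simp add: D_def)
  define g where "g n = integrand (odd_fun (a n) (K n))" for n
  have gi: "integrable circle_measure (g n)" for n unfolding g_def by (rule integrable_integrand_odd)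
  have gd: "cmod (g n t - integrand \<phi> t) \<le> Linf_norm f * \<epsilon> n * cmod (circle_deriv f t)" for n t
  proof (cases "t \<in> {0..2*pi} \<and> f t \<noteq> 0")
    case True
    let ?x = "(cmod (f t))\<^sup>2"
    have 0: "odd_fun (a n) (K n) 0 = 0" by (simp add: poly_odd_poly)
    have "cmod (g n t - integrand \<phi> t) = cmod (odd_fun (a n) (K n) ?x - (\<phi> ?x - \<phi> 0)) * (cmod (circle_deriv f t) / cmod (f t))"
      unfolding g_def integrand_def 0 diff_zero left_diff_distrib[symmetric] norm_mult norm_divide ..
    also have "\<dots> \<le> (?x * \<epsilon> n) * (cmod (circle_deriv f t) / cmod (f t))"
      using True by (intro mult_right_mono approx range_f) auto
    also have "\<dots> = cmod (f t) * (\<epsilon> n * cmod (circle_deriv f t))" using True by (simp add: power2_eq_square)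
    also have "\<dots> \<le> Linf_norm f * (\<epsilon> n * cmod (circle_deriv f t))"
      using True \<epsilon>(2) by (intro mult_right_mono f_le_Linf mult_nonneg_nonneg) auto
    finally show ?thesis by simp
  next
    case False
    have "Linf_norm f \<ge> 0" by (rule order_trans[OF norm_ge_zero f_le_Linf[of 0]]) simp
    moreover have "g n t = 0" "integrand \<phi> t = 0"
      using False circle_deriv_outside[of t] by (auto simp: g_def integrand_def)
    ultimately show ?thesis using \<epsilon>(2) by simp
  qed
  have dint: "integrable circle_measure (\<lambda>t. Linf_norm f * \<epsilon> n * cmod (circle_deriv f t))" for n
    by (intro integrable_mult_right integrable_norm integrable_circle_deriv(1)[OF W_11])
  have meas: "integrand \<phi> \<in> borel_measurable circle_measure"
  proof (rule borel_measurable_LIMSEQ_metric)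
    show "g n \<in> borel_measurable circle_measure" for n by (rule borel_measurable_integrable[OF gi])
    show "(\<lambda>n. g n t) \<longlonglongrightarrow> integrand \<phi> t" for t
    proof (rule LIM_zero_cancel, rule Lim_null_comparison)
      show "\<forall>\<^sub>F n in sequentially. cmod (g n t - integrand \<phi> t) \<le> Linf_norm f * \<epsilon> n * cmod (circle_deriv f t)"
        by (rule always_eventually) (simp add: gd)
      show "(\<lambda>n. Linf_norm f * \<epsilon> n * cmod (circle_deriv f t)) \<longlonglongrightarrow> 0"
        by (rule tendsto_mult_left_zero[OF tendsto_mult_right_zero[OF \<epsilon>(1)]])
    qed
  qed
  have di: "integrable circle_measure (\<lambda>t. g n t - integrand \<phi> t)" for n
  proof (rule Bochner_Integration.integrable_bound[OF dint[of n]])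
    show "(\<lambda>t. g n t - integrand \<phi> t) \<in> borel_measurable circle_measure"
      by (rule borel_measurable_diff[OF borel_measurable_integrable[OF gi] meas])
    show "AE t in circle_measure. norm (g n t - integrand \<phi> t) \<le> norm (Linf_norm f * \<epsilon> n * cmod (circle_deriv f t))"
      by (rule AE_I2) (use gd in \<open>auto intro: order_trans[OF gd abs_ge_self]\<close>)
  qed
  have int: "integrable circle_measure (integrand \<phi>)"
    using Bochner_Integration.integrable_diff[OF gi[of 0] di[of 0]] by simp
  define I where "I = (LINT t|circle_measure. cmod (circle_deriv f t))"
  have gd_int: "cmod ((LINT t|circle_measure. g n t) - (LINT t|circle_measure. integrand \<phi> t)) \<le> Linf_norm f * \<epsilon> n * I" for n
  proof -
    have "(LINT t|circle_measure. g n t) - (LINT t|circle_measure. integrand \<phi> t) = (LINT t|circle_measure. g n t - integrand \<phi> t)"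
      by (rule Bochner_Integration.integral_diff[OF gi int, symmetric])
    also have "cmod \<dots> \<le> (LINT t|circle_measure. Linf_norm f * \<epsilon> n * cmod (circle_deriv f t))"
      by (rule Bochner_Integration.integral_norm_bound_integral[OF di dint gd])
    finally show ?thesis by (simp add: I_def)
  qed
  have "(\<lambda>n. LINT t|circle_measure. g n t) \<longlonglongrightarrow> (LINT t|circle_measure. integrand \<phi> t)"
  proof (rule LIM_zero_cancel, rule Lim_null_comparison)
    show "\<forall>\<^sub>F n in sequentially. cmod ((LINT t|circle_measure. g n t) - (LINT t|circle_measure. integrand \<phi> t)) \<le> Linf_norm f * \<epsilon> n * I"
      by (rule always_eventually) (simp add: gd_int)
    show "(\<lambda>n. Linf_norm f * \<epsilon> n * I) \<longlonglongrightarrow> 0"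
      by (rule tendsto_mult_left_zero[OF tendsto_mult_right_zero[OF \<epsilon>(1)]])
  qed
  then have "(\<lambda>n. winding_integral (odd_fun (a n) (K n))) \<longlonglongrightarrow> winding_integral \<phi>"
    unfolding winding_integral_def g_def by (intro tendsto_mult tendsto_const)
  with has_tr_limit[OF has_tr_odd_poly_diff trace_norm_le _ \<eta>, of "\<lambda>n. a n" "\<lambda>n. K n"] tD
  have "has_tr (cfc \<phi> A - cfc \<phi> B) (winding_integral \<phi>)" by (simp add: D_def)
  then show ?thesis unfolding trace_formula_def using cont trace_norm_le int by blast
qed

text \<open>
  Integration of the Taylor polynomials over \<open>\<bar>s\<bar> \<le> n\<close>, of a degree \<open>K n\<close> so large that the Taylor tail is
  below \<open>1/(n+1)\<close> for these \<open>s\<close>. For the remaining \<open>s\<close> the bound by a constant in trace norm, and by \<open>x\<close>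
  pointwise, is multiplied by the small measure of \<open>\<bar>s\<bar> > n\<close>. Both errors are thus governed by the same
  null sequence \<open>\<tau>\<close>.
\<close>

theorem trace_formula_primitive:
  assumes "finite_borel_measure N"
  shows "trace_formula (primitive N)"
proof -
  interpret N: finite_borel_measure N by (rule assms)
  have "\<exists>n0. \<forall>k\<ge>n0. exp_tail k (real n * M) < 1 / real (Suc n)" for n
    by (rule exp_tail_small) simp
  then obtain k0 where k0: "\<And>n k. k \<ge> k0 n \<Longrightarrow> exp_tail k (real n * M) < 1 / real (Suc n)" by metis
  \<comment> \<open>a monotone majorant of \<open>k0\<close>: differences of two approximants need nested partial sums\<close>
  define K where "K n = (\<Sum>i\<le>n. k0 i)" for n
  have K_mono: "K n \<le> K m" if "n \<le> m" for n m unfolding K_def using that by (intro sum_mono2) auto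
  have K: "exp_tail (K n) r \<le> 1 / real (Suc n)" if "0 \<le> r" "r \<le> real n * M" for n r
  proof -
    have "k0 n \<le> K n" unfolding K_def by (rule member_le_sum) auto
    from k0[OF this] exp_tail_mono[OF that, of "K n"] show ?thesis by linarith
  qed
  define w where "w n s = (if \<bar>s\<bar> \<le> real n then 1 else 0 :: complex)" for n s
  define a where "a n k = (LINT s|N. w n s * exp_coeff s k)" for n k
  \<comment> \<open>the Taylor error on \<open>\<bar>s\<bar> \<le> n\<close> plus the mass of the neglected part\<close>
  define \<tau> where "\<tau> n = measure N UNIV / real (Suc n) + measure N {s. real n < \<bar>s\<bar>}" for n
  define b where "b n s = 1 / real (Suc n) + indicator {s. real n < \<bar>s\<bar>} s" for n :: nat and s :: real
  have wm [measurable]: "w n \<in> borel_measurable borel" for n unfolding w_def by measurable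
  have set [measurable]: "{s::real. real n < \<bar>s\<bar>} \<in> sets borel" for n by measurable
  have b_int: "integrable N (b n)" and b_val: "(LINT s|N. b n s) = \<tau> n" for n
    unfolding b_def \<tau>_def by (auto simp: N.emeasure_eq_measure less_top[symmetric])
  have a_int: "integrable N (\<lambda>s. w n s * exp_coeff s k)" for n k
  proof (rule N.integrable_const_bound[of _ "real n ^ k / fact (Suc k)"])
    show "AE s in N. norm (w n s * exp_coeff s k) \<le> real n ^ k / fact (Suc k)"
      by (rule AE_I2) (auto simp: w_def exp_coeff_def norm_divide norm_power norm_mult norm_fact simp del: fact_Suc
          intro!: divide_right_mono power_mono)
  qed measurable
  have tau: "\<tau> \<longlonglongrightarrow> 0"
  proof -
    have "(\<lambda>n. measure N {s. real n < \<bar>s\<bar>}) \<longlonglongrightarrow> measure N (\<Inter>n. {s. real n < \<bar>s\<bar>})"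
      by (rule N.finite_Lim_measure_decseq) (auto simp: decseq_def)
    moreover have "(\<Inter>n. {s::real. real n < \<bar>s\<bar>}) = {}"
    proof -
      have "\<exists>n. \<not> real n < \<bar>s\<bar>" for s :: real using real_arch_simple[of "\<bar>s\<bar>"] by (auto simp: not_less)
      then show ?thesis by auto
    qed
    moreover have "(\<lambda>n. measure N UNIV / real (Suc n)) \<longlonglongrightarrow> 0" by (rule LIMSEQ_Suc[OF lim_const_over_n])
    ultimately show ?thesis unfolding \<tau>_def using tendsto_add by fastforce
  qed
  show ?thesis
  proof (rule trace_formula_limit[where a = a and K = K and \<epsilon> = \<tau> and \<eta> = "\<lambda>n. 2 * comm_bound * \<tau> n"])
    show "continuous_on {0..M} (primitive N)" by (rule N.primitive_continuous)
    show "\<tau> \<longlonglongrightarrow> 0" by (rule tau)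
    show "\<tau> n \<ge> 0" for n by (simp add: \<tau>_def)
    show "(\<lambda>n. 2 * comm_bound * \<tau> n) \<longlonglongrightarrow> 0" by (rule tendsto_mult_right_zero[OF tau])
    show "cmod (odd_fun (a n) (K n) x - (primitive N x - primitive N 0)) \<le> x * \<tau> n" if x: "x \<in> {0..M}" for n x
    proof -
      have i1: "integrable N (\<lambda>s. w n s * exp_coeff s k * complex_of_real x ^ Suc k)" for k
        by (rule integrable_mult_left[OF a_int])
      have "odd_fun (a n) (K n) x = (LINT s|N. (\<Sum>k<K n. w n s * exp_coeff s k * complex_of_real x ^ Suc k))"
        unfolding poly_odd_poly a_def by (subst Bochner_Integration.integral_sum[OF i1]) (simp del: power_Suc)
      then have eq: "odd_fun (a n) (K n) x - (primitive N x - primitive N 0)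
          = (LINT s|N. (\<Sum>k<K n. w n s * exp_coeff s k * complex_of_real x ^ Suc k) - exp_quot s x)"
        unfolding N.primitive_0 primitive_def
        by (subst Bochner_Integration.integral_diff)
          (auto intro!: Bochner_Integration.integrable_sum i1 N.integrable_exp_quot simp: exp_quot_0 simp del: power_Suc)
      have "cmod (LINT s|N. (\<Sum>k<K n. w n s * exp_coeff s k * complex_of_real x ^ Suc k) - exp_quot s x) \<le> (LINT s|N. x * b n s)"
      proof (rule Bochner_Integration.integral_norm_bound_integral)
        show "integrable N (\<lambda>s. (\<Sum>k<K n. w n s * exp_coeff s k * complex_of_real x ^ Suc k) - exp_quot s x)"
          by (intro Bochner_Integration.integrable_diff Bochner_Integration.integrable_sum i1 N.integrable_exp_quot)
        show "integrable N (\<lambda>s. x * b n s)" using b_int by simp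
        fix s
        show "cmod ((\<Sum>k<K n. w n s * exp_coeff s k * complex_of_real x ^ Suc k) - exp_quot s x) \<le> x * b n s"
        proof (cases "\<bar>s\<bar> \<le> real n")
          case True
          have "\<bar>s\<bar> * x \<le> real n * M" using True x by (intro mult_mono) auto
          then have "x * exp_tail (K n) (\<bar>s\<bar> * x) \<le> x * (1 / real (Suc n))"
            using x by (intro mult_left_mono K) auto
          with exp_quot_partial_sum[of x s "K n"] x True show ?thesis
            by (simp add: w_def b_def norm_minus_commute del: of_nat_Suc power_Suc)
        next
          case False
          have "x * 1 \<le> x * (1 + 1 / real (Suc n))" using x by (intro mult_left_mono) auto
          with norm_exp_quot_le[of s x] x False show ?thesis
            by (simp add: w_def b_def add.commute del: of_nat_Suc power_Suc)
        qed
      qed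
      also have "\<dots> = x * \<tau> n" by (simp add: b_val)
      finally show ?thesis unfolding eq .
    qed
    show "trace_norm_le (odd_poly_diff (a m) (K m) - odd_poly_diff (a n) (K n)) (2 * comm_bound * \<tau> n)" if nm: "n \<le> m" for n m
    proof -
      let ?D = "\<lambda>s. odd_poly_diff (\<lambda>k. w m s * exp_coeff s k) (K m) - odd_poly_diff (\<lambda>k. w n s * exp_coeff s k) (K n)"
      have i: "integrable N (\<lambda>s. cinner (blinfun_apply (odd_poly_diff (\<lambda>k. w n s * exp_coeff s k) j) x) y)" for n j x y
        unfolding cinner_odd_poly_diff by (intro Bochner_Integration.integrable_sum integrable_mult_left a_int)
      have v: "(LINT s|N. cinner (blinfun_apply (odd_poly_diff (\<lambda>k. w n s * exp_coeff s k) j) x) y) = cinner (blinfun_apply (odd_poly_diff (a n) j) x) y" for n j x y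
        unfolding cinner_odd_poly_diff a_def
        by (subst Bochner_Integration.integral_sum) (auto intro!: integrable_mult_left a_int)
      have "trace_norm_le (odd_poly_diff (a m) (K m) - odd_poly_diff (a n) (K n)) (LINT s|N. 2 * comm_bound * b n s)"
      proof (rule trace_norm_le_integral[where D = ?D])
        show "integrable N (\<lambda>s. cinner (blinfun_apply (?D s) x) y)" for x y
          unfolding blinfun.diff_left cinner.diff_left by (intro Bochner_Integration.integrable_diff i)
        show "cinner (blinfun_apply (odd_poly_diff (a m) (K m) - odd_poly_diff (a n) (K n)) x) y = (LINT s|N. cinner (blinfun_apply (?D s) x) y)" for x y
          unfolding blinfun.diff_left cinner.diff_left by (simp add: Bochner_Integration.integral_diff[OF i i] v)
        show "integrable N (\<lambda>s. 2 * comm_bound * b n s)" using b_int by simp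
        fix s
        have w1: "odd_poly_diff (\<lambda>k. w j s * exp_coeff s k) l = odd_poly_diff (exp_coeff s) l" if "\<bar>s\<bar> \<le> real j" for j l using that by (simp add: w_def)
        have w0: "odd_poly_diff (\<lambda>k. w j s * exp_coeff s k) l = 0" if "\<not> \<bar>s\<bar> \<le> real j" for j l
        proof -
          have "w j s = 0" using that by (simp add: w_def)
          then show ?thesis unfolding odd_poly_diff_cmult by (intro blinfun_eqI) (simp add: scaleC.zero_left)
        qed
        show "trace_norm_le (?D s) (2 * comm_bound * b n s)"
        proof (cases "\<bar>s\<bar> \<le> real n")
          case True
          then have "\<bar>s\<bar> \<le> real m" using nm by simp
          have "\<bar>s\<bar> * M \<le> real n * M" using True by (intro mult_right_mono) auto
          then have "comm_bound * exp_tail (K n) (\<bar>s\<bar> * M) \<le> comm_bound * (1 / real (Suc n))"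
            by (intro mult_left_mono K comm_bound_nonneg) auto
          moreover have "comm_bound * (1 / real (Suc n)) \<le> 2 * comm_bound * b n s"
            using comm_bound_nonneg by (auto simp: b_def indicator_def field_simps)
          ultimately show ?thesis
            unfolding w1[OF True] w1[OF \<open>\<bar>s\<bar> \<le> real m\<close>]
            by (intro trace_norm_le_mono[OF trace_norm_le_exp_coeff_diff[OF K_mono[OF nm]]]) simp
        next
          case n: False
          have b1: "2 * comm_bound * 1 \<le> 2 * comm_bound * b n s"
            using n comm_bound_nonneg by (intro mult_left_mono) (auto simp: b_def)
          show ?thesis
          proof (cases "\<bar>s\<bar> \<le> real m")
            case True
            have "\<bar>s\<bar> * M \<le> real m * M" using True by (intro mult_right_mono) auto
            then have "exp_tail (K m) (\<bar>s\<bar> * M) \<le> 1 / real (Suc m)" by (intro K) auto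
            also have "\<dots> \<le> 1" by simp
            finally have "comm_bound * exp_tail (K m) (\<bar>s\<bar> * M) \<le> comm_bound * 1" by (rule mult_left_mono[OF _ comm_bound_nonneg])
            then have "comm_bound + comm_bound * exp_tail (K m) (\<bar>s\<bar> * M) \<le> 2 * comm_bound * b n s" using b1 by linarith
            then show ?thesis unfolding w1[OF True] w0[OF n] diff_zero by (rule trace_norm_le_mono[OF trace_norm_le_exp_coeff])
          next
            case False
            have "0 \<le> 2 * comm_bound * b n s" using b1 comm_bound_nonneg by linarith
            then show ?thesis unfolding w0[OF False] w0[OF n] diff_zero by (rule trace_norm_le_mono[OF trace_norm_le_zero])
          qed
        qed
      qed
      then show ?thesis by (simp add: b_val)
    qed
  qed
qed

theorem trace_formula_W1:
  assumes "\<phi> \<in> W1_interval 0 M"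
  shows "trace_formula \<phi>"
proof -
  obtain \<psi> where \<psi>: "\<psi> \<in> W1_line" "\<And>x. x \<in> {0..M} \<Longrightarrow> \<psi> x = \<phi> x"
    using assms unfolding W1_interval_def by blast
  obtain N1 N2 N3 N4 where N: "\<forall>N\<in>{N1, N2, N3, N4}. finite_borel_measure N"
    and eq: "\<And>x. \<psi> x = \<psi> 0 + (primitive N1 x - primitive N2 x + \<i> * (primitive N3 x - primitive N4 x))"
    using W1_line_representation[OF \<psi>(1)] by blast
  have p: "trace_formula (primitive N1)" "trace_formula (primitive N2)" "trace_formula (primitive N3)" "trace_formula (primitive N4)"
    using N by (auto intro: trace_formula_primitive)
  have "trace_formula (\<lambda>x. \<psi> 0 + ((primitive N1 x + (- 1) * primitive N2 x) + \<i> * (primitive N3 x + (- 1) * primitive N4 x)))"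
    by (intro trace_formula_add trace_formula_const trace_formula_cmult p)
  moreover have "\<psi> 0 + ((primitive N1 x + (- 1) * primitive N2 x) + \<i> * (primitive N3 x + (- 1) * primitive N4 x)) = \<psi> x" for x
    using eq[of x] by simp
  ultimately show ?thesis using \<psi>(2) by (intro trace_formula_cong[of \<psi> \<phi>]) (simp_all only:)
qed

end

theorem theorem2p7:
  fixes f \<phi> :: "real \<Rightarrow> complex"
  assumes "f \<in> W_half_2 \<inter> W_1_1"
    and "\<phi> \<in> W1_interval 0 ((Linf_norm f)\<^sup>2)"
  shows "let T = toeplitz f;
             D = cfc \<phi> (cadjoint T o\<^sub>L T) - cfc \<phi> (T o\<^sub>L cadjoint T);
             F = (\<lambda>t. (\<phi> ((cmod (f t))\<^sup>2) - \<phi> 0) * (vector_derivative f (at t) / f t))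
         in trace_class D \<and> set_integrable lebesgue {0..2*pi} F \<and>
            trace_op D = 1 / (2 * of_real pi * \<i>) * (LINT t:{0..2*pi}|lebesgue. F t)"
proof -
  interpret krein_symbol f using assms(1) by unfold_locales auto
  define D where "D = cfc \<phi> A - cfc \<phi> B"
  define F where "F t = (\<phi> ((cmod (f t))\<^sup>2) - \<phi> 0) * (vector_derivative f (at t) / f t)" for t
  obtain C where tf: "continuous_on {0..M} \<phi>" "trace_norm_le D C" "integrable circle_measure (integrand \<phi>)" "has_tr D (winding_integral \<phi>)"
    using trace_formula_W1[OF assms(2)] unfolding trace_formula_def D_def by blast
  have "adj_pair D (cfc (\<lambda>x. cnj (\<phi> x)) A - cfc (\<lambda>x. cnj (\<phi> x)) B)"
    unfolding D_def by (intro adj_pair_diff A.adj_pair_cfc B.adj_pair_cfc tf)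
  then have 1: "trace_class D" by (rule trace_classI[OF _ tf(2) orthonormal_basis_H2chr])
  have ind: "indicator {0..2*pi} t *\<^sub>R integrand \<phi> t = indicator {0..2*pi} t *\<^sub>R F t" for t
    by (simp add: integrand_def F_def circle_deriv_def indicator_def)
  have meas: "integrand \<phi> \<in> borel_measurable lebesgue"
    using borel_measurable_integrable[OF tf(3)] by (simp add: borel_measurable_circle_measure)
  have 2: "set_integrable lebesgue {0..2*pi} F"
    using tf(3) unfolding integrable_circle_measure[OF meas] set_integrable_def ind .
  have "trace_op D = winding_integral \<phi>" by (rule trace_op_eq[OF tf(4)]) (use orthonormal_basis_H2chr in blast)
  also have "\<dots> = 1 / \<i> * ((1 / (2*pi)) * (LINT t:{0..2*pi}|lebesgue. F t))"
    unfolding winding_integral_def integral_circle_measure[OF meas] set_lebesgue_integral_def ind ..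
  also have "\<dots> = 1 / (2 * of_real pi * \<i>) * (LINT t:{0..2*pi}|lebesgue. F t)" by (simp add: field_simps)
  finally have 3: "trace_op D = 1 / (2 * of_real pi * \<i>) * (LINT t:{0..2*pi}|lebesgue. F t)" .
  show ?thesis
    unfolding Let_def cadjoint_T D_def[symmetric] F_def[symmetric] using 1 2 3 by blast
qed

end
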